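(* Let $n\geq 2$, $d\geq 3$, $S=\mathbb{C}[x_0,\ldots,x_n]$, let $0\neq f\in S_d$ be a homogeneous polynomial of degree $d$, and let $X=V(f)\subseteq\mathbb{P}^n$ be a hypersurface with at most isolated singularities. Assume that $\dim\operatorname{Aut}_{\mathbb{P}^n}(X)=0$ and that, for a general linear form $\ell\in S_1$, the multiplication map $\ell:M(f)_{d-1}\to M(f)_d$ is injective. Then the hyperplane-section map $$\Phi(f):\mathbb{P}^{n*}\dashrightarrow \mathcal{M}(d,n-1)$$ is generically finite onto its image. In particular, if $\tau(X)<(d-2)(d-1)^{n-1}$, if $(n,d)$ lies in one of the ranges $$n=2,\ d\geq 5;\qquad n=3,\ d\geq 4;\qquad n\geq 4,\ d\geq 3,$$ and if $M(f)$ satisfies the Weak Lefschetz Property in degree $d$, then $\Phi(f)$ is generically finite onto its image.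
   Context: Milnor algebra: $J_f=(f_0,\ldots,f_n)$ with $f_i=\partial f/\partial x_i$, and $M(f)=S/J_f$ with its standard grading. Automorphisms: $\operatorname{Aut}_{\mathbb{P}^n}(X)=\{g\in PGL_{n+1}(\mathbb{C})\mid g(X)=X\}$, i.e. the stabilizer of $[f]\in\mathbb{P}(S_d)$. Tjurina number: for $p\in\operatorname{Sing}(X)$, with local coordinates $y_1,\ldots,y_n$ at $p$ and a local equation $h\in\mathcal{O}_{\mathbb{P}^n,p}$ of $X$, $\tau(X,p)=\dim_{\mathbb{C}}\mathcal{O}_{\mathbb{P}^n,p}/(h,\partial h/\partial y_1,\ldots,\partial h/\partial y_n)$, and $\tau(X)=\sum_{p\in\operatorname{Sing}(X)}\tau(X,p)$. Weak Lefschetz Property: a finitely generated graded $S$-module $M$ satisfies WLP in degree $j$ if, for a general linear form $\ell\in S_1$, the multiplication map $\ell:M_{j-1}\to M_j$ has maximal rank. "General" means: for all $\ell$ in some nonempty Zariski open subset of $S_1$. Moduli: $\mathcal{M}(d,n-1)$ is the coarse moduli space of smooth degree $d$ hypersurfaces in $\mathbb{P}^{n-1}$, i.e. the geometric (GIT) quotient by $PGL_n(\mathbb{C})$ of the open subset of $\mathbb{P}(\mathbb{C}[x_1,\ldots,x_n]_d)$ parametrizing smooth hypersurfaces. Hyperplane-section map: $U_f=\{H\in\mathbb{P}^{n*}\mid X\cap H\text{ is smooth}\}$ is a nonempty Zariski open subset of the dual projective space (since $X$ has isolated singularities), and $\Phi(f):\mathbb{P}^{n*}\dashrightarrow\mathcal{M}(d,n-1)$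 is the rational map given on $U_f$ by $H\mapsto[X\cap H]$, where $X\cap H\subseteq H\simeq\mathbb{P}^{n-1}$. It is generically finite onto its image if the general fiber of $\mathbb{P}^{n*}\dashrightarrow\operatorname{Im}\Phi(f)$ is finite, equivalently $\dim\operatorname{Im}\Phi(f)=n$. *)

theory Defs
  imports
    "HOL-Library.Poly_Mapping"
    "HOL-Library.Extended_Nat"
    "HOL-Computational_Algebra.Fraction_Field"
    "HOL-Algebra.Embedded_Algebras"
    "HOL-Algebra.QuotRing"
    "HOL-Analysis.Abstract_Topology"
begin

section \<open>Vectors, polynomials and linear maps\<close>

text \<open>
  A vector of \<open>\<complex>\<^sup>I\<close> is a finitely supported function with support in \<open>I\<close>. A polynomial is a
  vector indexed by monomials, so the space of forms of a given degree is again of the shape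
  \<open>\<complex>\<^sup>I\<close>, and so is the space of matrices (indexed by pairs: row, column). This allows one
  definition of the Zariski topologies to serve all of them.
\<close>

type_synonym 'v cvec = "'v \<Rightarrow>\<^sub>0 complex"
type_synonym 'v cpoly = "('v \<Rightarrow>\<^sub>0 nat) \<Rightarrow>\<^sub>0 complex"

definition cspace :: "'v set \<Rightarrow> 'v cvec set"
  where "cspace I = {v. Poly_Mapping.keys v \<subseteq> I}"

definition mons :: "'v set \<Rightarrow> nat \<Rightarrow> ('v \<Rightarrow>\<^sub>0 nat) set"
  where "mons I k = {m. Poly_Mapping.keys m \<subseteq> I \<and> (\<Sum>i\<in>Poly_Mapping.keys m. Poly_Mapping.lookup m i) = k}"

definition polys :: "'v set \<Rightarrow> 'v cpoly set"
  where "polys I = {p. \<forall>m\<in>Poly_Mapping.keys p. Poly_Mapping.keys m \<subseteq> I}"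

abbreviation forms :: "'v set \<Rightarrow> nat \<Rightarrow> 'v cpoly set"
  where "forms I k \<equiv> cspace (mons I k)"

definition pconst :: "complex \<Rightarrow> 'v cpoly"
  where "pconst c = Poly_Mapping.single 0 c"

definition pvar :: "'v \<Rightarrow> 'v cpoly"
  where "pvar i = Poly_Mapping.single (Poly_Mapping.single i 1) 1"

definition peval :: "'v cpoly \<Rightarrow> ('v \<Rightarrow> complex) \<Rightarrow> complex"
  where "peval p x = (\<Sum>m\<in>Poly_Mapping.keys p. Poly_Mapping.lookup p m * (\<Prod>i\<in>Poly_Mapping.keys m. x i ^ Poly_Mapping.lookup m i))"

definition psubst :: "('v \<Rightarrow> 'w cpoly) \<Rightarrow> 'v cpoly \<Rightarrow> 'w cpoly"
  where "psubst \<sigma> p = (\<Sum>m\<in>Poly_Mapping.keys p. pconst (Poly_Mapping.lookup p m) * (\<Prod>i\<in>Poly_Mapping.keys m. \<sigma> i ^ Poly_Mapping.lookup m i))"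

definition pdiff :: "'v \<Rightarrow> 'v cpoly \<Rightarrow> 'v cpoly"
  where "pdiff i p =
    (\<Sum>m\<in>Poly_Mapping.keys p. Poly_Mapping.single (m - Poly_Mapping.single i 1) (of_nat (Poly_Mapping.lookup m i) * Poly_Mapping.lookup p m))"

definition mat_app :: "('v \<times> 'w) cvec \<Rightarrow> 'w cvec \<Rightarrow> 'v cvec"
  where "mat_app A v = (\<Sum>(i, j)\<in>Poly_Mapping.keys A. Poly_Mapping.single i (Poly_Mapping.lookup A (i, j) * Poly_Mapping.lookup v j))"

text \<open>Composition of a polynomial with the linear map given by \<open>A\<close>: substitute
  \<open>\<Sum>\<^sub>j A\<^sub>i\<^sub>j x\<^sub>j\<close> for \<open>x\<^sub>i\<close>.\<close>

definition pullback :: "('v \<times> 'w) cvec \<Rightarrow> 'v cpoly \<Rightarrow> 'w cpoly"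
  where "pullback A = psubst (\<lambda>i. \<Sum>j\<in>snd ` Poly_Mapping.keys A. pconst (Poly_Mapping.lookup A (i, j)) * pvar j)"

definition GL :: "'v set \<Rightarrow> ('v \<times> 'v) cvec set"
  where "GL I = {A \<in> cspace (I \<times> I). bij_betw (mat_app A) (cspace I) (cspace I)}"


section \<open>Projective spaces, Zariski topologies, dimension\<close>

definition line :: "'v cvec \<Rightarrow> 'v cvec set"
  where "line v = {Poly_Mapping.map ((*) c) v |c. c \<noteq> 0}"

definition proj :: "'v set \<Rightarrow> 'v cvec set set"
  where "proj I = line ` (cspace I - {0})"

text \<open>Both topologies are generated by the principal open sets of (homogeneous) polynomials in
  the coordinates; these are closed under finite intersection.\<close>

definition zariski_affine :: "'v set \<Rightarrow> 'v cvec topology"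
  where "zariski_affine I =
    topology_generated_by {{v \<in> cspace I. peval q (Poly_Mapping.lookup v) \<noteq> 0} |q. q \<in> polys I}"

definition zariski_proj :: "'v set \<Rightarrow> 'v cvec set topology"
  where "zariski_proj I =
    topology_generated_by {{L \<in> proj I. \<forall>v\<in>L. peval q (Poly_Mapping.lookup v) \<noteq> 0} |q k. q \<in> forms I k}"

definition irreducible_closed :: "'a topology \<Rightarrow> 'a set \<Rightarrow> bool"
  where "irreducible_closed T Z \<longleftrightarrow> closedin T Z \<and> Z \<noteq> {} \<and>
    (\<forall>A B. closedin T A \<and> closedin T B \<and> Z = A \<union> B \<longrightarrow> A = Z \<or> B = Z)"

text \<open>Krull dimension; it is only meant for nonempty spaces (the empty space gets \<open>0\<close>).\<close>

definition krull_dim :: "'a topology \<Rightarrow> enat"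
  where "krull_dim T = Sup {enat k |k. \<exists>Z :: nat \<Rightarrow> 'a set.
    (\<forall>i\<le>k. irreducible_closed T (Z i)) \<and> (\<forall>i<k. Z i \<subset> Z (Suc i))}"

definition for_general_linear_form :: "'v set \<Rightarrow> ('v cpoly \<Rightarrow> bool) \<Rightarrow> bool"
  where "for_general_linear_form I P \<longleftrightarrow>
    (\<exists>W. openin (zariski_affine (mons I 1)) W \<and> W \<noteq> {} \<and> (\<forall>l\<in>W. P l))"


section \<open>The Milnor algebra and the weak Lefschetz property\<close>

definition ring_on :: "'a::comm_ring_1 set \<Rightarrow> 'a ring"
  where "ring_on A = \<lparr>carrier = A, monoid.mult = (*), one = 1, zero = 0, add = (+)\<rparr>"

definition poly_ring :: "'v set \<Rightarrow> 'v cpoly ring"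
  where "poly_ring I = ring_on (polys I)"

definition jacobian_ideal :: "'v set \<Rightarrow> 'v cpoly \<Rightarrow> 'v cpoly set"
  where "jacobian_ideal I f = genideal (poly_ring I) ((\<lambda>i. pdiff i f) ` I)"

definition milnor_algebra :: "'v set \<Rightarrow> 'v cpoly \<Rightarrow> 'v cpoly set ring"
  where "milnor_algebra I f = FactRing (poly_ring I) (jacobian_ideal I f)"

definition milnor_class :: "'v set \<Rightarrow> 'v cpoly \<Rightarrow> 'v cpoly \<Rightarrow> 'v cpoly set"
  where "milnor_class I f g = a_r_coset (poly_ring I) (jacobian_ideal I f) g"

definition milnor_piece :: "'v set \<Rightarrow> 'v cpoly \<Rightarrow> nat \<Rightarrow> 'v cpoly set set"
  where "milnor_piece I f k = milnor_class I f ` forms I k"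

definition milnor_mult :: "'v set \<Rightarrow> 'v cpoly \<Rightarrow> 'v cpoly \<Rightarrow> 'v cpoly set \<Rightarrow> 'v cpoly set"
  where "milnor_mult I f l a = monoid.mult (milnor_algebra I f) (milnor_class I f l) a"

definition milnor_mult_injective :: "'v set \<Rightarrow> 'v cpoly \<Rightarrow> nat \<Rightarrow> 'v cpoly \<Rightarrow> bool"
  where "milnor_mult_injective I f j l \<longleftrightarrow> inj_on (milnor_mult I f l) (milnor_piece I f (j - 1))"

definition milnor_mult_surjective :: "'v set \<Rightarrow> 'v cpoly \<Rightarrow> nat \<Rightarrow> 'v cpoly \<Rightarrow> bool"
  where "milnor_mult_surjective I f j l \<longleftrightarrow>
    milnor_mult I f l ` milnor_piece I f (j - 1) = milnor_piece I f j"

text \<open>The degree \<open>j\<close> refers to the target of the map from degree \<open>j - 1\<close> to degree \<open>j\<close>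
  (\<open>j \<ge> 1\<close>). Maximal rank means injective or surjective.\<close>

definition milnor_WLP_in_degree :: "'v set \<Rightarrow> 'v cpoly \<Rightarrow> nat \<Rightarrow> bool"
  where "milnor_WLP_in_degree I f j \<longleftrightarrow>
    for_general_linear_form I
      (\<lambda>l. milnor_mult_injective I f j l \<or> milnor_mult_surjective I f j l)"


section \<open>Singularities and Tjurina numbers\<close>

text \<open>Points of the hypersurface \<open>f = 0\<close> in the projective space with homogeneous
  coordinates indexed by \<open>I\<close>.\<close>

definition hypersurface :: "'v set \<Rightarrow> 'v cpoly \<Rightarrow> 'v cvec set set"
  where "hypersurface I f = {L \<in> proj I. \<forall>v\<in>L. peval f (Poly_Mapping.lookup v) = 0}"

definition sing :: "'v set \<Rightarrow> 'v cpoly \<Rightarrow> 'v cvec set set"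
  where "sing I f = {L \<in> hypersurface I f. \<forall>v\<in>L. \<forall>i\<in>I. peval (pdiff i f) (Poly_Mapping.lookup v) = 0}"

definition at_most_isolated_singularities :: "'v set \<Rightarrow> 'v cpoly \<Rightarrow> bool"
  where "at_most_isolated_singularities I f \<longleftrightarrow>
    (\<forall>L\<in>sing I f. \<exists>U. openin (zariski_proj I) U \<and> U \<inter> sing I f = {L})"

text \<open>The local ring of the affine space with coordinates indexed by \<open>J\<close> at the point \<open>a\<close>,
  inside the field of rational functions.\<close>

definition local_ring :: "nat set \<Rightarrow> (nat \<Rightarrow> complex) \<Rightarrow> nat cpoly fract ring"
  where "local_ring J a = ring_on {Fract p q |p q. p \<in> polys J \<and> q \<in> polys J \<and> peval q a \<noteq> 0}"

definition affine_tjurina_ideal ::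
    "nat set \<Rightarrow> (nat \<Rightarrow> complex) \<Rightarrow> nat cpoly \<Rightarrow> nat cpoly fract set"
  where "affine_tjurina_ideal J a h =
    genideal (local_ring J a) (insert (Fract h 1) ((\<lambda>j. Fract (pdiff j h) 1) ` J))"

definition affine_tjurina :: "nat set \<Rightarrow> (nat \<Rightarrow> complex) \<Rightarrow> nat cpoly \<Rightarrow> nat"
  where "affine_tjurina J a h =
    (let R = local_ring J a; T = affine_tjurina_ideal J a h; Q = FactRing R T;
         K = range (\<lambda>c. a_r_coset R T (Fract (pconst c) 1))
     in THE k. ring.dimension Q k K (carrier Q))"

text \<open>
  The Tjurina number at the point \<open>L\<close>: choose a standard affine chart \<open>x\<^sub>i \<noteq> 0\<close> containing
  \<open>L\<close> and the representative \<open>v\<close> with \<open>v\<^sub>i = 1\<close>. The other coordinates of \<open>v\<close> are the affine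
  coordinates of the point, the local equation is \<open>f\<close> with \<open>x\<^sub>i\<close> set to \<open>1\<close>, and the local
  coordinates \<open>y\<^sub>j = x\<^sub>j - v\<^sub>j\<close> for \<open>j \<noteq> i\<close> satisfy \<open>\<partial>/\<partial>y\<^sub>j = \<partial>/\<partial>x\<^sub>j\<close>. The result does not depend on
  the chart.
\<close>

definition tjurina_at :: "nat set \<Rightarrow> nat cpoly \<Rightarrow> nat cvec set \<Rightarrow> nat"
  where "tjurina_at I f L =
    (let (i, v) = (SOME (i, v). i \<in> I \<and> v \<in> L \<and> Poly_Mapping.lookup v i = 1)
     in affine_tjurina (I - {i}) (Poly_Mapping.lookup v) (psubst (\<lambda>j. if j = i then 1 else pvar j) f))"

definition tjurina :: "nat set \<Rightarrow> nat cpoly \<Rightarrow> nat"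
  where "tjurina I f = (\<Sum>L\<in>sing I f. tjurina_at I f L)"


section \<open>Automorphisms\<close>

text \<open>The projective linear group is the set of lines spanned by invertible matrices, with the
  Zariski topology induced from the projective space of all matrices. It acts on forms up to
  scalars by \<open>[f] \<mapsto> [f \<circ> A]\<close>.\<close>

definition projective_aut :: "'v set \<Rightarrow> 'v cpoly \<Rightarrow> ('v \<times> 'v) cvec set set"
  where "projective_aut I f = {line A |A. A \<in> GL I \<and> pullback A ` line f = line f}"

definition dim_projective_aut :: "'v set \<Rightarrow> 'v cpoly \<Rightarrow> enat"
  where "dim_projective_aut I f =
    krull_dim (subtopology (zariski_proj (I \<times> I)) (projective_aut I f))"


section \<open>Moduli of smooth hypersurfaces\<close>

definition smooth_forms :: "'v set \<Rightarrow> nat \<Rightarrow> 'v cpoly set"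
  where "smooth_forms J d = {g \<in> forms J d. g \<noteq> 0 \<and> sing J g = {}}"

definition smooth_locus :: "'v set \<Rightarrow> nat \<Rightarrow> 'v cpoly set set"
  where "smooth_locus J d = line ` smooth_forms J d"

definition moduli_class :: "'v set \<Rightarrow> 'v cpoly set \<Rightarrow> 'v cpoly set set"
  where "moduli_class J L = {pullback A ` L |A. A \<in> GL J}"

text \<open>The geometric quotient: its points are the orbits, and its topology is the quotient
  topology of the Zariski topology on the smooth locus.\<close>

definition moduli_space :: "'v set \<Rightarrow> nat \<Rightarrow> 'v cpoly set set topology"
  where "moduli_space J d = topology (\<lambda>W. W \<subseteq> moduli_class J ` smooth_locus J d \<and>
    openin (subtopology (zariski_proj (mons J d)) (smooth_locus J d))
      {L \<in> smooth_locus J d. moduli_class J L \<in> W})"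

lemma openin_moduli_space:
  "openin (moduli_space J d) W \<longleftrightarrow> W \<subseteq> moduli_class J ` smooth_locus J d \<and>
    openin (subtopology (zariski_proj (mons J d)) (smooth_locus J d))
      {L \<in> smooth_locus J d. moduli_class J L \<in> W}"
proof -
  let ?X = "smooth_locus J d" and ?\<pi> = "moduli_class J"
  let ?T = "subtopology (zariski_proj (mons J d)) ?X"
  have "istopology (\<lambda>W. W \<subseteq> ?\<pi> ` ?X \<and> openin ?T {L \<in> ?X. ?\<pi> L \<in> W})"
    unfolding istopology_def
  proof (intro conjI allI impI)
    fix S U assume "S \<subseteq> ?\<pi> ` ?X \<and> openin ?T {L \<in> ?X. ?\<pi> L \<in> S}"
      and "U \<subseteq> ?\<pi> ` ?X \<and> openin ?T {L \<in> ?X. ?\<pi> L \<in> U}"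
    moreover have "{L \<in> ?X. ?\<pi> L \<in> S \<inter> U} = {L \<in> ?X. ?\<pi> L \<in> S} \<inter> {L \<in> ?X. ?\<pi> L \<in> U}"
      by blast
    ultimately show "S \<inter> U \<subseteq> ?\<pi> ` ?X" "openin ?T {L \<in> ?X. ?\<pi> L \<in> S \<inter> U}"
      by (auto intro: openin_Int)
  next
    fix K assume K: "\<forall>S\<in>K. S \<subseteq> ?\<pi> ` ?X \<and> openin ?T {L \<in> ?X. ?\<pi> L \<in> S}"
    then show "\<Union>K \<subseteq> ?\<pi> ` ?X" by blast
    have "{L \<in> ?X. ?\<pi> L \<in> \<Union>K} = (\<Union>S\<in>K. {L \<in> ?X. ?\<pi> L \<in> S})" by blast
    then show "openin ?T {L \<in> ?X. ?\<pi> L \<in> \<Union>K}" using K by auto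
  qed
  then show ?thesis by (simp add: moduli_space_def)
qed


section \<open>The hyperplane-section map\<close>

text \<open>
  The ambient projective space has coordinates \<open>x\<^sub>0, \<dots>, x\<^sub>n\<close>; a hyperplane is a point \<open>H\<close> of
  the dual space, which is the projective space of linear forms. A hyperplane is identified with
  the projective space with coordinates \<open>x\<^sub>1, \<dots>, x\<^sub>n\<close> by choosing a linear parametrization; the
  resulting section is well defined up to the action of the general linear group.
\<close>

definition dual_proj :: "nat \<Rightarrow> nat cpoly set set"
  where "dual_proj n = proj (mons {..n} 1)"

definition hyperplane_points :: "nat \<Rightarrow> nat cpoly set \<Rightarrow> nat cvec set"
  where "hyperplane_points n H = {v \<in> cspace {..n}. \<forall>l\<in>H. peval l (Poly_Mapping.lookup v) = 0}"

definition hyperplane_param :: "nat \<Rightarrow> nat cpoly set \<Rightarrow> (nat \<times> nat) cvec"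
  where "hyperplane_param n H = (SOME B. B \<in> cspace ({..n} \<times> {1..n}) \<and>
    bij_betw (mat_app B) (cspace {1..n}) (hyperplane_points n H))"

definition hyperplane_section :: "nat \<Rightarrow> nat cpoly \<Rightarrow> nat cpoly set \<Rightarrow> nat cpoly"
  where "hyperplane_section n f H = pullback (hyperplane_param n H) f"

definition smooth_section_locus :: "nat \<Rightarrow> nat \<Rightarrow> nat cpoly \<Rightarrow> nat cpoly set set"
  where "smooth_section_locus n d f =
    {H \<in> dual_proj n. hyperplane_section n f H \<in> smooth_forms {1..n} d}"

definition section_map :: "nat \<Rightarrow> nat cpoly \<Rightarrow> nat cpoly set \<Rightarrow> nat cpoly set set"
  where "section_map n f H = moduli_class {1..n} (line (hyperplane_section n f H))"

text \<open>General fibre: over all points of a nonempty Zariski open subset of the image (which is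
  irreducible, being an image of an open subset of the dual projective space).\<close>

definition section_map_generically_finite :: "nat \<Rightarrow> nat \<Rightarrow> nat cpoly \<Rightarrow> bool"
  where "section_map_generically_finite n d f \<longleftrightarrow>
    (let U = smooth_section_locus n d f; \<Phi> = section_map n f
     in \<exists>V. openin (subtopology (moduli_space {1..n} d) (\<Phi> ` U)) V \<and> V \<noteq> {} \<and>
          (\<forall>q\<in>V. finite {H \<in> U. \<Phi> H = q}))"

end

theory Submission
  imports Defs "HOL-Complex_Analysis.Complex_Analysis" "HOL-Computational_Algebra.Fundamental_Theorem_Algebra"
begin

text \<open>
  Let \<open>B\<close> be a parametrization of a hyperplane \<open>\<ell> = 0\<close>. The differential of \<open>B \<mapsto> f \<circ> B\<close> kills \<open>Z\<close> iff
  \<open>\<Sum> f\<^sub>i(B y) (Z y)\<^sub>i = 0\<close> for all \<open>y\<close>, which yields linear forms \<open>a\<^sub>i\<close> with \<open>\<Sum> a\<^sub>i f\<^sub>i = \<ell> h\<close>. If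
  multiplication by \<open>\<ell>\<close> is injective from degree \<open>d - 1\<close> to degree \<open>d\<close> of the Milnor algebra, then
  \<open>h = \<Sum> c\<^sub>i f\<^sub>i\<close> with constants \<open>c\<^sub>i\<close>, so the \<open>a\<^sub>i - c\<^sub>i \<ell>\<close> form a linear syzygy of the partial derivatives.
  If there is no such syzygy, the differential is injective, the entries of \<open>B\<close> are algebraic over
  the values of \<open>f \<circ> B\<close>, and a general fibre of the hyperplane-section map is finite.

  A nonzero linear syzygy is excluded in both cases. It is an infinitesimal automorphism, and its
  exponential would be a one-parameter group of projective automorphisms of \<open>X\<close>. On the other hand it
  forces the Milnor algebra to have dimension at least \<open>(d - 2) (d - 1)\<^bsup>n - 1\<^esup>\<close> in high degrees (du Plessis
  and Wall): after a change of basis \<open>a g\<close> lies in the ideal of \<open>G\<^sub>1, \<dots>, G\<^sub>n\<close> for a linear form \<open>a\<close>, where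
  \<open>g, G\<^sub>1, \<dots>, G\<^sub>n\<close> span the partial derivatives, and \<open>G\<^sub>1, \<dots>, G\<^sub>n\<close> have no common zero on a
  general hyperplane; by Bezout the quotients by \<open>(G\<^sub>1, \<dots>, G\<^sub>n)\<close> and \<open>(G\<^sub>1, \<dots>, G\<^sub>n, a)\<close> have dimension at
  least \<open>(d - 1)\<^bsup>n\<^esup>\<close> and at most \<open>(d - 1)\<^bsup>n - 1\<^esup>\<close>. In high degrees the Jacobian ideal is the intersection
  of the local Tjurina ideals, so the dimension of the Milnor algebra is at most \<open>\<tau>(X)\<close>.
  Finally, without linear syzygies a dimension count shows that a surjective
  multiplication map from degree \<open>d - 1\<close> to degree \<open>d\<close> is injective in the given ranges of \<open>(n, d)\<close>.
\<close>

section \<open>Dimensions of subspaces\<close>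

text \<open>A parametrization has \<open>n * (n + 1)\<close> entries, and those with the same image
  differ by an invertible matrix of size \<open>n\<close>. Working with matrices therefore absorbs
  the passage to moduli: if a section lies in the class of a form \<open>g\<close>, a change of
  parameters and a rescaling by a \<open>d\<close>-th root make \<open>f \<circ> B\<close> equal to
  \<open>g\<close> itself. Finitely many matrices then give finitely many hyperplanes. The algebraic
  condition that ensures this finiteness must also be met by a smooth section; one is found on the
  line of matrices joining a smooth section to a matrix that satisfies the condition.

  The Bezout and Tjurina bounds are statements about Hilbert functions. Ideals are families of
  graded pieces, and multiplicities appear as eventual values of these functions. The threshold is
  the difference of the two Bezout numbers:
  \<open>(d - 1)^n - (d - 1)^(n - 1) = (d - 2) * (d - 1)^(n - 1)\<close>.

  Zariski-topological hypotheses are exploited through the classical topology: limits of points give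
  finiteness of the singular locus and stability of smoothness, and countability of the zeros of
  entire functions makes the closure of a one-parameter group irreducible.\<close>

abbreviation coef where "coef \<equiv> Poly_Mapping.lookup"
abbreviation supp where "supp \<equiv> Poly_Mapping.keys"
abbreviation sgl where "sgl \<equiv> Poly_Mapping.single"

definition smul :: "complex \<Rightarrow> 'v cvec \<Rightarrow> 'v cvec"
  where "smul c v = Poly_Mapping.map ((*) c) v"

lemma coef_smul [simp]: "coef (smul c v) i = c * coef v i"
  unfolding smul_def by (simp add: Poly_Mapping.map.rep_eq when_def)

interpretation cv: vector_space smul
  by unfold_locales (auto intro!: poly_mapping_eqI simp: lookup_add algebra_simps)

interpretation cvp: vector_space_pair smul smul
  by unfold_locales

text \<open>\<open>cv.dim\<close> is a natural number and collapses to 0 on infinite-dimensional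
  subspaces. Since the ambient space may be infinite-dimensional, finiteness is carried along as a
  separate predicate.\<close>

definition fdim :: "'v cvec set \<Rightarrow> bool"
  where "fdim V \<longleftrightarrow> (\<exists>B. finite B \<and> V \<subseteq> cv.span B)"

lemma fdim_mono: "fdim W \<Longrightarrow> V \<subseteq> W \<Longrightarrow> fdim V"
  unfolding fdim_def by blast

lemma fdim_basis:
  assumes "fdim V"
  obtains B where "B \<subseteq> V" "cv.independent B" "finite B" "V \<subseteq> cv.span B" "card B = cv.dim V"
proof -
  obtain B where B: "B \<subseteq> V" "cv.independent B" "V \<subseteq> cv.span B" "card B = cv.dim V"
    using cv.basis_exists[of V] by blast
  obtain S where S: "finite S" "V \<subseteq> cv.span S" using assms by (auto simp: fdim_def)
  have "finite B" using cv.independent_span_bound[OF S(1) B(2)] B(1) S(2) by blast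
  then show ?thesis using B that by blast
qed

lemma dim_mono:
  assumes "fdim W" "V \<subseteq> W"
  shows "cv.dim V \<le> cv.dim W"
proof -
  obtain B where B: "finite B" "W \<subseteq> cv.span B" "card B = cv.dim W"
    using fdim_basis[OF assms(1)] by metis
  then show ?thesis using cv.dim_le_card[of V B] assms(2) by auto
qed

text \<open>A basis \<open>C\<close> of the kernel is extended to a basis \<open>D\<close> of
  \<open>V\<close>; the map is injective on the span of \<open>D - C\<close>, and the images of
  these vectors span the image.\<close>

lemma rank_nullity:
  assumes T: "Vector_Spaces.linear smul smul T" and V: "cv.subspace V" "fdim V"
  shows "cv.dim V = cv.dim (T ` V) + cv.dim {v \<in> V. T v = 0}"
proof -
  interpret T: Vector_Spaces.linear smul smul T by fact
  let ?K = "{v \<in> V. T v = 0}"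
  have fK: "fdim ?K" using V(2) by (rule fdim_mono) auto
  have sK: "cv.subspace ?K"
  proof (rule cv.subspaceI)
    show "0 \<in> ?K" using cv.subspace_0[OF V(1)] T.zero by simp
    show "x + y \<in> ?K" if "x \<in> ?K" "y \<in> ?K" for x y
      using cv.subspace_add[OF V(1), of x y] that by (simp add: T.add)
    show "smul c x \<in> ?K" if "x \<in> ?K" for c x
      using cv.subspace_scale[OF V(1), of x c] that by (simp add: T.scale)
  qed
  obtain C where C: "C \<subseteq> ?K" "cv.independent C" "finite C" "?K \<subseteq> cv.span C" "card C = cv.dim ?K"
    by (rule fdim_basis[OF fK]) blast
  have CV: "C \<subseteq> V" using C(1) by auto
  obtain D where D: "C \<subseteq> D" "D \<subseteq> V" "cv.independent D" "V \<subseteq> cv.span D"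
    by (rule cv.maximal_independent_subset_extend[OF CV C(2)]) blast
  have fD: "finite D"
  proof -
    obtain S where S: "finite S" "V \<subseteq> cv.span S" using V(2) by (auto simp: fdim_def)
    then show ?thesis using cv.independent_span_bound[OF S(1) D(3)] D(2) by blast
  qed
  have dD: "cv.dim V = card D" using cv.basis_card_eq_dim[OF D(2,4,3)] by simp
  have spD: "cv.span (D - C) \<subseteq> V"
    using V(1) D(2) by (metis Diff_subset cv.span_minimal subset_trans)
  have z: "v = 0" if v: "v \<in> cv.span (D - C)" "T v = 0" for v
  proof -
    have "v \<in> cv.span C" using v spD C(4) by blast
    \<comment> \<open>A vector in both spans has a unique expansion in \<open>D\<close>, which would
      be supported both on \<open>C\<close> and off \<open>C\<close>.\<close>
    moreover have "cv.span C \<inter> cv.span (D - C) = {0}"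
    proof -
      have "u = 0" if u: "u \<in> cv.span C" "u \<in> cv.span (D - C)" for u
      proof -
        have sub: "cv.representation D u = cv.representation C u" 
          using cv.representation_extend[OF D(3) u(1) D(1)] .
        have sub': "cv.representation D u = cv.representation (D - C) u" 
          using cv.representation_extend[OF D(3) u(2)] by blast
        have "cv.representation D u b = 0" for b
          using sub sub' cv.representation_ne_zero[of C u b] cv.representation_ne_zero[of "D - C" u b]
          by (metis DiffD2)
        then have "(\<Sum>b\<in>D. smul (cv.representation D u b) b) = 0" by simp
        moreover have "u \<in> cv.span D" using u(1) D(1) cv.span_mono by blast
        ultimately show "u = 0"
          using cv.sum_representation_eq[OF D(3), of u D] fD by simp
      qed
      then show ?thesis by (auto simp: cv.span_zero)
    qed
    ultimately show ?thesis using v(1) by blast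
  qed
  have inj: "inj_on T (cv.span (D - C))"
    using T.inj_on_iff_eq_0[OF cv.subspace_span] z by blast
  have ind: "cv.independent (T ` (D - C))"
    using T.independent_inj_on_image[OF _ inj] cv.independent_mono[OF D(3)] by auto
  have span: "T ` V \<subseteq> cv.span (T ` (D - C))"
  proof
    fix y assume "y \<in> T ` V"
    then obtain v where v: "v \<in> V" "y = T v" by blast
    have "v \<in> cv.span D" using v D by blast
    then have "T v \<in> cv.span (T ` D)" using T.span_image by blast
    moreover have "cv.span (T ` D) \<subseteq> cv.span (T ` (D - C))"
    proof (rule cv.span_minimal)
      show "T ` D \<subseteq> cv.span (T ` (D - C))"
      proof
        fix w assume "w \<in> T ` D"
        then obtain b where b: "b \<in> D" "w = T b" by blast
        show "w \<in> cv.span (T ` (D - C))"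
        proof (cases "b \<in> C")
          case True
          then have "w = 0" using C(1) b by auto
          then show ?thesis by (simp add: cv.span_zero)
        next
          case False
          then show ?thesis using b by (auto intro: cv.span_base)
        qed
      qed
    qed simp
    ultimately show "y \<in> cv.span (T ` (D - C))" using v by blast
  qed
  have "cv.dim (T ` V) = card (T ` (D - C))"
    by (rule cv.dim_unique[OF _ span ind refl]) (use D in blast)
  also have "\<dots> = card (D - C)"
    by (rule card_image, rule inj_on_subset[OF inj]) (auto intro: cv.span_base)
  finally have "cv.dim (T ` V) + card C = card D"
    using D(1) fD C(3) card_mono[OF fD D(1)] by (simp add: card_Diff_subset)
  then show ?thesis using C(5) dD by simp
qed

text \<open>Quotients are modelled inside the ambient space: a basis of the span is extended to a
  basis of everything, and \<open>\<pi>\<close> kills the first part and fixes the rest.\<close>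

lemma projection_along:
  obtains \<pi> :: "'v cvec \<Rightarrow> 'v cvec" where "Vector_Spaces.linear smul smul \<pi>" "\<And>x. \<pi> x = 0 \<longleftrightarrow> x \<in> cv.span A"
proof -
  obtain B where B: "B \<subseteq> A" "cv.independent B" "A \<subseteq> cv.span B" 
    using cv.maximal_independent_subset[of A] by blast
  have spB: "cv.span B = cv.span A"
    using B cv.span_mono[of B A] cv.span_minimal[OF B(3)] by auto
  obtain E where E: "B \<subseteq> E" "cv.independent E" "UNIV \<subseteq> cv.span E"
    by (rule cv.maximal_independent_subset_extend[OF subset_UNIV B(2)]) blast
  obtain \<pi> where \<pi>: "Vector_Spaces.linear smul smul \<pi>" "\<forall>x\<in>E. \<pi> x = (if x \<in> B then 0 else x)"
    using cvp.linear_independent_extend[OF E(2), of "\<lambda>x. if x \<in> B then 0 else x"] by blast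
  interpret P: Vector_Spaces.linear smul smul \<pi> by fact
  have "\<pi> x = 0 \<longleftrightarrow> x \<in> cv.span A" for x
  proof
    assume "x \<in> cv.span A"
    then have x: "x \<in> cv.span B" using spB by simp
    show "\<pi> x = 0"
    proof (rule P.eq_0_on_span[OF _ x])
      show "\<pi> b = 0" if "b \<in> B" for b using that \<pi>(2) E(1) by auto
    qed
  next
    assume 0: "\<pi> x = 0"
    have "B \<union> (E - B) = E" using E(1) by blast
    then have "x \<in> cv.span (B \<union> (E - B))" using E(3) by auto
    then obtain y z where yz: "x = y + z" "y \<in> cv.span B" "z \<in> cv.span (E - B)"
      unfolding cv.span_Un by blast
    have "\<pi> y = 0"
    proof (rule P.eq_0_on_span[OF _ yz(2)])
      show "\<pi> b = 0" if "b \<in> B" for b using that \<pi>(2) E(1) by auto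
    qed
    moreover have "\<pi> z = z"
      using cvp.linear_eq_on[OF \<pi>(1) cv.linear_id yz(3)] \<pi>(2) by auto
    ultimately have "z = 0" using 0 yz by (simp add: P.add)
    then show "x \<in> cv.span A" using yz spB by simp
  qed
  then show ?thesis using that \<pi>(1) by blast
qed

lemma fdim_sums:
  assumes "fdim A" "fdim B" shows "fdim {a + b |a b. a \<in> A \<and> b \<in> B}"
proof -
  obtain S T where "finite S" "A \<subseteq> cv.span S" "finite T" "B \<subseteq> cv.span T"
    using assms by (auto simp: fdim_def)
  then show ?thesis unfolding fdim_def
    by (intro exI[of _ "S \<union> T"]) (auto simp: cv.span_Un)
qed

text \<open>The projection along \<open>A\<close> has the same image on the sum and on
  \<open>B\<close>, with kernels \<open>A\<close> and \<open>A \<inter> B\<close>; the formula is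
  the difference of the two rank formulas.\<close>

lemma dim_sums_Int:
  assumes A: "cv.subspace A" "fdim A" and B: "cv.subspace B" "fdim B"
  shows "cv.dim {a + b |a b. a \<in> A \<and> b \<in> B} + cv.dim (A \<inter> B) = cv.dim A + cv.dim B"
proof -
  let ?S = "{a + b |a b. a \<in> A \<and> b \<in> B}"
  obtain \<pi> :: "'a cvec \<Rightarrow> 'a cvec" where \<pi>: "Vector_Spaces.linear smul smul \<pi>" and
    ker: "\<And>x. \<pi> x = 0 \<longleftrightarrow> x \<in> A"
    using projection_along[of A] A(1) by (metis cv.span_eq_iff)
  interpret P: Vector_Spaces.linear smul smul \<pi> by fact
  have AS: "A \<subseteq> ?S" using cv.subspace_0[OF B(1)] by force
  have im: "\<pi> ` ?S = \<pi> ` B"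
  proof
    show "\<pi> ` ?S \<subseteq> \<pi> ` B"
    proof
      fix y assume "y \<in> \<pi> ` ?S"
      then obtain a b where "a \<in> A" "b \<in> B" "y = \<pi> (a + b)" by blast
      then show "y \<in> \<pi> ` B" using ker[of a] by (simp add: P.add)
    qed
    show "\<pi> ` B \<subseteq> \<pi> ` ?S"
    proof
      fix y assume "y \<in> \<pi> ` B"
      then obtain b where "b \<in> B" "y = \<pi> (0 + b)" by auto
      then show "y \<in> \<pi> ` ?S" using cv.subspace_0[OF A(1)] by blast
    qed
  qed
  have 1: "cv.dim ?S = cv.dim (\<pi> ` ?S) + cv.dim {v \<in> ?S. \<pi> v = 0}"
    by (rule rank_nullity[OF \<pi> cv.subspace_sums[OF A(1) B(1)] fdim_sums[OF A(2) B(2)]])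
  have 2: "cv.dim B = cv.dim (\<pi> ` B) + cv.dim {v \<in> B. \<pi> v = 0}"
    by (rule rank_nullity[OF \<pi> B])
  have "{v \<in> ?S. \<pi> v = 0} = A" using ker AS by blast
  moreover have "{v \<in> B. \<pi> v = 0} = A \<inter> B" using ker by blast
  ultimately show ?thesis using 1 2 im by simp
qed

lemma dim_0_iff:
  assumes "cv.subspace V" "fdim V"
  shows "cv.dim V = 0 \<longleftrightarrow> V = {0}"
proof
  assume "cv.dim V = 0"
  then obtain B where "finite B" "V \<subseteq> cv.span B" "card B = 0" using fdim_basis[OF assms(2)] by metis
  then have "V \<subseteq> {0}" by auto
  then show "V = {0}" using cv.subspace_0[OF assms(1)] by blast
next
  assume "V = {0}"
  then show "cv.dim V = 0"
    by (metis card.empty cv.basis_exists cv.dim_le_card cv.independent_empty cv.span_empty 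
        cv.span_eq_dim cv.dim_eq_card_independent cv.span_insert_0)
qed

lemma dim_inj_image:
  assumes T: "Vector_Spaces.linear smul smul T" and V: "cv.subspace V" "fdim V"
    and inj: "\<And>v. v \<in> V \<Longrightarrow> T v = 0 \<Longrightarrow> v = 0"
  shows "cv.dim (T ` V) = cv.dim V"
proof -
  interpret T: Vector_Spaces.linear smul smul T by fact
  have "{v \<in> V. T v = 0} = {0}" using inj cv.subspace_0[OF V(1)] T.zero by auto
  moreover have "fdim {0 :: 'a cvec}" unfolding fdim_def by (intro exI[of _ "{}"]) simp
  ultimately show ?thesis using rank_nullity[OF T V] dim_0_iff[of "{0}"]
    by (simp add: cv.subspace_single_0)
qed

lemma subspace_eq_of_dim:
  assumes "cv.subspace V" "fdim W" "V \<subseteq> W" "cv.dim W \<le> cv.dim V"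
  shows "V = W"
proof
  have fV: "fdim V" using fdim_mono assms by blast
  obtain B where B: "B \<subseteq> V" "cv.independent B" "finite B" "V \<subseteq> cv.span B" "card B = cv.dim V"
    using fdim_basis[OF fV] by metis
  show "W \<subseteq> V"
  proof
    fix w assume w: "w \<in> W"
    show "w \<in> V"
    proof (rule ccontr)
      assume "w \<notin> V"
      then have "w \<notin> cv.span B" using B assms(1) cv.span_minimal by blast
      then have "cv.independent (insert w B)" "w \<notin> B"
        using B cv.independent_insertI cv.span_base by blast+
      moreover obtain C where C: "finite C" "W \<subseteq> cv.span C" "card C = cv.dim W"
        using fdim_basis[OF assms(2)] by metis
      ultimately have "card (insert w B) \<le> card C"
        using cv.independent_span_bound[OF C(1), of "insert w B"] w B assms(3) by blast
      then show False using \<open>w \<notin> B\<close> B C assms(4) by simp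
    qed
  qed
qed (rule assms)

text \<open>Vectors independent modulo \<open>W\<close> stay independent under the projection along
  \<open>W\<close>, whose image of \<open>V\<close> has the codimension as its dimension. The family
  is indexed by numbers so that a repeated vector counts as a relation.\<close>

lemma codim_ge_family:
  assumes V: "cv.subspace V" "fdim V" and W: "cv.subspace W" "W \<subseteq> V"
    and g: "\<And>i. i < m \<Longrightarrow> g i \<in> V"
    and ind: "\<And>c. (\<Sum>i<m. smul (c i) (g i)) \<in> W \<Longrightarrow> \<forall>i<m. c i = 0"
  shows "cv.dim W + m \<le> cv.dim V"
proof -
  obtain \<pi> :: "'a cvec \<Rightarrow> 'a cvec" where \<pi>: "Vector_Spaces.linear smul smul \<pi>" and
    ker: "\<And>x. \<pi> x = 0 \<longleftrightarrow> x \<in> W"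
    using projection_along[of W] W(1) by (metis cv.span_eq_iff)
  interpret P: Vector_Spaces.linear smul smul \<pi> by fact
  have inj: "inj_on (\<lambda>i. \<pi> (g i)) {..<m}"
  proof (rule inj_onI, rule ccontr)
    fix i j assume ij: "i \<in> {..<m}" "j \<in> {..<m}" "\<pi> (g i) = \<pi> (g j)" "i \<noteq> j"
    \<comment> \<open>Equal images would make the difference of the two members a nontrivial
      relation modulo \<open>W\<close>.\<close>
    let ?c = "\<lambda>k. if k = i then 1 else if k = j then -1 else 0 :: complex"
    have eq: "(\<Sum>k<m. smul (?c k) (g k)) = (\<Sum>k\<in>{i, j}. smul (?c k) (g k))"
      using ij by (intro sum.mono_neutral_right) auto
    have "\<pi> (\<Sum>k<m. smul (?c k) (g k)) = 0" using ij unfolding eq by (simp add: P.add P.scale P.diff P.neg)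
    then show False using ind[of ?c] ker ij by force
  qed
  have "cv.independent ((\<lambda>i. \<pi> (g i)) ` {..<m})"
  proof (rule cv.independent_if_scalars_zero)
    fix f x assume s: "(\<Sum>x\<in>(\<lambda>i. \<pi> (g i)) ` {..<m}. smul (f x) x) = 0" and x: "x \<in> (\<lambda>i. \<pi> (g i)) ` {..<m}"
    have "\<pi> (\<Sum>i<m. smul (f (\<pi> (g i))) (g i)) = 0"
      using s inj by (simp add: sum.reindex P.sum P.scale)
    then have "\<forall>i<m. f (\<pi> (g i)) = 0" using ind[of "\<lambda>i. f (\<pi> (g i))"] ker by blast
    then show "f x = 0" using x by auto
  qed simp
  then have "card ((\<lambda>i. \<pi> (g i)) ` {..<m}) \<le> cv.dim (\<pi> ` V)"
  proof -
    assume i: "cv.independent ((\<lambda>i. \<pi> (g i)) ` {..<m})"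
    obtain S where S: "finite S" "V \<subseteq> cv.span S" using V by (auto simp: fdim_def)
    then have "\<pi> ` V \<subseteq> cv.span (\<pi> ` S)" using P.span_image by blast
    then have "fdim (\<pi> ` V)" using S by (auto simp: fdim_def)
    from dim_mono[OF this, of "(\<lambda>i. \<pi> (g i)) ` {..<m}"] show ?thesis
      using g cv.dim_eq_card_independent[OF i] by fastforce
  qed
  moreover have "card ((\<lambda>i. \<pi> (g i)) ` {..<m}) = m" using inj by (simp add: card_image)
  moreover have "{v \<in> V. \<pi> v = 0} = W" using ker W by blast
  ultimately show ?thesis using rank_nullity[OF \<pi> V] by simp
qed

text \<open>Converse of \<open>codim_ge_family\<close>: the vectors that extend a basis of
  \<open>W\<close> to a basis of \<open>V\<close> are independent modulo \<open>W\<close>, and there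
  are at least \<open>m\<close> of them.\<close>

lemma codim_family:
  assumes V: "fdim V" and W: "cv.subspace W" "W \<subseteq> V" and m: "cv.dim W + m \<le> cv.dim V"
  obtains g where "\<And>i. i < m \<Longrightarrow> g i \<in> V"
    "\<And>c. (\<Sum>i<m. smul (c i) (g i)) \<in> W \<Longrightarrow> \<forall>i<m. c i = 0"
proof -
  have fW: "fdim W" using fdim_mono V W by blast
  obtain C where C: "C \<subseteq> W" "cv.independent C" "finite C" "W \<subseteq> cv.span C" "card C = cv.dim W"
    using fdim_basis[OF fW] by metis
  have CV: "C \<subseteq> V" using C(1) W(2) by blast
  obtain D where D: "C \<subseteq> D" "D \<subseteq> V" "cv.independent D" "V \<subseteq> cv.span D"
    by (rule cv.maximal_independent_subset_extend[OF CV C(2)]) blast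
  have fD: "finite D"
  proof -
    obtain S where S: "finite S" "V \<subseteq> cv.span S" using V by (auto simp: fdim_def)
    then show ?thesis using cv.independent_span_bound[OF S(1) D(3)] D(2) by blast
  qed
  have dD: "cv.dim V = card D" using cv.basis_card_eq_dim[OF D(2,4,3)] by simp
  have "m \<le> card (D - C)" using m dD C D fD by (simp add: card_Diff_subset)
  then obtain F where F: "F \<subseteq> D - C" "card F = m" by (meson obtain_subset_with_card_n)
  have fF: "finite F" using F fD finite_subset by blast
  obtain g where g: "bij_betw g {..<m} F"
    using ex_bij_betw_nat_finite[OF fF] F by (auto simp: atLeast0LessThan)
  show ?thesis
  proof
    show "g i \<in> V" if "i < m" for i using bij_betwE[OF g] that F D by blast
    fix c :: "nat \<Rightarrow> complex" assume s: "(\<Sum>i<m. smul (c i) (g i)) \<in> W"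
    define e where "e x = c (the_inv_into {..<m} g x)" for x
    have e: "e (g i) = c i" if "i < m" for i
      using that g by (simp add: e_def bij_betw_def the_inv_into_f_f)
    have "(\<Sum>i<m. smul (c i) (g i)) = (\<Sum>i<m. smul (e (g i)) (g i))" using e by auto
    also have "\<dots> = (\<Sum>x\<in>F. smul (e x) x)" using sum.reindex_bij_betw[OF g, of "\<lambda>x. smul (e x) x"] .
    finally have "(\<Sum>x\<in>F. smul (e x) x) \<in> cv.span C" using s C by auto
    then obtain u where u: "(\<Sum>x\<in>F. smul (e x) x) = (\<Sum>x\<in>C. smul (u x) x)"
      using cv.span_finite[OF C(3)] by auto
    \<comment> \<open>The expansions of one vector over \<open>F\<close> and over \<open>C\<close>
      are merged into a single relation on the independent set \<open>F \<union> C\<close>.\<close>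
    let ?h = "\<lambda>x. if x \<in> F then e x else - u x"
    have "(\<Sum>x\<in>F \<union> C. smul (?h x) x) = (\<Sum>x\<in>F. smul (?h x) x) + (\<Sum>x\<in>C. smul (?h x) x)"
      using F fF C by (intro sum.union_disjoint) auto
    also have "(\<Sum>x\<in>C. smul (?h x) x) = - (\<Sum>x\<in>C. smul (u x) x)"
      unfolding sum_negf[symmetric] using F by (intro sum.cong) auto
    finally have "(\<Sum>x\<in>F \<union> C. smul (?h x) x) = 0" using u by simp
    moreover have "cv.independent (F \<union> C)" using cv.independent_mono[OF D(3)] F D by blast
    ultimately have "?h x = 0" if "x \<in> F" for x
      using cv.independentD[of "F \<union> C" "F \<union> C" ?h x] fF C that by auto
    then have "e x = 0" if "x \<in> F" for x using that by auto
    then show "\<forall>i<m. c i = 0" using e g by (metis bij_betwE lessThan_iff)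
  qed
qed

section \<open>Coordinate spaces and their dimension\<close>

lemma cspace_eq_span: "cspace I = cv.span ((\<lambda>i. sgl i 1) ` I)"
proof
  show "cv.span ((\<lambda>i. sgl i 1) ` I) \<subseteq> cspace I"
  proof (rule cv.span_minimal)
    show "cv.subspace (cspace I :: 'a cvec set)"
      by (rule cv.subspaceI) (auto simp: cspace_def subset_iff in_keys_iff lookup_add, metis add_0)
  qed (auto simp: cspace_def)
  show "cspace I \<subseteq> cv.span ((\<lambda>i. sgl i 1) ` I)"
  proof
    fix v :: "'a cvec" assume v: "v \<in> cspace I"
    have "v = (\<Sum>i\<in>supp v. smul (coef v i) (sgl i 1))"
      by (rule poly_mapping_eqI) 
        (auto simp: lookup_sum lookup_single when_def in_keys_iff if_distrib[of "(*) _"] cong: if_cong)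
    also have "\<dots> \<in> cv.span ((\<lambda>i. sgl i 1) ` I)"
      using v by (intro cv.span_sum cv.span_scale cv.span_base) (auto simp: cspace_def)
    finally show "v \<in> cv.span ((\<lambda>i. sgl i 1) ` I)" .
  qed
qed

lemma subspace_cspace [simp]: "cv.subspace (cspace I)"
  unfolding cspace_eq_span by simp

lemma fdim_cspace: "finite I \<Longrightarrow> fdim (cspace I)"
  unfolding fdim_def cspace_eq_span by blast

lemma independent_sgl: "cv.independent ((\<lambda>i. sgl i (1::complex)) ` I)"
proof -
  show ?thesis unfolding cv.independent_explicit_module
  proof (intro allI impI)
    fix t u and v :: "'a cvec"
    assume a: "finite t" "t \<subseteq> (\<lambda>i. sgl i (1::complex)) ` I" "(\<Sum>v\<in>t. smul (u v) v) = 0" "v \<in> t"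
    then obtain i where i: "v = sgl i 1" by blast
    have "0 = coef (\<Sum>w\<in>t. smul (u w) w) i" using a by simp
    also have "\<dots> = (\<Sum>w\<in>t. u w * coef w i)" by (simp add: lookup_sum)
    also have "\<dots> = (\<Sum>w\<in>{v}. u w * coef w i)"
    proof (rule sum.mono_neutral_right)
      show "\<forall>w\<in>t - {v}. u w * coef w i = 0"
      proof
        fix w assume w: "w \<in> t - {v}"
        then obtain j where "w = sgl j 1" using a by blast
        then show "u w * coef w i = 0" using w i by (auto simp: lookup_single when_def)
      qed
    qed (use a in auto)
    finally show "u v = 0" using i by simp
  qed
qed

lemma dim_cspace: "cv.dim (cspace I) = card I"
proof -
  have "inj_on (\<lambda>i::'a. sgl i (1::complex)) I" 
    by (auto intro!: inj_onI dest!: arg_cong[of _ _ "\<lambda>p. coef p _"] simp: lookup_single when_def split: if_splits)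
  then show ?thesis unfolding cspace_eq_span cv.dim_span
    using cv.dim_eq_card_independent[OF independent_sgl, of I] by (simp add: card_image)
qed

section \<open>Evaluation and substitution\<close>

text \<open>The value of a monomial in an arbitrary commutative monoid, so that numbers and
  polynomials can both be substituted for the variables.\<close>

definition mval :: "('v \<Rightarrow> 'r::comm_monoid_mult) \<Rightarrow> ('v \<Rightarrow>\<^sub>0 nat) \<Rightarrow> 'r"
  where "mval \<sigma> m = (\<Prod>i\<in>supp m. \<sigma> i ^ coef m i)"

lemma mval_superset: "finite A \<Longrightarrow> supp m \<subseteq> A \<Longrightarrow> mval \<sigma> m = (\<Prod>i\<in>A. \<sigma> i ^ coef m i)"
  unfolding mval_def by (rule prod.mono_neutral_left) (auto simp: in_keys_iff)

lemma mval_0 [simp]: "mval \<sigma> 0 = 1"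
  by (simp add: mval_def)

lemma mval_add: "mval \<sigma> (m + m') = mval \<sigma> m * mval \<sigma> m'"
proof -
  let ?A = "supp m \<union> supp m'"
  have "mval \<sigma> (m + m') = (\<Prod>i\<in>?A. \<sigma> i ^ coef (m + m') i)"
    by (rule mval_superset) (simp_all add: keys_add)
  also have "\<dots> = (\<Prod>i\<in>?A. \<sigma> i ^ coef m i) * (\<Prod>i\<in>?A. \<sigma> i ^ coef m' i)"
    by (simp add: lookup_add power_add prod.distrib)
  also have "\<dots> = mval \<sigma> m * mval \<sigma> m'"
    by (simp add: mval_superset[of ?A])
  finally show ?thesis .
qed

lemma mval_sgl [simp]: "mval \<sigma> (sgl i k) = \<sigma> i ^ k"
  by (simp add: mval_def)

text \<open>Evaluation at a point and substitution of polynomials are the same construction over two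
  coefficient maps, the identity and \<open>pconst\<close>; the homomorphism laws are proved once
  for both.\<close>

locale coeff_hom =
  fixes \<phi> :: "complex \<Rightarrow> 'r::comm_ring_1"
  assumes hom_add: "\<phi> (a + b) = \<phi> a + \<phi> b" and hom_mult: "\<phi> (a * b) = \<phi> a * \<phi> b" and hom_1: "\<phi> 1 = 1"
begin

lemma hom_0: "\<phi> 0 = 0"
  using hom_add[of 0 0] by simp

definition geval :: "('v \<Rightarrow> 'r) \<Rightarrow> 'v cpoly \<Rightarrow> 'r"
  where "geval \<sigma> p = (\<Sum>m\<in>supp p. \<phi> (coef p m) * mval \<sigma> m)"

lemma geval_superset: "finite A \<Longrightarrow> supp p \<subseteq> A \<Longrightarrow> geval \<sigma> p = (\<Sum>m\<in>A. \<phi> (coef p m) * mval \<sigma> m)"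
  unfolding geval_def by (rule sum.mono_neutral_left) (auto simp: in_keys_iff hom_0)

lemma geval_0: "geval \<sigma> 0 = 0"
  by (simp add: geval_def)

lemma geval_add: "geval \<sigma> (p + q) = geval \<sigma> p + geval \<sigma> q"
proof -
  let ?A = "supp p \<union> supp q"
  have "geval \<sigma> (p + q) = (\<Sum>m\<in>?A. \<phi> (coef (p + q) m) * mval \<sigma> m)"
    by (rule geval_superset) (simp_all add: keys_add)
  also have "\<dots> = (\<Sum>m\<in>?A. \<phi> (coef p m) * mval \<sigma> m) + (\<Sum>m\<in>?A. \<phi> (coef q m) * mval \<sigma> m)"
    by (simp add: lookup_add hom_add algebra_simps sum.distrib)
  finally show ?thesis by (simp add: geval_superset[of ?A])
qed

lemma geval_sum: "geval \<sigma> (sum f A) = (\<Sum>a\<in>A. geval \<sigma> (f a))"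
  by (induction A rule: infinite_finite_induct) (simp_all add: geval_0 geval_add)

lemma geval_sgl: "geval \<sigma> (sgl m c) = \<phi> c * mval \<sigma> m"
  by (simp add: geval_def hom_0)

end

lemma poly_expansion: "p = (\<Sum>m\<in>supp p. sgl m (coef p m))"
  by (rule poly_mapping_eqI)
    (auto simp: lookup_sum lookup_single when_def in_keys_iff if_distrib[of "(*) _"] cong: if_cong)

context coeff_hom begin

lemma geval_mult: "geval \<sigma> (p * q) = geval \<sigma> p * geval \<sigma> q"
proof -
  have "p * q = (\<Sum>m\<in>supp p. \<Sum>m'\<in>supp q. sgl (m + m') (coef p m * coef q m'))"
    by (subst poly_expansion[of p], subst poly_expansion[of q]) (simp add: sum_product mult_single)
  then have "geval \<sigma> (p * q) = (\<Sum>m\<in>supp p. \<Sum>m'\<in>supp q. \<phi> (coef p m) * mval \<sigma> m * (\<phi> (coef q m') * mval \<sigma> m'))"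
    by (simp add: geval_sum geval_sgl mval_add hom_mult algebra_simps)
  then show ?thesis by (simp add: geval_def sum_product)
qed

lemma geval_1: "geval \<sigma> 1 = 1"
  using geval_sgl[of \<sigma> 0 1] by (simp add: hom_1)

lemma geval_power: "geval \<sigma> (p ^ k) = geval \<sigma> p ^ k"
  by (induction k) (simp_all add: geval_1 geval_mult)

lemma geval_prod: "geval \<sigma> (prod f A) = (\<Prod>a\<in>A. geval \<sigma> (f a))"
  by (induction A rule: infinite_finite_induct) (simp_all add: geval_1 geval_mult)

lemma geval_uminus: "geval \<sigma> (- p) = - geval \<sigma> p"
  using geval_add[of \<sigma> p "- p"] by (simp add: geval_0 eq_neg_iff_add_eq_0 add.commute)

lemma geval_diff: "geval \<sigma> (p - q) = geval \<sigma> p - geval \<sigma> q"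
  using geval_add[of \<sigma> p "- q"] by (simp add: geval_uminus)

lemma geval_pconst: "geval \<sigma> (pconst c) = \<phi> c"
  by (simp add: pconst_def geval_sgl)

lemma geval_pvar: "geval \<sigma> (pvar i) = \<sigma> i"
  by (simp add: pvar_def geval_sgl hom_1)

end

lemma pconst_add: "pconst (a + b) = pconst a + pconst b"
  by (simp add: pconst_def single_add)
lemma pconst_mult: "pconst (a * b) = pconst a * pconst b"
  by (simp add: pconst_def mult_single)
lemma pconst_1 [simp]: "pconst 1 = 1"
  by (simp add: pconst_def)
lemma pconst_0 [simp]: "pconst 0 = 0"
  by (simp add: pconst_def)
interpretation ev: coeff_hom "\<lambda>c. c"
  rewrites "ev.geval \<sigma> p = peval p \<sigma>"
proof -
  show "coeff_hom (\<lambda>c::complex. c)" by unfold_locales simp_all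
  then interpret coeff_hom "\<lambda>c::complex. c" .
  show "geval \<sigma> p = peval p \<sigma>" by (simp add: geval_def peval_def mval_def)
qed

interpretation sub: coeff_hom pconst
  rewrites "sub.geval \<sigma> p = psubst \<sigma> p"
proof -
  show "coeff_hom (pconst :: complex \<Rightarrow> 'a cpoly)" 
    by unfold_locales (simp_all add: pconst_add pconst_mult)
  then interpret coeff_hom "pconst :: complex \<Rightarrow> 'a cpoly" .
  show "geval \<sigma> p = psubst \<sigma> p" for \<sigma> and p :: "'b cpoly"
    by (simp add: geval_def psubst_def mval_def)
qed

lemmas peval_simps = ev.geval_0 ev.geval_1 ev.geval_add ev.geval_mult ev.geval_sum ev.geval_prod ev.geval_power
  ev.geval_uminus ev.geval_diff ev.geval_pconst ev.geval_pvar
lemmas psubst_simps = sub.geval_0 sub.geval_1 sub.geval_add sub.geval_mult sub.geval_sum sub.geval_prod 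
  sub.geval_power sub.geval_uminus sub.geval_diff sub.geval_pconst sub.geval_pvar

lemma peval_psubst: "peval (psubst \<sigma> p) x = peval p (\<lambda>i. peval (\<sigma> i) x)"
  unfolding psubst_def by (simp add: peval_simps peval_def[of p])

lemma smul_conv: "smul c p = pconst c * (p :: 'v cpoly)"
  by (simp add: smul_def pconst_def mult_map_scale_conv_mult)

lemma peval_smul: "peval (smul c p) x = c * peval p x"
  by (simp add: smul_conv peval_simps)

lemma psubst_smul: "psubst \<sigma> (smul c p) = smul c (psubst \<sigma> p)"
  by (simp add: smul_conv psubst_simps)

lemma smul_mult_left: "smul c p * q = smul c (p * q)" for p q :: "'v cpoly"
  by (simp add: smul_conv mult.assoc)

lemma smul_mult_right: "p * smul c q = smul c (p * q)" for p q :: "'v cpoly"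
  by (simp add: smul_conv algebra_simps)

lemma linear_psubst: "Vector_Spaces.linear smul smul (psubst \<sigma>)"
  by unfold_locales (simp_all add: psubst_simps psubst_smul)

lemma linear_mult: "Vector_Spaces.linear smul smul ((*) (p :: 'v cpoly))"
  by unfold_locales (simp_all add: algebra_simps smul_mult_right)

section \<open>Polynomials in given variables and forms\<close>

lemma mdeg_superset: "finite A \<Longrightarrow> supp m \<subseteq> A \<Longrightarrow> (\<Sum>i\<in>supp m. coef m i) = (\<Sum>i\<in>A. coef m i)"
  by (rule sum.mono_neutral_left) (auto simp: in_keys_iff)

lemma mdeg_add: "(\<Sum>i\<in>supp (m + m'). coef (m + m') i) = (\<Sum>i\<in>supp m. coef m i) + (\<Sum>i\<in>supp m'. coef m' i)"
  for m m' :: "'v \<Rightarrow>\<^sub>0 nat"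
proof -
  let ?A = "supp m \<union> supp m'"
  have "(\<Sum>i\<in>supp (m + m'). coef (m + m') i) = (\<Sum>i\<in>?A. coef (m + m') i)"
    by (rule mdeg_superset) (simp_all add: keys_add)
  also have "\<dots> = (\<Sum>i\<in>?A. coef m i) + (\<Sum>i\<in>?A. coef m' i)"
    by (simp add: lookup_add sum.distrib)
  finally show ?thesis by (simp add: mdeg_superset[of ?A])
qed

lemma supp_add_nat: "supp (m + m') = supp m \<union> supp m'" for m m' :: "'v \<Rightarrow>\<^sub>0 nat"
  by (auto simp: in_keys_iff lookup_add)

lemma mons_add: "m \<in> mons X j \<Longrightarrow> m' \<in> mons X k \<Longrightarrow> m + m' \<in> mons X (j + k)"
  unfolding mons_def mem_Collect_eq mdeg_add by (simp add: supp_add_nat)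

lemma mons_0: "mons X 0 = {0}"
proof -
  have "m = 0" if "(\<Sum>i\<in>supp m. coef m i) = 0" for m :: "'a \<Rightarrow>\<^sub>0 nat"
    using that by (intro poly_mapping_eqI) (auto simp: in_keys_iff)
  then show ?thesis by (auto simp: mons_def)
qed

lemma forms_mult: "p \<in> forms X j \<Longrightarrow> q \<in> forms X k \<Longrightarrow> p * q \<in> forms X (j + k)"
  unfolding cspace_def using keys_mult[of p q] mons_add by fastforce

lemma forms_add: "p \<in> forms X j \<Longrightarrow> q \<in> forms X j \<Longrightarrow> p + q \<in> forms X j"
  by (rule cv.subspace_add) simp_all
lemma forms_diff: "p \<in> forms X j \<Longrightarrow> q \<in> forms X j \<Longrightarrow> p - q \<in> forms X j"
  by (rule cv.subspace_diff) simp_all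
lemma forms_0 [simp]: "0 \<in> forms X j"
  by (rule cv.subspace_0) simp_all
lemma forms_sum: "(\<And>a. a \<in> A \<Longrightarrow> f a \<in> forms X j) \<Longrightarrow> sum f A \<in> forms X j"
  by (rule cv.subspace_sum) simp_all
lemma forms_smul: "p \<in> forms X j \<Longrightarrow> smul c p \<in> forms X j"
  by (rule cv.subspace_scale) simp_all

lemma pconst_forms: "pconst c \<in> forms X 0"
  by (simp add: cspace_def pconst_def mons_0)

lemma one_forms: "1 \<in> forms X 0"
  using pconst_forms[of 1] by simp

lemma forms_0_iff: "p \<in> forms X 0 \<longleftrightarrow> (\<exists>c. p = pconst c)"
proof
  assume p: "p \<in> forms X 0"
  have "p = pconst (coef p 0)"
    by (rule poly_mapping_eqI) (use p in \<open>auto simp: cspace_def mons_0 pconst_def lookup_single when_def in_keys_iff subset_iff\<close>)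
  then show "\<exists>c. p = pconst c" ..
qed (use pconst_forms in blast)

lemma pvar_forms: "i \<in> X \<Longrightarrow> pvar i \<in> forms X 1"
  by (simp add: cspace_def pvar_def mons_def)

lemma forms_power: "p \<in> forms X j \<Longrightarrow> p ^ k \<in> forms X (k * j)"
  by (induction k) (simp_all add: one_forms forms_mult)

lemma forms_prod: "finite A \<Longrightarrow> (\<And>a. a \<in> A \<Longrightarrow> f a \<in> forms X (d a)) \<Longrightarrow> prod f A \<in> forms X (sum d A)"
  by (induction A rule: finite_induct) (simp_all add: one_forms forms_mult)

lemma forms_psubst:
  assumes p: "p \<in> forms X k" and \<sigma>: "\<And>i. i \<in> X \<Longrightarrow> \<sigma> i \<in> forms Y e"
  shows "psubst \<sigma> p \<in> forms Y (k * e)"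
  unfolding psubst_def
proof (rule forms_sum)
  fix m assume m: "m \<in> supp p"
  then have m': "supp m \<subseteq> X" "(\<Sum>i\<in>supp m. coef m i) = k" using p by (auto simp: cspace_def mons_def)
  have "(\<Prod>i\<in>supp m. \<sigma> i ^ coef m i) \<in> forms Y (\<Sum>i\<in>supp m. coef m i * e)"
    by (rule forms_prod) (use m' \<sigma> in \<open>auto intro: forms_power\<close>)
  also have "(\<Sum>i\<in>supp m. coef m i * e) = k * e" using m' by (simp flip: sum_distrib_right)
  finally show "pconst (coef p m) * (\<Prod>i\<in>supp m. \<sigma> i ^ coef m i) \<in> forms Y (k * e)"
    using forms_mult[OF pconst_forms] by fastforce
qed

lemma peval_homog:
  assumes "p \<in> forms X k"
  shows "peval p (\<lambda>i. c * x i) = c ^ k * peval p x"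
proof -
  have "(\<Prod>i\<in>supp m. (c * x i) ^ coef m i) = c ^ k * (\<Prod>i\<in>supp m. x i ^ coef m i)" if "m \<in> supp p" for m
  proof -
    have "(\<Sum>i\<in>supp m. coef m i) = k" using that assms by (auto simp: cspace_def mons_def)
    then show ?thesis by (simp add: power_mult_distrib prod.distrib flip: power_sum)
  qed
  then show ?thesis unfolding peval_def by (simp add: sum_distrib_left algebra_simps)
qed

lemma peval_cong_vars:
  assumes "p \<in> polys X" "\<And>i. i \<in> X \<Longrightarrow> x i = y i"
  shows "peval p x = peval p y"
  unfolding peval_def
proof (rule sum.cong[OF refl])
  fix m assume "m \<in> supp p"
  then have "supp m \<subseteq> X" using assms by (auto simp: polys_def)
  then have "(\<Prod>i\<in>supp m. x i ^ coef m i) = (\<Prod>i\<in>supp m. y i ^ coef m i)"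
    using assms by (intro prod.cong) auto
  then show "coef p m * (\<Prod>i\<in>supp m. x i ^ coef m i) = coef p m * (\<Prod>i\<in>supp m. y i ^ coef m i)" by simp
qed

lemma forms_subset_polys: "forms X k \<subseteq> polys X"
  by (auto simp: cspace_def polys_def mons_def)

lemma polys_eq_cspace: "polys X = cspace {m. supp m \<subseteq> X}"
  by (auto simp: polys_def cspace_def)

lemma subspace_polys [simp]: "cv.subspace (polys X)"
  unfolding polys_eq_cspace by simp

lemma polys_mult: "p \<in> polys X \<Longrightarrow> q \<in> polys X \<Longrightarrow> p * q \<in> polys X"
proof -
  assume pq: "p \<in> polys X" "q \<in> polys X"
  have "supp m \<subseteq> X" if "m \<in> supp (p * q)" for m
  proof -
    obtain a b where "a \<in> supp p" "b \<in> supp q" "m = a + b" using \<open>m \<in> supp (p * q)\<close> keys_mult[of p q] by blast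
    then show ?thesis using pq by (auto simp: polys_def supp_add_nat)
  qed
  then show ?thesis by (simp add: polys_def)
qed

lemma polys_add: "p \<in> polys X \<Longrightarrow> q \<in> polys X \<Longrightarrow> p + q \<in> polys X"
  by (rule cv.subspace_add) simp_all
lemma polys_diff: "p \<in> polys X \<Longrightarrow> q \<in> polys X \<Longrightarrow> p - q \<in> polys X"
  by (rule cv.subspace_diff) simp_all
lemma polys_uminus: "p \<in> polys X \<Longrightarrow> - p \<in> polys X"
  by (rule cv.subspace_neg) simp_all
lemma polys_0 [simp]: "0 \<in> polys X"
  by (rule cv.subspace_0) simp_all
lemma polys_sum: "(\<And>a. a \<in> A \<Longrightarrow> f a \<in> polys X) \<Longrightarrow> sum f A \<in> polys X"
  by (rule cv.subspace_sum) simp_all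
lemma polys_smul: "p \<in> polys X \<Longrightarrow> smul c p \<in> polys X"
  by (rule cv.subspace_scale) simp_all
lemma pconst_polys [simp]: "pconst c \<in> polys X"
  using pconst_forms forms_subset_polys by blast
lemma one_polys [simp]: "1 \<in> polys X"
  using one_forms forms_subset_polys by blast
lemma pvar_polys: "i \<in> X \<Longrightarrow> pvar i \<in> polys X"
  using pvar_forms[of i X] forms_subset_polys[of X 1] by blast
lemma polys_power: "p \<in> polys X \<Longrightarrow> p ^ k \<in> polys X"
  by (induction k) (simp_all add: polys_mult)
lemma polys_prod: "(\<And>a. a \<in> A \<Longrightarrow> f a \<in> polys X) \<Longrightarrow> prod f A \<in> polys X"
  by (induction A rule: infinite_finite_induct) (simp_all add: polys_mult)

lemma polys_psubst:
  assumes p: "p \<in> polys X" and \<sigma>: "\<And>i. i \<in> X \<Longrightarrow> \<sigma> i \<in> polys Y"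
  shows "psubst \<sigma> p \<in> polys Y"
  unfolding psubst_def
  by (intro polys_sum polys_mult polys_prod polys_power pconst_polys \<sigma>) (use p in \<open>auto simp: polys_def\<close>)

text \<open>The monomials are grouped by their exponent of \<open>v\<close>. Inductions on the
  number of variables use only the expansion; division by a linear form and the relations for the
  entries of \<open>B\<close> also use that the coefficients of a form are forms.\<close>

lemma poly_split:
  assumes p: "p \<in> polys (insert v X)" and v: "v \<notin> X"
  obtains D c where "\<And>j. c j \<in> polys X" "p = (\<Sum>j\<le>D. c j * pvar v ^ j)"
    "\<And>k j. p \<in> forms (insert v X) k \<Longrightarrow> j \<le> k \<Longrightarrow> c j \<in> forms X (k - j)"
    "\<And>k j. p \<in> forms (insert v X) k \<Longrightarrow> k < j \<Longrightarrow> c j = 0"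
    "\<And>j. D < j \<Longrightarrow> c j = 0"
proof -
  define r where "r m = m - sgl v (coef m v)" for m :: "'a \<Rightarrow>\<^sub>0 nat"
  define c where "c j = (\<Sum>m\<in>{m \<in> supp p. coef m v = j}. sgl (r m) (coef p m))" for j
  define D where "D = Max (insert 0 ((\<lambda>m. coef m v) ` supp p))"
  have D: "coef m v \<le> D" if "m \<in> supp p" for m unfolding D_def using that by auto
  have rm: "m = r m + sgl v (coef m v)" for m
    by (rule poly_mapping_eqI) (auto simp: r_def lookup_add lookup_minus lookup_single when_def)
  have rs: "supp (r m) \<subseteq> X" if "m \<in> supp p" for m
  proof
    fix t assume "t \<in> supp (r m)"
    then have "t \<noteq> v" "t \<in> supp m" 
      by (auto simp: r_def in_keys_iff lookup_minus lookup_single when_def split: if_splits)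
    then show "t \<in> X" using that p by (auto simp: polys_def)
  qed
  have pv: "pvar v ^ j = sgl (sgl v j) 1" for j
    by (induction j) (simp_all add: pvar_def mult_single flip: single_add)
  show ?thesis
  proof
    show "c j \<in> polys X" for j
      unfolding c_def by (rule polys_sum) (use rs in \<open>auto simp: polys_def\<close>)
    have "p = (\<Sum>m\<in>supp p. sgl (r m) (coef p m) * pvar v ^ coef m v)"
      by (subst poly_expansion[of p], rule sum.cong) (simp_all add: pv mult_single flip: rm)
    also have "\<dots> = (\<Sum>j\<le>D. \<Sum>m\<in>{m \<in> supp p. coef m v = j}. sgl (r m) (coef p m) * pvar v ^ coef m v)"
      by (rule sum.group[symmetric]) (use D in auto)
    also have "\<dots> = (\<Sum>j\<le>D. c j * pvar v ^ j)"
      unfolding c_def by (simp add: sum_distrib_right)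
    finally show "p = (\<Sum>j\<le>D. c j * pvar v ^ j)" .
    have dr: "(\<Sum>i\<in>supp m. coef m i) = (\<Sum>i\<in>supp (r m). coef (r m) i) + coef m v" for m
      using mdeg_add[of "r m" "sgl v (coef m v)"] rm[of m] by (simp split: if_splits)
    show "c j \<in> forms X (k - j)" if f: "p \<in> forms (insert v X) k" and "j \<le> k" for j k
      unfolding c_def
    proof (rule forms_sum)
      fix m assume m: "m \<in> {m \<in> supp p. coef m v = j}"
      then have "(\<Sum>i\<in>supp m. coef m i) = k" using f by (auto simp: cspace_def mons_def)
      then have "r m \<in> mons X (k - j)" using m rs dr[of m] by (auto simp: mons_def)
      then show "sgl (r m) (coef p m) \<in> forms X (k - j)" by (simp add: cspace_def)
    qed
    show "c j = 0" if f: "p \<in> forms (insert v X) k" and "k < j" for j k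
    proof -
      have "{m \<in> supp p. coef m v = j} = {}"
      proof -
        have "coef m v \<le> k" if "m \<in> supp p" for m
        proof -
          have "(\<Sum>i\<in>supp m. coef m i) = k" using f that by (auto simp: cspace_def mons_def)
          then show ?thesis using dr[of m] by simp
        qed
        then show ?thesis using \<open>k < j\<close> by force
      qed
      then show ?thesis unfolding c_def by (simp only: sum.empty)
    qed
    show "c j = 0" if "D < j" for j
    proof -
      have "{m \<in> supp p. coef m v = j} = {}" using D that by force
      then show ?thesis unfolding c_def by (simp only: sum.empty)
    qed
  qed
qed

lemma polys_empty: "p \<in> polys {} \<Longrightarrow> p = pconst (coef p 0)"
  by (rule poly_mapping_eqI) (auto simp: polys_def pconst_def lookup_single when_def in_keys_iff)

lemma poly_vars: obtains X where "finite X" "p \<in> polys X"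
proof
  show "finite (\<Union>m\<in>supp p. supp m)" by simp
  show "p \<in> polys (\<Union>m\<in>supp p. supp m)" by (auto simp: polys_def)
qed

section \<open>Polynomials as functions, and points where they do not vanish\<close>

lemma finite_zeros_powers:
  fixes a :: "nat \<Rightarrow> complex"
  assumes "j \<le> D" "a j \<noteq> 0"
  shows "finite {t. (\<Sum>j\<le>D. a j * t ^ j) = 0}"
  using polyfun_finite_roots[of a D] assms by blast

text \<open>Induction on the variables: at a point where one coefficient in the last variable does
  not vanish, only finitely many values of that variable are excluded.\<close>

lemma peval_nonzero_ex:
  assumes "p \<noteq> 0"
  obtains x where "peval p x \<noteq> 0"
proof -
  obtain X where "finite X" "p \<in> polys X" by (rule poly_vars)
  then have "\<exists>x. peval p x \<noteq> 0" using assms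
  proof (induction X arbitrary: p rule: finite_induct)
    case empty
    then have "p = pconst (coef p 0)" using polys_empty by blast
    then have "peval p x = coef p 0" for x by (metis ev.geval_pconst)
    moreover have "coef p 0 \<noteq> 0" using \<open>p = pconst (coef p 0)\<close> empty by auto
    ultimately show ?case by auto
  next
    case (insert v X)
    obtain D c where c: "\<And>j. c j \<in> polys X" "p = (\<Sum>j\<le>D. c j * pvar v ^ j)"
      by (rule poly_split[OF insert.prems(1) insert.hyps(2)]) (rule that, assumption+)
    have "\<exists>j\<le>D. c j \<noteq> 0"
    proof (rule ccontr)
      assume "\<not> (\<exists>j\<le>D. c j \<noteq> 0)"
      then have "p = 0" unfolding c(2) by (intro sum.neutral) auto
      then show False using insert.prems(2) by simp
    qed
    then obtain j where j: "j \<le> D" "c j \<noteq> 0" by blast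
    obtain x where x: "peval (c j) x \<noteq> 0" using insert.IH[OF c(1) j(2)] by blast
    have "finite {t. (\<Sum>j\<le>D. peval (c j) x * t ^ j) = 0}" 
      using finite_zeros_powers[of j D "\<lambda>j. peval (c j) x"] j x by blast
    then obtain t where t: "(\<Sum>j\<le>D. peval (c j) x * t ^ j) \<noteq> 0"
      using ex_new_if_finite[OF infinite_UNIV_char_0[where 'a = complex]] by blast
    have "peval (c j) (x(v := t)) = peval (c j) x" for j
      by (rule peval_cong_vars[OF c(1)]) (use insert.hyps in auto)
    then have "peval p (x(v := t)) \<noteq> 0" using t by (simp add: c(2) peval_simps)
    then show ?case by blast
  qed
  then show ?thesis using that by blast
qed

lemma peval_eq_0: "(\<And>x. peval p x = 0) \<Longrightarrow> p = 0"
  using peval_nonzero_ex by metis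

lemma peval_eqI: "(\<And>x. peval p x = peval q x) \<Longrightarrow> p = q"
  using peval_eq_0[of "p - q"] by (simp add: peval_simps)

lemma peval_line_poly:
  obtains D a where "\<And>s. peval p (\<lambda>i. x i + s * y i) = (\<Sum>j\<le>D. a j * s ^ j)"
proof -
  \<comment> \<open>Substituting the line turns \<open>p\<close> into a polynomial in one variable,
    indexed by the unit type, so that \<open>poly_split\<close> reads off its coefficients.\<close>
  define q :: "unit cpoly" where "q = psubst (\<lambda>i. pconst (x i) + pvar () * pconst (y i)) p"
  have "q \<in> polys (insert () {})" by (auto simp: polys_def)
  then obtain D c where c: "\<And>j. c j \<in> polys ({} :: unit set)" "q = (\<Sum>j\<le>D. c j * pvar () ^ j)"
    by (rule poly_split) auto
  have cc: "peval (c j) z = coef (c j) 0" for j z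
    using polys_empty[OF c(1)[of j]] by (metis ev.geval_pconst)
  have "peval p (\<lambda>i. x i + s * y i) = peval q (\<lambda>_. s)" for s
    by (simp add: q_def peval_psubst peval_simps)
  also have "peval q (\<lambda>_. s) = (\<Sum>j\<le>D. coef (c j) 0 * s ^ j)" for s
    by (simp add: c(2) peval_simps cc)
  finally show ?thesis by (rule that)
qed

lemma peval_line_finite:
  assumes "peval p (\<lambda>i. x i + s0 * y i) \<noteq> 0"
  shows "finite {s. peval p (\<lambda>i. x i + s * y i) = 0}"
proof -
  obtain D a where a: "\<And>s. peval p (\<lambda>i. x i + s * y i) = (\<Sum>j\<le>D. a j * s ^ j)"
    by (rule peval_line_poly[of p x y]) (rule that)
  have "\<exists>j\<le>D. a j \<noteq> 0"
  proof (rule ccontr)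
    assume "\<not> (\<exists>j\<le>D. a j \<noteq> 0)"
    then show False using assms a[of s0] by simp
  qed
  then show ?thesis using finite_zeros_powers[of _ D a] a by auto
qed

text \<open>Irreducibility of affine space in concrete form: on the line joining a point good for
  \<open>P\<close> to a point good for \<open>q\<close>, each polynomial has only finitely many
  zeros.\<close>

lemma peval_common_nonzero:
  assumes "finite P" "\<And>p. p \<in> P \<Longrightarrow> p \<noteq> 0"
  obtains x where "\<And>p. p \<in> P \<Longrightarrow> peval p x \<noteq> 0"
proof -
  have "\<exists>x. \<forall>p\<in>P. peval p x \<noteq> 0" using assms
  proof (induction P rule: finite_induct)
    case (insert q P)
    then obtain x where x: "\<forall>p\<in>P. peval p x \<noteq> 0" by blast
    obtain y where y: "peval q y \<noteq> 0" using insert.prems peval_nonzero_ex by blast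
    let ?l = "\<lambda>s i. x i + s * (y i - x i)"
    have "finite {s. peval p (?l s) = 0}" if "p \<in> insert q P" for p
      using that x y peval_line_finite[of p x 0 "\<lambda>i. y i - x i"] peval_line_finite[of p x 1 "\<lambda>i. y i - x i"] by auto
    then have "finite (\<Union>p\<in>insert q P. {s. peval p (?l s) = 0})" using insert.hyps by blast
    then obtain s where "s \<notin> (\<Union>p\<in>insert q P. {s. peval p (?l s) = 0})"
      using ex_new_if_finite[OF infinite_UNIV_char_0[where 'a = complex]] by blast
    then show ?case by blast
  qed simp
  then show ?thesis using that by blast
qed

lemma cpoly_no_zero_divisors:
  fixes p q :: "'v cpoly"
  assumes "p * q = 0" shows "p = 0 \<or> q = 0"
proof (rule ccontr)
  assume "\<not> ?thesis"
  then obtain x where "\<And>r. r \<in> {p, q} \<Longrightarrow> peval r x \<noteq> 0" using peval_common_nonzero[of "{p, q}"] by blast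
  then have "peval (p * q) x \<noteq> 0" by (simp add: peval_simps)
  then show False using assms by (simp add: peval_simps)
qed

section \<open>Counting monomials\<close>

text \<open>A monomial either avoids \<open>v\<close> or is divisible by it. On cardinalities this
  becomes Pascal's rule.\<close>

lemma mons_insert_Suc:
  assumes "v \<notin> X"
  shows "mons (insert v X) (Suc k) = mons X (Suc k) \<union> (\<lambda>m. m + sgl v 1) ` mons (insert v X) k"
proof (intro equalityI subsetI)
  fix m assume m: "m \<in> mons (insert v X) (Suc k)"
  show "m \<in> mons X (Suc k) \<union> (\<lambda>m. m + sgl v 1) ` mons (insert v X) k"
  proof (cases "coef m v = 0")
    case True
    then have "v \<notin> supp m" by (simp add: in_keys_iff)
    then show ?thesis using m by (auto simp: mons_def)
  next
    case False
    define r where "r = m - sgl v 1"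
    have r: "m = r + sgl v 1"
      by (rule poly_mapping_eqI) (use False in \<open>auto simp: r_def lookup_add lookup_minus lookup_single when_def\<close>)
    have "supp r \<subseteq> insert v X" using m by (simp add: mons_def r supp_add_nat)
    moreover have "(\<Sum>i\<in>supp r. coef r i) = k"
      using m mdeg_add[of r "sgl v 1"] by (simp add: mons_def r)
    ultimately show ?thesis using r by (auto simp: mons_def)
  qed
next
  fix m assume "m \<in> mons X (Suc k) \<union> (\<lambda>m. m + sgl v 1) ` mons (insert v X) k"
  then show "m \<in> mons (insert v X) (Suc k)"
  proof
    assume "m \<in> (\<lambda>m. m + sgl v 1) ` mons (insert v X) k"
    then obtain r where r: "r \<in> mons (insert v X) k" "m = r + sgl v 1" by blast
    have "sgl v 1 \<in> mons (insert v X) 1" by (simp add: mons_def)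
    from mons_add[OF r(1) this] show ?thesis using r by simp
  qed (auto simp: mons_def)
qed

lemma mons_empty_Suc: "mons {} (Suc k) = {}"
  by (auto simp: mons_def)

lemma finite_mons: "finite X \<Longrightarrow> finite (mons X k)"
proof (induction X arbitrary: k rule: finite_induct)
  case empty
  then show ?case by (cases k) (simp_all add: mons_0 mons_empty_Suc)
next
  case (insert v X)
  show ?case
  proof (induction k)
    case (Suc k)
    then show ?case using insert by (simp add: mons_insert_Suc)
  qed (simp add: mons_0)
qed

lemma card_mons_insert:
  assumes "finite X" "v \<notin> X"
  shows "card (mons (insert v X) (Suc k)) = card (mons X (Suc k)) + card (mons (insert v X) k)"
proof -
  have "inj_on (\<lambda>m. m + sgl v (1::nat)) (mons (insert v X) k)" by (auto intro: inj_onI)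
  moreover have "mons X (Suc k) \<inter> (\<lambda>m. m + sgl v 1) ` mons (insert v X) k = {}"
    using assms by (auto simp: mons_def supp_add_nat)
  ultimately show ?thesis
    unfolding mons_insert_Suc[OF assms(2)]
    using assms by (subst card_Un_disjoint) (simp_all add: finite_mons card_image)
qed

lemma card_mons:
  assumes "finite X" "card X = Suc n"
  shows "card (mons X k) = (k + n) choose n"
  using assms
proof (induction n arbitrary: X k)
  case 0
  then obtain v where X: "X = insert v {}" by (auto simp: card_Suc_eq)
  have "card (mons (insert v {}) k) = 1"
    by (induction k) (simp_all add: mons_0 card_mons_insert mons_empty_Suc)
  then show ?case by (simp add: X)
next
  case (Suc n)
  then obtain v Y where X: "X = insert v Y" "v \<notin> Y" "finite Y" "card Y = Suc n"
    by (metis card_Suc_eq finite_insert)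
  show ?case unfolding X(1)
  proof (induction k)
    case (Suc k)
    have "card (mons (insert v Y) (Suc k)) = ((Suc k + n) choose n) + ((k + Suc n) choose Suc n)"
      using card_mons_insert[OF X(3,2)] Suc.IH Suc.prems \<open>\<And>X k. finite X \<Longrightarrow> card X = Suc n \<Longrightarrow> card (mons X k) = (k + n choose n)\<close> X
      by simp
    then show ?case by simp
  qed (simp add: mons_0)
qed

lemma fdim_forms: "finite X \<Longrightarrow> fdim (forms X k)"
  by (rule fdim_cspace) (rule finite_mons)

lemma dim_forms: "cv.dim (forms X k) = card (mons X k)"
  by (rule dim_cspace)

section \<open>Graded ideals\<close>

locale graded =
  fixes X :: "'v set"
  assumes finX: "finite X"
begin

text \<open>Cofactors of a generator of degree \<open>e\<close> in degree \<open>k\<close>. Below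
  degree \<open>e\<close> they must be 0: truncated subtraction would otherwise admit
  constants.\<close>

definition cofac :: "nat \<Rightarrow> nat \<Rightarrow> 'v cpoly set"
  where "cofac k e = (if e \<le> k then forms X (k - e) else {0})"

text \<open>A homogeneous ideal, represented by the sequence of its graded pieces, each of which is
  finite-dimensional.\<close>

definition gideal :: "(nat \<Rightarrow> 'v cpoly set) \<Rightarrow> bool"
  where "gideal I \<longleftrightarrow> (\<forall>k. cv.subspace (I k) \<and> I k \<subseteq> forms X k) \<and> (\<forall>j k p u. p \<in> forms X j \<longrightarrow> u \<in> I k \<longrightarrow> p * u \<in> I (j + k))"

definition gspan :: "('i \<Rightarrow> 'v cpoly) \<Rightarrow> ('i \<Rightarrow> nat) \<Rightarrow> 'i set \<Rightarrow> nat \<Rightarrow> 'v cpoly set"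
  where "gspan z \<delta> A k = {\<Sum>i\<in>A. q i * z i |q. \<forall>i\<in>A. q i \<in> cofac k (\<delta> i)}"

definition gadd :: "(nat \<Rightarrow> 'v cpoly set) \<Rightarrow> 'v cpoly \<Rightarrow> nat \<Rightarrow> nat \<Rightarrow> 'v cpoly set"
  where "gadd I g e k = {u + q * g |u q. u \<in> I k \<and> q \<in> cofac k e}"

text \<open>The colon ideal \<open>I : g\<close> for a form \<open>g\<close> of degree
  \<open>e\<close>.\<close>

definition gcol :: "(nat \<Rightarrow> 'v cpoly set) \<Rightarrow> 'v cpoly \<Rightarrow> nat \<Rightarrow> nat \<Rightarrow> 'v cpoly set"
  where "gcol I g e k = {u \<in> forms X k. g * u \<in> I (k + e)}"

definition nzd :: "(nat \<Rightarrow> 'v cpoly set) \<Rightarrow> 'v cpoly \<Rightarrow> nat \<Rightarrow> bool"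
  where "nzd I g e \<longleftrightarrow> (\<forall>k u. u \<in> forms X k \<longrightarrow> g * u \<in> I (k + e) \<longrightarrow> u \<in> I k)"

text \<open>The Hilbert function of the quotient by \<open>I\<close>.\<close>

definition hilb :: "(nat \<Rightarrow> 'v cpoly set) \<Rightarrow> nat \<Rightarrow> nat"
  where "hilb I k = cv.dim (forms X k) - cv.dim (I k)"

lemma subspace_cofac: "cv.subspace (cofac k e)"
  by (simp add: cofac_def cv.subspace_single_0)

lemma cofac_mult: "p \<in> forms X j \<Longrightarrow> q \<in> cofac k e \<Longrightarrow> p * q \<in> cofac (j + k) e"
  unfolding cofac_def using forms_mult[of p X j q "k - e"] by (auto split: if_splits)

lemma cofac_form: "q \<in> cofac k e \<Longrightarrow> g \<in> forms X e \<Longrightarrow> q * g \<in> forms X k"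
  unfolding cofac_def using forms_mult[of q X "k - e" g e] by (auto split: if_splits)

lemma gidealD:
  assumes "gideal I"
  shows "cv.subspace (I k)" "u \<in> I k \<Longrightarrow> u \<in> forms X k" "p \<in> forms X j \<Longrightarrow> u \<in> I k \<Longrightarrow> p * u \<in> I (j + k)"
    "0 \<in> I k" "u \<in> I k \<Longrightarrow> v \<in> I k \<Longrightarrow> u + v \<in> I k" "u \<in> I k \<Longrightarrow> v \<in> I k \<Longrightarrow> u - v \<in> I k" "I k \<subseteq> forms X k"
  using assms unfolding gideal_def by (auto intro: cv.subspace_0 cv.subspace_add cv.subspace_diff)

lemma gideal_mult_cofac:
  assumes "gideal I" "u \<in> I e" "q \<in> cofac k e"
  shows "q * u \<in> I k"
  using gidealD(3)[OF assms(1), of q "k - e" u e] gidealD(4)[OF assms(1)] assms(2,3)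
  by (auto simp: cofac_def split: if_splits)

lemma fdim_gideal: "gideal I \<Longrightarrow> fdim (I k)"
  using fdim_mono[OF fdim_forms[OF finX]] gidealD(7) by blast

lemma dim_le: "gideal I \<Longrightarrow> cv.dim (I k) \<le> cv.dim (forms X k)"
  using dim_mono[OF fdim_forms[OF finX]] gidealD(7) by blast

lemma hilb_mono: "gideal I \<Longrightarrow> gideal I' \<Longrightarrow> I k \<subseteq> I' k \<Longrightarrow> hilb I' k \<le> hilb I k"
  unfolding hilb_def using dim_mono[OF fdim_gideal] by (meson diff_le_mono2)

lemma hilb_eq_0: "gideal I \<Longrightarrow> hilb I k = 0 \<longleftrightarrow> I k = forms X k"
  unfolding hilb_def using subspace_eq_of_dim[OF gidealD(1) fdim_forms[OF finX] gidealD(7), of I k I k]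
  by auto

lemma hilb_eqD: "gideal I \<Longrightarrow> gideal I' \<Longrightarrow> I k \<subseteq> I' k \<Longrightarrow> hilb I k \<le> hilb I' k \<Longrightarrow> I k = I' k"
  unfolding hilb_def using dim_le[of I k] dim_le[of I' k]
  by (intro subspace_eq_of_dim gidealD(1) fdim_gideal) auto

lemma gideal_gcol: 
  assumes I: "gideal I" and g: "g \<in> forms X e" shows "gideal (gcol I g e)"
  unfolding gideal_def
proof (intro conjI allI impI)
  fix k
  show "cv.subspace (gcol I g e k)"
  proof (rule cv.subspaceI)
    show "0 \<in> gcol I g e k" using gidealD(4)[OF I] by (simp add: gcol_def)
    show "x + y \<in> gcol I g e k" if "x \<in> gcol I g e k" "y \<in> gcol I g e k" for x y
      using that gidealD(5)[OF I] by (simp add: gcol_def forms_add distrib_left)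
    show "smul c x \<in> gcol I g e k" if "x \<in> gcol I g e k" for c x
      using that cv.subspace_scale[OF gidealD(1)[OF I]] by (simp add: gcol_def forms_smul smul_mult_right)
  qed
  show "gcol I g e k \<subseteq> forms X k" by (auto simp: gcol_def)
next
  fix j k p u assume p: "p \<in> forms X j" and u: "u \<in> gcol I g e k"
  have "p * (g * u) \<in> I (j + (k + e))" using gidealD(3)[OF I p] u by (simp add: gcol_def)
  then show "p * u \<in> gcol I g e (j + k)"
    using forms_mult[OF p, of u k] u by (simp add: gcol_def algebra_simps)
qed

lemma gcol_superset: "gideal I \<Longrightarrow> g \<in> forms X e \<Longrightarrow> I k \<subseteq> gcol I g e k"
  using gidealD(2,3) by (fastforce simp: gcol_def add.commute)

lemma nzd_gcol: "gideal I \<Longrightarrow> g \<in> forms X e \<Longrightarrow> nzd I g e \<Longrightarrow> gcol I g e k = I k"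
  using gcol_superset by (fastforce simp: gcol_def nzd_def)

lemma gadd_alt: "gadd I g e k = {u + v |u v. u \<in> I k \<and> v \<in> (\<lambda>q. q * g) ` cofac k e}"
  unfolding gadd_def by blast

lemma gideal_gadd:
  assumes I: "gideal I" and g: "g \<in> forms X e" shows "gideal (gadd I g e)"
  unfolding gideal_def
proof (intro conjI allI impI)
  fix k
  have "cv.subspace ((\<lambda>q. q * g) ` cofac k e)"
  proof -
    interpret T: Vector_Spaces.linear smul smul "(*) g" by (rule linear_mult)
    have "(\<lambda>q. q * g) ` cofac k e = (*) g ` cofac k e" by (simp add: mult.commute[of g])
    then show ?thesis using T.subspace_image[OF subspace_cofac] by simp
  qed
  then show "cv.subspace (gadd I g e k)"
    unfolding gadd_alt by (rule cv.subspace_sums[OF gidealD(1)[OF I]])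
  show "gadd I g e k \<subseteq> forms X k"
    using gidealD(2)[OF I] cofac_form[OF _ g] by (auto simp: gadd_def intro: forms_add)
next
  fix j k p w assume p: "p \<in> forms X j" and w: "w \<in> gadd I g e k"
  then obtain u q where uq: "w = u + q * g" "u \<in> I k" "q \<in> cofac k e" by (auto simp: gadd_def)
  then have "p * w = p * u + (p * q) * g" by (simp add: algebra_simps)
  then show "p * w \<in> gadd I g e (j + k)"
    using gidealD(3)[OF I p uq(2)] cofac_mult[OF p uq(3)] by (auto simp: gadd_def)
qed

lemma gadd_superset: "I k \<subseteq> gadd I g e k"
  using cv.subspace_0[OF subspace_cofac] by (force simp: gadd_def)

lemma gadd_mem: "gideal I \<Longrightarrow> q \<in> cofac k e \<Longrightarrow> q * g \<in> gadd I g e k"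
  using gidealD(4)[of I k] by (force simp: gadd_def)

lemma gadd_low: "k < e \<Longrightarrow> gadd I g e k = I k"
  by (auto simp: gadd_def cofac_def)

lemma gadd_least: "gideal I' \<Longrightarrow> (\<And>k. I k \<subseteq> I' k) \<Longrightarrow> g \<in> I' e \<Longrightarrow> gadd I g e k \<subseteq> I' k"
  using gideal_mult_cofac by (auto simp: gadd_def intro!: gidealD(5))

text \<open>Dimension count in the exact sequence in which multiplication by \<open>g\<close> embeds
  the quotient by \<open>I : g\<close>, shifted by \<open>e\<close>, into the quotient by
  \<open>I\<close>, with cokernel the quotient by \<open>I\<close> and \<open>g\<close>. The
  intersection of \<open>I\<close> with the multiples of \<open>g\<close> is \<open>g\<close> times
  the colon ideal.\<close>

lemma hilb_gadd:
  assumes I: "gideal I" and g: "g \<in> forms X e" "g \<noteq> 0"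
  shows "hilb (gadd I g e) (k + e) + hilb (gcol I g e) k = hilb I (k + e)"
proof -
  interpret T: Vector_Spaces.linear smul smul "(*) g" by (rule linear_mult)
  let ?B = "(*) g ` forms X k"
  have inj: "g * v = 0 \<Longrightarrow> v = 0" for v using cpoly_no_zero_divisors g by blast
  have fB: "fdim ?B"
    by (rule fdim_mono[OF fdim_forms[OF finX, of "k + e"]]) (use forms_mult g in \<open>fastforce simp: add.commute\<close>)
  have sB: "cv.subspace ?B" by (rule T.subspace_image) simp
  have B: "(\<lambda>q. q * g) ` cofac (k + e) e = ?B" by (simp add: cofac_def mult.commute[of g])
  have "cv.dim (gadd I g e (k + e)) + cv.dim (I (k + e) \<inter> ?B) = cv.dim (I (k + e)) + cv.dim ?B"
    unfolding gadd_alt B by (rule dim_sums_Int[OF gidealD(1)[OF I] fdim_gideal[OF I] sB fB])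
  moreover have "cv.dim ?B = cv.dim (forms X k)"
    by (rule dim_inj_image[OF linear_mult _ fdim_forms[OF finX]]) (use inj in auto)
  moreover have "I (k + e) \<inter> ?B = (*) g ` gcol I g e k" by (auto simp: gcol_def)
  moreover have "cv.dim ((*) g ` gcol I g e k) = cv.dim (gcol I g e k)"
    using gideal_gcol[OF I g(1)] by (intro dim_inj_image[OF linear_mult] gidealD fdim_gideal) (use inj in auto)
  ultimately have "cv.dim (gadd I g e (k + e)) + cv.dim (gcol I g e k) = cv.dim (I (k + e)) + cv.dim (forms X k)"
    by simp
  then show ?thesis
    using dim_le[OF I, of "k + e"] dim_le[OF gideal_gadd[OF I g(1)], of "k + e"] dim_le[OF gideal_gcol[OF I g(1)], of k]
    unfolding hilb_def by linarith
qed

lemma gspan_empty: "gspan z \<delta> {} k = {0}"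
  by (simp add: gspan_def)

lemma gideal_0: "gideal (\<lambda>k. {0})"
  by (auto simp: gideal_def cv.subspace_single_0)

lemma gspan_insert:
  assumes "finite A" "i \<notin> A"
  shows "gspan z \<delta> (insert i A) k = gadd (gspan z \<delta> A) (z i) (\<delta> i) k"
proof (intro equalityI subsetI)
  fix w assume "w \<in> gspan z \<delta> (insert i A) k"
  then obtain q where q: "w = (\<Sum>j\<in>insert i A. q j * z j)" "\<forall>j\<in>insert i A. q j \<in> cofac k (\<delta> j)"
    by (auto simp: gspan_def)
  then have "w = (\<Sum>j\<in>A. q j * z j) + q i * z i" using assms by (simp add: add.commute)
  then show "w \<in> gadd (gspan z \<delta> A) (z i) (\<delta> i) k"
    using q(2) unfolding gspan_def gadd_def by blast
next
  fix w assume "w \<in> gadd (gspan z \<delta> A) (z i) (\<delta> i) k"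
  then obtain q q' where q: "w = (\<Sum>i\<in>A. q i * z i) + q' * z i" "\<forall>i\<in>A. q i \<in> cofac k (\<delta> i)" "q' \<in> cofac k (\<delta> i)"
    by (auto simp: gspan_def gadd_def)
  have "w = (\<Sum>j\<in>insert i A. (q(i := q')) j * z j)"
    using assms q(1) by (simp add: add.commute) (rule sum.cong, auto)
  then show "w \<in> gspan z \<delta> (insert i A) k" using q assms unfolding gspan_def by fastforce
qed

lemma gspan_insert': "finite A \<Longrightarrow> i \<notin> A \<Longrightarrow> gspan z \<delta> (insert i A) = gadd (gspan z \<delta> A) (z i) (\<delta> i)"
  by (rule ext) (rule gspan_insert)

lemma gideal_gspan: "finite A \<Longrightarrow> (\<And>i. i \<in> A \<Longrightarrow> z i \<in> forms X (\<delta> i)) \<Longrightarrow> gideal (gspan z \<delta> A)"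
proof (induction A rule: finite_induct)
  case empty
  then show ?case using gideal_0 by (simp add: gspan_empty[abs_def] gideal_def)
next
  case (insert i A)
  then show ?case by (simp add: gspan_insert' gideal_gadd)
qed

lemma gspan_gen:
  assumes "finite A" "i \<in> A"
  shows "z i \<in> gspan z \<delta> A (\<delta> i)"
proof -
  have "(\<Sum>j\<in>A. (if j = i then 1 else 0) * z j) = z i" using assms by (simp add: if_distrib[of "\<lambda>q. q * _"] cong: if_cong)
  moreover have "\<forall>j\<in>A. (if j = i then 1 else 0) \<in> cofac (\<delta> i) (\<delta> j)" 
    using one_forms by (auto simp: cofac_def)
  ultimately show ?thesis unfolding gspan_def by force
qed

lemma gspan_least:
  assumes "gideal I" "\<And>i. i \<in> A \<Longrightarrow> z i \<in> I (\<delta> i)"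
  shows "gspan z \<delta> A k \<subseteq> I k"
proof
  fix w assume "w \<in> gspan z \<delta> A k"
  then obtain q where q: "w = (\<Sum>i\<in>A. q i * z i)" "\<forall>i\<in>A. q i \<in> cofac k (\<delta> i)" by (auto simp: gspan_def)
  show "w \<in> I k" unfolding q(1)
    by (rule cv.subspace_sum[OF gidealD(1)[OF assms(1)]]) (use q assms gideal_mult_cofac in blast)
qed

lemma gspan_cong: "(\<And>i. i \<in> A \<Longrightarrow> z i = z' i \<and> \<delta> i = \<delta>' i) \<Longrightarrow> gspan z \<delta> A = gspan z' \<delta>' A"
  unfolding gspan_def by (intro ext Collect_cong ex_cong1) (simp cong: sum.cong)

lemma gspan_mono:
  assumes "finite B" "\<And>i. i \<in> B \<Longrightarrow> z i \<in> forms X (\<delta> i)" "A \<subseteq> B"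
  shows "gspan z \<delta> A k \<subseteq> gspan z \<delta> B k"
proof (rule gspan_least[OF gideal_gspan[OF assms(1,2)]])
  show "z i \<in> gspan z \<delta> B (\<delta> i)" if "i \<in> A" for i
    using gspan_gen[OF assms(1), of i] assms(3) that by blast
qed

subsection \<open>Regular sequences\<close>

text \<open>The induction descends along the degree of the cofactor.\<close>

lemma nzd_swap1:
  assumes I: "gideal I" and a: "a \<in> forms X da" "0 < da" "nzd I a da" and b: "b \<in> forms X db" "nzd (gadd I a da) b db"
  shows "nzd I b db"
  unfolding nzd_def
proof (intro allI impI)
  fix k u assume "u \<in> forms X k" "b * u \<in> I (k + db)"
  then show "u \<in> I k"
  proof (induction k arbitrary: u rule: less_induct)
    case (less k)
    have "b * u \<in> gadd I a da (k + db)" using less.prems gadd_superset by blast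
    then have "u \<in> gadd I a da k" using b(2) less.prems(1) unfolding nzd_def by blast
    then obtain i q where iq: "u = i + q * a" "i \<in> I k" "q \<in> cofac k da" by (auto simp: gadd_def)
    show "u \<in> I k"
    proof (cases "da \<le> k")
      case False
      then show ?thesis using iq by (simp add: cofac_def)
    next
      case True
      have q: "q \<in> forms X (k - da)" using iq True by (simp add: cofac_def)
      have "b * u - b * i \<in> I (k + db)"
        using gidealD(6)[OF I less.prems(2)] gidealD(3)[OF I b(1) iq(2)] by (simp add: add.commute)
      then have "a * (b * q) \<in> I (k - da + db + da)" using iq(1) True by (simp add: algebra_simps)
      moreover have "b * q \<in> forms X (k - da + db)" using forms_mult[OF b(1) q] by (simp add: add.commute)
      ultimately have "b * q \<in> I (k - da + db)" using a(3) unfolding nzd_def by blast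
      then have "q \<in> I (k - da)" using less.IH[of "k - da" q] q True a(2) by simp
      then have "a * q \<in> I k" using gidealD(3)[OF I a(1), of q "k - da"] True by simp
      then show ?thesis using iq gidealD(5)[OF I] by (simp add: mult.commute)
    qed
  qed
qed

text \<open>If \<open>a v = i + w b\<close> with \<open>i\<close> in \<open>I\<close>, then
  \<open>w\<close> lies in the ideal of \<open>I\<close> and \<open>a\<close>, say
  \<open>w = i' + w' a\<close>. Then \<open>a (v - w' b)\<close> lies in \<open>I\<close>, and
  \<open>a\<close> can be cancelled. With \<open>nzd_swap1\<close> this permutes regular
  sequences.\<close>

lemma nzd_swap2:
  assumes I: "gideal I" and a: "a \<in> forms X da" "nzd I a da" and b: "b \<in> forms X db" "nzd (gadd I a da) b db"
  shows "nzd (gadd I b db) a da"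
  unfolding nzd_def
proof (intro allI impI)
  fix k v assume v: "v \<in> forms X k" "a * v \<in> gadd I b db (k + da)"
  then obtain i w where iw: "a * v = i + w * b" "i \<in> I (k + da)" "w \<in> cofac (k + da) db" by (auto simp: gadd_def)
  show "v \<in> gadd I b db k"
  proof (cases "db \<le> k + da")
    case False
    then have "a * v \<in> I (k + da)" using iw by (simp add: cofac_def)
    then show ?thesis using a(2) v(1) gadd_superset unfolding nzd_def by blast
  next
    case True
    have w: "w \<in> forms X (k + da - db)" using iw True by (simp add: cofac_def)
    have "b * w = v * a - i" using iw(1) by (simp add: algebra_simps)
    also have "\<dots> \<in> gadd I a da (k + da)"
    proof (rule gidealD(6)[OF gideal_gadd[OF I a(1)] gadd_mem[OF I]])
      show "v \<in> cofac (k + da) da" using v(1) by (simp add: cofac_def)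
      show "i \<in> gadd I a da (k + da)" using iw(2) gadd_superset by blast
    qed
    finally have "b * w \<in> gadd I a da (k + da - db + db)" using True by simp
    then have "w \<in> gadd I a da (k + da - db)" using b(2) w unfolding nzd_def by blast
    then obtain i' w' where iw': "w = i' + w' * a" "i' \<in> I (k + da - db)" "w' \<in> cofac (k + da - db) da" by (auto simp: gadd_def)
    have w': "w' \<in> cofac k db" using iw'(3) True by (auto simp: cofac_def split: if_splits)
    have wb: "w' * b \<in> forms X k" using cofac_form[OF w' b(1)] .
    have "a * (v - w' * b) = i + b * i'" using iw(1) iw'(1) by (simp add: algebra_simps)
    also have "\<dots> \<in> I (k + da)"
      using gidealD(5)[OF I iw(2)] gidealD(3)[OF I b(1) iw'(2)] True by simp
    finally have "v - w' * b \<in> I k" using a(2) forms_diff[OF v(1) wb] unfolding nzd_def by blast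
    moreover have "v = (v - w' * b) + w' * b" by simp
    ultimately show ?thesis using w' unfolding gadd_def by blast
  qed
qed

text \<open>Regularity over every subset, not just along one ordering: any member can then be
  singled out, removed or exchanged.\<close>

definition good :: "('i \<Rightarrow> 'v cpoly) \<Rightarrow> ('i \<Rightarrow> nat) \<Rightarrow> 'i set \<Rightarrow> bool"
  where "good z \<delta> A0 \<longleftrightarrow> finite A0 \<and> (\<forall>i\<in>A0. z i \<in> forms X (\<delta> i) \<and> 0 < \<delta> i \<and> z i \<noteq> 0) \<and>
    (\<forall>A i. A \<subseteq> A0 \<longrightarrow> i \<in> A0 - A \<longrightarrow> nzd (gspan z \<delta> A) (z i) (\<delta> i))"

text \<open>The quotient by \<open>I\<close> has finite length \<open>D\<close>: its Hilbert
  function is eventually 0 and sums to \<open>D\<close>.\<close>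

definition total_length :: "(nat \<Rightarrow> 'v cpoly set) \<Rightarrow> nat \<Rightarrow> bool"
  where "total_length I D \<longleftrightarrow> (\<exists>K. \<forall>k\<ge>K. I k = forms X k \<and> (\<Sum>j<k. hilb I j) = D)"

section \<open>Hilbert functions along regular sequences\<close>

lemma nzd_power:
  assumes I: "gideal I" and a: "a \<in> forms X e" "nzd I a e" and u: "u \<in> forms X k" "a ^ N * u \<in> I (k + N * e)"
  shows "u \<in> I k"
  using u(2)
proof (induction N)
  case (Suc N)
  have "a * (a ^ N * u) \<in> I ((k + N * e) + e)" using Suc.prems by (simp add: algebra_simps)
  moreover have "a ^ N * u \<in> forms X (k + N * e)" using forms_mult[OF forms_power[OF a(1)] u(1)] by (simp add: add.commute)
  ultimately show ?case using Suc.IH a(2) unfolding nzd_def by blast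
qed simp

lemma hilb_sum_nzd:
  assumes I: "gideal I" and g: "g \<in> forms X e" "g \<noteq> 0" "nzd I g e"
  shows "(\<Sum>j<K + e. hilb (gadd I g e) j) + (\<Sum>j<K. hilb I j) = (\<Sum>j<K + e. hilb I j)"
proof -
  have "(\<Sum>j<K + e. f j) = (\<Sum>j<e. f j) + (\<Sum>j<K. f (j + e))" for f :: "nat \<Rightarrow> nat"
    using sum.nat_group[of f] by (induction K) (simp_all add: add.commute add.left_commute)
  moreover have "hilb (gadd I g e) (j + e) + hilb I j = hilb I (j + e)" for j
    using hilb_gadd[OF I g(1,2), of j] nzd_gcol[OF I g(1,3), of j] by (simp add: hilb_def)
  then have "(\<Sum>j<K. hilb (gadd I g e) (j + e)) + (\<Sum>j<K. hilb I j) = (\<Sum>j<K. hilb I (j + e))"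
    by (simp flip: sum.distrib)
  moreover have "(\<Sum>j<e. hilb (gadd I g e) j) = (\<Sum>j<e. hilb I j)"
    by (rule sum.cong) (simp_all add: hilb_def gadd_low)
  ultimately show ?thesis by simp
qed

lemma good_gideal: "good z \<delta> A0 \<Longrightarrow> A \<subseteq> A0 \<Longrightarrow> gideal (gspan z \<delta> A)"
  unfolding good_def by (intro gideal_gspan) (auto intro: finite_subset)

lemma good_remove: "good z \<delta> A0 \<Longrightarrow> i \<in> A0 \<Longrightarrow> gadd (gspan z \<delta> (A0 - {i})) (z i) (\<delta> i) = gspan z \<delta> A0"
  using gspan_insert'[of "A0 - {i}" i z \<delta>] by (simp add: good_def insert_absorb)

text \<open>Removing a linear member sums the Hilbert function. In high degrees the value is
  therefore the length of the full quotient, which is how multiplicities are read off.\<close>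

lemma good_hilb_linear:
  assumes good: "good z \<delta> A0" and i: "i \<in> A0" "\<delta> i = 1"
  shows "hilb (gspan z \<delta> (A0 - {i})) K = (\<Sum>j\<le>K. hilb (gspan z \<delta> A0) j)"
proof -
  have I: "gideal (gspan z \<delta> (A0 - {i}))" by (rule good_gideal[OF good]) auto
  have g: "z i \<in> forms X 1" "z i \<noteq> 0" "nzd (gspan z \<delta> (A0 - {i})) (z i) 1"
  proof -
    show "z i \<in> forms X 1" "z i \<noteq> 0" using good i by (auto simp: good_def)
    have "A0 - {i} \<subseteq> A0" "i \<in> A0 - (A0 - {i})" using i by auto
    then show "nzd (gspan z \<delta> (A0 - {i})) (z i) 1" using good i(2) unfolding good_def by metis
  qed
  show ?thesis using hilb_sum_nzd[OF I g, of K] good_remove[OF good i(1)] i(2)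
    by (simp add: lessThan_Suc_atMost atMost_Suc flip: lessThan_Suc_atMost)
qed

text \<open>Bezout in steps: replacing a linear member of the sequence by a form of degree \<open>e\<close> multiplies the
  length of the quotient by \<open>e\<close>.\<close>

lemma exchange:
  assumes good: "good z \<delta> A0" and i: "i0 \<in> A0" "\<delta> i0 = 1" and D: "total_length (gspan z \<delta> A0) D"
    and g: "g \<in> forms X e" "0 < e" "g \<noteq> 0" and full: "\<And>k. k \<ge> K0 \<Longrightarrow> gspan (z(i0 := g)) (\<delta>(i0 := e)) A0 k = forms X k"
  shows "good (z(i0 := g)) (\<delta>(i0 := e)) A0 \<and> total_length (gspan (z(i0 := g)) (\<delta>(i0 := e)) A0) (e * D)"
proof -
  define z' where "z' = z(i0 := g)"
  define \<delta>' where "\<delta>' = \<delta>(i0 := e)"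
  have fin: "finite A0" and zA: "\<And>i. i \<in> A0 \<Longrightarrow> z i \<in> forms X (\<delta> i) \<and> 0 < \<delta> i \<and> z i \<noteq> 0"
    and reg: "\<And>A i. A \<subseteq> A0 \<Longrightarrow> i \<in> A0 \<Longrightarrow> i \<notin> A \<Longrightarrow> nzd (gspan z \<delta> A) (z i) (\<delta> i)"
    using good by (auto simp: good_def)
  let ?I = "gspan z \<delta> (A0 - {i0})"
  have I: "gideal ?I" by (rule good_gideal[OF good]) auto
  have same: "gspan z' \<delta>' A = gspan z \<delta> A" if "i0 \<notin> A" for A
    by (rule gspan_cong) (use that in \<open>auto simp: z'_def \<delta>'_def\<close>)
  have ins: "gspan z' \<delta>' (insert i0 A) = gadd (gspan z \<delta> A) g e" if "A \<subseteq> A0" "i0 \<notin> A" for A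
    using gspan_insert'[of A i0 z' \<delta>'] same[of A] that fin finite_subset by (auto simp: z'_def \<delta>'_def)
  have top': "gspan z' \<delta>' A0 = gadd ?I g e" using ins[of "A0 - {i0}"] i by (simp add: insert_absorb)
  have fullg: "gadd ?I g e k = forms X k" if "k \<ge> K0" for k using full[OF that] top' by (simp add: z'_def \<delta>'_def)
  \<comment> \<open>Some power of the linear form \<open>z i0\<close> is congruent to a multiple of
    \<open>g\<close>. Hence \<open>g u\<close> in the ideal puts a power of \<open>z i0\<close>
    times \<open>u\<close> there, and this power can be cancelled.\<close>
  have top: "nzd ?I g e"
    unfolding nzd_def
  proof (intro allI impI)
    fix k u assume u: "u \<in> forms X k" "g * u \<in> ?I (k + e)"
    \<comment> \<open>At least \<open>K0\<close>, so that the enlarged ideal is everything in degree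
      \<open>N\<close>, and at least \<open>e\<close>, so that the cofactor of \<open>g\<close> has
      degree \<open>N - e\<close>.\<close>
    define N where "N = K0 + e"
    have "z i0 ^ N \<in> forms X N" using forms_power[of "z i0" X 1 N] zA[OF i(1)] i(2) by simp
    then have "z i0 ^ N \<in> gadd ?I g e N" using fullg[of N] by (simp add: N_def)
    then obtain p w where pw: "z i0 ^ N = p + w * g" "p \<in> ?I N" "w \<in> cofac N e" by (auto simp: gadd_def)
    have w: "w \<in> forms X (N - e)" using pw(3) by (simp add: cofac_def N_def)
    have "z i0 ^ N * u = u * p + w * (g * u)" using pw(1) by (simp add: algebra_simps)
    also have "\<dots> \<in> ?I (k + N)"
    proof (rule gidealD(5)[OF I gidealD(3)[OF I u(1) pw(2)]])
      show "w * (g * u) \<in> ?I (k + N)" using gidealD(3)[OF I w u(2)] by (simp add: N_def algebra_simps)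
    qed
    finally show "u \<in> ?I k" using nzd_power[OF I, of "z i0" 1 u k N] zA[OF i(1)] i reg[of "A0 - {i0}" i0] u by auto
  qed
  \<comment> \<open>Downward induction on \<open>A\<close>, starting from all of
    \<open>A0 - {i0}\<close>: \<open>nzd_swap1\<close> removes one member at a time.\<close>
  have low: "nzd (gspan z \<delta> A) g e" if "A \<subseteq> A0 - {i0}" for A
    using that
  proof (induction "card (A0 - {i0} - A)" arbitrary: A)
    case 0
    then have "A = A0 - {i0}" using fin by auto
    then show ?case using top by simp
  next
    case (Suc n)
    then obtain j where j: "j \<in> A0 - {i0} - A" by (metis card_eq_0_iff equals0I nat.distinct(1))
    have fA: "finite A" using Suc.prems fin finite_subset by blast
    have "A0 - {i0} - insert j A = (A0 - {i0} - A) - {j}" by blast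
    then have "n = card (A0 - {i0} - insert j A)" using Suc.hyps(2) j fin by simp
    from Suc.hyps(1)[OF this] have "nzd (gspan z \<delta> (insert j A)) g e" using j Suc.prems by blast
    then have *: "nzd (gadd (gspan z \<delta> A) (z j) (\<delta> j)) g e" using gspan_insert'[OF fA] j by simp
    show ?case
      by (rule nzd_swap1[OF good_gideal[OF good] _ _ reg _ *]) (use Suc.prems j zA g in auto)
  qed
  have reg': "nzd (gspan z' \<delta>' A) (z' i) (\<delta>' i)" if A: "A \<subseteq> A0" "i \<in> A0 - A" for A i
  proof (cases "i0 \<in> A")
    case False
    show ?thesis
    proof (cases "i = i0")
      case True
      then show ?thesis using low[of A] same[OF False] A False by (auto simp: z'_def \<delta>'_def)
    next
      case F: False
      then show ?thesis using reg[of A i] same[OF False] A by (auto simp: z'_def \<delta>'_def)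
    qed
  next
    case True
    define B where "B = A - {i0}"
    have B: "A = insert i0 B" "i0 \<notin> B" "B \<subseteq> A0 - {i0}" "i \<noteq> i0" "i \<notin> B" "finite B" using True A fin finite_subset by (auto simp: B_def)
    \<comment> \<open>Regularity of \<open>g\<close> after \<open>z i\<close> is exchanged into
      regularity of \<open>z i\<close> after \<open>g\<close>.\<close>
    have "nzd (gspan z \<delta> (insert i B)) g e" by (rule low) (use A B in auto)
    then have *: "nzd (gadd (gspan z \<delta> B) (z i) (\<delta> i)) g e" using gspan_insert'[OF B(6,5)] by simp
    have "nzd (gadd (gspan z \<delta> B) g e) (z i) (\<delta> i)"
      by (rule nzd_swap2[OF good_gideal[OF good] _ reg _ *]) (use A B zA g in auto)
    moreover have "gspan z' \<delta>' A = gadd (gspan z \<delta> B) g e" using ins[of B] B by auto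
    ultimately show ?thesis using B by (simp add: z'_def \<delta>'_def)
  qed
  have good': "good z' \<delta>' A0"
    unfolding good_def using fin zA g reg' by (auto simp: z'_def \<delta>'_def)
  obtain K1 where K1: "\<And>k. k \<ge> K1 \<Longrightarrow> (\<Sum>j<k. hilb (gspan z \<delta> A0) j) = D" using D by (auto simp: total_length_def)
  have hI: "hilb ?I k = D" if "k \<ge> K1" for k
    using good_hilb_linear[OF good i, of k] K1[of "Suc k"] that by (simp add: lessThan_Suc_atMost)
  have len: "(\<Sum>j<k. hilb (gspan z' \<delta>' A0) j) = e * D" if k: "k \<ge> K1 + e" for k
  proof -
    define K where "K = k - e"
    have kK: "k = K + e" "K \<ge> K1" using k by (auto simp: K_def)
    have "(\<Sum>j<K + e. hilb (gadd ?I g e) j) + (\<Sum>j<K. hilb ?I j) = (\<Sum>j<K + e. hilb ?I j)"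
      by (rule hilb_sum_nzd[OF I g(1,3) top])
    \<comment> \<open>Beyond \<open>K1\<close> the Hilbert function is constantly \<open>D\<close>,
      so the \<open>e\<close> extra degrees contribute \<open>e * D\<close>; this is the factor of
      Bezout.\<close>
    moreover have "(\<Sum>j<K + e. hilb ?I j) = (\<Sum>j<K. hilb ?I j) + e * D"
    proof -
      have "(\<Sum>j<K + m. hilb ?I j) = (\<Sum>j<K. hilb ?I j) + m * D" for m
        by (induction m) (use hI kK(2) in \<open>simp_all add: algebra_simps\<close>)
      then show ?thesis .
    qed
    ultimately show ?thesis unfolding kK top' by linarith
  qed
  have "total_length (gspan z' \<delta>' A0) (e * D)"
    unfolding total_length_def 
  proof (intro exI[of _ "K0 + K1 + e"] allI impI conjI)
    fix k assume "K0 + K1 + e \<le> k"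
    then show "gspan z' \<delta>' A0 k = forms X k" "(\<Sum>j<k. hilb (gspan z' \<delta>' A0) j) = e * D"
      using full[of k] len[of k] by (auto simp: z'_def \<delta>'_def)
  qed
  then show ?thesis using good' by (simp add: z'_def \<delta>'_def)
qed

end

section \<open>The Nullstellensatz\<close>

definition pideal :: "'v set \<Rightarrow> 'v cpoly set \<Rightarrow> bool"
  where "pideal X P \<longleftrightarrow> P \<subseteq> polys X \<and> 0 \<in> P \<and> (\<forall>p\<in>P. \<forall>q\<in>P. p + q \<in> P) \<and> (\<forall>p\<in>polys X. \<forall>q\<in>P. p * q \<in> P)"

lemma pidealD:
  assumes "pideal X P"
  shows "P \<subseteq> polys X" "0 \<in> P" "p \<in> P \<Longrightarrow> q \<in> P \<Longrightarrow> p + q \<in> P" "r \<in> polys X \<Longrightarrow> p \<in> P \<Longrightarrow> r * p \<in> P"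
  using assms by (auto simp: pideal_def)

lemma pideal_uminus: "pideal X P \<Longrightarrow> p \<in> P \<Longrightarrow> - p \<in> P"
  using pidealD(4)[of X P "- 1" p] by (simp add: polys_uminus)

lemma pideal_diff: "pideal X P \<Longrightarrow> p \<in> P \<Longrightarrow> q \<in> P \<Longrightarrow> p - q \<in> P"
  using pidealD(3)[of X P p "- q"] pideal_uminus by fastforce

lemma pideal_sum: "pideal X P \<Longrightarrow> (\<And>a. a \<in> A \<Longrightarrow> f a \<in> P) \<Longrightarrow> sum f A \<in> P"
  by (induction A rule: infinite_finite_induct) (auto intro: pidealD)

lemma pideal_extend:
  assumes P: "pideal X P" and q: "q \<in> polys X"
  shows "pideal X {p + a * q |p a. p \<in> P \<and> a \<in> polys X}" (is "pideal X ?Q") 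
    and "P \<subseteq> {p + a * q |p a. p \<in> P \<and> a \<in> polys X}" and "q \<in> {p + a * q |p a. p \<in> P \<and> a \<in> polys X}"
proof -
  show "pideal X ?Q"
    unfolding pideal_def
  proof (intro conjI ballI)
    show "?Q \<subseteq> polys X" using pidealD(1)[OF P] q by (auto intro!: polys_add polys_mult)
    show "0 \<in> ?Q" using pidealD(2)[OF P] by (force intro: exI[of _ 0])
    fix u v assume "u \<in> ?Q" "v \<in> ?Q"
    then obtain p a p' a' where "u = p + a * q" "v = p' + a' * q" "p \<in> P" "p' \<in> P" "a \<in> polys X" "a' \<in> polys X" by blast
    moreover from this have "u + v = (p + p') + (a + a') * q" by (simp add: algebra_simps)
    ultimately show "u + v \<in> ?Q" using pidealD(3)[OF P] polys_add by blast
  next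
    fix r u assume r: "r \<in> polys X" and "u \<in> ?Q"
    then obtain p a where "u = p + a * q" "p \<in> P" "a \<in> polys X" by blast
    moreover from this have "r * u = r * p + (r * a) * q" by (simp add: algebra_simps)
    ultimately show "r * u \<in> ?Q" using pidealD(4)[OF P r] polys_mult[OF r] by blast
  qed
  show "P \<subseteq> ?Q" by (force intro: exI[of _ 0])
  show "q \<in> ?Q" using pidealD(2)[OF P] by (force intro: exI[of _ 0] exI[of _ 1])
qed

lemma peval_univariate: "peval (poly (map_poly pconst q) p) x = poly q (peval p x)"
  by (induction q) (simp_all add: map_poly_pCons peval_simps)

lemma polys_univariate: "p \<in> polys X \<Longrightarrow> poly (map_poly pconst q) p \<in> polys X"
  by (induction q) (simp_all add: map_poly_pCons polys_add polys_mult)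

lemma psubst_pvar: "psubst pvar p = p"
  by (rule peval_eqI) (simp add: peval_psubst ev.geval_pvar)

text \<open>Any \<open>card I + 1\<close> members of the family are dependent. Choosing distinct
  indices rather than distinct vectors covers repetitions.\<close>

lemma infinite_dependent:
  fixes g :: "complex \<Rightarrow> 'v cvec"
  assumes "infinite C" "finite I" "\<And>c. c \<in> C \<Longrightarrow> g c \<in> cspace I"
  obtains F \<mu> c0 where "finite F" "F \<subseteq> C" "(\<Sum>c\<in>F. smul (\<mu> c) (g c)) = 0" "c0 \<in> F" "\<mu> c0 \<noteq> 0"
proof -
  define m where "m = Suc (card I)"
  obtain F where F: "finite F" "F \<subseteq> C" "card F = m" using infinite_arbitrarily_large[OF assms(1)] by blast
  obtain e where e: "bij_betw e {..<m} F" using ex_bij_betw_nat_finite[OF F(1)] F(3) by (auto simp: atLeast0LessThan)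
  have "\<not> (\<forall>c. (\<Sum>i<m. smul (c i) (g (e i))) \<in> {0} \<longrightarrow> (\<forall>i<m. c i = 0))"
  proof
    assume *: "\<forall>c. (\<Sum>i<m. smul (c i) (g (e i))) \<in> {0} \<longrightarrow> (\<forall>i<m. c i = 0)"
    have ge: "g (e i) \<in> cspace I" if "i < m" for i
      using bij_betwE[OF e] that F(2) assms(3) by blast
    have "cv.dim {0 :: 'v cvec} + m \<le> cv.dim (cspace I :: 'v cvec set)"
      by (rule codim_ge_family[where g = "\<lambda>i. g (e i)"])
        (use * ge fdim_cspace[OF assms(2)] cv.subspace_0[OF subspace_cspace] in \<open>auto simp: cv.subspace_single_0\<close>)
    then show False by (simp add: dim_cspace m_def)
  qed
  then obtain c i0 where c: "(\<Sum>i<m. smul (c i) (g (e i))) = 0" "i0 < m" "c i0 \<noteq> 0" by auto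
  define \<mu> where "\<mu> x = c (the_inv_into {..<m} e x)" for x
  have \<mu>: "\<mu> (e i) = c i" if "i < m" for i
    using that e by (simp add: \<mu>_def bij_betw_def the_inv_into_f_f)
  have "(\<Sum>x\<in>F. smul (\<mu> x) (g x)) = (\<Sum>i<m. smul (\<mu> (e i)) (g (e i)))"
    using sum.reindex_bij_betw[OF e, of "\<lambda>x. smul (\<mu> x) (g x)"] by simp
  also have "\<dots> = 0" using c(1) \<mu> by simp
  finally show ?thesis using that[of F \<mu> "e i0"] F c \<mu> e by (auto simp: bij_betw_def)
qed

text \<open>A prime ideal maximal among those missing the powers of \<open>l\<close> is the ideal of a point: otherwise
  \<open>x\<^sub>i - c\<close> divides a power of \<open>l\<close> modulo the ideal for each of the uncountably many constants \<open>c\<close>, and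
  infinitely many of the quotients lie in one finite-dimensional space.\<close>

theorem nullstellensatz:
  assumes fin: "finite X" and P: "pideal X P" and l: "l \<in> polys X"
    and van: "\<And>x. (\<And>p. p \<in> P \<Longrightarrow> peval p x = 0) \<Longrightarrow> peval l x = 0"
  obtains N where "l ^ N \<in> P"
proof (rule ccontr)
  assume "\<not> thesis"
  then have no: "l ^ N \<notin> P" for N using that by blast
  define C where "C = {Q. pideal X Q \<and> P \<subseteq> Q \<and> (\<forall>N. l ^ N \<notin> Q)}"
  have "\<exists>M\<in>C. \<forall>Q\<in>C. M \<subseteq> Q \<longrightarrow> Q = M"
  proof (rule subset_Zorn_nonempty)
    show "C \<noteq> {}" using P no by (auto simp: C_def)
    fix K assume K: "K \<noteq> {}" "subset.chain C K"
    then have KC: "K \<subseteq> C" and ch: "\<And>A B. A \<in> K \<Longrightarrow> B \<in> K \<Longrightarrow> A \<subseteq> B \<or> B \<subseteq> A"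
      by (auto simp: subset.chain_def)
    have "pideal X (\<Union>K)"
      unfolding pideal_def
    proof (intro conjI ballI)
      show "\<Union>K \<subseteq> polys X" using KC by (auto simp: C_def pideal_def)
      show "0 \<in> \<Union>K" using K(1) KC by (auto simp: C_def pideal_def)
      fix p q assume "p \<in> \<Union>K" "q \<in> \<Union>K"
      then obtain A B where "A \<in> K" "B \<in> K" "p \<in> A" "q \<in> B" by blast
      then obtain D where "D \<in> K" "p \<in> D" "q \<in> D" using ch by blast
      moreover from this have "pideal X D" using KC by (auto simp: C_def)
      ultimately show "p + q \<in> \<Union>K" using pidealD(3) by blast
    next
      fix p q assume "p \<in> polys X" "q \<in> \<Union>K"
      then obtain D where "D \<in> K" "q \<in> D" by blast
      moreover from this have "pideal X D" using KC by (auto simp: C_def)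
      ultimately show "p * q \<in> \<Union>K" using pidealD(4) \<open>p \<in> polys X\<close> by blast
    qed
    then show "\<Union>K \<in> C" using K(1) KC by (auto simp: C_def)
  qed
  then obtain M where M: "pideal X M" "P \<subseteq> M" "\<And>N. l ^ N \<notin> M" and max: "\<And>Q. Q \<in> C \<Longrightarrow> M \<subseteq> Q \<Longrightarrow> Q = M"
    by (auto simp: C_def)
  have ext: "\<exists>N p a. l ^ N = p + a * q \<and> p \<in> M \<and> a \<in> polys X" if q: "q \<in> polys X" "q \<notin> M" for q
  proof -
    let ?Q = "{p + a * q |p a. p \<in> M \<and> a \<in> polys X}"
    have "?Q \<notin> C"
    proof
      assume "?Q \<in> C"
      then have "?Q = M" using max pideal_extend(2)[OF M(1) q(1)] by blast
      then show False using pideal_extend(3)[OF M(1) q(1)] q(2) by blast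
    qed
    moreover have "P \<subseteq> ?Q" using pideal_extend(2)[OF M(1) q(1)] M(2) by (rule subset_trans[rotated])
    ultimately have "\<exists>N. l ^ N \<in> ?Q" using pideal_extend(1)[OF M(1) q(1)] unfolding C_def by auto
    then show ?thesis by blast
  qed
  have prime: "q \<in> M \<or> r \<in> M" if qr: "q \<in> polys X" "r \<in> polys X" "q * r \<in> M" for q r
  proof (rule ccontr)
    assume "\<not> (q \<in> M \<or> r \<in> M)"
    then obtain N p a N' p' a' where 1: "l ^ N = p + a * q" "p \<in> M" "a \<in> polys X"
      and 2: "l ^ N' = p' + a' * r" "p' \<in> M" "a' \<in> polys X" using ext qr by metis
    have "l ^ (N + N') = (p' + a' * r) * p + (a * q) * p' + (a * a') * (q * r)"
      by (simp add: power_add 1 2 algebra_simps)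
    moreover have "\<dots> \<in> M"
      by (intro pidealD(3)[OF M(1)] pidealD(4)[OF M(1)] polys_mult polys_add qr 1 2) 
        (use 2 pidealD(1)[OF M(1)] in blast)
    ultimately show False using M(3) by metis
  qed
  have one: "1 \<notin> M" using M(3)[of 0] by simp
  \<comment> \<open>A one-variable polynomial relation for \<open>pvar i\<close> modulo
    \<open>M\<close> factors over the complex numbers, and a linear factor lies in the prime ideal
    \<open>M\<close>.\<close>
  have split: "\<exists>c. pvar i - pconst c \<in> M" if i: "i \<in> X" "q \<noteq> 0" "poly (map_poly pconst q) (pvar i) \<in> M" for q i
    using that
  proof (induction "degree q" arbitrary: q)
    case 0
    then obtain b where b: "q = [:b:]" "b \<noteq> 0" by (metis degree_eq_zeroE pCons_0_0)
    then have "pconst (1 / b) * pconst b \<in> M" using 0 pidealD(4)[OF M(1) pconst_polys] by (simp add: map_poly_pCons)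
    then show ?case using one b by (simp flip: pconst_mult)
  next
    case (Suc d)
    obtain c where "poly q c = 0" 
      using Fundamental_Theorem_Algebra.fundamental_theorem_of_algebra[of q] Suc.hyps(2) by (auto simp: constant_degree)
    then obtain r where r: "q = [:- c, 1:] * r" by (metis dvdE poly_eq_0_iff_dvd)
    have x: "pvar i - pconst c \<in> polys X" using i by (intro polys_diff pvar_polys) auto
    have y: "poly (map_poly pconst r) (pvar i) \<in> polys X" by (rule polys_univariate[OF pvar_polys[OF i(1)]])
    have "poly (map_poly pconst q) (pvar i) = (pvar i - pconst c) * poly (map_poly pconst r) (pvar i)"
      by (rule peval_eqI) (simp add: peval_univariate peval_simps r algebra_simps)
    then consider "pvar i - pconst c \<in> M" | "poly (map_poly pconst r) (pvar i) \<in> M"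
      using prime[OF x y] Suc.prems(3) by auto
    then show ?case
    proof cases
      case 2
      have "r \<noteq> 0" using r Suc.prems(2) by auto
      then have "degree q = Suc (degree r)" unfolding r by (subst degree_mult_eq) auto
      then show ?thesis using Suc.hyps(1)[of r] Suc.hyps(2) \<open>r \<noteq> 0\<close> i 2 by simp
    qed blast
  qed
  have "\<exists>c. pvar i - pconst c \<in> M" if i: "i \<in> X" for i
  proof (rule ccontr)
    assume neg: "\<nexists>c. pvar i - pconst c \<in> M"
    have xc: "pvar i - pconst c \<in> polys X" for c using i by (intro polys_diff pvar_polys) auto
    have *: "\<forall>c. \<exists>N p a. l ^ N = p + a * (pvar i - pconst c) \<and> p \<in> M \<and> a \<in> polys X"
      using ext[OF xc] neg by blast
    obtain N p a where Npa: "\<And>c. l ^ N c = p c + a c * (pvar i - pconst c)" "\<And>c. p c \<in> M" "\<And>c. a c \<in> polys X"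
      using * by metis
    define B where "B D = (\<Union>k\<le>D. mons X k)" for D
    have fB: "finite (B D)" for D using finite_mons[OF fin] by (simp add: B_def)
    have "\<exists>D. a c \<in> cspace (B D)" for c
    proof -
      define D where "D = Max (insert 0 ((\<lambda>m. \<Sum>i\<in>supp m. coef m i) ` supp (a c)))"
      have "(\<Sum>i\<in>supp m. coef m i) \<le> D" if "m \<in> supp (a c)" for m unfolding D_def using that by auto
      then have "a c \<in> cspace (B D)" using Npa(3)[of c] by (auto simp: cspace_def B_def mons_def polys_def)
      then show ?thesis ..
    qed
    then obtain D where D: "\<And>c. a c \<in> cspace (B (D c))" by metis
    \<comment> \<open>There are uncountably many constants \<open>c\<close> but only countably many
      pairs of an exponent and a degree bound.\<close>
    have "\<exists>n d. infinite {c. N c = n \<and> D c = d}"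
    proof (rule ccontr)
      assume *: "\<nexists>n d. infinite {c. N c = n \<and> D c = d}"
      have "(UNIV :: complex set) = (\<Union>n. \<Union>d. {c. N c = n \<and> D c = d})" by blast
      moreover have "countable (\<Union>n. \<Union>d. {c. N c = n \<and> D c = d})"
        using * by (intro countable_UN countableI_type) (auto intro: countable_finite)
      ultimately show False using uncountable_UNIV_complex by simp
    qed
    then obtain n d where inf: "infinite {c. N c = n \<and> D c = d}" by blast
    obtain F \<mu> c0 where F: "finite F" "F \<subseteq> {c. N c = n \<and> D c = d}" "(\<Sum>c\<in>F. smul (\<mu> c) (a c)) = 0" "c0 \<in> F" "\<mu> c0 \<noteq> 0"
    proof (rule infinite_dependent[OF inf fB[of d]])
      show "a c \<in> cspace (B d)" if "c \<in> {c. N c = n \<and> D c = d}" for c using D[of c] that by simp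
    qed blast
    \<comment> \<open>The numerator of the sum of the fractions \<open>\<mu> c / (x - c)\<close>
      over \<open>F\<close>. It is nonzero because at \<open>c0\<close> only the term of
      \<open>c0\<close> survives.\<close>
    define q where "q = (\<Sum>c\<in>F. Polynomial.smult (\<mu> c) (\<Prod>c'\<in>F - {c}. [:- c', 1:]))"
    define Q where "Q = poly (map_poly pconst q) (pvar i)"
    define L where "L c = pvar i - pconst c" for c
    have "poly q c0 = (\<Sum>c\<in>{c0}. \<mu> c * (\<Prod>c'\<in>F - {c}. c0 - c'))"
      unfolding q_def poly_sum using F(1,4)
      by (intro sum.mono_neutral_cong_right) (auto simp: poly_prod)
    then have q0: "q \<noteq> 0" using F(1,5) by auto
    have LX: "(\<Prod>c'\<in>G. L c') \<in> polys X" for G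
      unfolding L_def by (rule polys_prod) (rule xc)
    have "Q = (\<Sum>c\<in>F. smul (\<mu> c) (\<Prod>c'\<in>F - {c}. L c'))"
      unfolding Q_def q_def L_def
      by (rule peval_eqI) (simp add: peval_univariate peval_simps peval_smul poly_sum poly_prod)
    then have "l ^ n * Q = (\<Sum>c\<in>F. l ^ n * smul (\<mu> c) (\<Prod>c'\<in>F - {c}. L c'))"
      by (simp only: sum_distrib_left)
    also have "\<dots> = (\<Sum>c\<in>F. smul (\<mu> c) ((\<Prod>c'\<in>F - {c}. L c') * (p c + a c * L c)))"
    proof (rule sum.cong[OF refl])
      fix c assume "c \<in> F"
      then have "l ^ n = p c + a c * L c" using F(2) Npa(1)[of c] by (auto simp: L_def)
      then show "l ^ n * smul (\<mu> c) (\<Prod>c'\<in>F - {c}. L c') = smul (\<mu> c) ((\<Prod>c'\<in>F - {c}. L c') * (p c + a c * L c))"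
        by (simp only: smul_mult_right mult.commute)
    qed
    \<comment> \<open>After \<open>l ^ n\<close> is replaced by \<open>p c + a c * L c\<close>, the
      terms with \<open>a c\<close> share the product of all \<open>L c\<close>, and what remains of
      them is the vanishing relation. Only members of \<open>M\<close> are left.\<close>
    also have "\<dots> = (\<Sum>c\<in>F. smul (\<mu> c) (\<Prod>c'\<in>F - {c}. L c') * p c) + (\<Prod>c\<in>F. L c) * (\<Sum>c\<in>F. smul (\<mu> c) (a c))"
      unfolding sum_distrib_left sum.distrib[symmetric]
    proof (rule sum.cong[OF refl])
      fix c assume "c \<in> F"
      then have "(\<Prod>c\<in>F. L c) = L c * (\<Prod>c'\<in>F - {c}. L c')" by (rule prod.remove[OF F(1)])
      then show "smul (\<mu> c) ((\<Prod>c'\<in>F - {c}. L c') * (p c + a c * L c)) = 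
          smul (\<mu> c) (\<Prod>c'\<in>F - {c}. L c') * p c + (\<Prod>c\<in>F. L c) * smul (\<mu> c) (a c)"
        by (simp add: smul_conv algebra_simps)
    qed
    also have "\<dots> \<in> M" unfolding F(3)
      by (simp, rule pideal_sum[OF M(1)]) (intro pidealD(4)[OF M(1)] polys_smul LX Npa(2))
    finally have "l ^ n \<in> M \<or> Q \<in> M"
      using prime[OF polys_power[OF l] polys_univariate[OF pvar_polys[OF i]]] by (simp add: Q_def)
    then show False using M(3) split[OF i q0] neg by (auto simp: Q_def)
  qed
  then obtain x where x: "\<And>i. i \<in> X \<Longrightarrow> pvar i - pconst (x i) \<in> M" by metis
  \<comment> \<open>Congruence of \<open>p\<close> to its value at \<open>x\<close> modulo
    \<open>M\<close>. It holds for constants and variables and is closed under sums and products, so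
    it holds throughout.\<close>
  define R where "R p \<longleftrightarrow> p \<in> polys X \<and> p - pconst (peval p x) \<in> M" for p
  have Rc: "R (pconst c)" for c using pidealD(2)[OF M(1)] by (simp add: R_def ev.geval_pconst)
  have Rv: "R (pvar i)" if "i \<in> X" for i using x[OF that] that by (simp add: R_def ev.geval_pvar pvar_polys)
  have Radd: "R (p + q)" if "R p" "R q" for p q
    using that pidealD(3)[OF M(1), of "p - pconst (peval p x)" "q - pconst (peval q x)"]
    by (simp add: R_def polys_add peval_simps pconst_add algebra_simps)
  have Rmult: "R (p * q)" if pq: "R p" "R q" for p q
  proof -
    have "p * q - pconst (peval (p * q) x) = q * (p - pconst (peval p x)) + pconst (peval p x) * (q - pconst (peval q x))"
      by (simp add: peval_simps pconst_mult algebra_simps)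
    also have "\<dots> \<in> M"
      using pq by (intro pidealD(3)[OF M(1)] pidealD(4)[OF M(1)]) (auto simp: R_def)
    finally show ?thesis using pq by (simp add: R_def polys_mult)
  qed
  have Rpow: "R (p ^ k)" if "R p" for p k
    by (induction k) (use Rc[of 1] Rmult that in auto)
  have Rprod: "R (prod f A)" if "\<And>a. a \<in> A \<Longrightarrow> R (f a)" for f and A :: "'a set"
    using that by (induction A rule: infinite_finite_induct) (use Rc[of 1] Rmult in auto)
  have Rsum: "R (sum f A)" if "\<And>a. a \<in> A \<Longrightarrow> R (f a)" for f and A :: "('a \<Rightarrow>\<^sub>0 nat) set"
    using that by (induction A rule: infinite_finite_induct) (use Rc[of 0] Radd in auto)
  have R: "R p" if "p \<in> polys X" for p
  proof -
    have "R (psubst pvar p)" unfolding psubst_def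
      by (intro Rsum Rmult Rc Rprod Rpow Rv) (use that in \<open>auto simp: polys_def\<close>)
    then show ?thesis by (simp add: psubst_pvar)
  qed
  have zero: "peval p x = 0" if "p \<in> M" for p
  proof (rule ccontr)
    assume ne: "peval p x \<noteq> 0"
    have "p - (p - pconst (peval p x)) \<in> M"
      by (rule pideal_diff[OF M(1) that]) (use R[of p] that pidealD(1)[OF M(1)] in \<open>auto simp: R_def\<close>)
    then have "pconst (1 / peval p x) * pconst (peval p x) \<in> M" using pidealD(4)[OF M(1)] by simp
    then show False using one ne by (simp flip: pconst_mult)
  qed
  then have "peval l x = 0" using van M(2) by blast
  then have "l ^ 1 \<in> M" using R[OF l] by (simp add: R_def)
  then show False using M(3) by blast
qed

section \<open>Homogeneous parts\<close>

definition hpart :: "nat \<Rightarrow> 'v cpoly \<Rightarrow> 'v cpoly"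
  where "hpart k p = (\<Sum>m\<in>{m \<in> supp p. (\<Sum>i\<in>supp m. coef m i) = k}. sgl m (coef p m))"

lemma coef_hpart: "coef (hpart k p) m = (if (\<Sum>i\<in>supp m. coef m i) = k then coef p m else 0)"
proof -
  have "coef (hpart k p) m = (\<Sum>m'\<in>{m \<in> supp p. (\<Sum>i\<in>supp m. coef m i) = k}. if m' = m then coef p m' else 0)"
    by (simp add: hpart_def lookup_sum lookup_single when_def)
  then show ?thesis by (auto simp: in_keys_iff)
qed

lemma hpart_add: "hpart k (p + q) = hpart k p + hpart k q"
  by (rule poly_mapping_eqI) (simp add: coef_hpart lookup_add)

lemma hpart_0: "hpart k 0 = 0"
  by (rule poly_mapping_eqI) (simp add: coef_hpart)

lemma hpart_sum: "hpart k (sum f A) = (\<Sum>a\<in>A. hpart k (f a))"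
  by (induction A rule: infinite_finite_induct) (simp_all add: hpart_0 hpart_add)

lemma hpart_forms: "p \<in> polys X \<Longrightarrow> hpart k p \<in> forms X k"
  by (auto simp: cspace_def polys_def mons_def in_keys_iff coef_hpart split: if_splits)

lemma hpart_form: "p \<in> forms X j \<Longrightarrow> hpart k p = (if j = k then p else 0)"
  by (rule poly_mapping_eqI) (auto simp: coef_hpart cspace_def mons_def in_keys_iff)

lemma hpart_decomp: obtains D where "p = (\<Sum>j\<le>D. hpart j p)"
proof
  define D where "D = Max (insert 0 ((\<lambda>m. \<Sum>i\<in>supp m. coef m i) ` supp p))"
  have D: "(\<Sum>i\<in>supp m. coef m i) \<le> D" if "m \<in> supp p" for m unfolding D_def using that by auto
  show "p = (\<Sum>j\<le>D. hpart j p)"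
    by (rule poly_mapping_eqI) (use D in \<open>auto simp: lookup_sum coef_hpart in_keys_iff\<close>)
qed

lemma hpart_mult_form:
  assumes p: "p \<in> polys X" and z: "z \<in> forms X e"
  shows "hpart k (p * z) = (if e \<le> k then hpart (k - e) p * z else 0)"
proof -
  obtain D where D: "p = (\<Sum>j\<le>D. hpart j p)" by (rule hpart_decomp)
  have big: "hpart j p = 0" if "j > D" for j
  proof -
    have "hpart j p = (\<Sum>i\<le>D. hpart j (hpart i p))" by (subst D) (rule hpart_sum)
    also have "\<dots> = 0" using that by (simp add: hpart_form[OF hpart_forms[OF p]])
    finally show ?thesis .
  qed
  have "p * z = (\<Sum>j\<le>D. hpart j p * z)" by (subst D) (rule sum_distrib_right)
  then have "hpart k (p * z) = (\<Sum>j\<le>D. hpart k (hpart j p * z))" by (simp add: hpart_sum)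
  also have "\<dots> = (\<Sum>j\<le>D. if j + e = k then hpart j p * z else 0)"
    by (simp add: hpart_form[OF forms_mult[OF hpart_forms[OF p] z]])
  also have "\<dots> = (\<Sum>j\<le>D. if e \<le> k \<and> j = k - e then hpart j p * z else 0)"
    by (rule sum.cong) auto
  also have "\<dots> = (if e \<le> k then hpart (k - e) p * z else 0)" using big by auto
  finally show ?thesis .
qed

context graded begin

text \<open>Taking the part of degree \<open>k\<close> of both sides replaces arbitrary cofactors by
  homogeneous ones of the right degree.\<close>

lemma gspan_of_combination:
  assumes w: "w \<in> forms X k" "w = (\<Sum>i\<in>A. q i * z i)" and q: "\<And>i. i \<in> A \<Longrightarrow> q i \<in> polys X"
    and z: "\<And>i. i \<in> A \<Longrightarrow> z i \<in> forms X (\<delta> i)"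
  shows "w \<in> gspan z \<delta> A k"
proof -
  define r where "r i = (if \<delta> i \<le> k then hpart (k - \<delta> i) (q i) else 0)" for i
  have "w = hpart k w" using w(1) by (simp add: hpart_form)
  also have "\<dots> = (\<Sum>i\<in>A. hpart k (q i * z i))" by (simp add: w(2) hpart_sum)
  also have "\<dots> = (\<Sum>i\<in>A. r i * z i)"
    by (rule sum.cong) (simp_all add: hpart_mult_form[OF q z] r_def)
  finally have "w = (\<Sum>i\<in>A. r i * z i)" .
  moreover have "\<forall>i\<in>A. r i \<in> cofac k (\<delta> i)" using hpart_forms[OF q] by (auto simp: r_def cofac_def)
  ultimately show ?thesis unfolding gspan_def by blast
qed

lemma pideal_combinations:
  assumes z: "\<And>i. i \<in> A \<Longrightarrow> z i \<in> polys X"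
  shows "pideal X {\<Sum>i\<in>A. q i * z i |q. \<forall>i\<in>A. q i \<in> polys X}" (is "pideal X ?P")
  unfolding pideal_def
proof (intro conjI ballI)
  show "?P \<subseteq> polys X" using z by (auto intro!: polys_sum polys_mult)
  show "0 \<in> ?P" by (auto intro!: exI[of _ "\<lambda>i. 0"])
  fix u v assume "u \<in> ?P" "v \<in> ?P"
  then obtain q r where "u = (\<Sum>i\<in>A. q i * z i)" "v = (\<Sum>i\<in>A. r i * z i)" "\<forall>i\<in>A. q i \<in> polys X" "\<forall>i\<in>A. r i \<in> polys X" by blast
  then show "u + v \<in> ?P"
    by (auto intro!: exI[of _ "\<lambda>i. q i + r i"] polys_add simp: sum.distrib algebra_simps)
next
  fix p u assume p: "p \<in> polys X" and "u \<in> ?P"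
  then obtain q where "u = (\<Sum>i\<in>A. q i * z i)" "\<forall>i\<in>A. q i \<in> polys X" by blast
  then show "p * u \<in> ?P" using p
    by (auto intro!: exI[of _ "\<lambda>i. p * q i"] polys_mult simp: sum_distrib_left algebra_simps)
qed

lemma power_mem_gspan:
  assumes A: "finite A" and z: "\<And>i. i \<in> A \<Longrightarrow> z i \<in> forms X (\<delta> i)" and l: "l \<in> forms X e"
    and van: "\<And>x. (\<And>i. i \<in> A \<Longrightarrow> peval (z i) x = 0) \<Longrightarrow> peval l x = 0"
  obtains N where "l ^ N \<in> gspan z \<delta> A (N * e)"
proof -
  let ?P = "{\<Sum>i\<in>A. q i * z i |q. \<forall>i\<in>A. q i \<in> polys X}"
  have zX: "\<And>i. i \<in> A \<Longrightarrow> z i \<in> polys X" using z forms_subset_polys by blast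
  obtain N where "l ^ N \<in> ?P"
  proof (rule nullstellensatz[OF finX pideal_combinations[OF zX]])
    show "l \<in> polys X" using l forms_subset_polys by blast
    fix x assume *: "\<And>p. p \<in> ?P \<Longrightarrow> peval p x = 0"
    show "peval l x = 0"
    proof (rule van)
      fix i assume i: "i \<in> A"
      have "z i = (\<Sum>j\<in>A. (if j = i then 1 else 0) * z j)" using A i by (simp add: if_distrib[of "\<lambda>q. q * _"] cong: if_cong)
      then have "z i \<in> ?P" by (auto intro!: exI[of _ "\<lambda>j. if j = i then 1 else 0"])
      then show "peval (z i) x = 0" by (rule *)
    qed
  qed auto
  then obtain q where q: "l ^ N = (\<Sum>i\<in>A. q i * z i)" "\<And>i. i \<in> A \<Longrightarrow> q i \<in> polys X" by blast
  have "l ^ N \<in> gspan z \<delta> A (N * e)" by (rule gspan_of_combination[OF forms_power[OF l] q z])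
  then show ?thesis by (rule that)
qed

text \<open>Without a common zero other than the origin, each variable has a power in the ideal by
  the Nullstellensatz, and a monomial of large degree is divisible by one of these powers.\<close>

lemma full_of_no_zeros:
  assumes A: "finite A" and z: "\<And>i. i \<in> A \<Longrightarrow> z i \<in> forms X (\<delta> i)"
    and van: "\<And>x v. (\<And>i. i \<in> A \<Longrightarrow> peval (z i) x = 0) \<Longrightarrow> v \<in> X \<Longrightarrow> x v = 0"
  obtains K where "\<And>k. k \<ge> K \<Longrightarrow> gspan z \<delta> A k = forms X k"
proof -
  have I: "gideal (gspan z \<delta> A)" by (rule gideal_gspan[OF A z])
  have "\<exists>N. pvar v ^ N \<in> gspan z \<delta> A N" if v: "v \<in> X" for v
  proof -
    obtain N where "pvar v ^ N \<in> gspan z \<delta> A (N * 1)"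
    proof (rule power_mem_gspan[OF A z pvar_forms[OF v]])
      show "peval (pvar v) x = 0" if "\<And>i. i \<in> A \<Longrightarrow> peval (z i) x = 0" for x
        using van[OF that v] by (simp add: ev.geval_pvar)
    qed
    then show ?thesis by auto
  qed
  then obtain N where N: "\<And>v. v \<in> X \<Longrightarrow> pvar v ^ N v \<in> gspan z \<delta> A (N v)" by metis
  define K where "K = Suc (sum N X)"
  have "gspan z \<delta> A k = forms X k" if k: "k \<ge> K" for k
  proof
    show "gspan z \<delta> A k \<subseteq> forms X k" by (rule gidealD(7)[OF I])
    show "forms X k \<subseteq> gspan z \<delta> A k"
    proof
      fix p assume p: "p \<in> forms X k"
      have "(\<Sum>m\<in>supp p. sgl m (coef p m)) \<in> gspan z \<delta> A k"
      proof (rule cv.subspace_sum[OF gidealD(1)[OF I]])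
        fix m assume "m \<in> supp p"
        then have m: "supp m \<subseteq> X" "(\<Sum>i\<in>supp m. coef m i) = k" using p by (auto simp: cspace_def mons_def)
        \<comment> \<open>If every exponent stayed below \<open>N v\<close>, the degree would be at
          most the sum of \<open>N\<close>, which is less than \<open>K\<close>.\<close>
        have "\<exists>v\<in>X. N v \<le> coef m v"
        proof (rule ccontr)
          assume "\<not> ?thesis"
          then have "(\<Sum>i\<in>X. coef m i) \<le> sum N X" by (intro sum_mono) (simp add: not_le less_imp_le)
          then show False using k m mdeg_superset[OF finX m(1)] by (simp add: K_def)
        qed
        then obtain v where v: "v \<in> X" "N v \<le> coef m v" by blast
        define r where "r = m - sgl v (N v)"
        have r: "m = r + sgl v (N v)"
          by (rule poly_mapping_eqI) (use v in \<open>auto simp: r_def lookup_add lookup_minus lookup_single when_def\<close>)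
        have pv: "pvar v ^ j = sgl (sgl v j) 1" for j
          by (induction j) (simp_all add: pvar_def mult_single flip: single_add)
        have "(\<Sum>i\<in>supp m. coef m i) = (\<Sum>i\<in>supp r. coef r i) + N v"
          using mdeg_add[of r "sgl v (N v)"] by (simp add: r split: if_splits)
        moreover have "supp r \<subseteq> X" using m(1) by (simp add: r supp_add_nat)
        ultimately have "r \<in> mons X (k - N v)" "N v \<le> k" using m(2) by (auto simp: mons_def)
        then have "sgl r (coef p m) \<in> forms X (k - N v)" by (simp add: cspace_def)
        from gidealD(3)[OF I this N[OF v(1)]] \<open>N v \<le> k\<close> 
        have "sgl r (coef p m) * pvar v ^ N v \<in> gspan z \<delta> A k" by simp
        moreover have "sgl m (coef p m) = sgl r (coef p m) * pvar v ^ N v"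
          unfolding pv by (simp add: mult_single flip: r)
        ultimately show "sgl m (coef p m) \<in> gspan z \<delta> A k" by simp
      qed
      then show "p \<in> gspan z \<delta> A k" by (simp flip: poly_expansion)
    qed
  qed
  then show ?thesis by (rule that)
qed

lemma peval_gspan:
  assumes "u \<in> gspan z \<delta> A k" "\<And>i. i \<in> A \<Longrightarrow> peval (z i) x = 0"
  shows "peval u x = 0"
  using assms by (auto simp: gspan_def peval_simps)

end

section \<open>Bezout bounds\<close>

lemma proportional_of_minors:
  fixes x y :: "'v \<Rightarrow> complex"
  assumes "\<And>a b. a \<in> X \<Longrightarrow> b \<in> X \<Longrightarrow> x a * y b = x b * y a" "a0 \<in> X" "x a0 \<noteq> 0" "b0 \<in> X" "y b0 \<noteq> 0"
  obtains t where "t \<noteq> 0" "\<And>a. a \<in> X \<Longrightarrow> x a = t * y a"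
proof
  show 1: "x a = x b0 / y b0 * y a" if "a \<in> X" for a using assms(1)[OF that assms(4)] assms(5) by (simp add: field_simps)
  show "x b0 / y b0 \<noteq> 0" using 1[OF assms(2)] assms(3) by auto
qed

context graded begin

text \<open>Distinct projective points \<open>x 0\<close>, ..., \<open>x C\<close> impose
  independent conditions in degree \<open>C\<close>: a product of \<open>C\<close> linear forms
  vanishes at all of them but one.\<close>

lemma hilb_ge_points:
  fixes x :: "nat \<Rightarrow> 'v \<Rightarrow> complex"
  assumes I: "gideal I" and van: "\<And>i u. i \<le> C \<Longrightarrow> u \<in> I C \<Longrightarrow> peval u (x i) = 0"
    and sep: "\<And>i j. i \<le> C \<Longrightarrow> j \<le> C \<Longrightarrow> i \<noteq> j \<Longrightarrow> \<exists>a\<in>X. \<exists>b\<in>X. x i a * x j b \<noteq> x i b * x j a"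
  shows "C < hilb I C"
proof -
  have "\<exists>L\<in>forms X 1. peval L (x j) = 0 \<and> peval L (x i) \<noteq> 0" if ij: "i \<le> C" "j \<le> C" "i \<noteq> j" for i j
  proof -
    obtain a b where ab: "a \<in> X" "b \<in> X" "x i a * x j b \<noteq> x i b * x j a" using sep[OF ij] by blast
    let ?L = "smul (x j b) (pvar a) - smul (x j a) (pvar b)"
    have "?L \<in> forms X 1" using ab by (intro forms_diff forms_smul pvar_forms)
    moreover have "peval ?L (x j) = 0" "peval ?L (x i) \<noteq> 0"
      using ab(3) by (simp_all add: peval_simps peval_smul algebra_simps)
    ultimately show ?thesis by blast
  qed
  then obtain L where L: "\<And>i j. i \<le> C \<Longrightarrow> j \<le> C \<Longrightarrow> i \<noteq> j \<Longrightarrow> L i j \<in> forms X 1 \<and> peval (L i j) (x j) = 0 \<and> peval (L i j) (x i) \<noteq> 0"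
    by metis
  define q where "q i = (\<Prod>j\<in>{..C} - {i}. L i j)" for i
  have q: "q i \<in> forms X C" if "i \<le> C" for i
  proof -
    have "q i \<in> forms X (\<Sum>j\<in>{..C} - {i}. 1)" unfolding q_def by (rule forms_prod) (use L that in auto)
    then show ?thesis using that by simp
  qed
  have qq: "peval (q i) (x k) = 0 \<longleftrightarrow> i \<noteq> k" if "i \<le> C" "k \<le> C" for i k
    using L that unfolding q_def by (auto simp: peval_simps)
  have "cv.dim (I C) + Suc C \<le> cv.dim (forms X C)"
  proof (rule codim_ge_family[where g = q, OF subspace_cspace fdim_forms[OF finX] gidealD(1,7)[OF I]])
    show "q i \<in> forms X C" if "i < Suc C" for i using q that by simp
    fix c assume c: "(\<Sum>i<Suc C. smul (c i) (q i)) \<in> I C"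
    show "\<forall>i<Suc C. c i = 0"
    proof (intro allI impI)
      fix i assume i: "i < Suc C"
      have "0 = peval (\<Sum>k<Suc C. smul (c k) (q k)) (x i)" using van[OF _ c] i by simp
      also have "\<dots> = (\<Sum>k<Suc C. c k * peval (q k) (x i))" by (simp only: peval_simps peval_smul)
      also have "\<dots> = (\<Sum>k\<in>{i}. c k * peval (q k) (x i))"
        by (rule sum.mono_neutral_right) (use i qq in auto)
      finally show "c i = 0" using qq[of i i] i by simp
    qed
  qed
  then show ?thesis by (simp add: hilb_def)
qed

text \<open>If every combination along the moment curve in \<open>c\<close> had a zero in common
  with the \<open>z i\<close>, suitable choices of \<open>c\<close> would yield infinitely many
  points in the zero set of the \<open>z i\<close>, against the bound on the Hilbert
  function.\<close>

lemma generic_combination: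
  assumes A: "finite A" and z: "\<And>i. i \<in> A \<Longrightarrow> z i \<in> forms X (\<delta> i)" and C: "\<And>k. hilb (gspan z \<delta> A) k \<le> C"
    and G: "\<And>k. k < s \<Longrightarrow> G k \<in> forms X e"
    and van: "\<And>x v. (\<And>i. i \<in> A \<Longrightarrow> peval (z i) x = 0) \<Longrightarrow> (\<And>k. k < s \<Longrightarrow> peval (G k) x = 0) \<Longrightarrow> v \<in> X \<Longrightarrow> x v = 0"
  obtains c where "\<And>x v. (\<And>i. i \<in> A \<Longrightarrow> peval (z i) x = 0) \<Longrightarrow> peval (\<Sum>k<s. smul (c ^ k) (G k)) x = 0 \<Longrightarrow> v \<in> X \<Longrightarrow> x v = 0"
proof (rule ccontr)
  define g where "g c = (\<Sum>k<s. smul (c ^ k) (G k))" for c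
  have g: "g c \<in> forms X e" for c unfolding g_def by (intro forms_sum forms_smul) (use G in auto)
  assume "\<not> thesis"
  then have "\<forall>c. \<exists>x. (\<forall>i\<in>A. peval (z i) x = 0) \<and> peval (g c) x = 0 \<and> (\<exists>v\<in>X. x v \<noteq> 0)"
    unfolding g_def using that by metis
  then obtain x where x: "\<And>c i. i \<in> A \<Longrightarrow> peval (z i) (x c) = 0" "\<And>c. peval (g c) (x c) = 0" "\<And>c. \<exists>v\<in>X. x c v \<noteq> 0"
    by metis
  \<comment> \<open>The parameters whose combination vanishes at the point found for
    \<open>c\<close>: the zeros of a polynomial in \<open>c'\<close> with a nonzero coefficient, as
    not all \<open>G k\<close> vanish there.\<close>
  define Z where "Z c = {c'. peval (g c') (x c) = 0}" for c
  have fZ: "finite (Z c)" for c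
  proof -
    obtain k where k: "k < s" "peval (G k) (x c) \<noteq> 0" using van[of "x c"] x by blast
    have "Z c = {c'. (\<Sum>k\<le>s - 1. peval (G k) (x c) * c' ^ k) = 0}"
    proof -
      have "{..<s} = {..s - 1}" using k(1) by auto
      then show ?thesis unfolding Z_def g_def by (simp add: peval_simps peval_smul mult.commute)
    qed
    then show ?thesis using finite_zeros_powers[of k "s - 1" "\<lambda>k. peval (G k) (x c)"] k by auto
  qed
  \<comment> \<open>Each new parameter avoids the bad parameters of all earlier points. Its
    combination vanishes at the new point but at no earlier one, so the points are distinct.\<close>
  have "\<exists>c :: nat \<Rightarrow> complex. \<forall>n. \<forall>i<n. c n \<notin> Z (c i)"
  proof (rule dependent_wellorder_choice)
    fix n :: nat and c :: "nat \<Rightarrow> complex"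
    have "finite (\<Union>i<n. Z (c i))" using fZ by blast
    then obtain r where "r \<notin> (\<Union>i<n. Z (c i))" using ex_new_if_finite[OF infinite_UNIV_char_0[where 'a = complex]] by blast
    then show "\<exists>r. \<forall>i<n. r \<notin> Z (c i)" by blast
  qed auto
  then obtain c :: "nat \<Rightarrow> complex" where cZ: "\<forall>n. \<forall>i<n. c n \<notin> Z (c i)" ..
  have c: "\<And>n i. i < n \<Longrightarrow> c n \<notin> Z (c i)" using cZ by simp
  have sep: "\<exists>a\<in>X. \<exists>b\<in>X. x (c n) a * x (c i) b \<noteq> x (c n) b * x (c i) a" if "i < n" for n i
  proof (rule ccontr)
    assume "\<not> ?thesis"
    then have min: "\<And>a b. a \<in> X \<Longrightarrow> b \<in> X \<Longrightarrow> x (c n) a * x (c i) b = x (c n) b * x (c i) a" by blast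
    obtain a0 b0 where ab: "a0 \<in> X" "x (c n) a0 \<noteq> 0" "b0 \<in> X" "x (c i) b0 \<noteq> 0" using x(3) by metis
    obtain t where t: "t \<noteq> 0" "\<And>a. a \<in> X \<Longrightarrow> x (c n) a = t * x (c i) a"
      using proportional_of_minors[of X "x (c n)" "x (c i)" a0 b0] min ab by blast
    have "peval (g (c n)) (x (c n)) = peval (g (c n)) (\<lambda>a. t * x (c i) a)"
      by (rule peval_cong_vars[of _ X]) (use g forms_subset_polys t in blast)+
    then have "t ^ e * peval (g (c n)) (x (c i)) = 0" using peval_homog[OF g] x(2) by metis
    then show False using c[OF that] t(1) by (simp add: Z_def)
  qed
  have "C < hilb (gspan z \<delta> A) C"
  proof (rule hilb_ge_points[where x = "\<lambda>i. x (c i)", OF gideal_gspan[OF A z]])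
    show "peval u (x (c i)) = 0" if "u \<in> gspan z \<delta> A C" for i u
      using peval_gspan[OF that] x(1) by blast
    show "\<exists>a\<in>X. \<exists>b\<in>X. x (c i) a * x (c j) b \<noteq> x (c i) b * x (c j) a" if "i \<noteq> j" for i j
      using sep[of i j] sep[of j i] that by (metis linorder_neqE_nat mult.commute)
  qed auto
  then show False using C[of C] by simp
qed

lemma total_length_partial: "total_length I D \<Longrightarrow> (\<Sum>j<k. hilb I j) \<le> D"
proof -
  assume "total_length I D"
  then obtain K where K: "\<And>k. k \<ge> K \<Longrightarrow> (\<Sum>j<k. hilb I j) = D" by (auto simp: total_length_def)
  have "(\<Sum>j<k. hilb I j) \<le> (\<Sum>j<max k K. hilb I j)" by (rule sum_mono2) auto
  then show ?thesis using K[of "max k K"] by simp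
qed

text \<open>All members have positive degree, so the constants survive in the quotient and already
  contribute 1.\<close>

lemma good_length_pos:
  assumes "good z \<delta> A0" "total_length (gspan z \<delta> A0) D"
  shows "0 < D"
proof -
  have "gspan z \<delta> A0 0 \<subseteq> {0}"
    using assms(1) by (fastforce simp: gspan_def cofac_def good_def intro!: sum.neutral)
  then have "gspan z \<delta> A0 0 = {0}" using gidealD(4)[OF good_gideal[OF assms(1) order_refl], of 0] by blast
  moreover have "fdim {0 :: 'v cpoly}" by (rule fdim_mono[OF fdim_forms[OF finX, of 0]]) simp
  ultimately have "hilb (gspan z \<delta> A0) 0 = 1" 
    using dim_0_iff[of "{0 :: 'v cpoly}"] by (simp add: hilb_def dim_cspace mons_0 cv.subspace_single_0)
  then show ?thesis using total_length_partial[OF assms(2), of 1] by simp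
qed

lemma good_hilb_le:
  assumes good: "good z \<delta> A0" and i: "i \<in> A0" "\<delta> i = 1" and D: "total_length (gspan z \<delta> A0) D"
  shows "hilb (gspan z \<delta> (A0 - {i})) k \<le> D"
  using good_hilb_linear[OF good i, of k] total_length_partial[OF D, of "Suc k"] by (simp add: lessThan_Suc_atMost)

lemma good_hilb_eventually:
  assumes good: "good z \<delta> A0" and i: "i \<in> A0" "\<delta> i = 1" and D: "total_length (gspan z \<delta> A0) D"
  obtains K where "\<And>k. k \<ge> K \<Longrightarrow> hilb (gspan z \<delta> (A0 - {i})) k = D"
proof -
  obtain K where K: "\<And>k. k \<ge> K \<Longrightarrow> (\<Sum>j<k. hilb (gspan z \<delta> A0) j) = D" using D by (auto simp: total_length_def)
  have "hilb (gspan z \<delta> (A0 - {i})) k = D" if "k \<ge> K" for k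
    using good_hilb_linear[OF good i, of k] K[of "Suc k"] that by (simp add: lessThan_Suc_atMost)
  then show ?thesis by (rule that)
qed

lemma exchange_no_zeros:
  assumes good: "good z \<delta> A0" and i: "i0 \<in> A0" "\<delta> i0 = 1" and D: "total_length (gspan z \<delta> A0) D"
    and g: "g \<in> forms X e" "0 < e"
    and van: "\<And>x v. (\<And>i. i \<in> A0 - {i0} \<Longrightarrow> peval (z i) x = 0) \<Longrightarrow> peval g x = 0 \<Longrightarrow> v \<in> X \<Longrightarrow> x v = 0"
  shows "good (z(i0 := g)) (\<delta>(i0 := e)) A0 \<and> total_length (gspan (z(i0 := g)) (\<delta>(i0 := e)) A0) (e * D)"
proof -
  have fin: "finite A0" and zA: "\<And>i. i \<in> A0 \<Longrightarrow> z i \<in> forms X (\<delta> i)" using good by (auto simp: good_def)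
  \<comment> \<open>For \<open>g = 0\<close> the remaining forms alone would have no common zero,
    and their quotient would vanish in high degrees, where its Hilbert function equals the positive
    number \<open>D\<close>.\<close>
  have "g \<noteq> 0"
  proof
    assume "g = 0"
    then have van': "\<And>x v. (\<And>i. i \<in> A0 - {i0} \<Longrightarrow> peval (z i) x = 0) \<Longrightarrow> v \<in> X \<Longrightarrow> x v = 0"
      using van by (simp add: peval_simps)
    have fin': "finite (A0 - {i0})" using fin by simp
    have z': "z i \<in> forms X (\<delta> i)" if "i \<in> A0 - {i0}" for i using zA that by blast
    obtain K where K: "\<And>k. k \<ge> K \<Longrightarrow> gspan z \<delta> (A0 - {i0}) k = forms X k"
    proof (rule full_of_no_zeros[where z = z and \<delta> = \<delta> and A = "A0 - {i0}"])
      show "x v = 0" if "\<And>i. i \<in> A0 - {i0} \<Longrightarrow> peval (z i) x = 0" "v \<in> X" for x v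
        using van' that by blast
    qed (use fin' z' in auto)
    obtain K' where K': "\<And>k. k \<ge> K' \<Longrightarrow> hilb (gspan z \<delta> (A0 - {i0})) k = D"
      by (rule good_hilb_eventually[OF good i D]) auto
    have "D = 0" using K[of "K + K'"] K'[of "K + K'"] by (simp add: hilb_def)
    then show False using good_length_pos[OF good D] by simp
  qed
  moreover obtain K where "\<And>k. k \<ge> K \<Longrightarrow> gspan (z(i0 := g)) (\<delta>(i0 := e)) A0 k = forms X k"
  proof (rule full_of_no_zeros[OF fin])
    show "(z(i0 := g)) i \<in> forms X ((\<delta>(i0 := e)) i)" if "i \<in> A0" for i using zA that g by auto
    fix x v assume *: "\<And>i. i \<in> A0 \<Longrightarrow> peval ((z(i0 := g)) i) x = 0" and v: "v \<in> X"
    show "x v = 0"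
    proof (rule van[OF _ _ v])
      show "peval (z i) x = 0" if "i \<in> A0 - {i0}" for i using *[of i] that by auto
      show "peval g x = 0" using *[of i0] i by auto
    qed
  qed blast
  ultimately show ?thesis using exchange[OF good i D g] by blast
qed

text \<open>The linear members in \<open>T\<close> are exchanged one by one for general combinations
  of the \<open>G k\<close>. Each step spends one form of the list \<open>G\<close>. If the list is
  used up exactly, the new members generate all the \<open>G k\<close>, which is needed to compare
  Hilbert functions from below.\<close>

lemma exchange_process:
  assumes "finite T" "good z \<delta> A0" "total_length (gspan z \<delta> A0) D" "T \<subseteq> A0" "\<And>t. t \<in> T \<Longrightarrow> \<delta> t = 1"
    and "card T \<le> s" "0 < e" "\<And>k. k < s \<Longrightarrow> G k \<in> forms X e"
    and "\<And>x v. (\<And>i. i \<in> A0 - T \<Longrightarrow> peval (z i) x = 0) \<Longrightarrow> (\<And>k. k < s \<Longrightarrow> peval (G k) x = 0) \<Longrightarrow> v \<in> X \<Longrightarrow> x v = 0"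
  shows "\<exists>z' \<delta>'. (\<forall>i. i \<notin> T \<longrightarrow> z' i = z i \<and> \<delta>' i = \<delta> i) \<and> (\<forall>t\<in>T. \<delta>' t = e \<and> z' t \<in> gspan G (\<lambda>_. e) {..<s} e) \<and>
    good z' \<delta>' A0 \<and> total_length (gspan z' \<delta>' A0) (e ^ card T * D) \<and>
    (card T = s \<longrightarrow> (\<forall>k<s. G k \<in> gspan z' \<delta>' T e))"
  using assms
proof (induction T arbitrary: z \<delta> D G s rule: finite_induct)
  case empty
  then show ?case by (intro exI[of _ z] exI[of _ \<delta>]) simp
next
  case (insert t T)
  note prems = insert.prems
  have fin: "finite A0" and zA: "\<And>i. i \<in> A0 \<Longrightarrow> z i \<in> forms X (\<delta> i)" using prems(1) by (auto simp: good_def)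
  have t: "t \<in> A0" "\<delta> t = 1" using prems by auto
  obtain r where r: "s = Suc r" using prems(5) insert.hyps by (cases s) auto
  have fin': "finite (A0 - {t})" using fin by simp
  have z': "z i \<in> forms X (\<delta> i)" if "i \<in> A0 - {t}" for i using zA that by blast
  obtain c where c: "\<And>x v. (\<And>i. i \<in> A0 - {t} \<Longrightarrow> peval (z i) x = 0) \<Longrightarrow> peval (\<Sum>k<s. smul (c ^ k) (G k)) x = 0 \<Longrightarrow> v \<in> X \<Longrightarrow> x v = 0"
  proof (rule generic_combination[OF fin' z' good_hilb_le[OF prems(1) t prems(2)] prems(7)])
    fix x v assume *: "\<And>i. i \<in> A0 - {t} \<Longrightarrow> peval (z i) x = 0" "\<And>k. k < s \<Longrightarrow> peval (G k) x = 0" "v \<in> X"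
    show "x v = 0" by (rule prems(8)) (use * in auto)
  qed blast+
  define g where "g = (\<Sum>k<s. smul (c ^ k) (G k))"
  have g: "g \<in> forms X e" unfolding g_def by (intro forms_sum forms_smul) (use prems(7) in auto)
  \<comment> \<open>The coefficient of \<open>G 0\<close> is \<open>c ^ 0 = 1\<close>, so
    \<open>G 0\<close> can be recovered from \<open>g\<close> and the other forms; the induction
    continues with the list without \<open>G 0\<close>.\<close>
  have gG: "g = G 0 + (\<Sum>k<r. smul (c ^ Suc k) (G (Suc k)))"
    unfolding g_def r by (subst sum.lessThan_Suc_shift) (simp add: smul_conv)
  define z1 where "z1 = z(t := g)"
  define \<delta>1 where "\<delta>1 = \<delta>(t := e)"
  have good1: "good z1 \<delta>1 A0" "total_length (gspan z1 \<delta>1 A0) (e * D)"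
    using exchange_no_zeros[OF prems(1) t prems(2) g prems(6)] c unfolding z1_def \<delta>1_def g_def by blast+
  have "\<exists>z' \<delta>'. (\<forall>i. i \<notin> T \<longrightarrow> z' i = z1 i \<and> \<delta>' i = \<delta>1 i) \<and> 
    (\<forall>t\<in>T. \<delta>' t = e \<and> z' t \<in> gspan (\<lambda>k. G (Suc k)) (\<lambda>_. e) {..<r} e) \<and>
    good z' \<delta>' A0 \<and> total_length (gspan z' \<delta>' A0) (e ^ card T * (e * D)) \<and>
    (card T = r \<longrightarrow> (\<forall>k<r. G (Suc k) \<in> gspan z' \<delta>' T e))"
  proof (rule insert.IH[OF good1])
    show "T \<subseteq> A0" "\<And>u. u \<in> T \<Longrightarrow> \<delta>1 u = 1" "card T \<le> r" "0 < e" "\<And>k. k < r \<Longrightarrow> G (Suc k) \<in> forms X e"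
      using prems insert.hyps r by (auto simp: \<delta>1_def)
    fix x v assume *: "\<And>i. i \<in> A0 - T \<Longrightarrow> peval (z1 i) x = 0" "\<And>k. k < r \<Longrightarrow> peval (G (Suc k)) x = 0" and v: "v \<in> X"
    have "peval g x = 0" using *(1)[of t] t insert.hyps by (simp add: z1_def)
    then have G0: "peval (G 0) x = 0" using *(2) by (simp add: gG peval_simps peval_smul)
    show "x v = 0"
    proof (rule prems(8)[OF _ _ v])
      show "peval (z i) x = 0" if "i \<in> A0 - insert t T" for i using *(1)[of i] that by (auto simp: z1_def)
      show "peval (G k) x = 0" if "k < s" for k using that G0 *(2) r by (cases k) auto
    qed
  qed
  then obtain z' \<delta>' where z': "\<forall>i. i \<notin> T \<longrightarrow> z' i = z1 i \<and> \<delta>' i = \<delta>1 i"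
    "\<forall>t\<in>T. \<delta>' t = e \<and> z' t \<in> gspan (\<lambda>k. G (Suc k)) (\<lambda>_. e) {..<r} e"
    "good z' \<delta>' A0" "total_length (gspan z' \<delta>' A0) (e ^ card T * (e * D))"
    "card T = r \<longrightarrow> (\<forall>k<r. G (Suc k) \<in> gspan z' \<delta>' T e)" by blast
  have zt: "z' t = g" "\<delta>' t = e" using z'(1) insert.hyps by (auto simp: z1_def \<delta>1_def)
  have IG: "gideal (gspan G (\<lambda>_. e) {..<s})" by (rule gideal_gspan) (use prems(7) in auto)
  have GG: "G k \<in> gspan G (\<lambda>_. e) {..<s} e" if "k < s" for k using gspan_gen[of "{..<s}" k G "\<lambda>_. e"] that by simp
  have sub: "gspan (\<lambda>k. G (Suc k)) (\<lambda>_. e) {..<r} e \<subseteq> gspan G (\<lambda>_. e) {..<s} e"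
    by (rule gspan_least[OF IG]) (use GG r in auto)
  have gG': "g \<in> gspan G (\<lambda>_. e) {..<s} e"
    unfolding g_def by (intro cv.subspace_sum[OF gidealD(1)[OF IG]] cv.subspace_scale[OF gidealD(1)[OF IG]] GG) auto
  have "G k \<in> gspan z' \<delta>' (insert t T) e" if card: "card (insert t T) = s" and k: "k < s" for k
  proof -
    have zf: "z' i \<in> forms X (\<delta>' i)" if "i \<in> insert t T" for i
      using that z'(3) prems(3) by (auto simp: good_def)
    have I': "gideal (gspan z' \<delta>' (insert t T))" by (rule gideal_gspan) (use zf insert.hyps in auto)
    have sub': "gspan z' \<delta>' T e \<subseteq> gspan z' \<delta>' (insert t T) e"
      by (rule gspan_mono) (use zf insert.hyps in auto)
    have Suc: "G (Suc k) \<in> gspan z' \<delta>' (insert t T) e" if "k < r" for k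
      using z'(5) sub' card insert.hyps r that by auto
    have gI: "g \<in> gspan z' \<delta>' (insert t T) e"
      using gspan_gen[of "insert t T" t z' \<delta>'] insert.hyps zt by simp
    have "G 0 = g - (\<Sum>k<r. smul (c ^ Suc k) (G (Suc k)))" using gG by simp
    also have "\<dots> \<in> gspan z' \<delta>' (insert t T) e"
      by (intro gidealD(6)[OF I' gI] cv.subspace_sum[OF gidealD(1)[OF I']] cv.subspace_scale[OF gidealD(1)[OF I']] Suc) auto
    finally show ?thesis using Suc k r by (cases k) auto
  qed
  then show ?case
    using z' zt sub gG' insert.hyps
    by (intro exI[of _ z'] exI[of _ \<delta>']) (auto simp: z1_def \<delta>1_def mult.assoc mult.left_commute)
qed

section \<open>Linear forms as starting sequences for the exchange\<close>

lemma gspan_pvar: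
  assumes "A \<subseteq> X" "p \<in> forms X k" "\<And>m. m \<in> supp p \<Longrightarrow> supp m \<inter> A \<noteq> {}"
  shows "p \<in> gspan pvar (\<lambda>_. 1) A k"
proof -
  have fA: "finite A" using assms(1) finX finite_subset by blast
  have I: "gideal (gspan pvar (\<lambda>_. 1) A)" by (rule gideal_gspan[OF fA]) (rule pvar_forms, use assms(1) in blast)
  have "(\<Sum>m\<in>supp p. sgl m (coef p m)) \<in> gspan pvar (\<lambda>_. 1) A k"
  proof (rule cv.subspace_sum[OF gidealD(1)[OF I]])
    fix m assume m: "m \<in> supp p"
    then obtain v where v: "v \<in> supp m" "v \<in> A" using assms(3) by blast
    define r where "r = m - sgl v 1"
    have r: "m = r + sgl v 1"
      by (rule poly_mapping_eqI) (use v in \<open>auto simp: r_def lookup_add lookup_minus lookup_single when_def in_keys_iff\<close>)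
    have mk: "supp m \<subseteq> X" "(\<Sum>i\<in>supp m. coef m i) = k" using m assms(2) by (auto simp: cspace_def mons_def)
    have "(\<Sum>i\<in>supp m. coef m i) = (\<Sum>i\<in>supp r. coef r i) + 1"
      using mdeg_add[of r "sgl v 1"] by (simp add: r)
    moreover have "supp r \<subseteq> X" using mk(1) by (simp add: r supp_add_nat)
    ultimately have "r \<in> mons X (k - 1)" "1 \<le> k" using mk(2) by (auto simp: mons_def)
    then have "sgl r (coef p m) \<in> cofac k 1" by (simp add: cspace_def cofac_def)
    from gideal_mult_cofac[OF I _ this] gspan_gen[of A v pvar "\<lambda>_. 1"] fA v(2)
    have "sgl r (coef p m) * pvar v \<in> gspan pvar (\<lambda>_. 1) A k" by simp
    moreover have "sgl r c * pvar v = sgl (r + sgl v 1) c" for c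
      by (simp add: pvar_def mult_single)
    then have "sgl m (coef p m) = sgl r (coef p m) * pvar v"
      using r by metis
    ultimately show "sgl m (coef p m) \<in> gspan pvar (\<lambda>_. 1) A k" by simp
  qed
  then show ?thesis by (simp flip: poly_expansion)
qed

lemma gspan_pvar_supp:
  assumes "u \<in> gspan pvar (\<lambda>_. 1) A k" "m \<in> supp u"
  shows "supp m \<inter> A \<noteq> {}"
proof -
  obtain q where q: "u = (\<Sum>i\<in>A. q i * pvar i)" using assms(1) by (auto simp: gspan_def)
  have "coef u m = (\<Sum>i\<in>A. coef (q i * pvar i) m)" by (simp add: q lookup_sum)
  then obtain i where i: "i \<in> A" "m \<in> supp (q i * pvar i)"
    using assms(2) by (metis (no_types, lifting) in_keys_iff sum.neutral)
  then obtain b where "m = b + sgl i 1" using keys_mult[of "q i" "pvar i"] by (auto simp: pvar_def)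
  then show ?thesis using i(1) by (auto simp: supp_add_nat)
qed

lemma good_pvar: "good pvar (\<lambda>_. 1) X"
  unfolding good_def
proof (intro conjI ballI allI impI finX)
  fix i assume "i \<in> X"
  then show "pvar i \<in> forms X 1" by (rule pvar_forms)
  have "peval (pvar i) (\<lambda>_. 1) \<noteq> 0" by (simp add: ev.geval_pvar)
  then show "pvar i \<noteq> 0" using ev.geval_0 by metis
next
  fix A i assume A: "A \<subseteq> X" and i: "i \<in> X - A"
  show "nzd (gspan pvar (\<lambda>_. 1) A) (pvar i) 1"
    unfolding nzd_def
  proof (intro allI impI)
    fix k u assume u: "u \<in> forms X k" "pvar i * u \<in> gspan pvar (\<lambda>_. 1) A (k + 1)"
    show "u \<in> gspan pvar (\<lambda>_. 1) A k"
    proof (rule gspan_pvar[OF A u(1)])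
      fix m assume m: "m \<in> supp u"
      have "pvar i * u = (\<Sum>m'\<in>supp u. sgl (sgl i 1 + m') (coef u m'))"
        by (subst poly_expansion[of u]) (simp add: sum_distrib_left pvar_def mult_single)
      then have "coef (pvar i * u) (sgl i 1 + m) = (\<Sum>m'\<in>supp u. if m' = m then coef u m' else 0)"
        by (auto simp: lookup_sum lookup_single when_def intro!: sum.cong)
      then have "sgl i 1 + m \<in> supp (pvar i * u)" using m by (simp add: in_keys_iff)
      from gspan_pvar_supp[OF u(2) this] show "supp m \<inter> A \<noteq> {}" using i by (auto simp: supp_add_nat)
    qed
  qed
qed simp

lemma length_pvar: "total_length (gspan pvar (\<lambda>_. 1) X) 1"
proof -
  have I: "gideal (gspan pvar (\<lambda>_. 1) X)" by (rule good_gideal[OF good_pvar order_refl])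
  have full: "gspan pvar (\<lambda>_. 1) X k = forms X k" if "k \<ge> 1" for k
  proof
    show "forms X k \<subseteq> gspan pvar (\<lambda>_. 1) X k"
    proof
      fix p assume p: "p \<in> forms X k"
      show "p \<in> gspan pvar (\<lambda>_. 1) X k"
      proof (rule gspan_pvar[OF order_refl p])
        fix m assume "m \<in> supp p"
        then have m: "supp m \<subseteq> X" "(\<Sum>i\<in>supp m. coef m i) = k" using p by (auto simp: cspace_def mons_def)
        then have "supp m \<noteq> {}" using that by (metis not_one_le_zero sum.empty)
        then show "supp m \<inter> X \<noteq> {}" using m(1) by blast
      qed
    qed
  qed (rule gidealD(7)[OF I])
  have "gspan pvar (\<lambda>_. 1) X 0 = {0}"
  proof -
    have "gspan pvar (\<lambda>_. 1) X 0 \<subseteq> {0}" by (fastforce simp: gspan_def cofac_def intro!: sum.neutral)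
    then show ?thesis using gidealD(4)[OF I, of 0] by blast
  qed
  moreover have "fdim {0 :: 'v cpoly}" by (rule fdim_mono[OF fdim_forms[OF finX, of 0]]) simp
  ultimately have h0: "hilb (gspan pvar (\<lambda>_. 1) X) 0 = 1" 
    using dim_0_iff[of "{0 :: 'v cpoly}"] by (simp add: hilb_def dim_cspace mons_0 cv.subspace_single_0)
  have "(\<Sum>j<k. hilb (gspan pvar (\<lambda>_. 1) X) j) = 1" if "k \<ge> 1" for k
    using that
  proof (induction k rule: dec_induct)
    case (step k)
    then show ?case using full[of k] by (simp add: hilb_def)
  qed (simp add: h0[simplified])
  then show ?thesis using full unfolding total_length_def by (intro exI[of _ 1]) auto
qed

lemma peval_linear: "l \<in> forms X 1 \<Longrightarrow> peval l x = (\<Sum>i\<in>X. coef l (sgl i 1) * x i)"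
proof -
  assume l: "l \<in> forms X 1"
  have m1: "mons X 1 = (\<lambda>i. sgl i 1) ` X"
  proof (intro equalityI subsetI)
    fix m assume m: "m \<in> mons X 1"
    then have s: "(\<Sum>i\<in>supp m. coef m i) = 1" "supp m \<subseteq> X" by (auto simp: mons_def)
    then obtain i where i: "i \<in> supp m" by (metis ex_in_conv sum.empty zero_neq_one)
    have "(\<Sum>i\<in>supp m. coef m i) = coef m i + (\<Sum>j\<in>supp m - {i}. coef m j)" using i by (simp add: sum.remove)
    moreover have "0 < coef m i" using i by (simp add: in_keys_iff)
    ultimately have "coef m i = 1" "(\<Sum>j\<in>supp m - {i}. coef m j) = 0" using s(1) by linarith+
    then have "m = sgl i 1"
    proof -
      assume m0: "coef m i = 1" "(\<Sum>j\<in>supp m - {i}. coef m j) = 0"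
      have "coef m a = 0" if "a \<noteq> i" for a
        using m0(2) that by (metis DiffI finite_Diff finite_keys in_keys_iff singletonD sum_eq_0_iff)
      then show ?thesis using m0(1) by (intro poly_mapping_eqI) (auto simp: lookup_single when_def)
    qed
    then show "m \<in> (\<lambda>i. sgl i 1) ` X" using i s by blast
  qed (auto simp: mons_def)
  have "peval l x = (\<Sum>m\<in>(\<lambda>i. sgl i 1) ` X. coef l m * mval x m)"
  proof (rule ev.geval_superset)
    show "supp l \<subseteq> (\<lambda>i. sgl i 1) ` X" using l unfolding cspace_def m1 by simp
  qed (use finX in simp)
  also have "\<dots> = (\<Sum>i\<in>X. coef l (sgl i 1) * x i)"
    by (subst sum.reindex) (auto intro!: inj_onI dest!: arg_cong[of _ _ "\<lambda>p. coef p _"] simp: lookup_single when_def split: if_splits)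
  finally show ?thesis .
qed

lemma linear_nonzero_coef:
  assumes "l \<in> forms X 1" "l \<noteq> 0"
  obtains i where "i \<in> X" "coef l (sgl i 1) \<noteq> 0"
  using assms peval_nonzero_ex[of l] peval_linear[of l] by (metis (no_types, lifting) mult_zero_left sum.neutral)

text \<open>A linear form with nonzero coefficient at \<open>i\<close> may replace the variable
  \<open>i\<close>; by the exchange step with \<open>e = 1\<close> the length stays 1.\<close>

lemma good_linear:
  assumes l: "l \<in> forms X 1" and i: "i \<in> X" "coef l (sgl i 1) \<noteq> 0"
  shows "good (pvar(i := l)) (\<lambda>_. 1) X \<and> total_length (gspan (pvar(i := l)) (\<lambda>_. 1) X) 1"
proof -
  have "good (pvar(i := l)) ((\<lambda>_. 1)(i := 1)) X \<and> total_length (gspan (pvar(i := l)) ((\<lambda>_. 1)(i := 1)) X) (1 * 1)"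
  proof (rule exchange_no_zeros[OF good_pvar i(1) refl length_pvar l])
    fix x v assume *: "\<And>j. j \<in> X - {i} \<Longrightarrow> peval (pvar j) x = 0" "peval l x = 0" "v \<in> X"
    have "peval l x = (\<Sum>j\<in>{i}. coef l (sgl j 1) * x j)"
      unfolding peval_linear[OF l] by (rule sum.mono_neutral_right) (use finX i * in \<open>auto simp: ev.geval_pvar\<close>)
    then have "x i = 0" using * i by simp
    then show "x v = 0" using * by (cases "v = i") (auto simp: ev.geval_pvar)
  qed simp
  then show ?thesis by (simp add: fun_upd_idem)
qed

text \<open>The nonzero minor makes the two linear equations in the remaining coordinates
  \<open>x i\<close> and \<open>x j\<close> uniquely solvable, so the modified sequence still has no
  common zero but the origin.\<close>

lemma good_two_linear:
  assumes l: "l \<in> forms X 1" and a: "a \<in> forms X 1" and i: "i \<in> X" "coef l (sgl i 1) \<noteq> 0" and j: "j \<in> X" "j \<noteq> i"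
    "coef l (sgl i 1) * coef a (sgl j 1) \<noteq> coef l (sgl j 1) * coef a (sgl i 1)"
  shows "good (pvar(i := l, j := a)) (\<lambda>_. 1) X \<and> total_length (gspan (pvar(i := l, j := a)) (\<lambda>_. 1) X) 1"
proof -
  have "good (pvar(i := l, j := a)) ((\<lambda>_. 1)(j := 1)) X \<and> total_length (gspan (pvar(i := l, j := a)) ((\<lambda>_. 1)(j := 1)) X) (1 * 1)"
  proof (rule exchange_no_zeros[OF _ j(1) refl _ a])
    show "good (pvar(i := l)) (\<lambda>_. 1) X" "total_length (gspan (pvar(i := l)) (\<lambda>_. 1) X) 1"
      using good_linear[OF l i] by auto
    fix x v assume *: "\<And>k. k \<in> X - {j} \<Longrightarrow> peval ((pvar(i := l)) k) x = 0" "peval a x = 0" "v \<in> X"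
    have 0: "x k = 0" if "k \<in> X" "k \<noteq> i" "k \<noteq> j" for k using *(1)[of k] that by (simp add: ev.geval_pvar)
    have l0: "peval l x = 0" using *(1)[of i] i j by auto
    have two: "peval h x = coef h (sgl i 1) * x i + coef h (sgl j 1) * x j" if "h \<in> forms X 1" for h
    proof -
      have "peval h x = (\<Sum>k\<in>{i, j}. coef h (sgl k 1) * x k)"
        unfolding peval_linear[OF that] by (rule sum.mono_neutral_right) (use finX i j 0 in auto)
      then show ?thesis using j by simp
    qed
    let ?li = "coef l (sgl i 1)" and ?lj = "coef l (sgl j 1)" and ?ai = "coef a (sgl i 1)" and ?aj = "coef a (sgl j 1)"
    have e1: "?li * x i + ?lj * x j = 0" and e2: "?ai * x i + ?aj * x j = 0" 
      using l0 *(2) two[OF l] two[OF a] by simp_all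
    have "(?li * ?aj - ?lj * ?ai) * x j = ?li * (?ai * x i + ?aj * x j) - ?ai * (?li * x i + ?lj * x j)"
      by (simp add: algebra_simps)
    then have "x j = 0" using e1 e2 j(3) by simp
    then have "x i = 0" using e1 i by simp
    then show "x v = 0" using 0 \<open>x j = 0\<close> *(3) by (cases "v = i"; cases "v = j") auto
  qed simp
  then show ?thesis by (simp add: fun_upd_idem)
qed

text \<open>In a sequence of \<open>l\<close> and \<open>n\<close> variables the variables are
  exchanged for combinations of the \<open>G k\<close>. Without \<open>l\<close> the quotient has
  Hilbert function \<open>e ^ n\<close> in high degrees, and its ideal contains all the
  \<open>G k\<close>.\<close>

lemma bezout_ge:
  assumes card: "card X = Suc n" and l: "l \<in> forms X 1" "l \<noteq> 0" and e: "0 < e" and G: "\<And>k. k < n \<Longrightarrow> G k \<in> forms X e"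
    and van: "\<And>x v. peval l x = 0 \<Longrightarrow> (\<And>k. k < n \<Longrightarrow> peval (G k) x = 0) \<Longrightarrow> v \<in> X \<Longrightarrow> x v = 0"
  obtains K where "\<And>k. k \<ge> K \<Longrightarrow> e ^ n \<le> hilb (gspan G (\<lambda>_. e) {..<n}) k"
proof -
  obtain i where i: "i \<in> X" "coef l (sgl i 1) \<noteq> 0" by (rule linear_nonzero_coef[OF l])
  have cT: "card (X - {i}) = n" using card i by simp
  have gl: "good (pvar(i := l)) (\<lambda>_. 1) X" "total_length (gspan (pvar(i := l)) (\<lambda>_. 1) X) 1"
    using good_linear[OF l(1) i] by auto
  have "\<exists>z' \<delta>'. (\<forall>j. j \<notin> X - {i} \<longrightarrow> z' j = (pvar(i := l)) j \<and> \<delta>' j = 1) \<and> (\<forall>t\<in>X - {i}. \<delta>' t = e \<and> z' t \<in> gspan G (\<lambda>_. e) {..<n} e) \<and>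
    good z' \<delta>' X \<and> total_length (gspan z' \<delta>' X) (e ^ card (X - {i}) * 1) \<and>
    (card (X - {i}) = n \<longrightarrow> (\<forall>k<n. G k \<in> gspan z' \<delta>' (X - {i}) e))"
  proof (rule exchange_process[OF _ gl])
    fix x v assume *: "\<And>j. j \<in> X - (X - {i}) \<Longrightarrow> peval ((pvar(i := l)) j) x = 0" "\<And>k. k < n \<Longrightarrow> peval (G k) x = 0" "v \<in> X"
    show "x v = 0" by (rule van) (use * i in auto)
  qed (use finX cT e G in auto)
  then obtain z' \<delta>' where z': "\<delta>' i = 1" "good z' \<delta>' X" "total_length (gspan z' \<delta>' X) (e ^ n)" "\<forall>k<n. G k \<in> gspan z' \<delta>' (X - {i}) e"
    using cT i by auto
  obtain K where K: "\<And>k. k \<ge> K \<Longrightarrow> hilb (gspan z' \<delta>' (X - {i})) k = e ^ n"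
    by (rule good_hilb_eventually[OF z'(2) i(1) z'(1,3)]) auto
  have I': "gideal (gspan z' \<delta>' (X - {i}))" by (rule good_gideal[OF z'(2)]) auto
  have "e ^ n \<le> hilb (gspan G (\<lambda>_. e) {..<n}) k" if "k \<ge> K" for k
  proof -
    have "gspan G (\<lambda>_. e) {..<n} k \<subseteq> gspan z' \<delta>' (X - {i}) k" by (rule gspan_least[OF I']) (use z'(4) in auto)
    from hilb_mono[OF gideal_gspan I' this] G K[OF that] show ?thesis by simp
  qed
  then show ?thesis by (rule that)
qed

text \<open>The sequence starts with \<open>l\<close>, \<open>a\<close> and \<open>n - 1\<close>
  variables, which are exchanged for combinations of the \<open>G k\<close>. Without
  \<open>l\<close> its ideal is contained in that of \<open>a\<close> and the \<open>G k\<close>,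
  and the quotient has Hilbert function at most \<open>e ^ (n - 1)\<close>.\<close>

lemma bezout_le:
  assumes card: "card X = Suc n" "0 < n" and l: "l \<in> forms X 1" and e: "0 < e" and G: "\<And>k. k < n \<Longrightarrow> G k \<in> forms X e"
    and van: "\<And>x v. peval l x = 0 \<Longrightarrow> (\<And>k. k < n \<Longrightarrow> peval (G k) x = 0) \<Longrightarrow> v \<in> X \<Longrightarrow> x v = 0"
    and a: "a \<in> forms X 1" and y: "peval l y = 0" "peval a y \<noteq> 0" and l0: "l \<noteq> 0"
  shows "hilb (gadd (gspan G (\<lambda>_. e) {..<n}) a 1) k \<le> e ^ (n - 1)"
proof -
  obtain i where i: "i \<in> X" "coef l (sgl i 1) \<noteq> 0" by (rule linear_nonzero_coef[OF l l0])
  \<comment> \<open>If all minors with column \<open>i\<close> vanished, \<open>a\<close> would be a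
    multiple of \<open>l\<close>, contrary to the values at \<open>y\<close>.\<close>
  have "\<exists>j\<in>X. j \<noteq> i \<and> coef l (sgl i 1) * coef a (sgl j 1) \<noteq> coef l (sgl j 1) * coef a (sgl i 1)"
  proof (rule ccontr)
    assume "\<not> ?thesis"
    then have *: "coef l (sgl i 1) * coef a (sgl j 1) = coef l (sgl j 1) * coef a (sgl i 1)" if "j \<in> X" for j using that by (cases "j = i") auto
    have "coef l (sgl i 1) * peval a y = (\<Sum>j\<in>X. (coef l (sgl i 1) * coef a (sgl j 1)) * y j)"
      unfolding peval_linear[OF a] by (simp add: sum_distrib_left mult.assoc)
    also have "\<dots> = (\<Sum>j\<in>X. (coef l (sgl j 1) * coef a (sgl i 1)) * y j)"      by (rule sum.cong[OF refl]) (simp only: *)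
    also have "\<dots> = coef a (sgl i 1) * peval l y"
      unfolding peval_linear[OF l] by (simp add: sum_distrib_left algebra_simps)
    finally show False using y i by simp
  qed
  then obtain j where j: "j \<in> X" "j \<noteq> i" "coef l (sgl i 1) * coef a (sgl j 1) \<noteq> coef l (sgl j 1) * coef a (sgl i 1)" by blast
  let ?T = "X - {i, j}" and ?z = "pvar(i := l, j := a)"
  have cT: "card ?T = n - 1" using card i j finX by (simp add: card_Diff_subset)
  have gl: "good ?z (\<lambda>_. 1) X" "total_length (gspan ?z (\<lambda>_. 1) X) 1"
    using good_two_linear[OF l a i j] by auto
  have "\<exists>z' \<delta>'. (\<forall>k. k \<notin> ?T \<longrightarrow> z' k = ?z k \<and> \<delta>' k = 1) \<and> (\<forall>t\<in>?T. \<delta>' t = e \<and> z' t \<in> gspan G (\<lambda>_. e) {..<n} e) \<and>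
    good z' \<delta>' X \<and> total_length (gspan z' \<delta>' X) (e ^ card ?T * 1) \<and>
    (card ?T = n \<longrightarrow> (\<forall>k<n. G k \<in> gspan z' \<delta>' ?T e))"
  proof (rule exchange_process[OF _ gl])
    fix x v assume *: "\<And>k. k \<in> X - ?T \<Longrightarrow> peval (?z k) x = 0" "\<And>k. k < n \<Longrightarrow> peval (G k) x = 0" "v \<in> X"
    show "x v = 0" by (rule van) (use *(1)[of i] * i j in auto)
  qed (use finX cT e G card in auto)
  then obtain z' \<delta>' where z': "\<forall>k. k \<notin> ?T \<longrightarrow> z' k = ?z k \<and> \<delta>' k = 1" "\<forall>t\<in>?T. \<delta>' t = e \<and> z' t \<in> gspan G (\<lambda>_. e) {..<n} e"
    "good z' \<delta>' X" "total_length (gspan z' \<delta>' X) (e ^ (n - 1))"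
    using cT by auto
  have di: "\<delta>' i = 1" and zj: "z' j = a" "\<delta>' j = 1" using z'(1) j by auto
  have IG: "gideal (gspan G (\<lambda>_. e) {..<n})" by (rule gideal_gspan) (use G in auto)
  have IA: "gideal (gadd (gspan G (\<lambda>_. e) {..<n}) a 1)" by (rule gideal_gadd[OF IG a])
  have "gspan z' \<delta>' (X - {i}) k \<subseteq> gadd (gspan G (\<lambda>_. e) {..<n}) a 1 k"
  proof (rule gspan_least[OF IA])
    fix t assume t: "t \<in> X - {i}"
    show "z' t \<in> gadd (gspan G (\<lambda>_. e) {..<n}) a 1 (\<delta>' t)"
    proof (cases "t = j")
      case True
      have "1 * a \<in> gadd (gspan G (\<lambda>_. e) {..<n}) a 1 1"
        by (rule gadd_mem[OF IG]) (simp add: cofac_def one_forms)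
      then show ?thesis using zj True by simp
    next
      case False
      then have "z' t \<in> gspan G (\<lambda>_. e) {..<n} e" "\<delta>' t = e" using z'(2) t by auto
      then show ?thesis using gadd_superset[of "gspan G (\<lambda>_. e) {..<n}" e a 1] by auto
    qed
  qed
  then have "hilb (gadd (gspan G (\<lambda>_. e) {..<n}) a 1) k \<le> hilb (gspan z' \<delta>' (X - {i})) k"
    by (rule hilb_mono[OF good_gideal[OF z'(3)] IA, rotated]) blast
  also have "\<dots> \<le> e ^ (n - 1)" by (rule good_hilb_le[OF z'(3) i(1) di z'(4)])
  finally show ?thesis .
qed

text \<open>The relation puts \<open>a\<close> into the colon ideal of \<open>g\<close>, whose
  quotient then has Hilbert function at most \<open>e ^ (n - 1)\<close>. Adjoining \<open>g\<close>
  lowers the Hilbert function of the \<open>G k\<close> by no more than that.\<close>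

lemma syzygy_bound:
  assumes card: "card X = Suc n" "0 < n" and l: "l \<in> forms X 1" "l \<noteq> 0" and e: "0 < e" and G: "\<And>k. k < n \<Longrightarrow> G k \<in> forms X e"
    and van: "\<And>x v. peval l x = 0 \<Longrightarrow> (\<And>k. k < n \<Longrightarrow> peval (G k) x = 0) \<Longrightarrow> v \<in> X \<Longrightarrow> x v = 0"
    and a: "a \<in> forms X 1" "peval l y = 0" "peval a y \<noteq> 0"
    and g: "g \<in> forms X e" "g * a \<in> gspan G (\<lambda>_. e) {..<n} (e + 1)"
  obtains K where "\<And>k. k \<ge> K \<Longrightarrow> e ^ n \<le> hilb (gadd (gspan G (\<lambda>_. e) {..<n}) g e) k + e ^ (n - 1)"
proof -
  let ?I = "gspan G (\<lambda>_. e) {..<n}"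
  have IG: "gideal ?I" by (rule gideal_gspan) (use G in auto)
  obtain K where K: "\<And>k. k \<ge> K \<Longrightarrow> e ^ n \<le> hilb ?I k"
  proof (rule bezout_ge[where G = G and l = l and e = e and n = n])
    show "x v = 0" if "peval l x = 0" "\<And>k. k < n \<Longrightarrow> peval (G k) x = 0" "v \<in> X" for x v
      using van that by blast
  qed (use card l e G in auto)
  have "e ^ n \<le> hilb (gadd ?I g e) k + e ^ (n - 1)" if k: "k \<ge> K + e" for k
  proof (cases "g = 0")
    case True
    then have "gadd ?I g e k = ?I k" using gadd_least[OF IG order_refl, of g e k] gadd_superset[of ?I k g e] gidealD(4)[OF IG] by blast
    then show ?thesis using K[of k] k by (simp add: hilb_def)
  next
    case False
    have Ic: "gideal (gcol ?I g e)" by (rule gideal_gcol[OF IG g(1)])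
    have "a \<in> gcol ?I g e 1" using a(1) g(2) by (simp add: gcol_def add.commute)
    then have "gadd ?I a 1 (k - e) \<subseteq> gcol ?I g e (k - e)"
      by (rule gadd_least[OF Ic gcol_superset[OF IG g(1)]])
    then have "hilb (gcol ?I g e) (k - e) \<le> hilb (gadd ?I a 1) (k - e)"
      by (rule hilb_mono[OF gideal_gadd[OF IG a(1)] Ic])
    also have "\<dots> \<le> e ^ (n - 1)"
    proof (rule bezout_le[where G = G and l = l and e = e and n = n])
      show "x v = 0" if "peval l x = 0" "\<And>k. k < n \<Longrightarrow> peval (G k) x = 0" "v \<in> X" for x v
        using van that by blast
    qed (use card l e G a in auto)
    finally have "hilb (gcol ?I g e) (k - e) \<le> e ^ (n - 1)" .
    moreover have "hilb (gadd ?I g e) (k - e + e) + hilb (gcol ?I g e) (k - e) = hilb ?I (k - e + e)"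
      by (rule hilb_gadd[OF IG g(1) False])
    ultimately show ?thesis using K[of k] k by simp
  qed
  then show ?thesis by (rule that)
qed

end

section \<open>Derivatives\<close>

lemma peval_sgl: "peval (sgl m c) x = c * mval x m"
  by (rule ev.geval_sgl)

lemma peval_pdiff: "peval (pdiff i p) x = (\<Sum>m\<in>supp p. of_nat (coef m i) * coef p m * mval x (m - sgl i 1))"
  unfolding pdiff_def by (simp add: ev.geval_sum peval_sgl)

lemma mval_diff_sgl:
  assumes "i \<in> supp m"
  shows "mval x (m - sgl i 1) = x i ^ (coef m i - 1) * (\<Prod>j\<in>supp m - {i}. x j ^ coef m j)"
proof -
  have "mval x (m - sgl i 1) = (\<Prod>j\<in>supp m. x j ^ coef (m - sgl i 1) j)"
    by (rule mval_superset) (auto simp: in_keys_iff lookup_minus)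
  also have "\<dots> = x i ^ coef (m - sgl i 1) i * (\<Prod>j\<in>supp m - {i}. x j ^ coef (m - sgl i 1) j)"
    by (rule prod.remove) (use assms in auto)
  also have "(\<Prod>j\<in>supp m - {i}. x j ^ coef (m - sgl i 1) j) = (\<Prod>j\<in>supp m - {i}. x j ^ coef m j)"
    by (rule prod.cong) (auto simp: lookup_minus lookup_single when_def)
  finally show ?thesis by (simp add: lookup_minus)
qed

text \<open>Derivatives along curves are the only analytic input needed: formal partial derivatives
  are compared with complex derivatives through this rule.\<close>

lemma peval_chain:
  fixes u :: "complex \<Rightarrow> 'v \<Rightarrow> complex"
  assumes fin: "finite X" and p: "p \<in> polys X" and u: "\<And>i. i \<in> X \<Longrightarrow> ((\<lambda>s. u s i) has_field_derivative u' i) (at s)"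
  shows "((\<lambda>s. peval p (u s)) has_field_derivative (\<Sum>i\<in>X. peval (pdiff i p) (u s) * u' i)) (at s)"
proof -
  have mono: "((\<lambda>s. mval (u s) m) has_field_derivative (\<Sum>i\<in>X. of_nat (coef m i) * mval (u s) (m - sgl i 1) * u' i)) (at s)"
    if m: "supp m \<subseteq> X" for m
  proof -
    have "((\<lambda>s. mval (u s) m) has_field_derivative 
        (\<Sum>i\<in>supp m. (of_nat (coef m i) * u s i ^ (coef m i - 1) * u' i) * (\<Prod>j\<in>supp m - {i}. u s j ^ coef m j))) (at s)"
      unfolding mval_def
    proof (rule has_field_derivative_prod)
      fix i assume "i \<in> supp m"
      then show "((\<lambda>s. u s i ^ coef m i) has_field_derivative of_nat (coef m i) * u s i ^ (coef m i - 1) * u' i) (at s)"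
        using DERIV_power[OF u[of i], of "coef m i"] m by (auto simp: algebra_simps)
    qed
    also have "(\<Sum>i\<in>supp m. (of_nat (coef m i) * u s i ^ (coef m i - 1) * u' i) * (\<Prod>j\<in>supp m - {i}. u s j ^ coef m j))
        = (\<Sum>i\<in>supp m. of_nat (coef m i) * mval (u s) (m - sgl i 1) * u' i)"
    proof (rule sum.cong[OF refl])
      fix i assume i: "i \<in> supp m"
      show "(of_nat (coef m i) * u s i ^ (coef m i - 1) * u' i) * (\<Prod>j\<in>supp m - {i}. u s j ^ coef m j)
          = of_nat (coef m i) * mval (u s) (m - sgl i 1) * u' i"
        unfolding mval_diff_sgl[OF i] by (simp add: algebra_simps)
    qed
    also have "\<dots> = (\<Sum>i\<in>X. of_nat (coef m i) * mval (u s) (m - sgl i 1) * u' i)"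
      by (rule sum.mono_neutral_left) (use fin m in \<open>auto simp: in_keys_iff\<close>)
    finally show ?thesis .
  qed
  have "((\<lambda>s. \<Sum>m\<in>supp p. coef p m * mval (u s) m) has_field_derivative 
      (\<Sum>m\<in>supp p. coef p m * (\<Sum>i\<in>X. of_nat (coef m i) * mval (u s) (m - sgl i 1) * u' i))) (at s)"
    by (intro DERIV_sum DERIV_cmult mono) (use p in \<open>auto simp: polys_def\<close>)
  also have "(\<Sum>m\<in>supp p. coef p m * (\<Sum>i\<in>X. of_nat (coef m i) * mval (u s) (m - sgl i 1) * u' i)) 
      = (\<Sum>i\<in>X. peval (pdiff i p) (u s) * u' i)"
    unfolding peval_pdiff sum_distrib_left sum_distrib_right
    by (subst sum.swap) (simp add: algebra_simps)
  finally show ?thesis by (simp add: peval_def mval_def)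
qed

lemma pdiff_forms: "p \<in> forms X d \<Longrightarrow> pdiff i p \<in> forms X (d - 1)"
  unfolding pdiff_def
proof (rule forms_sum)
  fix m assume p: "p \<in> forms X d" and "m \<in> supp p"
  then have m: "supp m \<subseteq> X" "(\<Sum>i\<in>supp m. coef m i) = d" by (auto simp: cspace_def mons_def)
  show "sgl (m - sgl i 1) (of_nat (coef m i) * coef p m) \<in> forms X (d - 1)"
  proof (cases "coef m i = 0")
    case False
    define r where "r = m - sgl i 1"
    have r: "m = r + sgl i 1"
      by (rule poly_mapping_eqI) (use False in \<open>auto simp: r_def lookup_add lookup_minus lookup_single when_def\<close>)
    have "(\<Sum>i\<in>supp m. coef m i) = (\<Sum>i\<in>supp r. coef r i) + 1"
      using mdeg_add[of r "sgl i 1"] by (simp add: r)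
    moreover have "supp r \<subseteq> X" using m(1) by (simp add: r supp_add_nat)
    ultimately have "r \<in> mons X (d - 1)" using m(2) by (auto simp: mons_def)
    then show ?thesis by (simp add: r_def cspace_def)
  qed simp
qed

lemma polys_pdiff: "p \<in> polys X \<Longrightarrow> pdiff i p \<in> polys X"
  unfolding pdiff_def
proof (rule polys_sum)
  fix m assume "p \<in> polys X" "m \<in> supp p"
  then have "supp m \<subseteq> X" by (auto simp: polys_def)
  moreover have "supp (m - sgl i 1) \<subseteq> supp m" by (auto simp: in_keys_iff lookup_minus)
  ultimately show "sgl (m - sgl i 1) (of_nat (coef m i) * coef p m) \<in> polys X" by (auto simp: polys_def)
qed

text \<open>Both sides are the derivative of \<open>f (s x)\<close> at \<open>s = 1\<close>.\<close>

lemma euler: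
  assumes fin: "finite X" and p: "p \<in> forms X d"
  shows "(\<Sum>i\<in>X. x i * peval (pdiff i p) x) = of_nat d * peval p x"
proof -
  have "((\<lambda>s. peval p (\<lambda>i. s * x i)) has_field_derivative (\<Sum>i\<in>X. peval (pdiff i p) (\<lambda>i. 1 * x i) * x i)) (at 1)"
    by (rule peval_chain[OF fin]) (use p forms_subset_polys in \<open>auto intro!: derivative_eq_intros\<close>)
  moreover have "((\<lambda>s. peval p (\<lambda>i. s * x i)) has_field_derivative of_nat d * peval p x) (at 1)"
    unfolding peval_homog[OF p] by (auto intro!: derivative_eq_intros)
  ultimately show ?thesis using DERIV_unique by (fastforce simp: mult.commute)
qed

section \<open>Linear maps\<close>

definition vec :: "'v set \<Rightarrow> ('v \<Rightarrow> complex) \<Rightarrow> 'v cvec"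
  where "vec I x = (\<Sum>i\<in>I. sgl i (x i))"

lemma coef_vec: "finite I \<Longrightarrow> coef (vec I x) i = (if i \<in> I then x i else 0)"
  by (simp add: vec_def lookup_sum lookup_single when_def)

lemma vec_cspace: "finite I \<Longrightarrow> vec I x \<in> cspace I"
  by (auto simp: cspace_def in_keys_iff coef_vec split: if_splits)

lemma cspace_coef: "v \<in> cspace I \<Longrightarrow> i \<notin> I \<Longrightarrow> coef v i = 0"
  by (auto simp: cspace_def in_keys_iff)

text \<open>The matrix action on plain functions, which are what \<open>peval\<close> takes as
  points; no support conditions arise.\<close>

definition mvec :: "('v \<times> 'w) cvec \<Rightarrow> 'w set \<Rightarrow> ('w \<Rightarrow> complex) \<Rightarrow> 'v \<Rightarrow> complex"
  where "mvec A J y i = (\<Sum>j\<in>J. coef A (i, j) * y j)"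

lemma coef_mat_app:
  assumes A: "A \<in> cspace (I \<times> J)" and J: "finite J"
  shows "coef (mat_app A v) i = mvec A J (coef v) i"
proof -
  have "coef (mat_app A v) i = (\<Sum>q\<in>supp A. if fst q = i then coef A q * coef v (snd q) else 0)"
    unfolding mat_app_def by (simp add: lookup_sum lookup_single when_def case_prod_beta)
  also have "\<dots> = (\<Sum>q\<in>{q \<in> supp A. fst q = i}. coef A q * coef v (snd q))"
    by (simp add: sum.inter_filter)
  also have "\<dots> = (\<Sum>q\<in>Pair i ` J. coef A q * coef v (snd q))"
    by (rule sum.mono_neutral_left) (use A J in \<open>auto simp: cspace_def in_keys_iff\<close>)
  also have "\<dots> = mvec A J (coef v) i"
    unfolding mvec_def by (subst sum.reindex) (auto intro: inj_onI)
  finally show ?thesis .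
qed

lemma mat_app_cspace:
  assumes A: "A \<in> cspace (I \<times> J)" shows "mat_app A v \<in> cspace I"
  unfolding mat_app_def
  by (rule cv.subspace_sum[OF subspace_cspace]) (use A in \<open>auto simp: cspace_def split: if_splits\<close>)

lemma peval_pullback:
  assumes A: "A \<in> cspace (I \<times> J)" and J: "finite J"
  shows "peval (pullback A p) y = peval p (mvec A J y)"
proof -
  have "(\<Sum>j\<in>snd ` supp A. coef A (i, j) * y j) = (\<Sum>j\<in>J. coef A (i, j) * y j)" for i
    by (rule sum.mono_neutral_left[OF J]) (use A in \<open>force simp: cspace_def in_keys_iff\<close>)+
  then have "(\<lambda>i. \<Sum>j\<in>snd ` supp A. coef A (i, j) * y j) = mvec A J y"
    by (simp add: mvec_def fun_eq_iff)
  then show ?thesis unfolding pullback_def peval_psubst by (simp add: peval_simps)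
qed

lemma pullback_forms:
  assumes A: "A \<in> cspace (I \<times> J)" and p: "p \<in> forms I d"
  shows "pullback A p \<in> forms J d"
proof -
  have "psubst (\<lambda>i. \<Sum>j\<in>snd ` supp A. pconst (coef A (i, j)) * pvar j) p \<in> forms J (d * 1)"
  proof (rule forms_psubst[OF p])
    show "(\<Sum>j\<in>snd ` supp A. pconst (coef A (i, j)) * pvar j) \<in> forms J 1" for i
    proof (rule forms_sum)
      fix j assume "j \<in> snd ` supp A"
      then have "j \<in> J" using A by (auto simp: cspace_def)
      then show "pconst (coef A (i, j)) * pvar j \<in> forms J 1" 
        using forms_smul[OF pvar_forms, of j J "coef A (i, j)"] by (simp add: smul_conv)
    qed
  qed
  then show ?thesis by (simp add: pullback_def)
qed

lemma pullback_smul: "pullback A (smul c p) = smul c (pullback A p)"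
  by (simp add: pullback_def psubst_smul)

section \<open>Lines as points of projective space\<close>

lemma line_conv: "line v = {smul c v |c. c \<noteq> 0}"
  by (simp add: line_def smul_def)

lemma line_self: "v \<in> line v"
  unfolding line_conv using cv.scale_one[of v] by (metis (mono_tags, lifting) mem_Collect_eq zero_neq_one)

lemma line_smul: "c \<noteq> 0 \<Longrightarrow> line (smul c v) = line v"
proof (intro equalityI subsetI)
  assume c: "c \<noteq> 0"
  show "w \<in> line v" if "w \<in> line (smul c v)" for w
  proof -
    obtain b where "b \<noteq> 0" "w = smul b (smul c v)" using \<open>w \<in> line (smul c v)\<close> unfolding line_conv by blast
    then have "w = smul (b * c) v" "b * c \<noteq> 0" using c by simp_all
    then show ?thesis unfolding line_conv by blast
  qed
  show "w \<in> line (smul c v)" if "w \<in> line v" for w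
  proof -
    obtain b where "b \<noteq> 0" "w = smul b v" using \<open>w \<in> line v\<close> unfolding line_conv by blast
    then have "w = smul (b / c) (smul c v)" "b / c \<noteq> 0" using c by simp_all
    then show ?thesis unfolding line_conv by blast
  qed
qed

lemma line_mem: "w \<in> line v \<Longrightarrow> line w = line v"
proof -
  assume "w \<in> line v"
  then obtain c where "c \<noteq> 0" "w = smul c v" unfolding line_conv by blast
  then show ?thesis using line_smul by blast
qed

lemma line_eq_iff: "line v = line w \<longleftrightarrow> (\<exists>c. c \<noteq> 0 \<and> v = smul c w)"
  using line_self[of v] line_smul[of _ w] unfolding line_conv[of w] by auto

lemma pullback_line: "pullback A ` line p = line (pullback A p)"
proof -
  have "pullback A ` {smul c p |c. c \<noteq> 0} = (\<lambda>c. pullback A (smul c p)) ` {c. c \<noteq> 0}" by blast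
  then show ?thesis unfolding line_conv pullback_smul by blast
qed

lemma proj_iff: "L \<in> proj I \<longleftrightarrow> (\<exists>v\<in>cspace I. v \<noteq> 0 \<and> L = line v)"
  by (auto simp: proj_def)



lemma peval_coef_smul:
  assumes "q \<in> forms I k" shows "peval q (coef (smul c v)) = c ^ k * peval q (coef v)"
proof -
  have "coef (smul c v) = (\<lambda>i. c * coef v i)" by auto
  then show ?thesis using peval_homog[OF assms, of c "coef v"] by simp
qed

lemma line_forall_nonzero:
  assumes "q \<in> forms I k"
  shows "(\<forall>w\<in>line v. peval q (coef w) \<noteq> 0) \<longleftrightarrow> peval q (coef v) \<noteq> 0"
proof
  show "peval q (coef v) \<noteq> 0" if "\<forall>w\<in>line v. peval q (coef w) \<noteq> 0" using that line_self by blast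
  show "\<forall>w\<in>line v. peval q (coef w) \<noteq> 0" if "peval q (coef v) \<noteq> 0"
    using that peval_coef_smul[OF assms] unfolding line_conv by auto
qed

lemma peval_0_eq_0: "q \<in> forms I k \<Longrightarrow> 0 < k \<Longrightarrow> (\<And>i. i \<in> I \<Longrightarrow> x i = 0) \<Longrightarrow> peval q x = 0"
proof -
  assume q: "q \<in> forms I k" "0 < k" and x: "\<And>i. i \<in> I \<Longrightarrow> x i = 0"
  have "peval q x = peval q (\<lambda>i. 0 * x i)"
    by (rule peval_cong_vars[of q I]) (use q forms_subset_polys x in auto)
  then show ?thesis using peval_homog[OF q(1), of 0 x] q(2) by (simp add: power_0_left)
qed

lemma sing_line_iff:
  assumes f: "f \<in> forms I d" and v: "v \<in> cspace I" "v \<noteq> 0"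
  shows "line v \<in> sing I f \<longleftrightarrow> peval f (coef v) = 0 \<and> (\<forall>i\<in>I. peval (pdiff i f) (coef v) = 0)"
proof -
  have "peval f (coef (smul c v)) = c ^ d * peval f (coef v)" 
    "peval (pdiff i f) (coef (smul c v)) = c ^ (d - 1) * peval (pdiff i f) (coef v)" for c i
    by (rule peval_coef_smul[OF f], rule peval_coef_smul[OF pdiff_forms[OF f]])
  then show ?thesis using v line_self[of v] unfolding sing_def hypersurface_def 
    by (fastforce simp: line_conv proj_iff)
qed

lemma sing_iff:
  assumes fin: "finite I" and d: "0 < d" and f: "f \<in> forms I d" and v: "v \<in> cspace I" "v \<noteq> 0"
  shows "line v \<in> sing I f \<longleftrightarrow> (\<forall>i\<in>I. peval (pdiff i f) (coef v) = 0)"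
  using sing_line_iff[OF f v] euler[OF fin f, of "coef v"] d by auto

lemma sing_subset: "sing I f \<subseteq> proj I"
  by (auto simp: sing_def hypersurface_def)

section \<open>Compactness and finiteness of the singular locus\<close>

lemma convergent_subsequence:
  fixes x :: "nat \<Rightarrow> 'v \<Rightarrow> complex"
  assumes "finite X" "\<And>k i. i \<in> X \<Longrightarrow> norm (x k i) \<le> 1"
  shows "\<exists>r y. strict_mono (r :: nat \<Rightarrow> nat) \<and> (\<forall>i\<in>X. (\<lambda>k. x (r k) i) \<longlonglongrightarrow> y i)"
  using assms
proof (induction X rule: finite_induct)
  case empty
  then show ?case using strict_mono_id by fastforce
next
  case (insert v X)
  then obtain r y where r: "strict_mono (r :: nat \<Rightarrow> nat)" "\<forall>i\<in>X. (\<lambda>k. x (r k) i) \<longlonglongrightarrow> y i" by auto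
  have "x (r k) v \<in> cball 0 1" for k using insert.prems by simp
  then obtain l s where s: "strict_mono (s :: nat \<Rightarrow> nat)" "((\<lambda>k. x (r k) v) \<circ> s) \<longlonglongrightarrow> l"
    using compact_cball[of "0 :: complex" 1] unfolding compact_eq_seq_compact_metric seq_compact_def by metis
  have "(\<lambda>k. x (r (s k)) i) \<longlonglongrightarrow> (y(v := l)) i" if "i \<in> insert v X" for i
  proof (cases "i = v")
    case True
    then show ?thesis using s by (simp add: o_def)
  next
    case False
    then have "((\<lambda>k. x (r k) i) \<circ> s) \<longlonglongrightarrow> y i" using r that s(1) by (intro LIMSEQ_subseq_LIMSEQ) auto
    then show ?thesis using False by (simp add: o_def)
  qed
  moreover have "strict_mono (\<lambda>k. r (s k))" using strict_mono_o[OF r(1) s(1)] by (simp add: o_def)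
  ultimately show ?case by (intro exI[of _ "\<lambda>k. r (s k)"] exI[of _ "y(v := l)"]) auto
qed

text \<open>Sequential compactness of projective space: representatives are rescaled so that the
  norms of their coordinates sum to 1, which also keeps the limit away from the origin.\<close>

lemma normalized_subsequence:
  fixes x :: "nat \<Rightarrow> 'v \<Rightarrow> complex"
  assumes fin: "finite X" and nz: "\<And>k. \<exists>i\<in>X. x k i \<noteq> 0"
  obtains c r y where "\<And>k. c k \<noteq> 0" "strict_mono (r :: nat \<Rightarrow> nat)" "\<And>i. i \<in> X \<Longrightarrow> (\<lambda>k. c (r k) * x (r k) i) \<longlonglongrightarrow> y i" "\<exists>i\<in>X. y i \<noteq> 0"
proof -
  define S where "S k = (\<Sum>i\<in>X. norm (x k i))" for k
  have S: "0 < S k" for k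
    unfolding S_def using nz[of k] fin by (metis norm_ge_zero sum_pos2 zero_less_norm_iff)
  define c where "c k = complex_of_real (1 / S k)" for k
  have n: "norm (c k * x k i) = norm (x k i) / S k" for k i using S[of k] by (simp add: c_def norm_mult norm_divide)
  have "norm (c k * x k i) \<le> 1" if "i \<in> X" for k i
    unfolding n using S[of k] member_le_sum[of i X "\<lambda>i. norm (x k i)"] fin that by (simp add: S_def)
  then obtain r y where r: "strict_mono (r :: nat \<Rightarrow> nat)" and y: "\<And>i. i \<in> X \<Longrightarrow> (\<lambda>k. c (r k) * x (r k) i) \<longlonglongrightarrow> y i"
    using convergent_subsequence[OF fin, of "\<lambda>k i. c k * x k i"] by blast
  have "(\<Sum>i\<in>X. norm (c k * x k i)) = 1" for k
    unfolding n using S[of k] by (simp add: S_def flip: sum_divide_distrib)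
  moreover have "(\<lambda>k. \<Sum>i\<in>X. norm (c (r k) * x (r k) i)) \<longlonglongrightarrow> (\<Sum>i\<in>X. norm (y i))"
    by (intro tendsto_sum tendsto_norm y)
  ultimately have "(\<lambda>_ :: nat. 1) \<longlonglongrightarrow> (\<Sum>i\<in>X. norm (y i))" by simp
  then have "(\<Sum>i\<in>X. norm (y i)) = 1" by (simp add: LIMSEQ_const_iff)
  then have "\<exists>i\<in>X. y i \<noteq> 0" by (metis norm_zero sum.neutral zero_neq_one)
  then show ?thesis using that[of c r y] r y S by (simp add: c_def less_imp_neq[THEN not_sym])
qed

lemma peval_tendsto:
  assumes "p \<in> polys X" "\<And>i. i \<in> X \<Longrightarrow> ((\<lambda>k. x k i) \<longlongrightarrow> y i) F"
  shows "((\<lambda>k. peval p (x k)) \<longlongrightarrow> peval p y) F"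
  unfolding peval_def
  by (intro tendsto_sum tendsto_mult tendsto_const tendsto_prod tendsto_power) (use assms in \<open>auto simp: polys_def\<close>)

text \<open>Zariski open sets are open in the classical topology, in the form needed for sequences:
  induction on the generation of the topology, with continuity of polynomials for the basic
  sets.\<close>

lemma zariski_proj_eventually:
  assumes O: "openin (zariski_proj X) O'" and y: "line (vec X y) \<in> O'" and fin: "finite X"
    and x: "\<And>i. i \<in> X \<Longrightarrow> (\<lambda>k. x k i) \<longlonglongrightarrow> y i" and nz: "\<And>k. vec X (x k) \<noteq> 0"
  shows "\<forall>\<^sub>F k in sequentially. line (vec X (x k)) \<in> O'"
proof -
  have "generate_topology_on {{L \<in> proj X. \<forall>v\<in>L. peval q (coef v) \<noteq> 0} |q k. q \<in> forms X k} O'"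
    using O by (simp add: zariski_proj_def openin_topology_generated_by_iff)
  then show ?thesis using y
  proof (induction O' rule: generate_topology_on.induct)
    case (Int a b)
    then show ?case using eventually_conj by fastforce
  next
    case (UN K)
    then obtain k where "k \<in> K" "line (vec X y) \<in> k" by blast
    then show ?case using UN.IH by (fastforce elim: eventually_mono)
  next
    case (Basis s)
    then obtain q k where q: "s = {L \<in> proj X. \<forall>v\<in>L. peval q (coef v) \<noteq> 0}" "q \<in> forms X k" by blast
    have "peval q (coef (vec X y)) \<noteq> 0" using Basis.prems line_self unfolding q(1) by blast
    moreover have "(\<lambda>k. peval q (coef (vec X (x k)))) \<longlonglongrightarrow> peval q (coef (vec X y))"
    proof (rule peval_tendsto)
      show "q \<in> polys X" using q(2) forms_subset_polys by blast
    qed (use x fin in \<open>simp add: coef_vec\<close>)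
    ultimately have "\<forall>\<^sub>F k in sequentially. peval q (coef (vec X (x k))) \<noteq> 0"
      using tendsto_imp_eventually_ne by blast
    then show ?case
      by (rule eventually_mono) (use q nz vec_cspace[OF fin] in \<open>auto simp: line_forall_nonzero[OF q(2)] proj_iff\<close>)
  qed simp
qed

text \<open>Infinitely many singular points would accumulate at a point that is again singular,
  since its partial derivatives are limits of zeros. A Zariski neighbourhood isolating that point
  contains a tail of the sequence, so the tail would be constant.\<close>

lemma finite_sing:
  assumes fin: "finite X" and d: "0 < d" and f: "f \<in> forms X d" and iso: "at_most_isolated_singularities X f"
  shows "finite (sing X f)"
proof (rule ccontr)
  assume "infinite (sing X f)"
  then obtain L :: "nat \<Rightarrow> 'a cvec set" where L: "inj L" "range L \<subseteq> sing X f"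
    using infinite_countable_subset by blast
  have "\<exists>v. v \<in> cspace X \<and> v \<noteq> 0 \<and> L k = line v" for k
  proof -
    have "L k \<in> proj X" using L(2) sing_subset[of X f] by blast
    then show ?thesis by (auto simp: proj_iff)
  qed
  then obtain v where v: "\<And>k. v k \<in> cspace X" "\<And>k. v k \<noteq> 0" "\<And>k. L k = line (v k)" by metis
  have nz: "\<exists>i\<in>X. coef w i \<noteq> 0" if "w \<in> cspace X" "w \<noteq> 0" for w
    using that by (metis cspace_coef lookup_zero poly_mapping_eqI)
  obtain c r y where y: "\<And>k. c k \<noteq> 0" "strict_mono (r :: nat \<Rightarrow> nat)" "\<And>i. i \<in> X \<Longrightarrow> (\<lambda>k. c (r k) * coef (v (r k)) i) \<longlonglongrightarrow> y i" "\<exists>i\<in>X. y i \<noteq> 0"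
    using normalized_subsequence[OF fin, of "\<lambda>k. coef (v k)"] nz[OF v(1,2)] by blast
  define x where "x k i = c (r k) * coef (v (r k)) i" for k i
  have vx: "vec X (x k) = smul (c (r k)) (v (r k))" for k
    by (rule poly_mapping_eqI) (use fin cspace_coef[OF v(1)] in \<open>auto simp: coef_vec x_def\<close>)
  have Lx: "L (r k) = line (vec X (x k))" for k using vx v(3) line_smul y(1) by metis
  have vy: "vec X y \<noteq> 0" using y(4) coef_vec[OF fin, of y] by (metis lookup_zero)
  have "peval (pdiff i f) (coef (vec X y)) = 0" if i: "i \<in> X" for i
  proof -
    have "(\<lambda>k. peval (pdiff i f) (coef (vec X (x k)))) \<longlonglongrightarrow> peval (pdiff i f) (coef (vec X y))"
      by (rule peval_tendsto[of _ X]) (use polys_pdiff[OF subsetD[OF forms_subset_polys f]] y(3) fin in \<open>auto simp: coef_vec x_def\<close>)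
    moreover have "peval (pdiff i f) (coef (vec X (x k))) = 0" for k
    proof -
      have "line (v (r k)) \<in> sing X f" using L(2) v(3) by blast
      then show ?thesis using sing_iff[OF fin d f v(1,2)] i peval_coef_smul[OF pdiff_forms[OF f]] by (simp add: vx)
    qed
    ultimately show ?thesis by (simp add: LIMSEQ_const_iff)
  qed
  then have "line (vec X y) \<in> sing X f" using sing_iff[OF fin d f vec_cspace[OF fin] vy] by blast
  then obtain U where U: "openin (zariski_proj X) U" "U \<inter> sing X f = {line (vec X y)}"
    using iso unfolding at_most_isolated_singularities_def by blast
  have "\<forall>\<^sub>F k in sequentially. line (vec X (x k)) \<in> U"
    by (rule zariski_proj_eventually[OF U(1) _ fin]) (use U(2) y v in \<open>auto simp: x_def vx\<close>)
  then have "\<forall>\<^sub>F k in sequentially. L (r k) = line (vec X y)"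
    by (rule eventually_mono) (use U(2) L(2) Lx in blast)
  then obtain N where N: "\<And>k. k \<ge> N \<Longrightarrow> L (r k) = line (vec X y)" by (auto simp: eventually_sequentially)
  have "L (r N) = L (r (Suc N))" using N[of N] N[of "Suc N"] by simp
  then have "r N = r (Suc N)" using L(1) by (simp add: inj_eq)
  then show False using y(2) by (simp add: strict_mono_eq)
qed

section \<open>Algebraic dependence\<close>

text \<open>Pascal's rule applied \<open>\<delta>\<close> times; each step costs at most the largest
  binomial coefficient involved.\<close>

lemma binomial_gap:
  assumes "\<delta> \<le> j"
  shows "(j + Suc m) choose Suc m \<le> ((j - \<delta> + Suc m) choose Suc m) + \<delta> * ((j + m) choose m)"
  using assms
proof (induction \<delta>)
  case (Suc \<delta>)
  have "j - \<delta> = Suc (j - Suc \<delta>)" using Suc.prems by simp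
  then have "(j - \<delta> + Suc m) choose Suc m = ((j - \<delta> + m) choose m) + ((j - Suc \<delta> + Suc m) choose Suc m)" by simp
  also have "(j - \<delta> + m) choose m \<le> (j + m) choose m" by (rule binomial_right_mono) simp
  finally show ?case using Suc by simp
qed simp

lemma binomial_growth:
  assumes e: "0 < e"
  obtains k where "c \<le> k" "c * ((k * e + m) choose m) < (k + Suc m) choose Suc m"
proof
  \<comment> \<open>Chosen so that \<open>k + m + 1\<close> exceeds
    \<open>c * e ^ m * (m + 1) ^ (m + 1)\<close>. The right side grows like the power
    \<open>m + 1\<close> of \<open>k\<close>, the left side like the power \<open>m\<close>.\<close>
  define k where "k = c * e ^ m * Suc m ^ Suc m + c"
  show "c \<le> k" by (simp add: k_def)
  let ?M = "k + Suc m"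
  have "(k * e + m) choose m \<le> (k * e + m) ^ m" by (rule binomial_le_pow) simp
  also have "\<dots> \<le> (?M * e) ^ m"
  proof (rule power_mono)
    have "m \<le> m * e" using e by simp
    moreover have "?M * e = k * e + e + m * e" by (simp add: algebra_simps)
    ultimately show "k * e + m \<le> ?M * e" by linarith
  qed simp
  finally have 1: "real (c * ((k * e + m) choose m)) \<le> real c * (real ?M * real e) ^ m"
    by (metis mult_le_mono2 of_nat_le_iff of_nat_mult of_nat_power)
  have "real c * real e ^ m * real (Suc m) ^ Suc m < real ?M"
  proof -
    have "c * e ^ m * Suc m ^ Suc m < ?M" by (simp add: k_def)
    then show ?thesis by (metis of_nat_less_iff of_nat_mult of_nat_power)
  qed
  then have "real c * real e ^ m < real ?M / real (Suc m) ^ Suc m" by (simp add: pos_less_divide_eq)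
  then have "real c * real e ^ m * real ?M ^ m < real ?M / real (Suc m) ^ Suc m * real ?M ^ m"
    by (intro mult_strict_right_mono) simp_all
  moreover have "real c * real e ^ m * real ?M ^ m = real c * (real ?M * real e) ^ m"
    by (simp only: power_mult_distrib mult_ac)
  moreover have "real ?M / real (Suc m) ^ Suc m * real ?M ^ m = (real ?M / real (Suc m)) ^ Suc m"
    by (simp only: power_divide power_Suc[of "real ?M"] times_divide_eq_left)
  ultimately have 2: "real c * (real ?M * real e) ^ m < (real ?M / real (Suc m)) ^ Suc m"
    by metis
  have "(real ?M / real (Suc m)) ^ Suc m \<le> real (?M choose Suc m)"
    by (rule binomial_ge_n_over_k_pow_k) simp
  then show "c * ((k * e + m) choose m) < ?M choose Suc m"
    using 1 2 by linarith
qed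

text \<open>A count of dimensions: the forms of degree \<open>k\<close> in the \<open>F\<^sub>i\<close> outnumber the forms of degree \<open>k e\<close> modulo \<open>h\<close>.\<close>

lemma algebraic_dependence_on_hypersurface:
  assumes X: "finite X" "card X = Suc (Suc m)" and Y: "finite Y" "card Y = Suc (Suc m)"
    and h: "h \<in> forms X \<delta>" "h \<noteq> 0" and e: "0 < e" and F: "\<And>i. i \<in> Y \<Longrightarrow> F i \<in> forms X e"
  obtains k R where "R \<in> forms Y k" "R \<noteq> 0" "\<And>x. peval h x = 0 \<Longrightarrow> peval R (\<lambda>i. peval (F i) x) = 0"
proof -
  obtain k where k: "\<delta> \<le> k" "\<delta> * ((k * e + m) choose m) < (k + Suc m) choose Suc m" by (rule binomial_growth[OF e])
  have ke: "\<delta> \<le> k * e" using k(1) e by (metis Suc_leI le_trans mult.right_neutral mult_le_mono2 One_nat_def)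
  interpret T: Vector_Spaces.linear smul smul "psubst F" by (rule linear_psubst)
  interpret M: Vector_Spaces.linear smul smul "(*) h" by (rule linear_mult)
  have "\<exists>R\<in>forms Y k. R \<noteq> 0 \<and> (\<exists>q. psubst F R = h * q)"
  proof (cases "\<exists>R\<in>forms Y k. R \<noteq> 0 \<and> psubst F R = 0")
    case True
    then show ?thesis by (metis mult_zero_right)
  next
    case False
    let ?A = "psubst F ` forms Y k" and ?B = "(*) h ` forms X (k * e - \<delta>)" and ?S = "forms X (k * e)"
    have AS: "?A \<subseteq> ?S"
    proof (rule image_subsetI)
      show "psubst F R \<in> ?S" if "R \<in> forms Y k" for R by (rule forms_psubst[OF that F])
    qed
    have BS: "?B \<subseteq> ?S" using forms_mult[OF h(1)] ke by fastforce
    have A: "cv.subspace ?A" "fdim ?A" using T.subspace_image fdim_mono[OF fdim_forms[OF X(1)] AS] by auto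
    have B: "cv.subspace ?B" "fdim ?B" using M.subspace_image fdim_mono[OF fdim_forms[OF X(1)] BS] by auto
    have "cv.dim ?A = cv.dim (forms Y k)"
      by (rule dim_inj_image[OF linear_psubst _ fdim_forms[OF Y(1)]]) (use False in auto)
    then have dA: "cv.dim ?A = (k + Suc m) choose Suc m" by (simp add: dim_forms card_mons[OF Y])
    have "cv.dim ?B = cv.dim (forms X (k * e - \<delta>))"
      by (rule dim_inj_image[OF linear_mult _ fdim_forms[OF X(1)]]) (use cpoly_no_zero_divisors h(2) in auto)
    then have dB: "cv.dim ?B = (k * e - \<delta> + Suc m) choose Suc m" by (simp add: dim_forms card_mons[OF X])
    have "{a + b |a b. a \<in> ?A \<and> b \<in> ?B} \<subseteq> ?S" using AS BS by (blast intro: forms_add)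
    then have "cv.dim {a + b |a b. a \<in> ?A \<and> b \<in> ?B} \<le> cv.dim ?S" by (rule dim_mono[OF fdim_forms[OF X(1)]])
    also have "\<dots> = (k * e + Suc m) choose Suc m" by (simp add: dim_forms card_mons[OF X])
    also have "\<dots> \<le> ((k * e - \<delta> + Suc m) choose Suc m) + \<delta> * ((k * e + m) choose m)" by (rule binomial_gap[OF ke])
    also have "\<dots> < cv.dim ?A + cv.dim ?B" using dA dB k(2) by simp
    finally have "0 < cv.dim (?A \<inter> ?B)" using dim_sums_Int[OF A B] by linarith
    then have "?A \<inter> ?B \<noteq> {0}"
      using dim_0_iff[OF cv.subspace_inter[OF A(1) B(1)] fdim_mono[OF A(2)]] by auto
    then obtain w where w: "w \<in> ?A" "w \<in> ?B" "w \<noteq> 0"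
      using cv.subspace_0[OF A(1)] cv.subspace_0[OF B(1)] by blast
    then obtain R q where "R \<in> forms Y k" "w = psubst F R" "w = h * q" by blast
    then show ?thesis using w(3) T.zero by (metis)
  qed
  then obtain R q where R: "R \<in> forms Y k" "R \<noteq> 0" "psubst F R = h * q" by blast
  show ?thesis
  proof (rule that[OF R(1,2)])
    fix x assume "peval h x = 0"
    then have "peval (psubst F R) x = 0" by (simp add: R(3) peval_simps)
    then show "peval R (\<lambda>i. peval (F i) x) = 0" by (simp add: peval_psubst)
  qed
qed

text \<open>In degree \<open>k\<close> the monomials in the \<open>F i\<close> outnumber the
  monomials of degree \<open>k * e\<close> in \<open>X\<close>, which has one variable fewer; hence
  substitution of the \<open>F i\<close> is not injective.\<close>

lemma algebraic_dependence:
  assumes X: "finite X" "card X = Suc m" and Y: "finite Y" "card Y = Suc (Suc m)"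
    and e: "0 < e" and F: "\<And>i. i \<in> Y \<Longrightarrow> F i \<in> forms X e"
  obtains k R where "R \<in> forms Y k" "R \<noteq> 0" "\<And>x. peval R (\<lambda>i. peval (F i) x) = 0"
proof -
  obtain k where k: "1 * ((k * e + m) choose m) < (k + Suc m) choose Suc m" by (rule binomial_growth[OF e, of 1])
  have "\<exists>R\<in>forms Y k. R \<noteq> 0 \<and> psubst F R = 0"
  proof (rule ccontr)
    assume *: "\<not> ?thesis"
    have "cv.dim (psubst F ` forms Y k) = cv.dim (forms Y k)"
      by (rule dim_inj_image[OF linear_psubst _ fdim_forms[OF Y(1)]]) (use * in auto)
    moreover have "cv.dim (psubst F ` forms Y k) \<le> cv.dim (forms X (k * e))"
    proof (rule dim_mono[OF fdim_forms[OF X(1)] image_subsetI])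
      show "psubst F R \<in> forms X (k * e)" if "R \<in> forms Y k" for R by (rule forms_psubst[OF that F])
    qed
    ultimately show False using k by (simp add: dim_forms card_mons[OF X] card_mons[OF Y])
  qed
  then obtain R where R: "R \<in> forms Y k" "R \<noteq> 0" "psubst F R = 0" by blast
  show ?thesis
    by (rule that[OF R(1,2)]) (use R(3) in \<open>simp add: peval_simps flip: peval_psubst\<close>)
qed

section \<open>Hyperplane sections\<close>

lemma peval_pdiff_pullback:
  assumes B: "B \<in> cspace (I \<times> J)" and fin: "finite I" "finite J" and f: "f \<in> polys I" and j: "j \<in> J"
  shows "peval (pdiff j (pullback B f)) y = (\<Sum>i\<in>I. peval (pdiff i f) (mvec B J y) * coef B (i, j))"
proof -
  have pB: "pullback B f \<in> polys J"
    unfolding pullback_def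
    by (rule polys_psubst[OF f]) (use B in \<open>auto simp: cspace_def intro!: polys_sum polys_mult pvar_polys\<close>)
  let ?u = "\<lambda>s. y(j := y j + s)"
  have "((\<lambda>s. peval (pullback B f) (?u s)) has_field_derivative (\<Sum>k\<in>J. peval (pdiff k (pullback B f)) (?u 0) * (if k = j then 1 else 0))) (at 0)"
    by (rule peval_chain[OF fin(2) pB]) (auto intro!: derivative_eq_intros)
  moreover have "((\<lambda>s. peval (pullback B f) (?u s)) has_field_derivative (\<Sum>i\<in>I. peval (pdiff i f) (mvec B J (?u 0)) * coef B (i, j))) (at 0)"
    unfolding peval_pullback[OF B fin(2)]
  proof (rule peval_chain[OF fin(1) f])
    fix i
    have "mvec B J (?u s) i = mvec B J y i + s * coef B (i, j)" for s
    proof -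
      have "mvec B J (?u s) i = (\<Sum>k\<in>J. coef B (i, k) * y k + (if k = j then s * coef B (i, j) else 0))"
        unfolding mvec_def by (rule sum.cong) (auto simp: algebra_simps)
      then show ?thesis using fin(2) j by (simp add: sum.distrib mvec_def)
    qed
    then show "((\<lambda>s. mvec B J (?u s) i) has_field_derivative coef B (i, j)) (at 0)"
      by (auto intro!: derivative_eq_intros)
  qed
  ultimately have "(\<Sum>k\<in>J. peval (pdiff k (pullback B f)) (?u 0) * (if k = j then 1 else 0)) = (\<Sum>i\<in>I. peval (pdiff i f) (mvec B J (?u 0)) * coef B (i, j))"
    by (rule DERIV_unique)
  then show ?thesis using j fin(2) by (simp add: if_distrib[of "(*) _"] cong: if_cong)
qed

lemma dual_proj_iff: "H \<in> dual_proj n \<longleftrightarrow> (\<exists>l\<in>forms {..n} 1. l \<noteq> 0 \<and> H = line l)"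
  unfolding dual_proj_def proj_iff ..

lemma hyperplane_points_line: "hyperplane_points n (line l) = {v \<in> cspace {..n}. peval l (coef v) = 0}"
  unfolding hyperplane_points_def line_conv by (auto simp: peval_smul intro: exI[of _ 1])

definition is_param :: "nat \<Rightarrow> nat cpoly set \<Rightarrow> (nat \<times> nat) cvec \<Rightarrow> bool"
  where "is_param n H B \<longleftrightarrow> B \<in> cspace ({..n} \<times> {1..n}) \<and> bij_betw (mat_app B) (cspace {1..n}) (hyperplane_points n H)"

text \<open>The equation \<open>l = 0\<close> is solved for a variable \<open>i0\<close> with
  nonzero coefficient. The parameters are the other coordinates of the point, so
  \<open>\<sigma>\<close> selects them and inverts \<open>B\<close> on the hyperplane.\<close>

lemma explicit_param:
  assumes l: "l \<in> forms {..n} 1" "l \<noteq> 0"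
  obtains B \<sigma> where "is_param n (line l) B" "\<And>j. j \<in> {1..n} \<Longrightarrow> \<sigma> j \<le> n"
    "\<And>x i. peval l x = 0 \<Longrightarrow> i \<le> n \<Longrightarrow> mvec B {1..n} (\<lambda>j. x (\<sigma> j)) i = x i"
    "\<And>y. peval l (mvec B {1..n} y) = 0" "\<And>y j. j \<in> {1..n} \<Longrightarrow> mvec B {1..n} y (\<sigma> j) = y j"
proof -
  interpret graded "{..n}" by (simp add: graded_def)
  obtain i0 where i0: "i0 \<le> n" "coef l (sgl i0 1) \<noteq> 0" using linear_nonzero_coef[OF l] by auto
  \<comment> \<open>The increasing enumeration of \<open>{..n} - {i0}\<close> by
    \<open>{1..n}\<close>.\<close>
  define \<sigma> where "\<sigma> j = (if j \<le> i0 then j - 1 else j)" for j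
  have \<sigma>: "\<sigma> j \<le> n" "\<sigma> j \<noteq> i0" if "j \<in> {1..n}" for j using that i0 by (auto simp: \<sigma>_def)
  have bij: "bij_betw \<sigma> {1..n} ({..n} - {i0})"
  proof (rule bij_betwI[where g = "\<lambda>i. if i < i0 then Suc i else i"])
    show "\<sigma> \<in> {1..n} \<rightarrow> {..n} - {i0}" using \<sigma> by blast
    show "(\<lambda>i. if i < i0 then Suc i else i) \<in> {..n} - {i0} \<rightarrow> {1..n}" using i0(1) by auto
    show "(if \<sigma> j < i0 then Suc (\<sigma> j) else \<sigma> j) = j" if "j \<in> {1..n}" for j using that by (auto simp: \<sigma>_def)
    show "\<sigma> (if i < i0 then Suc i else i) = i" if "i \<in> {..n} - {i0}" for i using that by (auto simp: \<sigma>_def)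
  qed
  have \<sigma>inj: "\<sigma> j = \<sigma> k \<longleftrightarrow> j = k" if "j \<in> {1..n}" "k \<in> {1..n}" for j k
    using inj_on_eq_iff[OF bij_betw_imp_inj_on[OF bij]] that by blast
  let ?a = "\<lambda>j. coef l (sgl (\<sigma> j) 1)"
  define B where "B = vec ({..n} \<times> {1..n}) (\<lambda>(i, j). if i = \<sigma> j then 1 else if i = i0 then - ?a j / coef l (sgl i0 1) else 0)"
  have B: "B \<in> cspace ({..n} \<times> {1..n})" unfolding B_def by (rule vec_cspace) simp
  have m1: "mvec B {1..n} y (\<sigma> k) = y k" if k: "k \<in> {1..n}" for y k
  proof -
    have "mvec B {1..n} y (\<sigma> k) = (\<Sum>j\<in>{1..n}. if j = k then y k else 0)"
      unfolding mvec_def by (rule sum.cong) (use \<sigma> k \<sigma>inj in \<open>auto simp: B_def coef_vec\<close>)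
    then show ?thesis using k by simp
  qed
  have m0: "mvec B {1..n} y i0 = - (\<Sum>j\<in>{1..n}. ?a j * y j) / coef l (sgl i0 1)" for y
  proof -
    have "mvec B {1..n} y i0 = (\<Sum>j\<in>{1..n}. - (?a j * y j) / coef l (sgl i0 1))"
      unfolding mvec_def by (rule sum.cong) (use \<sigma> i0 in \<open>auto simp: B_def coef_vec\<close>)
    then show ?thesis by (simp add: sum_negf flip: sum_divide_distrib)
  qed
  have split: "peval l x = coef l (sgl i0 1) * x i0 + (\<Sum>j\<in>{1..n}. ?a j * x (\<sigma> j))" for x
  proof -
    have "peval l x = coef l (sgl i0 1) * x i0 + (\<Sum>i\<in>{..n} - {i0}. coef l (sgl i 1) * x i)"
      unfolding peval_linear[OF l(1)] by (rule sum.remove) (use i0 in auto)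
    also have "(\<Sum>i\<in>{..n} - {i0}. coef l (sgl i 1) * x i) = (\<Sum>j\<in>{1..n}. ?a j * x (\<sigma> j))"
      using sum.reindex_bij_betw[OF bij, of "\<lambda>i. coef l (sgl i 1) * x i"] by simp
    finally show ?thesis .
  qed
  have ker: "peval l (mvec B {1..n} y) = 0" for y
    unfolding split m0 using m1 i0(2) by simp
  have inv: "mvec B {1..n} (\<lambda>j. x (\<sigma> j)) i = x i" if x: "peval l x = 0" and i: "i \<le> n" for x i
  proof (cases "i = i0")
    case True
    have "coef l (sgl i0 1) * x i0 = - (\<Sum>j\<in>{1..n}. ?a j * x (\<sigma> j))" using x unfolding split by (simp add: eq_neg_iff_add_eq_0)
    then show ?thesis unfolding True m0 using i0(2) by (simp add: field_simps)
  next
    case False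
    then have "i \<in> \<sigma> ` {1..n}" unfolding bij_betw_imp_surj_on[OF bij] using i by simp
    then obtain j where "j \<in> {1..n}" "i = \<sigma> j" by blast
    then show ?thesis using m1[of j "\<lambda>j. x (\<sigma> j)"] by simp
  qed
  have "bij_betw (mat_app B) (cspace {1..n}) (hyperplane_points n (line l))"
    unfolding hyperplane_points_line
  proof (rule bij_betwI[where g = "\<lambda>v. vec {1..n} (\<lambda>j. coef v (\<sigma> j))"])
    show "mat_app B \<in> cspace {1..n} \<rightarrow> {v \<in> cspace {..n}. peval l (coef v) = 0}"
    proof
      fix y :: "nat cvec"
      have "coef (mat_app B y) = mvec B {1..n} (coef y)" using coef_mat_app[OF B] by auto
      then show "mat_app B y \<in> {v \<in> cspace {..n}. peval l (coef v) = 0}" using ker mat_app_cspace[OF B] by simp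
    qed
    show "(\<lambda>v. vec {1..n} (\<lambda>j. coef v (\<sigma> j))) \<in> {v \<in> cspace {..n}. peval l (coef v) = 0} \<rightarrow> cspace {1..n}"
      by (auto intro: vec_cspace)
    show "vec {1..n} (\<lambda>j. coef (mat_app B y) (\<sigma> j)) = y" if "y \<in> cspace {1..n}" for y
    proof (rule poly_mapping_eqI)
      fix k show "coef (vec {1..n} (\<lambda>j. coef (mat_app B y) (\<sigma> j))) k = coef y k"
        using m1 that by (auto simp: coef_vec coef_mat_app[OF B] cspace_coef[OF that])
    qed
    show "mat_app B (vec {1..n} (\<lambda>j. coef v (\<sigma> j))) = v" if v: "v \<in> {v \<in> cspace {..n}. peval l (coef v) = 0}" for v
    proof (rule poly_mapping_eqI)
      fix i
      have e: "mvec B {1..n} (coef (vec {1..n} (\<lambda>j. coef v (\<sigma> j)))) = mvec B {1..n} (\<lambda>j. coef v (\<sigma> j))"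
        unfolding mvec_def by (rule ext, rule sum.cong) (auto simp: coef_vec)
      show "coef (mat_app B (vec {1..n} (\<lambda>j. coef v (\<sigma> j)))) i = coef v i"
      proof (cases "i \<le> n")
        case True
        then show ?thesis using inv[of "coef v" i] v unfolding coef_mat_app[OF B finite_atLeastAtMost] e by simp
      next
        case False
        then show ?thesis using v cspace_coef[OF mat_app_cspace[OF B], of i] cspace_coef[of v "{..n}" i] by auto
      qed
    qed
  qed
  then have "is_param n (line l) B" using B by (simp add: is_param_def)
  then show ?thesis using that[of B \<sigma>] \<sigma>(1) inv ker m1 by blast
qed

lemma hyperplane_param_is_param:
  assumes "H \<in> dual_proj n" shows "is_param n H (hyperplane_param n H)"
proof -
  obtain l where "l \<in> forms {..n} 1" "l \<noteq> 0" "H = line l" using assms by (auto simp: dual_proj_iff)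
  then have "\<exists>B. is_param n H B" using explicit_param by metis
  then show ?thesis unfolding hyperplane_param_def is_param_def by (rule someI_ex)
qed

lemma is_paramD:
  assumes "is_param n H B"
  shows "B \<in> cspace ({..n} \<times> {1..n})" "mat_app B ` cspace {1..n} = hyperplane_points n H" "inj_on (mat_app B) (cspace {1..n})"
  using assms by (auto simp: is_param_def bij_betw_def)

lemma mat_app_0: "mat_app B 0 = 0"
  by (simp add: mat_app_def)

lemma coef_param:
  assumes "is_param n H B" shows "coef (mat_app B y) = mvec B {1..n} (coef y)"
  using coef_mat_app[OF is_paramD(1)[OF assms]] by auto

text \<open>Singularity of a section can be read off inside the hyperplane, whatever the parametrization.\<close>

definition section_singular :: "nat \<Rightarrow> nat cpoly \<Rightarrow> nat cvec set \<Rightarrow> bool"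
  where "section_singular n f W \<longleftrightarrow> (\<exists>x\<in>W. x \<noteq> 0 \<and> (\<forall>u\<in>W. (\<Sum>i\<le>n. peval (pdiff i f) (coef x) * coef u i) = 0))"

lemma mat_app_sgl_col:
  assumes B: "B \<in> cspace (I \<times> J)" and J: "finite J" and j: "j \<in> J"
  shows "coef (mat_app B (sgl j 1)) i = coef B (i, j)"
  unfolding coef_mat_app[OF B J] mvec_def using J j
  by (simp add: lookup_single when_def if_distrib[of "(*) _"] cong: if_cong)

text \<open>The partial derivatives of the section are the pairings of the gradient of
  \<open>f\<close> with the columns of \<open>B\<close>, and these columns span the
  hyperplane.\<close>

lemma pdiff_param_zero_iff:
  assumes B: "is_param n H B" and f: "f \<in> forms {..n} d"
  shows "(\<forall>j\<in>{1..n}. peval (pdiff j (pullback B f)) (coef y) = 0) \<longleftrightarrow>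
    (\<forall>u\<in>hyperplane_points n H. (\<Sum>i\<le>n. peval (pdiff i f) (coef (mat_app B y)) * coef u i) = 0)"
proof -
  note Bc = is_paramD(1)[OF B]
  have fp: "f \<in> polys {..n}" using f forms_subset_polys by blast
  have D: "peval (pdiff j (pullback B f)) (coef y) = (\<Sum>i\<le>n. peval (pdiff i f) (coef (mat_app B y)) * coef B (i, j))" if "j \<in> {1..n}" for j
    unfolding coef_param[OF B] by (rule peval_pdiff_pullback[OF Bc _ _ fp that]) auto
  show ?thesis
  proof
    assume 0: "\<forall>j\<in>{1..n}. peval (pdiff j (pullback B f)) (coef y) = 0"
    show "\<forall>u\<in>hyperplane_points n H. (\<Sum>i\<le>n. peval (pdiff i f) (coef (mat_app B y)) * coef u i) = 0"
    proof
      fix u assume "u \<in> hyperplane_points n H"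
      then obtain v where v: "u = mat_app B v" using is_paramD(2)[OF B] by blast
      have "(\<Sum>i\<le>n. peval (pdiff i f) (coef (mat_app B y)) * coef u i) = 
          (\<Sum>j\<in>{1..n}. (\<Sum>i\<le>n. peval (pdiff i f) (coef (mat_app B y)) * coef B (i, j)) * coef v j)"
        unfolding v coef_param[OF B, of v] mvec_def sum_distrib_left sum_distrib_right
        by (subst sum.swap) (simp add: algebra_simps)
      also have "\<dots> = 0" using D 0 by simp
      finally show "(\<Sum>i\<le>n. peval (pdiff i f) (coef (mat_app B y)) * coef u i) = 0" .
    qed
  next
    assume 0: "\<forall>u\<in>hyperplane_points n H. (\<Sum>i\<le>n. peval (pdiff i f) (coef (mat_app B y)) * coef u i) = 0"
    show "\<forall>j\<in>{1..n}. peval (pdiff j (pullback B f)) (coef y) = 0"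
    proof
      fix j assume j: "j \<in> {1..n}"
      then have "mat_app B (sgl j 1) \<in> hyperplane_points n H"
        using is_paramD(2)[OF B] by (auto simp: cspace_def)
      then show "peval (pdiff j (pullback B f)) (coef y) = 0"
        using 0 D[OF j] mat_app_sgl_col[OF Bc _ j] by fastforce
    qed
  qed
qed

lemma smooth_formsI:
  assumes f: "g \<in> forms J d" and J: "finite J" "J \<noteq> {}" and d: "0 < d"
    and ns: "\<And>y. y \<in> cspace J \<Longrightarrow> y \<noteq> 0 \<Longrightarrow> \<exists>j\<in>J. peval (pdiff j g) (coef y) \<noteq> 0"
  shows "g \<in> smooth_forms J d"
proof -
  have "sing J g = {}"
  proof (rule ccontr)
    assume "sing J g \<noteq> {}"
    then obtain L where L: "L \<in> sing J g" by blast
    then obtain y where y: "y \<in> cspace J" "y \<noteq> 0" "L = line y" using sing_subset by (metis proj_iff subsetD)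
    then show False using ns[OF y(1,2)] L sing_iff[OF J(1) d f y(1,2)] by blast
  qed
  moreover have "g \<noteq> 0"
  proof
    assume g: "g = 0"
    obtain j where "j \<in> J" using J by blast
    then have "sgl j 1 \<in> cspace J" "sgl j (1 :: complex) \<noteq> 0" by (auto simp: cspace_def poly_mapping_eq_iff fun_eq_iff lookup_single when_def)
    then obtain i where "peval (pdiff i g) (coef (sgl j 1)) \<noteq> 0" using ns by blast
    then show False by (simp add: g pdiff_def ev.geval_0)
  qed
  ultimately show ?thesis using f by (simp add: smooth_forms_def)
qed

lemma smooth_formsD:
  assumes "g \<in> smooth_forms J d" "finite J" "0 < d" "y \<in> cspace J" "y \<noteq> 0"
  shows "\<exists>j\<in>J. peval (pdiff j g) (coef y) \<noteq> 0"
  using assms sing_iff[of J d g y] by (auto simp: smooth_forms_def)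

lemma smooth_section_iff:
  assumes B: "is_param n H B" and f: "f \<in> forms {..n} d" and n: "1 \<le> n" and d: "0 < d"
  shows "pullback B f \<in> smooth_forms {1..n} d \<longleftrightarrow> \<not> section_singular n f (hyperplane_points n H)"
proof -
  have g: "pullback B f \<in> forms {1..n} d" by (rule pullback_forms[OF is_paramD(1)[OF B] f])
  have inj: "mat_app B y \<noteq> 0" if "y \<in> cspace {1..n}" "y \<noteq> 0" for y
    using inj_onD[OF is_paramD(3)[OF B], of y 0] that cv.subspace_0[OF subspace_cspace] by (auto simp: mat_app_0)
  show ?thesis
  proof
    assume s: "pullback B f \<in> smooth_forms {1..n} d"
    show "\<not> section_singular n f (hyperplane_points n H)"
    proof
      assume "section_singular n f (hyperplane_points n H)"
      then obtain x where x: "x \<in> hyperplane_points n H" "x \<noteq> 0" 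
        "\<forall>u\<in>hyperplane_points n H. (\<Sum>i\<le>n. peval (pdiff i f) (coef x) * coef u i) = 0" unfolding section_singular_def by blast
      then obtain y where y: "y \<in> cspace {1..n}" "x = mat_app B y" using is_paramD(2)[OF B] by blast
      have "y \<noteq> 0" using x(2) y(2) by (auto simp: mat_app_0)
      then show False using smooth_formsD[OF s _ d y(1)] pdiff_param_zero_iff[OF B f, of y] x(3) y(2) by auto
    qed
  next
    assume ns: "\<not> section_singular n f (hyperplane_points n H)"
    show "pullback B f \<in> smooth_forms {1..n} d"
    proof (rule smooth_formsI[OF g _ _ d])
      fix y :: "nat cvec" assume y: "y \<in> cspace {1..n}" "y \<noteq> 0"
      have "mat_app B y \<in> hyperplane_points n H" using is_paramD(2)[OF B] y by blast
      then show "\<exists>j\<in>{1..n}. peval (pdiff j (pullback B f)) (coef y) \<noteq> 0"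
        using ns inj[OF y] pdiff_param_zero_iff[OF B f, of y] unfolding section_singular_def by blast
    qed (use n in auto)
  qed
qed

text \<open>A general hyperplane is not in the closure of the tangent hyperplanes, which form the image of
  the hypersurface under the gradient.\<close>

lemma bertini:
  assumes n: "1 \<le> n" and d: "2 \<le> d" and f: "f \<in> forms {..n} d" "f \<noteq> 0" and iso: "at_most_isolated_singularities {..n} f"
  obtains l where "l \<in> forms {..n} 1" "l \<noteq> 0" "\<not> section_singular n f (hyperplane_points n (line l))"
proof -
  let ?X = "{..n}"
  obtain m where m: "n = Suc m" using n by (cases n) auto
  have cX: "finite ?X" "card ?X = Suc (Suc m)" using m by auto
  obtain k R where R: "R \<in> forms ?X k" "R \<noteq> 0" "\<And>x. peval f x = 0 \<Longrightarrow> peval R (\<lambda>i. peval (pdiff i f) x) = 0"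
    by (rule algebraic_dependence_on_hypersurface[OF cX cX f, of "d - 1" "\<lambda>i. pdiff i f"])
      (use pdiff_forms[OF f(1)] d in auto)
  have finS: "finite (sing ?X f)" by (rule finite_sing[OF _ _ f(1) iso]) (use d in auto)
  have "\<exists>v. v \<in> cspace ?X \<and> v \<noteq> 0 \<and> L = line v" if "L \<in> sing ?X f" for L
    using sing_subset[of ?X f] that by (metis proj_iff subsetD)
  then obtain v where v: "\<And>L. L \<in> sing ?X f \<Longrightarrow> v L \<in> cspace ?X \<and> v L \<noteq> 0 \<and> L = line (v L)" by metis
  \<comment> \<open>\<open>q L\<close> vanishes at \<open>w\<close> exactly if the hyperplane with
    coefficients \<open>w\<close> passes through the singular point \<open>L\<close>. The chosen
    \<open>w\<close> avoids these finitely many conditions and the relation \<open>R\<close> of the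
    tangent hyperplanes.\<close>
  define q where "q L = (\<Sum>i\<in>?X. smul (coef (v L) i) (pvar i))" for L
  have q: "peval (q L) w = (\<Sum>i\<in>?X. coef (v L) i * w i)" for L w
    unfolding q_def by (simp add: peval_simps peval_smul)
  have qnz: "q L \<noteq> 0" if "L \<in> sing ?X f" for L
  proof
    assume "q L = 0"
    then have *: "(\<Sum>i\<in>?X. coef (v L) i * w i) = 0" for w using q[of L w] by (simp add: ev.geval_0)
    have "coef (v L) i = 0" if "i \<in> ?X" for i
      using *[of "\<lambda>j. if j = i then 1 else 0"] that by (simp add: if_distrib[of "(*) _"] cong: if_cong)
    then have "v L = 0" using v[OF that] by (metis cspace_coef lookup_zero poly_mapping_eqI)
    then show False using v[OF that] by blast
  qed
  obtain w where w: "\<And>p. p \<in> insert R (q ` sing ?X f) \<Longrightarrow> peval p w \<noteq> 0"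
  proof (rule peval_common_nonzero[of "insert R (q ` sing ?X f)"])
    show "p \<noteq> 0" if p: "p \<in> insert R (q ` sing ?X f)" for p
      using p R(2) qnz by auto
    show "finite (insert R (q ` sing ?X f))" using finS by simp
    fix x assume x: "\<And>p. p \<in> insert R (q ` sing ?X f) \<Longrightarrow> peval p x \<noteq> 0"
    show thesis by (rule that) (rule x)
  qed
  define l where "l = (\<Sum>i\<in>?X. smul (w i) (pvar i))"
  have l: "l \<in> forms ?X 1" unfolding l_def by (intro forms_sum forms_smul pvar_forms)
  have pl: "peval l x = (\<Sum>i\<in>?X. w i * x i)" for x unfolding l_def by (simp add: peval_simps peval_smul)
  \<comment> \<open>\<open>R\<close> has positive degree, being nonzero and vanishing at the
    gradient at the origin; hence it vanishes at 0, whereas \<open>R\<close> does not vanish at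
    \<open>w\<close>.\<close>
  have nz: "\<exists>i\<in>?X. w i \<noteq> 0"
  proof (rule ccontr)
    assume "\<not> ?thesis"
    then have z: "\<And>i. i \<in> ?X \<Longrightarrow> w i = 0" by blast
    have "0 < k"
    proof (rule ccontr)
      assume "\<not> 0 < k"
      then obtain c where c: "R = pconst c" using R(1) forms_0_iff by auto
      have "peval f (\<lambda>i. 0) = 0" by (rule peval_0_eq_0[OF f(1)]) (use d in auto)
      then show False using R(2) R(3)[of "\<lambda>_. 0"] by (auto simp: c ev.geval_pconst)
    qed
    then have "peval R w = 0" by (intro peval_0_eq_0[OF R(1)] z) auto
    then show False using w by blast
  qed
  have l0: "l \<noteq> 0"
  proof
    assume "l = 0"
    then have *: "(\<Sum>i\<in>?X. w i * x i) = 0" for x using pl[of x] by (simp add: ev.geval_0)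
    obtain i where i: "i \<in> ?X" "w i \<noteq> 0" using nz by blast
    have "w i = 0" using *[of "\<lambda>j. if j = i then 1 else 0"] i(1) by (simp add: if_distrib[of "(*) _"] cong: if_cong)
    then show False using i by blast
  qed
  have "\<not> section_singular n f (hyperplane_points n (line l))"
  proof
    assume "section_singular n f (hyperplane_points n (line l))"
    then obtain x where x: "x \<in> cspace ?X" "peval l (coef x) = 0" "x \<noteq> 0" 
      and s: "\<And>u. u \<in> cspace ?X \<Longrightarrow> peval l (coef u) = 0 \<Longrightarrow> (\<Sum>i\<le>n. peval (pdiff i f) (coef x) * coef u i) = 0"
      unfolding section_singular_def hyperplane_points_line by blast
    let ?g = "\<lambda>i. peval (pdiff i f) (coef x)"
    \<comment> \<open>The vector \<open>w b\<close> at \<open>a\<close> minus \<open>w a\<close> at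
      \<open>b\<close> lies in the hyperplane. Pairing the gradient with all such vectors makes it
      proportional to \<open>w\<close>.\<close>
    have min: "?g a * w b = ?g b * w a" if ab: "a \<in> ?X" "b \<in> ?X" for a b
    proof -
      let ?u = "sgl a (w b) - sgl b (w a)"
      have cu: "(\<Sum>i\<in>?X. h i * coef ?u i) = h a * w b - h b * w a" for h :: "nat \<Rightarrow> complex"
        using ab by (simp add: lookup_minus lookup_single when_def right_diff_distrib sum_subtractf if_distrib[of "(*) _"] cong: if_cong)
      have "?u \<in> cspace ?X" using ab by (intro cv.subspace_diff[OF subspace_cspace]) (auto simp: cspace_def)
      moreover have "peval l (coef ?u) = 0" unfolding pl cu by simp
      ultimately show ?thesis using s[of ?u] cu[of ?g] by simp
    qed
    show False
    proof (cases "\<exists>i\<in>?X. ?g i \<noteq> 0")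
      case False
      then have "line x \<in> sing ?X f" using sing_iff[OF _ _ f(1) x(1,3)] d by auto
      then have L: "line x \<in> sing ?X f" "line x = line (v (line x))" using v by blast+
      then obtain c where c: "v (line x) = smul c x" using line_eq_iff by metis
      have "peval (q (line x)) w = c * peval l (coef x)"
        unfolding q pl c by (simp add: sum_distrib_left algebra_simps)
      then show False using w L(1) x(2) by auto
    next
      case True
      then obtain t where t: "t \<noteq> 0" "\<And>i. i \<in> ?X \<Longrightarrow> ?g i = t * w i"
        using proportional_of_minors[of ?X ?g w] min nz by metis
      \<comment> \<open>A gradient proportional to \<open>w\<close> pairs to 0 with a point of the
        hyperplane, so by Euler's relation the point lies on \<open>X\<close> and \<open>R\<close>
        applies to its gradient.\<close>
      have "of_nat d * peval f (coef x) = (\<Sum>i\<in>?X. coef x i * ?g i)" using euler[OF cX(1) f(1)] by simp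
      also have "\<dots> = t * peval l (coef x)" unfolding pl by (simp add: sum_distrib_left t algebra_simps)
      finally have "peval f (coef x) = 0" using x(2) d by simp
      then have "peval R ?g = 0" by (rule R(3))
      moreover have "peval R ?g = peval R (\<lambda>i. t * w i)"
        by (rule peval_cong_vars[of R ?X]) (use R(1) forms_subset_polys t in auto)
      ultimately have "t ^ k * peval R w = 0" using peval_homog[OF R(1)] by metis
      then show False using t(1) w by auto
    qed
  qed
  then show ?thesis by (rule that[OF l l0])
qed

section \<open>Jacobian syzygies\<close>

definition no_linear_syzygy :: "'v set \<Rightarrow> 'v cpoly \<Rightarrow> bool"
  where "no_linear_syzygy X f \<longleftrightarrow> (\<forall>a. (\<forall>i\<in>X. a i \<in> forms X 1) \<longrightarrow> (\<Sum>i\<in>X. a i * pdiff i f) = 0 \<longrightarrow> (\<forall>i\<in>X. a i = 0))"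

text \<open>Injectivity of multiplication by \<open>l\<close> from degree \<open>d - 1\<close> to
  degree \<open>d\<close> of the Milnor algebra, written out: in these degrees the Jacobian ideal
  consists of the combinations of the partial derivatives with constant and with linear
  coefficients.\<close>

definition linear_jacobian_injective :: "'v set \<Rightarrow> 'v cpoly \<Rightarrow> nat \<Rightarrow> 'v cpoly \<Rightarrow> bool"
  where "linear_jacobian_injective X f d l \<longleftrightarrow> (\<forall>h\<in>forms X (d - 1). \<forall>a. (\<forall>i\<in>X. a i \<in> forms X 1) \<longrightarrow> l * h = (\<Sum>i\<in>X. a i * pdiff i f) \<longrightarrow>
    (\<exists>c. h = (\<Sum>i\<in>X. smul (c i) (pdiff i f))))"

text \<open>Solving \<open>l = 0\<close> for \<open>x i\<close> gives a linear form \<open>L\<close>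
  in the other variables. The substitution of \<open>L\<close> for \<open>x i\<close> kills
  \<open>p\<close>, and \<open>x i - L\<close>, a multiple of \<open>l\<close>, divides the
  difference between \<open>p\<close> and the substituted polynomial.\<close>

lemma divisible_by_linear:
  assumes fin: "finite X" and l: "l \<in> forms X 1" "l \<noteq> 0" and p: "p \<in> forms X (Suc k)" 
    and van: "\<And>x. peval l x = 0 \<Longrightarrow> peval p x = 0"
  obtains h where "h \<in> forms X k" "p = l * h"
proof -
  interpret graded X by (simp add: graded_def fin)
  obtain i where i: "i \<in> X" "coef l (sgl i 1) \<noteq> 0" by (rule linear_nonzero_coef[OF l])
  let ?li = "coef l (sgl i 1)"
  define L where "L = pvar i - smul (1 / ?li) l"
  define Y where "Y = X - {i}"
  have Y: "X = insert i Y" "i \<notin> Y" using i by (auto simp: Y_def)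
  have L: "L \<in> forms X 1" unfolding L_def by (intro forms_diff pvar_forms forms_smul i l)
  have pL: "peval L x = - (\<Sum>j\<in>Y. coef l (sgl j 1) * x j) / ?li" for x
  proof -
    have "peval l x = ?li * x i + (\<Sum>j\<in>Y. coef l (sgl j 1) * x j)"
      unfolding peval_linear[OF l(1)] Y_def by (rule sum.remove[OF fin i(1)])
    then show ?thesis using i(2) by (simp add: L_def peval_simps peval_smul field_simps)
  qed
  have pY: "p \<in> polys (insert i Y)" using p forms_subset_polys Y by blast
  obtain c D where c: "\<And>j. c j \<in> polys Y" "p = (\<Sum>j\<le>D. c j * pvar i ^ j)"
    "\<And>j. j \<le> Suc k \<Longrightarrow> c j \<in> forms Y (Suc k - j)" "\<And>j. Suc k < j \<Longrightarrow> c j = 0"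
  proof (rule poly_split[OF pY Y(2)])
    fix c :: "nat \<Rightarrow> 'a cpoly" and D
    assume 1: "\<And>j. c j \<in> polys Y" "p = (\<Sum>j\<le>D. c j * pvar i ^ j)" 
      "\<And>k j. p \<in> forms (insert i Y) k \<Longrightarrow> j \<le> k \<Longrightarrow> c j \<in> forms Y (k - j)" "\<And>k j. p \<in> forms (insert i Y) k \<Longrightarrow> k < j \<Longrightarrow> c j = 0"
    have "p \<in> forms (insert i Y) (Suc k)" using p Y by simp
    then show thesis using that[of c D] 1 by blast
  qed
  have cX: "c j \<in> forms X (Suc k - j)" if "j \<le> Suc k" for j
    using c(3)[OF that] Y by (auto simp: cspace_def mons_def)
  \<comment> \<open>Replacing the coordinate \<open>i\<close> by the value of \<open>L\<close> moves
    any point onto the hyperplane and changes none of the coefficients \<open>c j\<close>.\<close>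
  have zero: "(\<Sum>j\<le>D. c j * L ^ j) = 0"
  proof (rule peval_eq_0)
    fix x
    let ?x = "x(i := peval L x)"
    have "(\<Sum>j\<in>Y. coef l (sgl j 1) * ?x j) = (\<Sum>j\<in>Y. coef l (sgl j 1) * x j)"
      by (rule sum.cong) (use Y(2) in auto)
    then have "- (\<Sum>j\<in>Y. coef l (sgl j 1) * ?x j) / ?li = peval L x" unfolding pL[of x] by simp
    with pL[of ?x] have "peval L ?x = peval L x" by (rule trans)
    then have "peval (smul (1 / ?li) l) ?x = 0" by (simp add: L_def peval_simps)
    then have "peval l ?x = 0" using i by (simp add: peval_smul)
    then have "peval p ?x = 0" by (rule van)
    moreover have "peval (c j) ?x = peval (c j) x" for j by (rule peval_cong_vars[OF c(1)]) (use Y(2) in auto)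
    ultimately show "peval (\<Sum>j\<le>D. c j * L ^ j) x = 0" by (simp add: c(2) peval_simps)
  qed
  \<comment> \<open>The cofactor in the factorization of \<open>pvar i ^ j - L ^ j\<close>.\<close>
  define S where "S j = (\<Sum>s<j. L ^ (j - Suc s) * pvar i ^ s)" for j
  have S: "S j \<in> forms X (j - 1)" for j
    unfolding S_def
  proof (rule forms_sum)
    fix s assume "s \<in> {..<j}"
    then have "(j - Suc s) * 1 + s * 1 = j - 1" by auto
    then show "L ^ (j - Suc s) * pvar i ^ s \<in> forms X (j - 1)"
      using forms_mult[OF forms_power[OF L, of "j - Suc s"] forms_power[OF pvar_forms[OF i(1)], of s]] by simp
  qed
  have diff: "pvar i ^ j - L ^ j = smul (1 / ?li) l * S j" for j
  proof -
    have "pvar i ^ j - L ^ j = (pvar i - L) * S j"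
      unfolding S_def by (rule power_diff_sumr2)
    then show ?thesis by (simp add: L_def)
  qed
  define h where "h = (\<Sum>j\<le>D. smul (1 / ?li) (c j * S j))"
  have "p = (\<Sum>j\<le>D. c j * pvar i ^ j) - (\<Sum>j\<le>D. c j * L ^ j)" using c(2) zero by simp
  also have "\<dots> = (\<Sum>j\<le>D. c j * (pvar i ^ j - L ^ j))" by (simp add: sum_subtractf right_diff_distrib)
  also have "\<dots> = l * h" unfolding diff h_def by (simp add: sum_distrib_left smul_conv algebra_simps)
  finally have "p = l * h" .
  moreover have "h \<in> forms X k"
    unfolding h_def
  proof (intro forms_sum forms_smul)
    fix j
    show "c j * S j \<in> forms X k"
    proof (cases "j = 0 \<or> Suc k < j")
      case True
      then show ?thesis using c(4) by (auto simp: S_def)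
    next
      case False
      then have "Suc k - j + (j - 1) = k" by auto
      then show ?thesis using forms_mult[OF cX S, of j j] False by auto
    qed
  qed
  ultimately show ?thesis using that by blast
qed

text \<open>Vanishing of the differential of \<open>B \<mapsto> f \<circ> B\<close> along \<open>Z\<close> means that a combination of the partial
  derivatives with linear coefficients is divisible by \<open>l\<close>.\<close>

lemma differential_injective:
  fixes n :: nat
  assumes f: "f \<in> forms {..n} d" and ns: "no_linear_syzygy {..n} f"
    and l: "l \<in> forms {..n} 1" "l \<noteq> 0" and inj: "linear_jacobian_injective {..n} f d l"
  obtains B where "B \<in> cspace ({..n} \<times> {1..n})"
    "\<And>Z. Z \<in> cspace ({..n} \<times> {1..n}) \<Longrightarrow> (\<And>y. (\<Sum>i\<le>n. peval (pdiff i f) (mvec B {1..n} y) * mvec Z {1..n} y i) = 0) \<Longrightarrow> Z = 0"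
proof -
  obtain B \<sigma> where B: "is_param n (line l) B" and \<sigma>: "\<And>j. j \<in> {1..n} \<Longrightarrow> \<sigma> j \<le> n"
    and inv: "\<And>x i. peval l x = 0 \<Longrightarrow> i \<le> n \<Longrightarrow> mvec B {1..n} (\<lambda>j. x (\<sigma> j)) i = x i"
    and ker: "\<And>y. peval l (mvec B {1..n} y) = 0" and m1: "\<And>y j. j \<in> {1..n} \<Longrightarrow> mvec B {1..n} y (\<sigma> j) = y j"
    by (rule explicit_param[OF l]) (rule that)
  have "Z = 0" if Z: "Z \<in> cspace ({..n} \<times> {1..n})" and 0: "\<And>y. (\<Sum>i\<le>n. peval (pdiff i f) (mvec B {1..n} y) * mvec Z {1..n} y i) = 0" for Z
  proof -
    \<comment> \<open>Row \<open>i\<close> of \<open>Z\<close> as a linear form on the ambient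
      space: on the hyperplane the parameters of a point are its coordinates at
      \<open>\<sigma> j\<close>.\<close>
    define a where "a i = (\<Sum>j\<in>{1..n}. smul (coef Z (i, j)) (pvar (\<sigma> j)))" for i
    have a: "a i \<in> forms {..n} 1" for i unfolding a_def by (intro forms_sum forms_smul pvar_forms) (use \<sigma> in auto)
    have pa: "peval (a i) x = mvec Z {1..n} (\<lambda>j. x (\<sigma> j)) i" for i x
      unfolding a_def mvec_def by (simp add: peval_simps peval_smul)
    let ?p = "\<Sum>i\<in>{..n}. a i * pdiff i f"
    have p: "?p \<in> forms {..n} (Suc (d - 1))"
      using forms_mult[OF a pdiff_forms[OF f]] by (intro forms_sum) simp
    have van: "peval ?p x = 0" if x: "peval l x = 0" for x
    proof -
      have "peval (pdiff i f) (mvec B {1..n} (\<lambda>j. x (\<sigma> j))) = peval (pdiff i f) x" for i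
        by (rule peval_cong_vars[of _ "{..n}"]) (use pdiff_forms[OF f] forms_subset_polys inv[OF x] in auto)
      then show ?thesis using 0[of "\<lambda>j. x (\<sigma> j)"] by (simp add: peval_simps pa mult.commute)
    qed
    obtain h where h: "h \<in> forms {..n} (d - 1)" "?p = l * h" by (rule divisible_by_linear[OF _ l p van]) auto
    then obtain c where c: "h = (\<Sum>i\<in>{..n}. smul (c i) (pdiff i f))"
      using inj[unfolded linear_jacobian_injective_def, rule_format, of h a] a by auto
    have "(\<Sum>i\<in>{..n}. (a i - smul (c i) l) * pdiff i f) = ?p - l * h"
      unfolding c by (simp add: left_diff_distrib sum_subtractf sum_distrib_left smul_conv algebra_simps)
    then have "(\<Sum>i\<in>{..n}. (a i - smul (c i) l) * pdiff i f) = 0" using h(2) by simp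
    moreover have "\<forall>i\<in>{..n}. a i - smul (c i) l \<in> forms {..n} 1" using a l by (auto intro: forms_diff forms_smul)
    ultimately have "\<forall>i\<in>{..n}. a i - smul (c i) l = 0" 
      using ns[unfolded no_linear_syzygy_def, rule_format, of "\<lambda>i. a i - smul (c i) l"] by blast
    \<comment> \<open>Each \<open>a i\<close> is a multiple of \<open>l\<close> and thus vanishes on
      the hyperplane; every parameter vector comes from a point there, so \<open>Z\<close> acts as
      0.\<close>
    then have al: "peval (a i) x = c i * peval l x" if "i \<le> n" for i x using that by (simp add: peval_smul)
    have "mvec Z {1..n} y i = 0" if "i \<le> n" for y i
    proof -
      have "mvec Z {1..n} y i = mvec Z {1..n} (\<lambda>j. mvec B {1..n} y (\<sigma> j)) i"
        unfolding mvec_def[of Z] by (rule sum.cong[OF refl]) (simp only: m1)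
      also have "\<dots> = 0" using al[OF that, of "mvec B {1..n} y"] ker by (simp add: pa)
      finally show ?thesis .
    qed
    then have "coef Z (i, j) = 0" if "i \<le> n" "j \<in> {1..n}" for i j
    proof -
      have "mvec Z {1..n} (\<lambda>k. if k = j then 1 else 0) i = coef Z (i, j)"
        unfolding mvec_def using that by (simp add: if_distrib[of "(*) _"] cong: if_cong)
      then show ?thesis using \<open>\<And>y i. i \<le> n \<Longrightarrow> mvec Z {1..n} y i = 0\<close> that by metis
    qed
    then show "Z = 0"
    proof (intro poly_mapping_eqI)
      fix p :: "nat \<times> nat"
      obtain i j where p: "p = (i, j)" by (cases p)
      show "coef Z p = coef 0 p"
      proof (cases "p \<in> {..n} \<times> {1..n}")
        case True
        then show ?thesis using \<open>\<And>i j. i \<le> n \<Longrightarrow> j \<in> {1..n} \<Longrightarrow> coef Z (i, j) = 0\<close> p by simp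
      next
        case False
        then show ?thesis using cspace_coef[OF Z] by simp
      qed
    qed
  qed
  then show ?thesis using that is_paramD(1)[OF B] by blast
qed

section \<open>Generic finiteness\<close>

text \<open>Some coordinate of the projection along \<open>W\<close> is a nonzero functional that
  kills \<open>W\<close>; \<open>Z\<close> lists its values on the unit vectors.\<close>

lemma annihilator:
  assumes I: "finite I" and W: "cv.subspace W" "W \<subseteq> cspace I" "W \<noteq> cspace I"
  obtains Z where "Z \<in> cspace I" "Z \<noteq> 0" "\<And>w. w \<in> W \<Longrightarrow> (\<Sum>i\<in>I. coef w i * coef Z i) = 0"
proof -
  obtain \<pi> :: "'a cvec \<Rightarrow> 'a cvec" where \<pi>: "Vector_Spaces.linear smul smul \<pi>" and ker: "\<And>x. \<pi> x = 0 \<longleftrightarrow> x \<in> W"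
    using projection_along[of W] W(1) by (metis cv.span_eq_iff)
  interpret P: Vector_Spaces.linear smul smul \<pi> by fact
  obtain v where v: "v \<in> cspace I" "v \<notin> W" using W by blast
  then have "\<pi> v \<noteq> 0" using ker by blast
  then obtain k where k: "coef (\<pi> v) k \<noteq> 0" by (metis lookup_zero poly_mapping_eqI)
  define Z where "Z = vec I (\<lambda>i. coef (\<pi> (sgl i 1)) k)"
  have exp: "coef (\<pi> u) k = (\<Sum>i\<in>I. coef u i * coef Z i)" if u: "u \<in> cspace I" for u
  proof -
    have "u = (\<Sum>i\<in>I. smul (coef u i) (sgl i 1))"
      by (rule poly_mapping_eqI)
        (use I cspace_coef[OF u] in \<open>auto simp: lookup_sum lookup_single when_def if_distrib[of "(*) _"] cong: if_cong\<close>)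
    then have "\<pi> u = (\<Sum>i\<in>I. smul (coef u i) (\<pi> (sgl i 1)))" by (metis (no_types, lifting) P.scale P.sum sum.cong)
    then show ?thesis using I by (simp add: lookup_sum Z_def coef_vec)
  qed
  show ?thesis
  proof
    show "Z \<in> cspace I" unfolding Z_def by (rule vec_cspace[OF I])
    show "Z \<noteq> 0" using exp[OF v(1)] k by auto
    fix w assume "w \<in> W"
    then show "(\<Sum>i\<in>I. coef w i * coef Z i) = 0" using exp[of w] ker[of w] W(2) by auto
  qed
qed

text \<open>A map whose differential at a point is the identity has algebraically independent components:
  the lowest nonzero homogeneous part of a relation at that point would vanish identically.\<close>

lemma algebraically_independent:
  fixes \<phi> :: "('p \<Rightarrow> complex) \<Rightarrow> complex \<Rightarrow> 'p \<Rightarrow> complex"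
  assumes R: "R \<in> polys P" "R \<noteq> 0"
    and D: "\<And>Z p. p \<in> P \<Longrightarrow> ((\<lambda>s. \<phi> Z s p) has_field_derivative Z p) (at 0)" and 0: "\<And>Z p. p \<in> P \<Longrightarrow> \<phi> Z 0 p = c p"
  obtains Z s where "peval R (\<phi> Z s) \<noteq> 0"
proof (rule ccontr)
  assume "\<not> thesis"
  then have van: "peval R (\<phi> Z s) = 0" for Z s using that by blast
  define Q where "Q = psubst (\<lambda>p. pvar p + pconst (c p)) R"
  have pQ: "peval Q x = peval R (\<lambda>p. x p + c p)" for x by (simp add: Q_def peval_psubst peval_simps)
  have QP: "Q \<in> polys P" unfolding Q_def by (rule polys_psubst[OF R(1)]) (auto intro: polys_add pvar_polys)
  obtain x0 where "peval R x0 \<noteq> 0" using peval_nonzero_ex[OF R(2)] .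
  then have "peval Q (\<lambda>p. x0 p - c p) \<noteq> 0" by (simp add: pQ)
  then have Q0: "Q \<noteq> 0" by (auto simp: ev.geval_0)
  obtain D where decomp: "Q = (\<Sum>j\<le>D. hpart j Q)" by (rule hpart_decomp)
  have "\<exists>j. hpart j Q \<noteq> 0"
  proof (rule ccontr)
    assume "\<not> ?thesis"
    then show False using decomp Q0 by simp
  qed
  define r where "r = (LEAST j. hpart j Q \<noteq> 0)"
  have r: "hpart r Q \<noteq> 0" unfolding r_def by (rule LeastI_ex) fact
  have low: "hpart j Q = 0" if "j < r" for j using not_less_Least[of j "\<lambda>j. hpart j Q \<noteq> 0"] that by (auto simp: r_def)
  obtain Z where Z: "peval (hpart r Q) Z \<noteq> 0" using peval_nonzero_ex[OF r] .
  \<comment> \<open>Difference quotients, tending to \<open>Z\<close>. In terms of them the relation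
    can be divided by \<open>s ^ r\<close>, since all parts below degree \<open>r\<close>
    vanish.\<close>
  define u where "u s p = (\<phi> Z s p - c p) / s" for s p
  have u: "((\<lambda>s. u s p) \<longlongrightarrow> Z p) (at 0)" if "p \<in> P" for p
    using assms(3)[OF that, of Z] 0[OF that, of Z] by (simp add: u_def DERIV_def)
  have hom: "peval (hpart j Q) (\<lambda>p. s * y p) = s ^ j * peval (hpart j Q) y" for j s y
    by (rule peval_homog[OF hpart_forms[OF QP]])
  have eq: "(\<Sum>j\<le>D. (if r \<le> j then s ^ (j - r) else 0) * peval (hpart j Q) (u s)) = 0" if s: "s \<noteq> 0" for s
  proof -
    have "0 = peval Q (\<lambda>p. s * u s p)" using van[of Z s] s by (simp add: pQ u_def)
    also have "\<dots> = (\<Sum>j\<le>D. s ^ j * peval (hpart j Q) (u s))" by (subst decomp) (simp add: ev.geval_sum hom)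
    also have "\<dots> = (\<Sum>j\<le>D. s ^ r * ((if r \<le> j then s ^ (j - r) else 0) * peval (hpart j Q) (u s)))"
      by (rule sum.cong) (auto simp: low ev.geval_0 not_le simp flip: power_add mult.assoc)
    finally show ?thesis using s by (simp flip: sum_distrib_left)
  qed
  have "((\<lambda>s. \<Sum>j\<le>D. (if r \<le> j then s ^ (j - r) else 0) * peval (hpart j Q) (u s)) \<longlongrightarrow>
      (\<Sum>j\<le>D. (if r \<le> j then 0 ^ (j - r) else 0) * peval (hpart j Q) Z)) (at 0)"
  proof (intro tendsto_sum tendsto_mult)
    fix j
    show "((\<lambda>s :: complex. if r \<le> j then s ^ (j - r) else 0) \<longlongrightarrow> (if r \<le> j then 0 ^ (j - r) else 0)) (at 0)"
      by (auto intro!: tendsto_eq_intros)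
    show "((\<lambda>s. peval (hpart j Q) (u s)) \<longlongrightarrow> peval (hpart j Q) Z) (at 0)"
      by (rule peval_tendsto[OF subsetD[OF forms_subset_polys hpart_forms[OF QP]]]) (rule u)
  qed
  moreover have "((\<lambda>s. \<Sum>j\<le>D. (if r \<le> j then s ^ (j - r) else 0) * peval (hpart j Q) (u s)) \<longlongrightarrow> 0) (at 0)"
    by (rule tendsto_eventually) (use eq in \<open>auto simp: eventually_at_filter\<close>)
  ultimately have "(\<Sum>j\<le>D. (if r \<le> j then 0 ^ (j - r) else 0) * peval (hpart j Q) Z) = 0"
    using tendsto_unique[OF trivial_limit_at] by blast
  \<comment> \<open>In the limit only the term \<open>j = r\<close> survives, because
    \<open>0 ^ 0 = 1\<close>.\<close>
  moreover have "(\<Sum>j\<le>D. (if r \<le> j then 0 ^ (j - r) else 0) * peval (hpart j Q) Z) = (\<Sum>j\<in>{r}. peval (hpart j Q) Z)"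
  proof (rule sum.mono_neutral_cong_right)
    show "{r} \<subseteq> {..D}"
    proof (rule ccontr)
      assume "\<not> {r} \<subseteq> {..D}"
      then have "Q = 0" using decomp low by simp
      then show False using Q0 by blast
    qed
  qed auto
  ultimately show False using Z by simp
qed

lemma mvec_add_line: "mvec (B + smul s Z) J y i = mvec B J y i + s * mvec Z J y i"
  by (simp add: mvec_def lookup_add distrib_right sum.distrib sum_distrib_left mult.assoc)

lemma finite_pow_eq: "finite {t :: complex. t ^ Suc d = a}"
proof -
  have "finite {t :: complex. (\<Sum>j\<le>Suc d. (if j = 0 then - a else if j = Suc d then 1 else 0) * t ^ j) = 0}"
    by (rule finite_zeros_powers[of "Suc d"]) auto
  moreover have "(\<Sum>j\<le>Suc d. (if j = 0 then - a else if j = Suc d then 1 else 0) * t ^ j) = t ^ Suc d - a" for t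
  proof -
    have "(\<Sum>j\<le>Suc d. (if j = 0 then - a else if j = Suc d then 1 else 0) * t ^ j) = 
        (\<Sum>j\<in>{0, Suc d}. (if j = 0 then - a else if j = Suc d then 1 else 0) * t ^ j)"
      by (rule sum.mono_neutral_right) auto
    then show ?thesis by simp
  qed
  ultimately show ?thesis by simp
qed

text \<open>The entries of \<open>B\<close> are algebraic over the values of \<open>f \<circ> B\<close>. The form \<open>c\<close> is a product of
  coefficients of the resulting relations.\<close>

lemma finite_fibres:
  fixes n :: nat
  assumes n: "1 \<le> n" and d: "0 < d" and f: "f \<in> forms {..n} d" and B0: "B0 \<in> cspace ({..n} \<times> {1..n})"
    and inj: "\<And>Z. Z \<in> cspace ({..n} \<times> {1..n}) \<Longrightarrow> 
      (\<And>y. (\<Sum>i\<le>n. peval (pdiff i f) (mvec B0 {1..n} y) * mvec Z {1..n} y i) = 0) \<Longrightarrow> Z = 0"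
  obtains c :: "(nat \<times> nat) option cpoly" and \<kappa> and T :: "nat \<times> nat \<Rightarrow> (nat \<times> nat) cvec set" and r Y where
    "c \<in> forms (Some ` ({..n} \<times> {1..n})) \<kappa>"
    "\<And>p. finite (T p)"
    "\<And>g. peval c (\<lambda>q. \<Sum>u\<in>T (the q). r (the q) u * peval g (Y (the q) u)) \<noteq> 0 \<Longrightarrow>
      finite {B \<in> cspace ({..n} \<times> {1..n}). \<forall>y. peval f (mvec B {1..n} y) = peval g y}"
    "\<exists>B\<in>cspace ({..n} \<times> {1..n}). peval c (\<lambda>q. \<Sum>u\<in>T (the q). r (the q) u * peval f (mvec B {1..n} (Y (the q) u))) \<noteq> 0"
proof -
  define P where "P = {..n} \<times> {1..n}"
  have finP: "finite P" by (simp add: P_def)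
  have fp: "f \<in> polys {..n}" using f forms_subset_polys by blast
  \<comment> \<open>The differential at \<open>B0\<close> of the value \<open>f (B y)\<close>, as a
    vector in the entries of the matrix. Injectivity of the total differential says that these
    vectors span everything.\<close>
  define w where "w y = vec P (\<lambda>(i, j). peval (pdiff i f) (mvec B0 {1..n} y) * y j)" for y
  have wsum: "(\<Sum>p\<in>P. coef (w y) p * z p) = (\<Sum>i\<le>n. peval (pdiff i f) (mvec B0 {1..n} y) * (\<Sum>j\<in>{1..n}. z (i, j) * y j))" for y z
    unfolding P_def w_def by (simp add: coef_vec sum.cartesian_product' sum_distrib_left algebra_simps)
  have span: "cv.span (range w) = cspace P"
  proof (rule ccontr)
    assume ne: "cv.span (range w) \<noteq> cspace P"
    have sub: "cv.span (range w) \<subseteq> cspace P"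
      by (rule cv.span_minimal) (auto simp: w_def intro: vec_cspace[OF finP])
    obtain Z where Z: "Z \<in> cspace P" "Z \<noteq> 0" "\<And>v. v \<in> cv.span (range w) \<Longrightarrow> (\<Sum>i\<in>P. coef v i * coef Z i) = 0"
      by (rule annihilator[OF finP cv.subspace_span sub ne]) blast
    have "(\<Sum>i\<le>n. peval (pdiff i f) (mvec B0 {1..n} y) * mvec Z {1..n} y i) = 0" for y
      using Z(3)[of "w y"] wsum[of y "coef Z"] by (simp add: cv.span_base mvec_def)
    then show False using inj[of Z] Z by (simp add: P_def)
  qed
  have "\<forall>p\<in>P. \<exists>tr. finite (fst tr) \<and> fst tr \<subseteq> range w \<and> sgl p 1 = (\<Sum>u\<in>fst tr. smul (snd tr u) u)"
  proof
    fix p assume p: "p \<in> P"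
    have "sgl p 1 \<in> cv.span (range w)" unfolding span using p by (simp add: cspace_def)
    then obtain t r where "finite t" "t \<subseteq> range w" "sgl p 1 = (\<Sum>u\<in>t. smul (r u) u)" unfolding cv.span_explicit by blast
    then show "\<exists>tr. finite (fst tr) \<and> fst tr \<subseteq> range w \<and> sgl p 1 = (\<Sum>u\<in>fst tr. smul (snd tr u) u)"
      by (intro exI[of _ "(t, r)"]) simp
  qed
  from bchoice[OF this] obtain tr where tr: "\<forall>p\<in>P. finite (fst (tr p)) \<and> fst (tr p) \<subseteq> range w \<and> sgl p 1 = (\<Sum>u\<in>fst (tr p). smul (snd (tr p) u) u)" ..
  define T0 where "T0 p = fst (tr p)" for p
  define r where "r p = snd (tr p)" for p
  have T0: "\<And>p. p \<in> P \<Longrightarrow> finite (T0 p) \<and> T0 p \<subseteq> range w \<and> sgl p 1 = (\<Sum>u\<in>T0 p. smul (r p u) u)"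
    using tr by (simp add: T0_def r_def)
  define T where "T p = (if p \<in> P then T0 p else {})" for p
  define Y where "Y p u = inv_into UNIV w u" for p :: "nat \<times> nat" and u
  have T: "finite (T p)" for p using T0 by (simp add: T_def)
  have wY: "w (Y p u) = u" if "u \<in> T p" for p u
  proof -
    have "u \<in> range w" using that T0[of p] unfolding T_def by (auto split: if_splits)
    then show ?thesis unfolding Y_def by (rule f_inv_into_f)
  qed
  have unit: "sgl p 1 = (\<Sum>u\<in>T p. smul (r p u) u)" if "p \<in> P" for p using T0[OF that] that by (simp add: T_def)
  define V where "V p g = (\<Sum>u\<in>T p. r p u * g (Y p u))" for p and g :: "(nat \<Rightarrow> complex) \<Rightarrow> complex"
  define q where "q y = psubst (\<lambda>i. \<Sum>j\<in>{1..n}. smul (y j) (pvar (i, j))) f" for y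
  have q: "q y \<in> forms P d" for y
  proof -
    have "q y \<in> forms P (d * 1)" unfolding q_def
    proof (rule forms_psubst[OF f])
      fix i assume "i \<in> {..n}"
      then show "(\<Sum>j\<in>{1..n}. smul (y j) (pvar (i, j))) \<in> forms P 1"
        by (intro forms_sum forms_smul pvar_forms) (simp add: P_def)
    qed
    then show ?thesis by simp
  qed
  have pq: "peval (q y) (coef B) = peval f (mvec B {1..n} y)" for y B
    unfolding q_def peval_psubst mvec_def by (simp add: peval_simps peval_smul mult.commute)
  \<comment> \<open>The combination of values of \<open>f \<circ> B\<close>, as a form in the
    entries of \<open>B\<close>, whose differential at \<open>B0\<close> is the entry
    \<open>p\<close>.\<close>
  define Q where "Q p = (\<Sum>u\<in>T p. smul (r p u) (q (Y p u)))" for p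
  have Q: "Q p \<in> forms P d" for p unfolding Q_def by (intro forms_sum forms_smul q)
  have pQ: "peval (Q p) (coef B) = V p (\<lambda>y. peval f (mvec B {1..n} y))" for p B
    unfolding Q_def V_def by (simp add: peval_simps peval_smul pq)
  text \<open>The differential of \<open>V\<close> composed with \<open>B \<mapsto> f \<circ> B\<close> at \<open>B0\<close> is the identity.\<close>
  have der: "((\<lambda>s. V p (\<lambda>y. peval f (mvec (B0 + smul s Z) {1..n} y))) has_field_derivative coef Z p) (at 0)" if p: "p \<in> P" for p Z
  proof -
    have "((\<lambda>s. peval f (mvec (B0 + smul s Z) {1..n} y)) has_field_derivative 
        (\<Sum>i\<in>{..n}. peval (pdiff i f) (mvec (B0 + smul 0 Z) {1..n} y) * mvec Z {1..n} y i)) (at 0)" for y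
      by (rule peval_chain[OF _ fp]) (auto simp: mvec_add_line intro!: derivative_eq_intros)
    then have "((\<lambda>s. V p (\<lambda>y. peval f (mvec (B0 + smul s Z) {1..n} y))) has_field_derivative 
        (\<Sum>u\<in>T p. r p u * (\<Sum>i\<in>{..n}. peval (pdiff i f) (mvec (B0 + smul 0 Z) {1..n} (Y p u)) * mvec Z {1..n} (Y p u) i))) (at 0)"
      unfolding V_def by (intro DERIV_sum DERIV_cmult)
    also have "(\<Sum>u\<in>T p. r p u * (\<Sum>i\<in>{..n}. peval (pdiff i f) (mvec (B0 + smul 0 Z) {1..n} (Y p u)) * mvec Z {1..n} (Y p u) i))
        = (\<Sum>u\<in>T p. r p u * (\<Sum>p'\<in>P. coef u p' * coef Z p'))"
    proof (rule sum.cong[OF refl])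
      fix u assume u: "u \<in> T p"
      show "r p u * (\<Sum>i\<in>{..n}. peval (pdiff i f) (mvec (B0 + smul 0 Z) {1..n} (Y p u)) * mvec Z {1..n} (Y p u) i)
          = r p u * (\<Sum>p'\<in>P. coef u p' * coef Z p')"
        using wsum[of "Y p u" "coef Z"] wY[OF u] by (simp add: mvec_def[of Z])
    qed
    also have "\<dots> = (\<Sum>p'\<in>P. coef (\<Sum>u\<in>T p. smul (r p u) u) p' * coef Z p')"
      unfolding sum_distrib_left lookup_sum sum_distrib_right by (subst sum.swap) (simp add: mult.assoc)
    also have "\<dots> = coef Z p"
      using p finP by (simp flip: unit add: lookup_single when_def if_distrib[of "\<lambda>x. x * _"] cong: if_cong)
    finally show ?thesis .
  qed
  obtain m where m: "card P = Suc m" using finP n by (cases "card P") (auto simp: P_def)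
  \<comment> \<open>The index \<open>None\<close> stands for the entry \<open>p\<close> itself. It
    is raised to the power \<open>d\<close> so that all members have the same degree and the
    dependence lemma for forms applies.\<close>
  define F where "F p o' = (case o' of None \<Rightarrow> pvar p ^ d | Some p' \<Rightarrow> Q p')" for p o'
  define Rel where "Rel p D c \<kappa> j \<longleftrightarrow> c j \<noteq> 0 \<and> j \<le> D \<and> c j \<in> forms (Some ` P) \<kappa> \<and>
     (\<forall>B. (\<Sum>j\<le>D. peval (c j) (\<lambda>o'. V (the o') (\<lambda>y. peval f (mvec B {1..n} y))) * (coef B p ^ d) ^ j) = 0)"
    for p and D :: nat and c \<kappa> j
  have rel: "\<exists>D c \<kappa> j. Rel p D c \<kappa> j" if p: "p \<in> P" for p
  proof -
    have "card (insert None (Some ` P)) = Suc (card P)" using finP by (subst card_insert_disjoint) (auto simp: card_image)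
    then have cO: "finite (insert None (Some ` P))" "card (insert None (Some ` P)) = Suc (Suc m)" using finP m by auto
    obtain k R where R: "R \<in> forms (insert None (Some ` P)) k" "R \<noteq> 0" "\<And>x. peval R (\<lambda>i. peval (F p i) x) = 0"
    proof (rule algebraic_dependence[OF finP m cO d])
      show "F p o' \<in> forms P d" if "o' \<in> insert None (Some ` P)" for o'
        using that Q forms_power[OF pvar_forms[OF p], of d] by (auto simp: F_def)
    qed blast
    have RP: "R \<in> polys (insert None (Some ` P))" using R(1) forms_subset_polys by blast
    have none: "None \<notin> Some ` P" by blast
    obtain D c where c: "\<And>j. c j \<in> polys (Some ` P)" "R = (\<Sum>j\<le>D. c j * pvar None ^ j)"
      "\<And>j. \<exists>\<kappa>. c j \<in> forms (Some ` P) \<kappa>"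
    proof (rule poly_split[OF RP none])
      fix c :: "nat \<Rightarrow> (nat \<times> nat) option cpoly" and D
      assume 1: "\<And>j. c j \<in> polys (Some ` P)" "R = (\<Sum>j\<le>D. c j * pvar None ^ j)" 
        "\<And>k j. R \<in> forms (insert None (Some ` P)) k \<Longrightarrow> j \<le> k \<Longrightarrow> c j \<in> forms (Some ` P) (k - j)" 
        "\<And>k j. R \<in> forms (insert None (Some ` P)) k \<Longrightarrow> k < j \<Longrightarrow> c j = 0"
      have "\<exists>\<kappa>. c j \<in> forms (Some ` P) \<kappa>" for j
        using 1(3,4)[OF R(1), of j] by (cases "j \<le> k") auto
      then show thesis using that[of c D] 1 by blast
    qed
    have "\<exists>j\<le>D. c j \<noteq> 0"
    proof (rule ccontr)
      assume "\<not> ?thesis"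
      then have "R = 0" unfolding c(2) by (intro sum.neutral) auto
      then show False using R(2) by blast
    qed
    then obtain j where j: "j \<le> D" "c j \<noteq> 0" by blast
    obtain \<kappa> where \<kappa>: "c j \<in> forms (Some ` P) \<kappa>" using c(3) by blast
    have "(\<Sum>j\<le>D. peval (c j) (\<lambda>o'. V (the o') (\<lambda>y. peval f (mvec B {1..n} y))) * (coef B p ^ d) ^ j) = 0" for B
    proof -
      have "peval (c j) (\<lambda>i. peval (F p i) (coef B)) = peval (c j) (\<lambda>o'. V (the o') (\<lambda>y. peval f (mvec B {1..n} y)))" for j
        by (rule peval_cong_vars[OF c(1)]) (auto simp: F_def pQ)
      then show ?thesis using R(3)[of "coef B"] unfolding c(2) by (simp add: peval_simps F_def)
    qed
    then show ?thesis using j \<kappa> unfolding Rel_def by blast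
  qed
  obtain D cc \<kappa>0 jj where cc': "\<And>p. p \<in> P \<Longrightarrow> Rel p (D p) (cc p) (\<kappa>0 p) (jj p)"
    using rel by metis
  have cc: "cc p (jj p) \<noteq> 0" "jj p \<le> D p" "cc p (jj p) \<in> forms (Some ` P) (\<kappa>0 p)"
    "(\<Sum>j\<le>D p. peval (cc p j) (\<lambda>o'. V (the o') (\<lambda>y. peval f (mvec B {1..n} y))) * (coef B p ^ d) ^ j) = 0" if "p \<in> P" for p B
    using cc'[OF that] unfolding Rel_def by blast+
  \<comment> \<open>Each factor is a nonzero coefficient of the relation for one entry. Where
    \<open>c\<close> does not vanish, every relation remains a nontrivial equation for its entry,
    and each entry has finitely many values.\<close>
  define c where "c = (\<Prod>p\<in>P. cc p (jj p))"
  have c: "c \<in> forms (Some ` P) (\<Sum>p\<in>P. \<kappa>0 p)" unfolding c_def by (rule forms_prod[OF finP]) (rule cc(3))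
  have c0: "c \<noteq> 0"
  proof -
    have pr: "prod h A \<noteq> 0" if "finite A" "\<And>a. a \<in> A \<Longrightarrow> h a \<noteq> 0" for h :: "nat \<times> nat \<Rightarrow> (nat \<times> nat) option cpoly" and A
      using that by (induction A rule: finite_induct) (auto dest: cpoly_no_zero_divisors)
    show ?thesis unfolding c_def by (rule pr[OF finP]) (rule cc(1))
  qed
  show ?thesis
  proof (rule that[of c _ T r Y])
    show "c \<in> forms (Some ` ({..n} \<times> {1..n})) (\<Sum>p\<in>P. \<kappa>0 p)" using c by (simp add: P_def)
    show "finite (T p)" for p by (rule T)
    show "finite {B \<in> cspace ({..n} \<times> {1..n}). \<forall>y. peval f (mvec B {1..n} y) = peval g y}"
      if g: "peval c (\<lambda>q. \<Sum>u\<in>T (the q). r (the q) u * peval g (Y (the q) u)) \<noteq> 0" for g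
    proof -
      let ?v = "\<lambda>o'. V (the o') (\<lambda>y. peval g y)"
      have nz: "peval (cc p (jj p)) ?v \<noteq> 0" if "p \<in> P" for p
        using g that finP unfolding c_def V_def by (auto simp: peval_simps)
      define A where "A p = {t. (\<Sum>j\<le>D p. peval (cc p j) ?v * t ^ j) = 0}" for p
      have finA: "finite (A p)" if "p \<in> P" for p unfolding A_def
        by (rule finite_zeros_powers[of "jj p"]) (use cc(2) nz that in auto)
      define A' where "A' p = {t. t ^ d \<in> A p}" for p
      have finA': "finite (A' p)" if "p \<in> P" for p
      proof -
        obtain d' where d': "d = Suc d'" using d by (cases d) auto
        have "A' p = (\<Union>a\<in>A p. {t. t ^ Suc d' = a})" by (auto simp: A'_def d')
        then show ?thesis using finA[OF that] finite_pow_eq by simp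
      qed
      have "{B \<in> cspace ({..n} \<times> {1..n}). \<forall>y. peval f (mvec B {1..n} y) = peval g y} \<subseteq> vec P ` (Pi\<^sub>E P A')"
      proof
        fix B assume "B \<in> {B \<in> cspace ({..n} \<times> {1..n}). \<forall>y. peval f (mvec B {1..n} y) = peval g y}"
        then have B: "B \<in> cspace P" "(\<lambda>y. peval f (mvec B {1..n} y)) = (\<lambda>y. peval g y)" by (auto simp: P_def)
        have "coef B p \<in> A' p" if "p \<in> P" for p
          using cc(4)[OF that, of B] unfolding A'_def A_def B(2) by simp
        then have "restrict (coef B) P \<in> Pi\<^sub>E P A'" by auto
        moreover have "B = vec P (restrict (coef B) P)"
          by (rule poly_mapping_eqI) (use cspace_coef[OF B(1)] in \<open>auto simp: coef_vec[OF finP]\<close>)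
        ultimately show "B \<in> vec P ` (Pi\<^sub>E P A')" by blast
      qed
      then show ?thesis by (rule finite_subset) (intro finite_imageI finite_PiE finP finA')
    qed
    \<comment> \<open>The functions \<open>V p\<close> have identity differential at
      \<open>B0\<close>, hence satisfy no algebraic relation; in particular \<open>c\<close> cannot
      vanish on all their values.\<close>
    have "\<exists>Z s. peval c (\<lambda>o'. V (the o') (\<lambda>y. peval f (mvec (B0 + smul s (vec P (\<lambda>p. Z (Some p)))) {1..n} y))) \<noteq> 0"
    proof -
      have cP: "c \<in> polys (Some ` P)" using c forms_subset_polys by blast
      show ?thesis
      proof (rule algebraically_independent[OF cP c0, where c = "\<lambda>o'. V (the o') (\<lambda>y. peval f (mvec B0 {1..n} y))"])
        fix Z :: "(nat \<times> nat) option \<Rightarrow> complex" and o' assume "o' \<in> Some ` P"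
        then obtain p where p: "o' = Some p" "p \<in> P" by blast
        show "((\<lambda>s. V (the o') (\<lambda>y. peval f (mvec (B0 + smul s (vec P (\<lambda>p. Z (Some p)))) {1..n} y))) has_field_derivative Z o') (at 0)"
          using der[OF p(2), of "vec P (\<lambda>p. Z (Some p))"] p by (simp add: coef_vec[OF finP])
        show "V (the o') (\<lambda>y. peval f (mvec (B0 + smul 0 (vec P (\<lambda>p. Z (Some p)))) {1..n} y)) = V (the o') (\<lambda>y. peval f (mvec B0 {1..n} y))"
          by simp
      qed blast
    qed
    then obtain Z s where Zs: "peval c (\<lambda>o'. V (the o') (\<lambda>y. peval f (mvec (B0 + smul s (vec P (\<lambda>p. Z (Some p)))) {1..n} y))) \<noteq> 0" by blast
    show "\<exists>B\<in>cspace ({..n} \<times> {1..n}). peval c (\<lambda>q. \<Sum>u\<in>T (the q). r (the q) u * peval f (mvec B {1..n} (Y (the q) u))) \<noteq> 0"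
    proof
      show "B0 + smul s (vec P (\<lambda>p. Z (Some p))) \<in> cspace ({..n} \<times> {1..n})"
        using B0 vec_cspace[OF finP] by (intro cv.subspace_add cv.subspace_scale subspace_cspace) (auto simp: P_def)
      show "peval c (\<lambda>q. \<Sum>u\<in>T (the q). r (the q) u * peval f (mvec (B0 + smul s (vec P (\<lambda>p. Z (Some p)))) {1..n} (Y (the q) u))) \<noteq> 0"
        using Zs by (simp add: V_def)
    qed
  qed
qed

section \<open>From matrices to hyperplanes and moduli classes\<close>

lemma linear_mat_app:
  assumes A: "A \<in> cspace (I \<times> J)" and J: "finite J"
  shows "Vector_Spaces.linear smul smul (mat_app A)"
  by unfold_locales
    (auto intro!: poly_mapping_eqI simp: coef_mat_app[OF A J] lookup_add mvec_def distrib_left sum.distrib sum_distrib_left algebra_simps)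

lemma mvec_outside: "A \<in> cspace (I \<times> J) \<Longrightarrow> i \<notin> I \<Longrightarrow> mvec A J y i = 0"
  using cspace_coef[of A "I \<times> J"] by (simp add: mvec_def)

lemma mvec_cong: "(\<And>j. j \<in> J \<Longrightarrow> y j = y' j) \<Longrightarrow> mvec A J y = mvec A J y'"
  by (simp add: mvec_def fun_eq_iff)

lemma mvec_vec: "finite J \<Longrightarrow> mvec A J (coef (vec J y)) = mvec A J y"
  by (rule mvec_cong) (simp add: coef_vec)

text \<open>Both parametrizations are bijections onto the same hyperplane; \<open>A\<close> is the
  matrix of the first followed by the inverse of the second.\<close>

lemma param_change:
  assumes B: "is_param n H B" and B': "is_param n H B'"
  obtains A where "A \<in> GL {1..n}" "\<And>y. mvec B {1..n} y = mvec B' {1..n} (mvec A {1..n} y)"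
proof -
  let ?J = "{1..n}"
  note b = is_paramD[OF B] and b' = is_paramD[OF B']
  interpret T: Vector_Spaces.linear smul smul "mat_app B" by (rule linear_mat_app[OF b(1)]) simp
  interpret T': Vector_Spaces.linear smul smul "mat_app B'" by (rule linear_mat_app[OF b'(1)]) simp
  have ex: "\<exists>v\<in>cspace ?J. mat_app B' v = mat_app B w" if "w \<in> cspace ?J" for w
    using b(2) b'(2) that by (metis imageE imageI)
  then obtain g where g: "\<And>w. w \<in> cspace ?J \<Longrightarrow> g w \<in> cspace ?J \<and> mat_app B' (g w) = mat_app B w" by metis
  define A where "A = vec (?J \<times> ?J) (\<lambda>(i, j). coef (g (sgl j 1)) i)"
  have A: "A \<in> cspace (?J \<times> ?J)" unfolding A_def by (rule vec_cspace) simp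
  have Av: "mat_app A v = (\<Sum>j\<in>?J. smul (coef v j) (g (sgl j 1)))" if v: "v \<in> cspace ?J" for v
  proof (rule poly_mapping_eqI)
    fix i
    show "coef (mat_app A v) i = coef (\<Sum>j\<in>?J. smul (coef v j) (g (sgl j 1))) i"
    proof (cases "i \<in> ?J")
      case True
      then show ?thesis unfolding coef_mat_app[OF A finite_atLeastAtMost] mvec_def lookup_sum
        by (intro sum.cong) (auto simp: A_def coef_vec)
    next
      case False
      have "g (sgl j 1) \<in> cspace ?J" if "j \<in> ?J" for j using g that by (simp add: cspace_def)
      then have "(\<Sum>j\<in>?J. smul (coef v j) (g (sgl j 1))) \<in> cspace ?J"
        by (intro cv.subspace_sum cv.subspace_scale subspace_cspace) auto
      then show ?thesis using cspace_coef[OF _ False] mat_app_cspace[OF A] by metis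
    qed
  qed
  have BA: "mat_app B' (mat_app A v) = mat_app B v" if v: "v \<in> cspace ?J" for v
  proof -
    have "mat_app B' (mat_app A v) = (\<Sum>j\<in>?J. smul (coef v j) (mat_app B (sgl j 1)))"
      unfolding Av[OF v] T'.sum T'.scale by (rule sum.cong) (use g in \<open>auto simp: cspace_def\<close>)
    also have "\<dots> = mat_app B (\<Sum>j\<in>?J. smul (coef v j) (sgl j 1))"
      unfolding T.sum T.scale ..
    also have "(\<Sum>j\<in>?J. smul (coef v j) (sgl j 1)) = v"
      by (rule poly_mapping_eqI)
        (use cspace_coef[OF v] in \<open>auto simp: lookup_sum lookup_single when_def if_distrib[of "(*) _"] cong: if_cong\<close>)
    finally show ?thesis .
  qed
  have "bij_betw (mat_app A) (cspace ?J) (cspace ?J)"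
    unfolding bij_betw_def
  proof
    show "inj_on (mat_app A) (cspace ?J)"
      by (rule inj_onI) (metis BA b(3) inj_onD)
    show "mat_app A ` cspace ?J = cspace ?J"
    proof (intro equalityI subsetI)
      fix w assume w: "w \<in> cspace ?J"
      obtain v where v: "v \<in> cspace ?J" "mat_app B v = mat_app B' w" using b(2) b'(2) w by (metis imageE imageI)
      then have "mat_app A v = w" using BA[OF v(1)] inj_onD[OF b'(3)] mat_app_cspace[OF A] w by metis
      then show "w \<in> mat_app A ` cspace ?J" using v(1) by blast
    qed (use mat_app_cspace[OF A] in blast)
  qed
  then have GL: "A \<in> GL ?J" using A by (simp add: GL_def)
  have "mvec B ?J y = mvec B' ?J (mvec A ?J y)" for y
  proof -
    have "vec ?J y \<in> cspace ?J" by (rule vec_cspace) simp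
    moreover have "coef (mat_app A v) = mvec A ?J (coef v)" for v using coef_mat_app[OF A] by auto
    ultimately show ?thesis using arg_cong[OF BA, of "vec ?J y" coef]
      by (simp add: coef_param[OF B] coef_param[OF B'] mvec_vec)
  qed
  then show ?thesis using that GL by blast
qed

text \<open>A linear form vanishing on the hyperplane of \<open>l\<close> is divisible by
  \<open>l\<close>, and the quotient has degree 0.\<close>

lemma hyperplane_points_inj:
  assumes H: "H \<in> dual_proj n" "H' \<in> dual_proj n" and eq: "hyperplane_points n H = hyperplane_points n H'"
  shows "H = H'"
proof -
  obtain l l' where l: "l \<in> forms {..n} 1" "l \<noteq> 0" "H = line l" and l': "l' \<in> forms {..n} 1" "l' \<noteq> 0" "H' = line l'"
    using H by (auto simp: dual_proj_iff)
  have van: "peval l' x = 0" if "peval l x = 0" for x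
  proof -
    have c: "peval h x = peval h (coef (vec {..n} x))" if "h \<in> forms {..n} 1" for h
      by (rule peval_cong_vars[OF subsetD[OF forms_subset_polys that]]) (simp add: coef_vec)
    have "vec {..n} x \<in> hyperplane_points n H" using that c[OF l(1)] vec_cspace[of "{..n}" x] by (simp add: l(3) hyperplane_points_line)
    then show ?thesis using eq c[OF l'(1)] by (simp add: l'(3) hyperplane_points_line)
  qed
  have l'1: "l' \<in> forms {..n} (Suc 0)" using l'(1) by simp
  obtain h where h: "h \<in> forms {..n} 0" "l' = l * h" by (rule divisible_by_linear[OF _ l(1,2) l'1 van]) auto
  then obtain c where "h = pconst c" by (auto simp: forms_0_iff)
  then have "l' = smul c l" using h(2) by (simp add: smul_conv mult.commute)
  moreover from this have "c \<noteq> 0" using l'(2) by auto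
  ultimately show ?thesis using line_smul l(3) l'(3) by metis
qed

text \<open>Evaluation at \<open>y\<close> as a linear form in the coefficients of the evaluated
  form. It turns conditions on values into polynomial conditions on forms, hence into Zariski open
  sets.\<close>

definition evalpoly :: "'v set \<Rightarrow> nat \<Rightarrow> ('v \<Rightarrow> complex) \<Rightarrow> ('v \<Rightarrow>\<^sub>0 nat) cpoly"
  where "evalpoly J d y = (\<Sum>m\<in>mons J d. smul (mval y m) (pvar m))"

lemma evalpoly_forms: "evalpoly J d y \<in> forms (mons J d) 1"
  unfolding evalpoly_def by (intro forms_sum forms_smul pvar_forms)

lemma peval_evalpoly:
  assumes "finite J" "g \<in> forms J d" shows "peval (evalpoly J d y) (coef g) = peval g y"
proof -
  have "peval g y = (\<Sum>m\<in>mons J d. coef g m * mval y m)"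
    by (rule ev.geval_superset[OF finite_mons[OF assms(1)]]) (use assms(2) in \<open>simp add: cspace_def\<close>)
  then show ?thesis unfolding evalpoly_def by (simp add: peval_simps peval_smul mult.commute)
qed

lemma complex_root_exists:
  assumes "0 < d" obtains z :: complex where "z ^ d = c"
proof (cases "c = 0")
  case True
  then show ?thesis using that[of 0] assms by (simp add: power_0_left)
next
  case False
  then have "exp (ln c / of_nat d) ^ d = c" using assms by (simp flip: exp_of_nat_mult)
  then show ?thesis by (rule that)
qed

text \<open>Smoothness persists for small \<open>s\<close>: singular points of the sections for a
  sequence of parameters tending to 0 would, after normalization, accumulate at a singular point of
  the section by \<open>B2\<close>.\<close>

lemma nonsingular_near:
  fixes n :: nat
  assumes B2: "B2 \<in> cspace ({..n} \<times> {1..n})" and Z: "Z \<in> cspace ({..n} \<times> {1..n})" and f: "f \<in> forms {..n} d" and F: "finite F"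
    and ns: "\<And>y. y \<in> cspace {1..n} \<Longrightarrow> y \<noteq> 0 \<Longrightarrow> \<exists>j\<in>{1..n}. peval (pdiff j (pullback B2 f)) (coef y) \<noteq> 0"
  obtains s where "s \<notin> F" "\<And>y. y \<in> cspace {1..n} \<Longrightarrow> y \<noteq> 0 \<Longrightarrow> \<exists>j\<in>{1..n}. peval (pdiff j (pullback (B2 + smul s Z) f)) (coef y) \<noteq> 0"
proof (rule ccontr)
  let ?J = "{1..n}"
  note gen = that
  assume neg: "\<not> thesis"
  have sing: "\<exists>y. y \<in> cspace ?J \<and> y \<noteq> 0 \<and> (\<forall>j\<in>?J. peval (pdiff j (pullback (B2 + smul s Z) f)) (coef y) = 0)" if s: "s \<notin> F" for s
  proof (rule ccontr)
    assume no: "\<not> ?thesis"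
    have thesis by (rule gen[OF s]) (use no in blast)
    then show False using neg by blast
  qed
  have lim: "(\<lambda>k. complex_of_real (inverse (real (Suc k)))) \<longlonglongrightarrow> 0"
    using tendsto_of_real[OF LIMSEQ_inverse_real_of_nat, where 'a = complex] by simp
  have "\<forall>\<^sub>F k in sequentially. complex_of_real (inverse (real (Suc k))) \<in> - (F - {0})"
  proof (rule topological_tendstoD[OF lim])
    show "open (- (F - {0}))" by (intro open_Compl finite_imp_closed) (use F in simp)
  qed simp
  then obtain K where K: "\<And>k. k \<ge> K \<Longrightarrow> complex_of_real (inverse (real (Suc k))) \<in> - (F - {0})"
    unfolding eventually_sequentially by blast
  \<comment> \<open>A tail of the reciprocals. The shift by \<open>K\<close> avoids the nonzero
    members of \<open>F\<close>, and 0 is never attained, so membership of 0 in \<open>F\<close>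
    does no harm.\<close>
  define s :: "nat \<Rightarrow> complex" where "s k = complex_of_real (inverse (real (Suc (k + K))))" for k
  have s: "s k \<notin> F" for k
  proof -
    have "s k \<in> - (F - {0})" unfolding s_def by (rule K) simp
    moreover have "s k \<noteq> 0" unfolding s_def by (simp del: of_nat_Suc)
    ultimately show ?thesis by blast
  qed
  have s0: "s \<longlonglongrightarrow> 0" unfolding s_def using LIMSEQ_ignore_initial_segment[OF lim, of K] by simp
  obtain y where y: "\<And>k. y k \<in> cspace ?J" "\<And>k. y k \<noteq> 0" 
    "\<And>k j. j \<in> ?J \<Longrightarrow> peval (pdiff j (pullback (B2 + smul (s k) Z) f)) (coef (y k)) = 0"
    using sing[OF s] by metis
  have nz: "\<exists>i\<in>?J. coef (y k) i \<noteq> 0" for k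
    using y(1,2)[of k] by (metis cspace_coef lookup_zero poly_mapping_eqI)
  obtain c r x where x: "\<And>k. c k \<noteq> 0" "strict_mono (r :: nat \<Rightarrow> nat)" "\<And>i. i \<in> ?J \<Longrightarrow> (\<lambda>k. c (r k) * coef (y (r k)) i) \<longlonglongrightarrow> x i" "\<exists>i\<in>?J. x i \<noteq> 0"
    using normalized_subsequence[of ?J "\<lambda>k. coef (y k)"] nz by blast
  have BZ: "B2 + smul t Z \<in> cspace ({..n} \<times> ?J)" for t
    by (intro cv.subspace_add cv.subspace_scale subspace_cspace B2 Z)
  have fp: "f \<in> polys {..n}" using f forms_subset_polys by blast
  have sr: "(\<lambda>k. s (r k)) \<longlonglongrightarrow> 0" using LIMSEQ_subseq_LIMSEQ[OF s0 x(2)] by (simp add: o_def)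
  let ?B = "\<lambda>k. B2 + smul (s (r k)) Z" and ?y = "\<lambda>k i. c (r k) * coef (y (r k)) i"
  have 0: "peval (pdiff j (pullback B2 f)) (coef (vec ?J x)) = 0" if j: "j \<in> ?J" for j
  proof -
    have "(\<lambda>k. \<Sum>i\<le>n. peval (pdiff i f) (mvec (?B k) ?J (?y k)) * coef (?B k) (i, j)) \<longlonglongrightarrow>
        (\<Sum>i\<le>n. peval (pdiff i f) (mvec B2 ?J x) * coef B2 (i, j))"
    proof (intro tendsto_sum tendsto_mult)
      fix i
      have cB: "(\<lambda>k. coef (?B k) q) \<longlonglongrightarrow> coef B2 q" for q
        using tendsto_add[OF tendsto_const tendsto_mult[OF sr tendsto_const], of "coef B2 q" "coef Z q"] by (simp add: lookup_add)
      then show "(\<lambda>k. coef (?B k) (i, j)) \<longlonglongrightarrow> coef B2 (i, j)" .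
      show "(\<lambda>k. peval (pdiff i f) (mvec (?B k) ?J (?y k))) \<longlonglongrightarrow> peval (pdiff i f) (mvec B2 ?J x)"
      proof (rule peval_tendsto[OF polys_pdiff[OF fp]])
        show "(\<lambda>k. mvec (?B k) ?J (?y k) i') \<longlonglongrightarrow> mvec B2 ?J x i'" for i'
          unfolding mvec_def by (intro tendsto_sum tendsto_mult cB x(3))
      qed
    qed
    moreover have "(\<Sum>i\<le>n. peval (pdiff i f) (mvec (?B k) ?J (?y k)) * coef (?B k) (i, j)) = 0" for k
    proof -
      have "(\<Sum>i\<le>n. peval (pdiff i f) (mvec (?B k) ?J (?y k)) * coef (?B k) (i, j)) = peval (pdiff j (pullback (?B k) f)) (?y k)"
        by (rule peval_pdiff_pullback[OF BZ _ _ fp j, symmetric]) auto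
      also have "\<dots> = c (r k) ^ (d - 1) * peval (pdiff j (pullback (?B k) f)) (coef (y (r k)))"
        by (rule peval_homog[OF pdiff_forms[OF pullback_forms[OF BZ f]]])
      finally show ?thesis using y(3)[OF j] by simp
    qed
    ultimately have "(\<Sum>i\<le>n. peval (pdiff i f) (mvec B2 ?J x) * coef B2 (i, j)) = 0" by (simp add: LIMSEQ_const_iff)
    moreover have "peval (pdiff j (pullback B2 f)) (coef (vec ?J x)) = (\<Sum>i\<le>n. peval (pdiff i f) (mvec B2 ?J (coef (vec ?J x))) * coef B2 (i, j))"
      by (rule peval_pdiff_pullback[OF B2 _ _ fp j]) auto
    ultimately show ?thesis by (simp add: mvec_vec)
  qed
  have "vec ?J x \<noteq> 0" using x(4) coef_vec[of ?J x] by (metis finite_atLeastAtMost lookup_zero)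
  then show False using ns[OF vec_cspace] 0 by (metis finite_atLeastAtMost)
qed

text \<open>A kernel vector of \<open>B\<close> would be a singular point of the section, because
  the gradient of \<open>f\<close> vanishes at the origin for \<open>d \<ge> 2\<close>. So
  \<open>B\<close> is injective, and its image of dimension \<open>n\<close> is the hyperplane of an
  annihilating linear form.\<close>

lemma nonsingular_is_param:
  fixes n :: nat
  assumes n: "1 \<le> n" and d: "2 \<le> d" and f: "f \<in> forms {..n} d" and B: "B \<in> cspace ({..n} \<times> {1..n})"
    and ns: "\<And>y. y \<in> cspace {1..n} \<Longrightarrow> y \<noteq> 0 \<Longrightarrow> \<exists>j\<in>{1..n}. peval (pdiff j (pullback B f)) (coef y) \<noteq> 0"
  obtains H where "H \<in> dual_proj n" "is_param n H B"
proof -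
  let ?J = "{1..n}"
  have fp: "f \<in> polys {..n}" using f forms_subset_polys by blast
  interpret T: Vector_Spaces.linear smul smul "mat_app B" by (rule linear_mat_app[OF B]) simp
  have inj: "y = 0" if y: "y \<in> cspace ?J" "mat_app B y = 0" for y
  proof (rule ccontr)
    assume "y \<noteq> 0"
    then obtain j where j: "j \<in> ?J" "peval (pdiff j (pullback B f)) (coef y) \<noteq> 0" using ns y by blast
    have "mvec B ?J (coef y) i = 0" for i using y(2) coef_mat_app[OF B, of y i] by simp
    then have "peval (pdiff i f) (mvec B ?J (coef y)) = 0" for i
      by (intro peval_0_eq_0[OF pdiff_forms[OF f]]) (use d in auto)
    moreover have "peval (pdiff j (pullback B f)) (coef y) = (\<Sum>i\<le>n. peval (pdiff i f) (mvec B ?J (coef y)) * coef B (i, j))"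
      by (rule peval_pdiff_pullback[OF B _ _ fp j(1)]) auto
    ultimately show False using j(2) by simp
  qed
  let ?W = "mat_app B ` cspace ?J"
  have W: "cv.subspace ?W" "?W \<subseteq> cspace {..n}" using T.subspace_image[OF subspace_cspace] mat_app_cspace[OF B] by auto
  have dimJ: "cv.dim (cspace ?J) = n" by (simp add: dim_cspace)
  have "cv.dim ?W = cv.dim (cspace ?J)"
  proof (rule dim_inj_image[OF linear_mat_app[OF B] subspace_cspace fdim_cspace])
    show "y = 0" if "y \<in> cspace ?J" "mat_app B y = 0" for y using that by (rule inj)
  qed simp_all
  then have dW: "cv.dim ?W = n" using dimJ by simp
  then have "?W \<noteq> cspace {..n}" using dim_cspace[of "{..n}"] by auto
  then obtain Z where Z: "Z \<in> cspace {..n}" "Z \<noteq> 0" "\<And>w. w \<in> ?W \<Longrightarrow> (\<Sum>i\<in>{..n}. coef w i * coef Z i) = 0"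
    using annihilator[OF _ W] by blast
  define l where "l = (\<Sum>i\<in>{..n}. smul (coef Z i) (pvar i))"
  have pl: "peval l x = (\<Sum>i\<in>{..n}. coef Z i * x i)" for x unfolding l_def by (simp add: peval_simps peval_smul)
  have l: "l \<in> forms {..n} 1" unfolding l_def by (intro forms_sum forms_smul pvar_forms)
  have l0: "l \<noteq> 0"
  proof
    assume "l = 0"
    then have *: "(\<Sum>i\<in>{..n}. coef Z i * x i) = 0" for x using pl[of x] by (simp add: ev.geval_0)
    have "coef Z i = 0" for i
    proof (cases "i \<in> {..n}")
      case True
      then show ?thesis using *[of "\<lambda>j. if j = i then 1 else 0"] by (simp add: if_distrib[of "(*) _"] cong: if_cong)
    qed (use cspace_coef[OF Z(1)] in auto)
    then show False using Z(2) by (simp add: poly_mapping_eq_iff fun_eq_iff)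
  qed
  let ?H = "hyperplane_points n (line l)"
  have WH: "?W \<subseteq> ?H" using W(2) Z(3) unfolding hyperplane_points_line pl by (auto simp: mult.commute)
  obtain B' \<sigma> where B': "is_param n (line l) B'" using explicit_param[OF l l0] by metis
  have "cv.dim ?H = n"
  proof -
    have "cv.dim (mat_app B' ` cspace ?J) = cv.dim (cspace ?J)"
    proof (rule dim_inj_image[OF linear_mat_app[OF is_paramD(1)[OF B']] subspace_cspace fdim_cspace])
      show "v = 0" if "v \<in> cspace ?J" "mat_app B' v = 0" for v
        using inj_onD[OF is_paramD(3)[OF B'], of v 0] that cv.subspace_0[OF subspace_cspace] by (auto simp: mat_app_0)
    qed auto
    then show ?thesis using is_paramD(2)[OF B'] dimJ by simp
  qed
  moreover have "fdim ?H" by (rule fdim_mono[OF fdim_cspace[of "{..n}"]]) (auto simp: hyperplane_points_line)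
  ultimately have "?W = ?H" using subspace_eq_of_dim[OF W(1) _ WH] dW by simp
  moreover have "inj_on (mat_app B) (cspace ?J)" using T.inj_on_iff_eq_0[OF subspace_cspace] inj by blast
  ultimately have "is_param n (line l) B" using B by (simp add: is_param_def bij_betw_def)
  then show ?thesis using that[of "line l"] l l0 by (auto simp: dual_proj_iff)
qed

text \<open>The open set consists of the classes of forms on which the condition \<open>C\<close> is
  met after some change of coordinates. Over such a class, every hyperplane of the fibre yields a
  matrix in one finite set, and the matrix determines the hyperplane by its image.\<close>

theorem generically_finite:
  fixes n :: nat
  assumes n: "1 \<le> n" and d: "2 \<le> d" and f: "f \<in> forms {..n} d" "f \<noteq> 0" and iso: "at_most_isolated_singularities {..n} f"
    and ns: "no_linear_syzygy {..n} f" and l: "l \<in> forms {..n} 1" "l \<noteq> 0" "linear_jacobian_injective {..n} f d l"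
  shows "section_map_generically_finite n d f"
proof -
  let ?J = "{1..n}"
  let ?P = "{..n} \<times> ?J"
  have J: "finite ?J" "?J \<noteq> {}" and d0: "0 < d" using n d by auto
  obtain B0 where B0: "B0 \<in> cspace ?P" "\<And>Z. Z \<in> cspace ?P \<Longrightarrow> 
      (\<And>y. (\<Sum>i\<le>n. peval (pdiff i f) (mvec B0 ?J y) * mvec Z ?J y i) = 0) \<Longrightarrow> Z = 0"
    by (rule differential_injective[OF f(1) ns l]) blast
  obtain c :: "(nat \<times> nat) option cpoly" and \<kappa> and T :: "nat \<times> nat \<Rightarrow> (nat \<times> nat) cvec set" and r Y where
    c: "c \<in> forms (Some ` ?P) \<kappa>" and T: "\<And>p. finite (T p)" and
    fib: "\<And>g. peval c (\<lambda>q. \<Sum>u\<in>T (the q). r (the q) u * peval g (Y (the q) u)) \<noteq> 0 \<Longrightarrow>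
      finite {B \<in> cspace ?P. \<forall>y. peval f (mvec B ?J y) = peval g y}" and
    ex: "\<exists>B\<in>cspace ?P. peval c (\<lambda>q. \<Sum>u\<in>T (the q). r (the q) u * peval f (mvec B ?J (Y (the q) u))) \<noteq> 0"
  proof (rule finite_fibres[OF n d0 f(1) B0(1)])
    show "Z = 0" if "Z \<in> cspace ?P" "\<And>y. (\<Sum>i\<le>n. peval (pdiff i f) (mvec B0 ?J y) * mvec Z ?J y i) = 0" for Z
      using B0(2) that by blast
  qed (rule that)
  define C where "C g = peval c (\<lambda>q. \<Sum>u\<in>T (the q). r (the q) u * peval g (Y (the q) u))" for g
  \<comment> \<open>The condition \<open>C\<close> after the coordinate change \<open>A\<close>, as
    a form in the coefficients of \<open>g\<close>; its nonvanishing is a basic Zariski open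
    set.\<close>
  define CA where "CA A = psubst (\<lambda>q. \<Sum>u\<in>T (the q). smul (r (the q) u) (evalpoly ?J d (mvec A ?J (Y (the q) u)))) c" for A
  have CA: "CA A \<in> forms (mons ?J d) \<kappa>" for A
  proof -
    have "CA A \<in> forms (mons ?J d) (\<kappa> * 1)" unfolding CA_def
      by (rule forms_psubst[OF c]) (intro forms_sum forms_smul evalpoly_forms)
    then show ?thesis by simp
  qed
  have pCA: "peval (CA A) (coef g) = C (pullback A g)" if "A \<in> cspace (?J \<times> ?J)" "g \<in> forms ?J d" for A g
    unfolding CA_def peval_psubst C_def peval_pullback[OF that(1) J(1)]
    by (simp only: peval_simps peval_smul peval_evalpoly[OF J(1) that(2)])
  have Csmul: "C (smul t g) = t ^ \<kappa> * C g" for t g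
  proof -
    have "C (smul t g) = peval c (\<lambda>q. t * (\<Sum>u\<in>T (the q). r (the q) u * peval g (Y (the q) u)))"
      unfolding C_def peval_smul by (simp add: sum_distrib_left algebra_simps)
    then show ?thesis using peval_homog[OF c] by (simp add: C_def)
  qed
  obtain B1 where B1: "B1 \<in> cspace ?P" "peval c (\<lambda>q. \<Sum>u\<in>T (the q). r (the q) u * peval f (mvec B1 ?J (Y (the q) u))) \<noteq> 0"
    using ex by blast
  then have CB1: "C (pullback B1 f) \<noteq> 0" unfolding C_def peval_pullback[OF B1(1) J(1)] by blast
  obtain l2 where l2: "l2 \<in> forms {..n} 1" "l2 \<noteq> 0" "\<not> section_singular n f (hyperplane_points n (line l2))"
    by (rule bertini[OF n d f iso])
  obtain B2 where B2: "is_param n (line l2) B2" using explicit_param[OF l2(1,2)] by metis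
  have sm2: "pullback B2 f \<in> smooth_forms ?J d" using smooth_section_iff[OF B2 f(1) n d0] l2(3) by blast
  \<comment> \<open>Direction of the line from the smooth section \<open>B2\<close> to the matrix
    \<open>B1\<close> that satisfies \<open>C\<close>. On it \<open>C\<close> fails for finitely
    many parameters only, and smoothness persists near \<open>B2\<close>.\<close>
  define Z where "Z = B1 - B2"
  have Z: "Z \<in> cspace ?P" unfolding Z_def by (rule cv.subspace_diff[OF subspace_cspace B1(1) is_paramD(1)[OF B2]])
  define Ch where "Ch = psubst (\<lambda>q. \<Sum>u\<in>T (the q). smul (r (the q) u) (psubst (\<lambda>i. \<Sum>j\<in>?J. smul (Y (the q) u j) (pvar (i, j))) f)) c"
  have pCh: "peval Ch (coef B) = C (pullback B f)" if "B \<in> cspace ?P" for B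
    unfolding Ch_def C_def peval_psubst peval_pullback[OF that J(1)]
    by (simp add: peval_simps peval_smul peval_psubst mvec_def[abs_def] mult.commute)
  have BZ: "B2 + smul s Z \<in> cspace ?P" for s
    by (intro cv.subspace_add cv.subspace_scale subspace_cspace is_paramD(1)[OF B2] Z)
  have cBZ: "coef (B2 + smul s Z) = (\<lambda>p. coef B2 p + s * coef Z p)" for s by (simp add: lookup_add fun_eq_iff)
  have "peval Ch (\<lambda>p. coef B2 p + 1 * coef Z p) \<noteq> 0"
    using pCh[OF BZ, of 1] CB1 unfolding cBZ by (simp add: Z_def)
  then have F: "finite {s. peval Ch (\<lambda>p. coef B2 p + s * coef Z p) = 0}" by (rule peval_line_finite)
  obtain s where s: "peval Ch (\<lambda>p. coef B2 p + s * coef Z p) \<noteq> 0" 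
    "\<And>y. y \<in> cspace ?J \<Longrightarrow> y \<noteq> 0 \<Longrightarrow> \<exists>j\<in>?J. peval (pdiff j (pullback (B2 + smul s Z) f)) (coef y) \<noteq> 0"
  proof (rule nonsingular_near[OF is_paramD(1)[OF B2] Z f(1) F])
    fix s assume s: "s \<notin> {s. peval Ch (\<lambda>p. coef B2 p + s * coef Z p) = 0}"
      and "\<And>y. y \<in> cspace ?J \<Longrightarrow> y \<noteq> 0 \<Longrightarrow> \<exists>j\<in>?J. peval (pdiff j (pullback (B2 + smul s Z) f)) (coef y) \<noteq> 0"
    then show thesis by (intro that[of s]) simp_all
  qed (rule smooth_formsD[OF sm2 J(1) d0])
  define B3 where "B3 = B2 + smul s Z"
  have B3: "B3 \<in> cspace ?P" "C (pullback B3 f) \<noteq> 0" using BZ pCh[OF BZ, of s] s(1) by (simp_all add: B3_def cBZ)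
  obtain H3 where H3: "H3 \<in> dual_proj n" "is_param n H3 B3"
    by (rule nonsingular_is_param[OF n d f(1) B3(1)]) (use s(2) in \<open>auto simp: B3_def\<close>)
  have sm3: "pullback B3 f \<in> smooth_forms ?J d"
    by (rule smooth_formsI[OF pullback_forms[OF B3(1) f(1)] J d0]) (use s(2) in \<open>auto simp: B3_def\<close>)
  define U where "U = smooth_section_locus n d f"
  define \<Phi> where "\<Phi> = section_map n f"
  have param: "is_param n H (hyperplane_param n H)" if "H \<in> dual_proj n" for H by (rule hyperplane_param_is_param[OF that])
  have UH: "H \<in> dual_proj n" "hyperplane_section n f H \<in> smooth_forms ?J d" "line (hyperplane_section n f H) \<in> smooth_locus ?J d"
    if "H \<in> U" for H using that by (auto simp: U_def smooth_section_locus_def smooth_locus_def)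
  have H3U: "H3 \<in> U"
  proof -
    have "pullback (hyperplane_param n H3) f \<in> smooth_forms ?J d"
      using sm3 smooth_section_iff[OF H3(2) f(1) n d0] smooth_section_iff[OF param[OF H3(1)] f(1) n d0] by blast
    then show ?thesis using H3(1) by (simp add: U_def smooth_section_locus_def hyperplane_section_def)
  qed
  define W where "W = moduli_class ?J ` {L \<in> smooth_locus ?J d. \<exists>A\<in>GL ?J. \<forall>g\<in>L. C (pullback A g) \<noteq> 0}"
  have locus: "\<exists>g\<in>smooth_forms ?J d. L = line g" if "L \<in> smooth_locus ?J d" for L
    using that by (auto simp: smooth_locus_def)
  have GLc: "A \<in> cspace (?J \<times> ?J)" if "A \<in> GL ?J" for A using that by (simp add: GL_def)
  have Cline: "(\<forall>g'\<in>line g. C (pullback A g') \<noteq> 0) \<longleftrightarrow> C (pullback A g) \<noteq> 0" for A g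
    unfolding line_conv using cv.scale_one[of g] by (auto simp: pullback_smul Csmul intro: exI[of _ 1])
  \<comment> \<open>The existential quantifier over coordinate changes makes the condition
    independent of the representative of the orbit, so \<open>W\<close> has a saturated open
    preimage.\<close>
  have W_iff: "moduli_class ?J L \<in> W \<longleftrightarrow> (\<exists>A\<in>GL ?J. \<forall>g\<in>L. C (pullback A g) \<noteq> 0)" if L: "L \<in> smooth_locus ?J d" for L
  proof
    assume "moduli_class ?J L \<in> W"
    then obtain L' A where L': "L' \<in> smooth_locus ?J d" "moduli_class ?J L = moduli_class ?J L'" "A \<in> GL ?J" "\<forall>g\<in>L'. C (pullback A g) \<noteq> 0"
      unfolding W_def by auto
    have "pullback A ` L' \<in> moduli_class ?J L" unfolding L'(2) using L'(3) by (auto simp: moduli_class_def)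
    then obtain A' where A': "A' \<in> GL ?J" "pullback A ` L' = pullback A' ` L" by (auto simp: moduli_class_def)
    have "C (pullback A' g) \<noteq> 0" if "g \<in> L" for g
    proof -
      have "pullback A' g \<in> pullback A ` L'" unfolding A'(2) using that by blast
      then show ?thesis using L'(4) by auto
    qed
    then show "\<exists>A\<in>GL ?J. \<forall>g\<in>L. C (pullback A g) \<noteq> 0" using A'(1) by blast
  next
    assume "\<exists>A\<in>GL ?J. \<forall>g\<in>L. C (pullback A g) \<noteq> 0"
    then show "moduli_class ?J L \<in> W" unfolding W_def using L by blast
  qed
  have openW: "openin (moduli_space ?J d) W"
    unfolding openin_moduli_space
  proof
    show "W \<subseteq> moduli_class ?J ` smooth_locus ?J d" by (auto simp: W_def)
    let ?O = "\<lambda>A. {L \<in> proj (mons ?J d). \<forall>v\<in>L. peval (CA A) (coef v) \<noteq> 0}"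
    have "openin (zariski_proj (mons ?J d)) (?O A)" for A
      unfolding zariski_proj_def using CA[of A] by (intro topology_generated_by_Basis) blast
    then have "openin (zariski_proj (mons ?J d)) (\<Union>A\<in>GL ?J. ?O A)" by blast
    moreover have "{L \<in> smooth_locus ?J d. moduli_class ?J L \<in> W} = (\<Union>A\<in>GL ?J. ?O A) \<inter> smooth_locus ?J d"
    proof -
      have "L \<in> (\<Union>A\<in>GL ?J. ?O A) \<longleftrightarrow> moduli_class ?J L \<in> W" if L: "L \<in> smooth_locus ?J d" for L
      proof -
        obtain g where g: "g \<in> smooth_forms ?J d" "L = line g" using locus[OF L] by blast
        have gf: "g \<in> forms ?J d" "g \<noteq> 0" using g(1) by (auto simp: smooth_forms_def)
        then have "L \<in> proj (mons ?J d)" using g(2) by (auto simp: proj_iff)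
        moreover have "v \<in> forms ?J d" if "v \<in> L" for v using that gf(1) unfolding g(2) line_conv by (auto intro: forms_smul)
        ultimately show ?thesis unfolding W_iff[OF L] using pCA[OF GLc] by auto
      qed
      then show ?thesis by blast
    qed
    ultimately show "openin (subtopology (zariski_proj (mons ?J d)) (smooth_locus ?J d)) {L \<in> smooth_locus ?J d. moduli_class ?J L \<in> W}"
      unfolding openin_subtopology by blast
  qed
  define V where "V = \<Phi> ` U \<inter> W"
  have openV: "openin (subtopology (moduli_space ?J d) (\<Phi> ` U)) V"
    unfolding V_def openin_subtopology using openW by blast
  have "\<Phi> H3 \<in> W"
  proof -
    obtain A where A: "A \<in> GL ?J" "\<And>y. mvec B3 ?J y = mvec (hyperplane_param n H3) ?J (mvec A ?J y)"
      by (rule param_change[OF H3(2) param[OF H3(1)]]) (rule that)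
    have "pullback A (hyperplane_section n f H3) = pullback B3 f"
      by (rule peval_eqI)
        (simp only: hyperplane_section_def peval_pullback[OF GLc[OF A(1)] J(1)] peval_pullback[OF is_paramD(1)[OF param[OF H3(1)]] J(1)] 
          peval_pullback[OF B3(1) J(1)] A(2))
    then have "C (pullback A (hyperplane_section n f H3)) \<noteq> 0" using B3(2) by simp
    then show ?thesis unfolding \<Phi>_def section_map_def using W_iff[OF UH(3)[OF H3U]] Cline A(1) by blast
  qed
  then have neV: "V \<noteq> {}" using H3U by (auto simp: V_def)
  have "finite {H \<in> U. \<Phi> H = q}" if q: "q \<in> V" for q
  proof -
    obtain L A0 where L: "L \<in> smooth_locus ?J d" "q = moduli_class ?J L" "A0 \<in> GL ?J" "\<forall>g\<in>L. C (pullback A0 g) \<noteq> 0"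
      using q by (auto simp: V_def W_def)
    obtain g' where g': "g' \<in> smooth_forms ?J d" "L = line g'" using locus[OF L(1)] by blast
    define g where "g = pullback A0 g'"
    have Cg: "C g \<noteq> 0" using L(4) g'(2) line_self unfolding g_def by blast
    have gq: "line g \<in> q" unfolding L(2) moduli_class_def g_def g'(2) using L(3) pullback_line by blast
    let ?S = "{B \<in> cspace ?P. \<forall>y. peval f (mvec B ?J y) = peval g y}"
    have finS: "finite ?S" by (rule fib) (use Cg in \<open>simp add: C_def\<close>)
    have "\<exists>B\<in>?S. mat_app B ` cspace ?J = hyperplane_points n H" if H: "H \<in> U" "\<Phi> H = q" for H
    proof -
      let ?B = "hyperplane_param n H"
      note pH = param[OF UH(1)[OF H(1)]]
      have "line g \<in> moduli_class ?J (line (pullback ?B f))" using gq H(2) by (simp add: \<Phi>_def section_map_def hyperplane_section_def)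
      then obtain A where A: "A \<in> GL ?J" "line g = line (pullback A (pullback ?B f))" by (auto simp: moduli_class_def pullback_line)
      then obtain t where t: "t \<noteq> 0" "g = smul t (pullback A (pullback ?B f))" using line_eq_iff by metis
      obtain z where z: "z ^ d = t" by (rule complex_root_exists[OF d0])
      have z0: "z \<noteq> 0" using z t(1) d0 by (auto simp: power_0_left)
      \<comment> \<open>The chosen parametrization after the coordinate change \<open>A\<close>,
        scaled by a \<open>d\<close>-th root \<open>z\<close> of the factor \<open>t\<close>, so
        that \<open>f \<circ> B\<close> equals \<open>g\<close> exactly and not only up to a
        scalar.\<close>
      define B where "B = vec ?P (\<lambda>(i, k). z * (\<Sum>j\<in>?J. coef ?B (i, j) * coef A (j, k)))"
      have B: "B \<in> cspace ?P" unfolding B_def by (rule vec_cspace) simp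
      have mB: "mvec B ?J y i = z * mvec ?B ?J (mvec A ?J y) i" for y i
      proof (cases "i \<le> n")
        case True
        have "mvec B ?J y i = (\<Sum>k\<in>?J. z * (\<Sum>j\<in>?J. coef ?B (i, j) * coef A (j, k)) * y k)"
          unfolding mvec_def by (rule sum.cong) (use True in \<open>auto simp: B_def coef_vec\<close>)
        also have "\<dots> = z * (\<Sum>j\<in>?J. \<Sum>k\<in>?J. coef ?B (i, j) * (coef A (j, k) * y k))"
          unfolding sum_distrib_left sum_distrib_right by (subst sum.swap) (simp add: mult.assoc)
        finally show ?thesis by (simp add: mvec_def sum_distrib_left)
      next
        case False
        then show ?thesis using mvec_outside[OF B] mvec_outside[OF is_paramD(1)[OF pH]] by simp
      qed
      have "peval f (mvec B ?J y) = peval g y" for y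
      proof -
        have "mvec B ?J y = (\<lambda>i. z * mvec ?B ?J (mvec A ?J y) i)" by (rule ext) (rule mB)
        then have "peval f (mvec B ?J y) = z ^ d * peval f (mvec ?B ?J (mvec A ?J y))"
          using peval_homog[OF f(1), of z "mvec ?B ?J (mvec A ?J y)"] by simp
        also have "\<dots> = peval g y"
          by (simp only: t(2) z peval_smul peval_pullback[OF GLc[OF A(1)] J(1)] peval_pullback[OF is_paramD(1)[OF pH] J(1)])
        finally show ?thesis .
      qed
      moreover have "mat_app B ` cspace ?J = hyperplane_points n H"
      proof -
        have e: "mat_app B y = mat_app ?B (mat_app A (smul z y))" for y
        proof (rule poly_mapping_eqI)
          fix i
          have "coef (mat_app A v) = mvec A ?J (coef v)" for v using coef_mat_app[OF GLc[OF A(1)] J(1)] by auto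
          then show "coef (mat_app B y) i = coef (mat_app ?B (mat_app A (smul z y))) i"
            unfolding coef_mat_app[OF B J(1)] coef_mat_app[OF is_paramD(1)[OF pH] J(1)] mB
            by (simp add: mvec_def sum_distrib_left algebra_simps)
        qed
        have "smul z ` cspace ?J = cspace ?J"
        proof (intro equalityI subsetI)
          fix w :: "nat cvec" assume "w \<in> cspace ?J"
          then have "w = smul z (smul (1 / z) w)" "smul (1 / z) w \<in> cspace ?J" using z0 cv.subspace_scale[OF subspace_cspace] by auto
          then show "w \<in> smul z ` cspace ?J" by blast
        qed (use cv.subspace_scale[OF subspace_cspace] in blast)
        moreover have "mat_app A ` cspace ?J = cspace ?J" using A(1) by (simp add: GL_def bij_betw_def)
        moreover have "mat_app B ` cspace ?J = mat_app ?B ` (mat_app A ` (smul z ` cspace ?J))" unfolding image_image e ..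
        ultimately show ?thesis using is_paramD(2)[OF pH] by simp
      qed
      ultimately show ?thesis using B by blast
    qed
    then have "\<forall>H\<in>{H \<in> U. \<Phi> H = q}. \<exists>B. B \<in> ?S \<and> mat_app B ` cspace ?J = hyperplane_points n H" by blast
    from bchoice[OF this] obtain b
      where b: "\<forall>H\<in>{H \<in> U. \<Phi> H = q}. b H \<in> ?S \<and> mat_app (b H) ` cspace ?J = hyperplane_points n H" ..
    have "inj_on b {H \<in> U. \<Phi> H = q}"
    proof (rule inj_onI)
      fix H H' assume H: "H \<in> {H \<in> U. \<Phi> H = q}" "H' \<in> {H \<in> U. \<Phi> H = q}" "b H = b H'"
      then have "hyperplane_points n H = hyperplane_points n H'" using bspec[OF b H(1)] bspec[OF b H(2)] by simp
      then show "H = H'" using hyperplane_points_inj[OF UH(1) UH(1)] H by blast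
    qed
    moreover have "b ` {H \<in> U. \<Phi> H = q} \<subseteq> ?S" using b by blast
    ultimately show ?thesis by (intro finite_imageD[of b] finite_subset[OF _ finS])
  qed
  then show ?thesis unfolding section_map_generically_finite_def Let_def
    using openV neV by (auto simp: U_def \<Phi>_def)
qed

section \<open>One-parameter groups of automorphisms\<close>

text \<open>A point of projective space is cut out by the two-by-two minors
  \<open>v b * x a - v a * x b\<close>.\<close>

lemma closedin_line_zariski_proj:
  assumes v: "v \<in> cspace I" "v \<noteq> 0"
  shows "closedin (zariski_proj I) {line v}"
proof -
  let ?T = "zariski_proj I"
  have nz: "\<exists>a\<in>I. coef w a \<noteq> 0" if "w \<in> cspace I" "w \<noteq> 0" for w
    using that by (metis cspace_coef lookup_zero poly_mapping_eqI)
  have top: "proj I \<subseteq> topspace ?T"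
  proof
    fix L assume L: "L \<in> proj I"
    have "{L \<in> proj I. \<forall>v\<in>L. peval 1 (coef v) \<noteq> 0} \<in> {{L \<in> proj I. \<forall>v\<in>L. peval q (coef v) \<noteq> 0} |q k. q \<in> forms I k}"
      using one_forms by blast
    moreover have "L \<in> {L \<in> proj I. \<forall>v\<in>L. peval 1 (coef v) \<noteq> 0}" using L by (simp add: ev.geval_1)
    ultimately show "L \<in> topspace ?T" unfolding zariski_proj_def topology_generated_by_topspace by blast
  qed
  define q where "q a b = smul (coef v b) (pvar a) - smul (coef v a) (pvar b)" for a b
  have q: "q a b \<in> forms I 1" if "a \<in> I" "b \<in> I" for a b unfolding q_def by (intro forms_diff forms_smul pvar_forms that)
  have pq: "peval (q a b) x = coef v b * x a - coef v a * x b" for a b x by (simp add: q_def peval_simps peval_smul)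
  let ?O = "\<lambda>a b. {L \<in> proj I. \<forall>w\<in>L. peval (q a b) (coef w) \<noteq> 0}"
  have "topspace ?T - {line v} = (\<Union>a\<in>I. \<Union>b\<in>I. ?O a b)"
  proof (intro equalityI subsetI)
    fix L assume L: "L \<in> topspace ?T - {line v}"
    then have "L \<in> proj I" unfolding zariski_proj_def topology_generated_by_topspace by blast
    then obtain w where w: "w \<in> cspace I" "w \<noteq> 0" "L = line w" by (auto simp: proj_iff)
    have "\<exists>a\<in>I. \<exists>b\<in>I. peval (q a b) (coef w) \<noteq> 0"
    proof (rule ccontr)
      assume "\<not> ?thesis"
      then have m: "coef w a * coef v b = coef w b * coef v a" if "a \<in> I" "b \<in> I" for a b using that by (auto simp: pq algebra_simps)
      obtain a0 b0 where ab: "a0 \<in> I" "coef w a0 \<noteq> 0" "b0 \<in> I" "coef v b0 \<noteq> 0" using nz v w by metis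
      obtain t where t: "t \<noteq> 0" "\<And>a. a \<in> I \<Longrightarrow> coef w a = t * coef v a"
        using proportional_of_minors[of I "coef w" "coef v" a0 b0] m ab by blast
      have "w = smul t v"
      proof (rule poly_mapping_eqI)
        fix a show "coef w a = coef (smul t v) a"
          using t(2) cspace_coef[OF w(1)] cspace_coef[OF v(1)] by (cases "a \<in> I") auto
      qed
      then show False using L w(3) line_smul[OF t(1)] by auto
    qed
    then obtain a b where "a \<in> I" "b \<in> I" "peval (q a b) (coef w) \<noteq> 0" by blast
    then show "L \<in> (\<Union>a\<in>I. \<Union>b\<in>I. ?O a b)" using \<open>L \<in> proj I\<close> line_forall_nonzero[OF q] w(3) by auto
  next
    fix L assume "L \<in> (\<Union>a\<in>I. \<Union>b\<in>I. ?O a b)"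
    then obtain a b where ab: "a \<in> I" "b \<in> I" "L \<in> proj I" "\<forall>w\<in>L. peval (q a b) (coef w) \<noteq> 0" by blast
    have "L \<noteq> line v" using ab(4) line_self[of v] by (auto simp: pq)
    then show "L \<in> topspace ?T - {line v}" using ab(3) top by blast
  qed
  moreover have "openin ?T (\<Union>a\<in>I. \<Union>b\<in>I. ?O a b)"
  proof (intro openin_Union)
    have "openin ?T (?O a b)" if "a \<in> I" "b \<in> I" for a b
      unfolding zariski_proj_def using q[OF that] by (intro topology_generated_by_Basis) blast
    then show "openin ?T U" if "U \<in> (\<lambda>a. \<Union>b\<in>I. ?O a b) ` I" for U using that by blast
  qed
  ultimately have "openin ?T (topspace ?T - {line v})" by simp
  moreover have "{line v} \<subseteq> topspace ?T"
  proof -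
    have "line v \<in> proj I" unfolding proj_iff using v by blast
    then show ?thesis using top by blast
  qed
  ultimately show ?thesis by (simp add: closedin_def)
qed

lemma topspace_zariski_proj: "topspace (zariski_proj I) = proj I"
proof
  show "topspace (zariski_proj I) \<subseteq> proj I"
    unfolding zariski_proj_def topology_generated_by_topspace by blast
  show "proj I \<subseteq> topspace (zariski_proj I)"
  proof
    fix L assume "L \<in> proj I"
    then obtain v where "v \<in> cspace I" "v \<noteq> 0" "L = line v" by (auto simp: proj_iff)
    then show "L \<in> topspace (zariski_proj I)" using closedin_subset[OF closedin_line_zariski_proj] by blast
  qed
qed

text \<open>The closure of the curve is irreducible: a closed set that misses a point of the curve
  contains it for countably many parameters only, and two such sets cannot cover the complex plane.
  With \<open>{x}\<close> below it this is a chain of length 1.\<close>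

lemma krull_dim_pos:
  assumes x: "closedin T {x}" and \<gamma>: "\<And>t :: complex. \<gamma> t \<in> topspace T" "\<gamma> s \<noteq> x" "\<gamma> 0 = x"
    and small: "\<And>O' t. openin T O' \<Longrightarrow> \<gamma> t \<in> O' \<Longrightarrow> countable {t. \<gamma> t \<notin> O'}"
  shows "krull_dim T \<noteq> 0"
proof -
  define Z where "Z = T closure_of (range \<gamma>)"
  have sub: "range \<gamma> \<subseteq> Z" unfolding Z_def by (rule closure_of_subset) (use \<gamma>(1) in blast)
  have irrZ: "irreducible_closed T Z"
    unfolding irreducible_closed_def
  proof (intro conjI allI impI)
    show "closedin T Z" by (simp add: Z_def)
    show "Z \<noteq> {}" using sub by blast
    fix A B assume AB: "closedin T A \<and> closedin T B \<and> Z = A \<union> B"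
    have small': "countable {t. \<gamma> t \<in> A}" if A: "closedin T A" "\<not> range \<gamma> \<subseteq> A" for A
    proof -
      obtain t where "\<gamma> t \<notin> A" using A(2) by blast
      then have "countable {t. \<gamma> t \<notin> topspace T - A}"
        using A(1) \<gamma>(1) by (intro small[of _ t]) (auto simp: closedin_def)
      then show ?thesis using \<gamma>(1) by simp
    qed
    have "range \<gamma> \<subseteq> A \<or> range \<gamma> \<subseteq> B"
    proof (rule ccontr)
      assume "\<not> ?thesis"
      then have "countable {t. \<gamma> t \<in> A}" "countable {t. \<gamma> t \<in> B}" using AB by (auto intro!: small')
      then have "countable ({t. \<gamma> t \<in> A} \<union> {t. \<gamma> t \<in> B})" by (rule countable_Un)
      moreover have "{t. \<gamma> t \<in> A} \<union> {t. \<gamma> t \<in> B} = UNIV"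
      proof -
        have "\<gamma> t \<in> A \<or> \<gamma> t \<in> B" for t using sub AB by auto
        then show ?thesis by auto
      qed
      ultimately show False using uncountable_UNIV_complex by simp
    qed
    then have "Z \<subseteq> A \<or> Z \<subseteq> B" unfolding Z_def using AB closure_of_minimal[of "range \<gamma>" A T] closure_of_minimal[of "range \<gamma>" B T] by argo
    then show "A = Z \<or> B = Z" using AB by blast
  qed
  have "A = {x} \<or> B = {x}" if h: "{x} = A \<union> B" for A B
  proof -
    have "A \<subseteq> {x}" "B \<subseteq> {x}" "x \<in> A \<or> x \<in> B" using h by auto
    then show ?thesis by blast
  qed
  then have irrx: "irreducible_closed T {x}" using x by (simp add: irreducible_closed_def)
  have "{x} \<subset> Z" using sub \<gamma> by blast
  then have "enat 1 \<in> {enat k |k. \<exists>Z. (\<forall>i\<le>k. irreducible_closed T (Z i)) \<and> (\<forall>i<k. Z i \<subset> Z (Suc i))}"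
    using irrx irrZ by (auto intro!: exI[of _ "1::nat"] exI[of _ "\<lambda>i::nat. if i = 0 then {x} else Z"])
  then have "enat 1 \<le> krull_dim T" unfolding krull_dim_def by (rule Sup_upper)
  then show ?thesis by (auto simp: zero_enat_def)
qed

section \<open>The matrix exponential, entry by entry\<close>

primrec pow_entry :: "'v set \<Rightarrow> ('v \<Rightarrow> 'v \<Rightarrow> complex) \<Rightarrow> nat \<Rightarrow> 'v \<Rightarrow> 'v \<Rightarrow> complex"
  where "pow_entry X \<alpha> 0 i j = (if i = j then 1 else 0)"
  | "pow_entry X \<alpha> (Suc k) i j = (\<Sum>l\<in>X. \<alpha> i l * pow_entry X \<alpha> k l j)"

definition exp_entry :: "'v set \<Rightarrow> ('v \<Rightarrow> 'v \<Rightarrow> complex) \<Rightarrow> complex \<Rightarrow> 'v \<Rightarrow> 'v \<Rightarrow> complex"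
  where "exp_entry X \<alpha> t i j = suminf (\<lambda>k. pow_entry X \<alpha> k i j / fact k * t ^ k)"

context
  fixes X :: "'v set" and \<alpha> :: "'v \<Rightarrow> 'v \<Rightarrow> complex"
  assumes fin: "finite X"
begin

lemma pow_entry_right: "i \<in> X \<Longrightarrow> j \<in> X \<Longrightarrow> pow_entry X \<alpha> (Suc k) i j = (\<Sum>l\<in>X. pow_entry X \<alpha> k i l * \<alpha> l j)"
proof (induction k arbitrary: i)
  case 0
  then show ?case using fin by (simp add: if_distrib[of "\<lambda>x. x * _"] if_distrib[of "(*) _"] cong: if_cong)
next
  case (Suc k)
  have "pow_entry X \<alpha> (Suc (Suc k)) i j = (\<Sum>l\<in>X. \<alpha> i l * (\<Sum>m\<in>X. pow_entry X \<alpha> k l m * \<alpha> m j))"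
    using Suc by (subst pow_entry.simps(2)) (intro sum.cong refl, metis)
  also have "\<dots> = (\<Sum>m\<in>X. (\<Sum>l\<in>X. \<alpha> i l * pow_entry X \<alpha> k l m) * \<alpha> m j)"
    unfolding sum_distrib_left sum_distrib_right by (subst sum.swap) (simp add: mult.assoc)
  finally show ?case by simp
qed

lemma pow_entry_bound:
  obtains M where "0 \<le> M" "\<And>k i j. i \<in> X \<Longrightarrow> norm (pow_entry X \<alpha> k i j) \<le> M ^ k"
proof
  define M where "M = (\<Sum>i\<in>X. \<Sum>l\<in>X. norm (\<alpha> i l))"
  show "0 \<le> M" by (simp add: M_def sum_nonneg)
  show "norm (pow_entry X \<alpha> k i j) \<le> M ^ k" if "i \<in> X" for k i j
    using that
  proof (induction k arbitrary: i)
    case (Suc k)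
    have "norm (pow_entry X \<alpha> (Suc k) i j) \<le> (\<Sum>l\<in>X. norm (\<alpha> i l) * M ^ k)"
      unfolding pow_entry.simps norm_mult[symmetric]
      by (rule sum_norm_le) (use Suc.IH in \<open>simp add: norm_mult mult_left_mono\<close>)
    also have "\<dots> = (\<Sum>l\<in>X. norm (\<alpha> i l)) * M ^ k" by (simp add: sum_distrib_right)
    also have "\<dots> \<le> M * M ^ k"
    proof (rule mult_right_mono)
      show "(\<Sum>l\<in>X. norm (\<alpha> i l)) \<le> M" unfolding M_def
        by (rule member_le_sum[of i X "\<lambda>i. \<Sum>l\<in>X. norm (\<alpha> i l)"]) (use fin Suc.prems in \<open>auto simp: sum_nonneg\<close>)
    qed (use \<open>0 \<le> M\<close> in simp)
    finally show ?case by simp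
  qed simp
qed

lemma summable_exp_entry: "i \<in> X \<Longrightarrow> summable (\<lambda>k. pow_entry X \<alpha> k i j / fact k * t ^ k)"
proof -
  assume i: "i \<in> X"
  obtain M where M: "0 \<le> M" "\<And>k i j. i \<in> X \<Longrightarrow> norm (pow_entry X \<alpha> k i j) \<le> M ^ k" by (rule pow_entry_bound) blast
  show ?thesis
  proof (rule summable_comparison_test[OF _ summable_exp[of "M * norm t"]])
    have "norm (pow_entry X \<alpha> k i j / fact k * t ^ k) \<le> inverse (fact k) * (M * norm t) ^ k" for k
    proof -
      have "norm (pow_entry X \<alpha> k i j / fact k * t ^ k) = norm (pow_entry X \<alpha> k i j) * (norm t ^ k / fact k)"
        by (simp add: norm_mult norm_divide norm_power)
      also have "\<dots> \<le> M ^ k * (norm t ^ k / fact k)" by (rule mult_right_mono[OF M(2)[OF i]]) simp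
      finally show ?thesis by (simp add: power_mult_distrib field_simps)
    qed
    then show "\<exists>N. \<forall>k\<ge>N. norm (pow_entry X \<alpha> k i j / fact k * t ^ k) \<le> inverse (fact k) * (M * norm t) ^ k" by blast
  qed
qed

lemma diffs_exp_entry: "diffs (\<lambda>k. pow_entry X \<alpha> k i j / fact k) k = pow_entry X \<alpha> (Suc k) i j / fact k"
proof -
  have "diffs (\<lambda>k. pow_entry X \<alpha> k i j / fact k) k = of_nat (Suc k) * pow_entry X \<alpha> (Suc k) i j / (of_nat (Suc k) * fact k)"
    unfolding diffs_def by (simp only: fact_Suc of_nat_mult of_nat_fact times_divide_eq_right)
  also have "\<dots> = pow_entry X \<alpha> (Suc k) i j / fact k" by (rule mult_divide_mult_cancel_left) (simp del: of_nat_Suc)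
  finally show ?thesis .
qed

lemma exp_entry_deriv:
  assumes i: "i \<in> X"
  shows "((\<lambda>t. exp_entry X \<alpha> t i j) has_field_derivative (\<Sum>l\<in>X. \<alpha> i l * exp_entry X \<alpha> t l j)) (at t)"
proof -
  have "((\<lambda>t. exp_entry X \<alpha> t i j) has_field_derivative suminf (\<lambda>k. diffs (\<lambda>k. pow_entry X \<alpha> k i j / fact k) k * t ^ k)) (at t)"
    unfolding exp_entry_def by (rule termdiffs_strong_converges_everywhere) (rule summable_exp_entry[OF i])
  also have "suminf (\<lambda>k. diffs (\<lambda>k. pow_entry X \<alpha> k i j / fact k) k * t ^ k) = suminf (\<lambda>k. \<Sum>l\<in>X. \<alpha> i l * (pow_entry X \<alpha> k l j / fact k * t ^ k))"
    unfolding diffs_exp_entry by (simp add: sum_divide_distrib sum_distrib_right mult.assoc)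
  also have "\<dots> = (\<Sum>l\<in>X. suminf (\<lambda>k. \<alpha> i l * (pow_entry X \<alpha> k l j / fact k * t ^ k)))"
    by (rule suminf_sum) (intro summable_mult summable_exp_entry)
  also have "\<dots> = (\<Sum>l\<in>X. \<alpha> i l * exp_entry X \<alpha> t l j)"
    unfolding exp_entry_def by (intro sum.cong refl suminf_mult summable_exp_entry)
  finally show ?thesis .
qed

lemma exp_entry_commute:
  assumes "i \<in> X" "j \<in> X"
  shows "(\<Sum>l\<in>X. \<alpha> i l * exp_entry X \<alpha> t l j) = (\<Sum>l\<in>X. exp_entry X \<alpha> t i l * \<alpha> l j)"
proof -
  have "(\<Sum>l\<in>X. \<alpha> i l * exp_entry X \<alpha> t l j) = (\<Sum>l\<in>X. suminf (\<lambda>k. \<alpha> i l * (pow_entry X \<alpha> k l j / fact k * t ^ k)))"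
    unfolding exp_entry_def by (intro sum.cong refl suminf_mult[symmetric] summable_exp_entry)
  also have "\<dots> = suminf (\<lambda>k. \<Sum>l\<in>X. \<alpha> i l * (pow_entry X \<alpha> k l j / fact k * t ^ k))"
    by (rule suminf_sum[symmetric]) (intro summable_mult summable_exp_entry)
  also have "\<dots> = suminf (\<lambda>k. pow_entry X \<alpha> (Suc k) i j / fact k * t ^ k)"
    by (simp add: sum_divide_distrib sum_distrib_right mult.assoc)
  also have "\<dots> = suminf (\<lambda>k. \<Sum>l\<in>X. (pow_entry X \<alpha> k i l / fact k * t ^ k) * \<alpha> l j)"
    unfolding pow_entry_right[OF assms] sum_divide_distrib sum_distrib_right by (simp add: mult.commute mult.left_commute)
  also have "\<dots> = (\<Sum>l\<in>X. suminf (\<lambda>k. (pow_entry X \<alpha> k i l / fact k * t ^ k) * \<alpha> l j))"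
    by (rule suminf_sum) (intro summable_mult2 summable_exp_entry assms)
  also have "\<dots> = (\<Sum>l\<in>X. exp_entry X \<alpha> t i l * \<alpha> l j)"
    unfolding exp_entry_def by (intro sum.cong refl suminf_mult2[symmetric] summable_exp_entry assms)
  finally show ?thesis .
qed

lemma exp_entry_0: "exp_entry X \<alpha> 0 i j = (if i = j then 1 else 0)"
  unfolding exp_entry_def using powser_zero[of "\<lambda>k. pow_entry X \<alpha> k i j / fact k"] by simp

text \<open>The product of the exponentials at \<open>t\<close> and \<open>- t\<close> has
  derivative 0, because the exponential commutes with \<open>\<alpha>\<close>, and it is the
  identity at 0.\<close>

lemma exp_entry_inverse:
  assumes ij: "i \<in> X" "j \<in> X"
  shows "(\<Sum>l\<in>X. exp_entry X \<alpha> t i l * exp_entry X \<alpha> (- t) l j) = (if i = j then 1 else 0)"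
proof -
  let ?E = "exp_entry X \<alpha>"
  define G where "G t = (\<Sum>l\<in>X. ?E t i l * ?E (- t) l j)" for t
  have "(G has_field_derivative 0) (at t)" for t
  proof -
    have "(G has_field_derivative (\<Sum>l\<in>X. (\<Sum>m\<in>X. \<alpha> i m * ?E t m l) * ?E (- t) l j + (\<Sum>m\<in>X. \<alpha> l m * ?E (- t) m j) * - 1 * ?E t i l)) (at t)"
      unfolding G_def
    proof (rule DERIV_sum)
      fix l assume l: "l \<in> X"
      have "((\<lambda>t. ?E (- t) l j) has_field_derivative (\<Sum>m\<in>X. \<alpha> l m * ?E (- t) m j) * - 1) (at t)"
        by (rule DERIV_chain2[OF exp_entry_deriv[OF l]]) (auto intro!: derivative_eq_intros)
      from DERIV_mult[OF exp_entry_deriv[OF ij(1), of l t] this]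
      show "((\<lambda>t. ?E t i l * ?E (- t) l j) has_field_derivative
          (\<Sum>m\<in>X. \<alpha> i m * ?E t m l) * ?E (- t) l j + (\<Sum>m\<in>X. \<alpha> l m * ?E (- t) m j) * - 1 * ?E t i l) (at t)" .
    qed
    also have "(\<Sum>l\<in>X. (\<Sum>m\<in>X. \<alpha> i m * ?E t m l) * ?E (- t) l j + (\<Sum>m\<in>X. \<alpha> l m * ?E (- t) m j) * - 1 * ?E t i l)
        = (\<Sum>l\<in>X. (\<Sum>m\<in>X. ?E t i m * \<alpha> m l) * ?E (- t) l j) - (\<Sum>l\<in>X. \<Sum>m\<in>X. ?E t i l * (\<alpha> l m * ?E (- t) m j))"
      by (simp add: exp_entry_commute[OF ij(1)] sum.distrib sum_negf sum_distrib_left sum_subtractf algebra_simps)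
    also have "(\<Sum>l\<in>X. (\<Sum>m\<in>X. ?E t i m * \<alpha> m l) * ?E (- t) l j) = (\<Sum>l\<in>X. \<Sum>m\<in>X. ?E t i l * (\<alpha> l m * ?E (- t) m j))"
      unfolding sum_distrib_right by (subst sum.swap) (simp add: mult.assoc)
    finally show ?thesis by simp
  qed
  then have "\<exists>c. \<forall>t\<in>UNIV. G t = c" by (intro has_field_derivative_zero_constant) auto
  then have "G t = G 0" by auto
  also have "G 0 = (if i = j then 1 else 0)"
    unfolding G_def using fin ij by (simp add: exp_entry_0 if_distrib[of "\<lambda>x. x * _"] if_distrib[of "(*) _"] cong: if_cong)
  finally show ?thesis by (simp add: G_def)
qed

definition exp_mat :: "complex \<Rightarrow> ('v \<times> 'v) cvec"
  where "exp_mat t = vec (X \<times> X) (\<lambda>(i, j). exp_entry X \<alpha> t i j)"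

lemma exp_mat_cspace: "exp_mat t \<in> cspace (X \<times> X)"
  unfolding exp_mat_def by (rule vec_cspace) (simp add: fin)

lemma coef_exp_mat: "i \<in> X \<Longrightarrow> j \<in> X \<Longrightarrow> coef (exp_mat t) (i, j) = exp_entry X \<alpha> t i j"
  unfolding exp_mat_def using fin by (simp add: coef_vec)

lemma exp_mat_inverse:
  assumes "v \<in> cspace X" shows "mat_app (exp_mat t) (mat_app (exp_mat (- t)) v) = v"
proof (rule poly_mapping_eqI)
  fix i
  show "coef (mat_app (exp_mat t) (mat_app (exp_mat (- t)) v)) i = coef v i"
  proof (cases "i \<in> X")
    case True
    have "coef (mat_app (exp_mat t) (mat_app (exp_mat (- t)) v)) i = 
        (\<Sum>j\<in>X. exp_entry X \<alpha> t i j * (\<Sum>k\<in>X. exp_entry X \<alpha> (- t) j k * coef v k))"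
      unfolding coef_mat_app[OF exp_mat_cspace fin] mvec_def using True by (simp add: coef_exp_mat)
    also have "\<dots> = (\<Sum>k\<in>X. (\<Sum>j\<in>X. exp_entry X \<alpha> t i j * exp_entry X \<alpha> (- t) j k) * coef v k)"
      unfolding sum_distrib_left sum_distrib_right by (subst sum.swap) (simp add: mult.assoc)
    also have "\<dots> = coef v i"
      using True fin by (simp add: exp_entry_inverse if_distrib[of "\<lambda>x. x * _"] cong: if_cong)
    finally show ?thesis .
  next
    case False
    then show ?thesis using cspace_coef[OF assms] cspace_coef[OF mat_app_cspace[OF exp_mat_cspace]] by metis
  qed
qed

lemma exp_mat_GL: "exp_mat t \<in> GL X"
proof -
  have "bij_betw (mat_app (exp_mat t)) (cspace X) (cspace X)"
    by (rule bij_betwI[where g = "mat_app (exp_mat (- t))"])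
      (use mat_app_cspace[OF exp_mat_cspace] exp_mat_inverse[of _ t] exp_mat_inverse[of _ "- t"] in auto)
  then show ?thesis using exp_mat_cspace by (simp add: GL_def)
qed

text \<open>Along the flow \<open>u' = \<alpha> u\<close> the derivative of \<open>f\<close> is the
  syzygy evaluated at \<open>u\<close>, so \<open>f\<close> is constant on orbits.\<close>

lemma exp_mat_invariant:
  assumes f: "f \<in> polys X" and a: "\<And>x. (\<Sum>i\<in>X. peval (pdiff i f) x * (\<Sum>l\<in>X. \<alpha> i l * x l)) = 0"
  shows "pullback (exp_mat t) f = f"
proof (rule peval_eqI)
  fix x
  define u where "u t = mvec (exp_mat t) X x" for t
  have u: "u t i = (\<Sum>j\<in>X. exp_entry X \<alpha> t i j * x j)" if "i \<in> X" for t i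
    unfolding u_def mvec_def using that by (simp add: coef_exp_mat)
  have "((\<lambda>t. peval f (u t)) has_field_derivative (\<Sum>i\<in>X. peval (pdiff i f) (u t) * (\<Sum>l\<in>X. \<alpha> i l * u t l))) (at t)" for t
  proof (rule peval_chain[OF fin f])
    fix i assume i: "i \<in> X"
    have "((\<lambda>t. \<Sum>j\<in>X. exp_entry X \<alpha> t i j * x j) has_field_derivative (\<Sum>j\<in>X. (\<Sum>l\<in>X. \<alpha> i l * exp_entry X \<alpha> t l j) * x j)) (at t)"
      by (intro DERIV_sum DERIV_cmult_right exp_entry_deriv i)
    also have "(\<Sum>j\<in>X. (\<Sum>l\<in>X. \<alpha> i l * exp_entry X \<alpha> t l j) * x j) = (\<Sum>l\<in>X. \<alpha> i l * u t l)"
      unfolding sum_distrib_right by (subst sum.swap) (simp add: u sum_distrib_left mult.assoc)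
    finally show "((\<lambda>t. u t i) has_field_derivative (\<Sum>l\<in>X. \<alpha> i l * u t l)) (at t)" using u[OF i] by simp
  qed
  then have "((\<lambda>t. peval f (u t)) has_field_derivative 0) (at t)" for t using a by simp
  then have "\<exists>c. \<forall>t\<in>UNIV. peval f (u t) = c" by (intro has_field_derivative_zero_constant) auto
  then have "peval f (u t) = peval f (u 0)" by auto
  also have "\<dots> = peval f x"
    by (rule peval_cong_vars[OF f]) (use fin in \<open>simp add: u exp_entry_0 if_distrib[of "\<lambda>x. x * _"] cong: if_cong\<close>)
  finally show "peval (pullback (exp_mat t) f) x = peval f x"
    by (simp add: peval_pullback[OF exp_mat_cspace fin] u_def)
qed

text \<open>A polynomial in the entries of the exponential is an entire function of
  \<open>t\<close>; unless it is constant, its zeros are countable.\<close>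

lemma exp_mat_countable:
  assumes q: "q \<in> polys (X \<times> X)" and t0: "peval q (coef (exp_mat t0)) \<noteq> 0"
  shows "countable {t. peval q (coef (exp_mat t)) = 0}"
proof -
  let ?h = "\<lambda>t. peval q (coef (exp_mat t))"
  have "\<exists>D. (?h has_field_derivative D) (at t)" for t
  proof -
    have "(?h has_field_derivative (\<Sum>p\<in>X \<times> X. peval (pdiff p q) (coef (exp_mat t)) * (\<Sum>l\<in>X. \<alpha> (fst p) l * exp_entry X \<alpha> t l (snd p)))) (at t)"
    proof (rule peval_chain[OF _ q])
      fix p assume "p \<in> X \<times> X"
      then obtain i j where p: "p = (i, j)" "i \<in> X" "j \<in> X" by blast
      then show "((\<lambda>s. coef (exp_mat s) p) has_field_derivative (\<Sum>l\<in>X. \<alpha> (fst p) l * exp_entry X \<alpha> t l (snd p))) (at t)"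
        using exp_entry_deriv[OF p(2), of j t] by (simp add: coef_exp_mat)
    qed (simp add: fin)
    then show ?thesis by blast
  qed
  then have hol: "?h holomorphic_on UNIV" unfolding holomorphic_on_def field_differentiable_def by simp
  show ?thesis
  proof (cases "?h constant_on UNIV")
    case True
    then have "{t. ?h t = 0} = {}" using t0 by (auto simp: constant_on_def)
    then show ?thesis by simp
  next
    case False
    moreover have "fsigma (UNIV :: complex set)" using fsigma.intros[of "\<lambda>_. UNIV :: complex set"] by simp
    ultimately show ?thesis using holomorphic_countable_zeros[OF hol open_UNIV connected_UNIV] False by simp
  qed
qed

end

text \<open>The exponentials of the coefficient matrix fix \<open>f\<close> and trace a curve of
  automorphisms through the identity. Dimension 0 forces the curve to be one point of projective
  space, hence the matrix to be scalar, and Euler's relation excludes a nonzero scalar.\<close>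

lemma no_linear_syzygy_of_finite_aut:
  assumes fin: "finite X" and f: "f \<in> forms X d" "f \<noteq> 0" and d: "0 < d" and dim: "dim_projective_aut X f = 0"
  shows "no_linear_syzygy X f"
  unfolding no_linear_syzygy_def
proof (intro allI impI)
  interpret graded X by (simp add: graded_def fin)
  fix a assume a: "\<forall>i\<in>X. a i \<in> forms X 1" and syz: "(\<Sum>i\<in>X. a i * pdiff i f) = 0"
  define \<alpha> where "\<alpha> i j = coef (a i) (sgl j 1)" for i j
  have pa: "peval (a i) x = (\<Sum>l\<in>X. \<alpha> i l * x l)" if "i \<in> X" for i x
    unfolding \<alpha>_def by (rule peval_linear) (use a that in blast)
  have syz': "(\<Sum>i\<in>X. peval (pdiff i f) x * (\<Sum>l\<in>X. \<alpha> i l * x l)) = 0" for x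
  proof -
    have "(\<Sum>i\<in>X. peval (pdiff i f) x * (\<Sum>l\<in>X. \<alpha> i l * x l)) = peval (\<Sum>i\<in>X. a i * pdiff i f) x"
      by (simp add: peval_simps pa mult.commute)
    then show ?thesis by (simp add: syz ev.geval_0)
  qed
  have fp: "f \<in> polys X" using f(1) forms_subset_polys by blast
  define E where "E t = exp_mat X \<alpha> t" for t
  have Ec: "E t \<in> cspace (X \<times> X)" for t unfolding E_def by (rule exp_mat_cspace[OF fin])
  define T where "T = subtopology (zariski_proj (X \<times> X)) (projective_aut X f)"
  have Xne: "X \<noteq> {}"
  proof
    assume "X = {}"
    then have "f \<in> polys {}" using fp by simp
    then have "f = pconst (coef f 0)" by (rule polys_empty)
    moreover have "peval f (\<lambda>_. 0) = 0" by (rule peval_0_eq_0[OF f(1) d]) simp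
    ultimately have "coef f 0 = 0" by (metis ev.geval_pconst)
    then show False using \<open>f = pconst (coef f 0)\<close> f(2) by simp
  qed
  have E0: "E t \<noteq> 0" for t
  proof
    assume 0: "E t = 0"
    obtain i where i: "i \<in> X" using Xne by blast
    have "sgl i 1 = mat_app (E t) (mat_app (E (- t)) (sgl i 1))"
      unfolding E_def by (rule exp_mat_inverse[OF fin, symmetric]) (use i in \<open>simp add: cspace_def\<close>)
    also have "\<dots> = 0" by (simp add: 0 mat_app_def)
    finally show False by (metis lookup_single_eq lookup_zero zero_neq_one)
  qed
  define \<gamma> where "\<gamma> t = line (E t)" for t
  have \<gamma>: "\<gamma> t \<in> projective_aut X f" for t
    unfolding projective_aut_def \<gamma>_def pullback_line
  proof (intro CollectI exI conjI refl)
    show "E t \<in> GL X" unfolding E_def by (rule exp_mat_GL[OF fin])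
    show "line (pullback (E t) f) = line f" unfolding E_def by (simp only: exp_mat_invariant[OF fin fp syz'])
  qed simp
  have \<gamma>P: "\<gamma> t \<in> proj (X \<times> X)" for t unfolding proj_iff \<gamma>_def using Ec E0 by blast
  have \<gamma>T: "\<gamma> t \<in> topspace T" for t
  proof -
    show ?thesis using \<gamma> \<gamma>P unfolding T_def by (simp add: topspace_zariski_proj)
  qed
  have scalar: "\<gamma> t = \<gamma> 0" for t
  proof (rule ccontr)
    assume s: "\<gamma> t \<noteq> \<gamma> 0"
    have "krull_dim T \<noteq> 0"
    proof (rule krull_dim_pos[where x = "\<gamma> 0", OF _ \<gamma>T s refl])
      have "closedin (zariski_proj (X \<times> X)) {\<gamma> 0}" unfolding \<gamma>_def by (rule closedin_line_zariski_proj[OF Ec E0])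
      then show "closedin T {\<gamma> 0}" unfolding T_def using \<gamma>[of 0] by (auto simp: closedin_subtopology)
      fix O' t assume O': "openin T O'" and t: "\<gamma> t \<in> O'"
      then obtain O2 where O2: "openin (zariski_proj (X \<times> X)) O2" "O' = O2 \<inter> projective_aut X f" by (auto simp: T_def openin_subtopology)
      have "generate_topology_on {{L \<in> proj (X \<times> X). \<forall>v\<in>L. peval q (coef v) \<noteq> 0} |q k. q \<in> forms (X \<times> X) k} O2"
        using O2(1) by (simp add: zariski_proj_def openin_topology_generated_by_iff)
      moreover have "\<gamma> t \<in> O2" using O2 t by blast
      ultimately have "countable {t. \<gamma> t \<notin> O2}"
      proof (induction O2 arbitrary: t rule: generate_topology_on.induct)
        case (Int a b)
        have "{t. \<gamma> t \<notin> a \<inter> b} = {t. \<gamma> t \<notin> a} \<union> {t. \<gamma> t \<notin> b}" by blast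
        then show ?case using Int by auto
      next
        case (UN K)
        then obtain k where k: "k \<in> K" "\<gamma> t \<in> k" by blast
        have "{t. \<gamma> t \<notin> \<Union>K} \<subseteq> {t. \<gamma> t \<notin> k}" using k by blast
        then show ?case using UN.IH[OF k] countable_subset by blast
      next
        case (Basis s)
        then obtain q k where q: "s = {L \<in> proj (X \<times> X). \<forall>v\<in>L. peval q (coef v) \<noteq> 0}" "q \<in> forms (X \<times> X) k" by blast
        have iff: "\<gamma> t \<in> s \<longleftrightarrow> peval q (coef (E t)) \<noteq> 0" for t
          unfolding q(1) using line_forall_nonzero[OF q(2), of "E t"] \<gamma>P[of t] by (simp add: \<gamma>_def)
        have qp: "q \<in> polys (X \<times> X)" using q(2) forms_subset_polys by blast
        have "countable {t. peval q (coef (E t)) = 0}"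
          unfolding E_def by (rule exp_mat_countable[OF fin qp, where ?t0.0 = t]) (use Basis.prems iff in \<open>simp add: E_def\<close>)
        then show ?case by (simp add: iff)
      qed simp
      moreover have "{t. \<gamma> t \<notin> O'} = {t. \<gamma> t \<notin> O2}" using O2(2) \<gamma> by blast
      ultimately show "countable {t. \<gamma> t \<notin> O'}" by simp
    qed
    then show False using dim by (simp add: dim_projective_aut_def T_def)
  qed
  \<comment> \<open>All exponentials are scalar matrices. Their derivatives at 0 are the entries of
    \<open>\<alpha>\<close>: off the diagonal these vanish, and on it they agree.\<close>
  have "\<exists>c. E t = smul c (E 0)" for t using scalar[of t] unfolding \<gamma>_def line_eq_iff by blast
  then obtain c where c: "\<And>t. E t = smul (c t) (E 0)" by metis
  have e: "exp_entry X \<alpha> t i j = c t * (if i = j then 1 else 0)" if "i \<in> X" "j \<in> X" for t i j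
    using arg_cong[OF c[of t], of "\<lambda>p. coef p (i, j)"] that 
    unfolding E_def by (simp add: coef_exp_mat[OF fin] exp_entry_0[OF fin])
  have der: "((\<lambda>t. exp_entry X \<alpha> t i j) has_field_derivative \<alpha> i j) (at 0)" if "i \<in> X" "j \<in> X" for i j
    using exp_entry_deriv[OF fin that(1), of \<alpha> j 0] that fin
    by (simp add: exp_entry_0[OF fin] if_distrib[of "(*) _"] cong: if_cong)
  have off: "\<alpha> i j = 0" if "i \<in> X" "j \<in> X" "i \<noteq> j" for i j
  proof -
    have "((\<lambda>t. exp_entry X \<alpha> t i j) has_field_derivative 0) (at 0)" using e[OF that(1,2)] that(3) by simp
    then show ?thesis using DERIV_unique[OF der[OF that(1,2)]] by blast
  qed
  have diag: "\<alpha> i i = \<alpha> j j" if "i \<in> X" "j \<in> X" for i j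
  proof -
    have "(\<lambda>t. exp_entry X \<alpha> t i i) = (\<lambda>t. exp_entry X \<alpha> t j j)" using e[OF that(1) that(1)] e[OF that(2) that(2)] by simp
    then show ?thesis using DERIV_unique der[OF that(1) that(1)] der[OF that(2) that(2)] by metis
  qed
  obtain i0 where i0: "i0 \<in> X" using Xne by blast
  have lin: "(\<Sum>l\<in>X. \<alpha> i l * x l) = \<alpha> i0 i0 * x i" if i: "i \<in> X" for i and x :: "'a \<Rightarrow> complex"
  proof -
    have "(\<Sum>l\<in>X. \<alpha> i l * x l) = (\<Sum>l\<in>{i}. \<alpha> i l * x l)" by (rule sum.mono_neutral_right) (use fin i off in auto)
    then show ?thesis using diag[OF i i0] by simp
  qed
  obtain x where x: "peval f x \<noteq> 0" using peval_nonzero_ex[OF f(2)] .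
  \<comment> \<open>For a scalar matrix the syzygy is a multiple of Euler's relation, evaluated at a
    point where \<open>f\<close> does not vanish.\<close>
  have "0 = (\<Sum>i\<in>X. peval (pdiff i f) x * (\<alpha> i0 i0 * x i))" using syz'[of x] by (simp add: lin)
  also have "\<dots> = \<alpha> i0 i0 * (\<Sum>i\<in>X. x i * peval (pdiff i f) x)" by (simp add: sum_distrib_left algebra_simps)
  finally have "\<alpha> i0 i0 = 0" using x d by (simp add: euler[OF fin f(1)])
  then show "\<forall>i\<in>X. a i = 0" using lin pa by (intro ballI peval_eq_0) simp
qed

section \<open>The Jacobian ideal in high degrees\<close>

lemma linear_combination_nonzero:
  assumes "finite X" "i \<in> X" "b i \<noteq> 0"
  shows "(\<Sum>j\<in>X. smul (b j) (pvar j)) \<noteq> 0"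
proof
  assume "(\<Sum>j\<in>X. smul (b j) (pvar j)) = 0"
  then have "peval (\<Sum>j\<in>X. smul (b j) (pvar j)) (\<lambda>j. if j = i then 1 else 0) = 0" by (simp only: ev.geval_0)
  moreover have "peval (\<Sum>j\<in>X. smul (b j) (pvar j)) (\<lambda>j. if j = i then 1 else 0) = b i"
    using assms(1,2) by (simp add: peval_simps peval_smul if_distrib[of "(*) _"] cong: if_cong)
  ultimately show False using assms(3) by simp
qed

context graded begin

lemma generic_linear_form:
  assumes P: "finite P" "\<And>v. v \<in> P \<Longrightarrow> v \<in> cspace X \<and> v \<noteq> 0"
    and a: "a \<in> forms X 1" "a \<noteq> 0" and card: "2 \<le> card X"
  obtains l y where "l \<in> forms X 1" "l \<noteq> 0" "\<And>v. v \<in> P \<Longrightarrow> peval l (coef v) \<noteq> 0" "peval l y = 0" "peval a y \<noteq> 0"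
proof -
  obtain p where p: "p \<in> X" "coef a (sgl p 1) \<noteq> 0" using linear_nonzero_coef[OF a] .
  have "\<not> X \<subseteq> {p}" using card card_mono[of "{p}" X] by auto
  then obtain q where q: "q \<in> X" "q \<noteq> p" by blast
  let ?\<alpha> = "\<lambda>i. coef a (sgl i 1)"
  define E where "E v = (\<Sum>j\<in>X. smul (coef v j) (pvar j))" for v :: "'v cvec"
  \<comment> \<open>The minor of \<open>a\<close> and \<open>l\<close> in the columns
    \<open>p\<close> and \<open>q\<close>. Its nonvanishing at \<open>\<xi>\<close>, the
    coefficients of \<open>l\<close>, makes \<open>a\<close> nonzero at the vector \<open>y\<close>
    of the plane of \<open>p\<close> and \<open>q\<close> that is killed by
    \<open>l\<close>.\<close>
  define D where "D = smul (?\<alpha> p) (pvar q) - smul (?\<alpha> q) (pvar p)"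
  have D: "peval D x = ?\<alpha> p * x q - ?\<alpha> q * x p" for x by (simp add: D_def peval_simps peval_smul)
  have D0: "D \<noteq> 0"
  proof
    assume "D = 0"
    then have "peval D (\<lambda>i. if i = q then 1 else 0) = 0" by (simp only: ev.geval_0)
    then show False using p q by (simp add: D)
  qed
  have E0: "E v \<noteq> 0" if v: "v \<in> P" for v
  proof -
    obtain i where "coef v i \<noteq> 0" using P(2)[OF v] by (metis lookup_zero poly_mapping_eqI)
    moreover from this have "i \<in> X" using cspace_coef P(2)[OF v] by metis
    ultimately show ?thesis unfolding E_def by (intro linear_combination_nonzero finX)
  qed
  have nz: "e \<noteq> 0" if "e \<in> insert D (E ` P)" for e using that D0 E0 by auto
  have "finite (insert D (E ` P))" using P(1) by simp
  then obtain \<xi> where \<xi>: "\<And>e. e \<in> insert D (E ` P) \<Longrightarrow> peval e \<xi> \<noteq> 0"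
    by (rule peval_common_nonzero[OF _ nz]) (assumption, rule that)
  define l where "l = (\<Sum>j\<in>X. smul (\<xi> j) (pvar j))"
  have pl: "peval l x = (\<Sum>j\<in>X. \<xi> j * x j)" for x by (simp add: l_def peval_simps peval_smul)
  define y where "y i = (if i = q then - \<xi> p else if i = p then \<xi> q else 0)" for i
  have sumy: "(\<Sum>j\<in>X. b j * y j) = b p * \<xi> q - b q * \<xi> p" for b :: "'v \<Rightarrow> complex"
  proof -
    have "(\<Sum>j\<in>X. b j * y j) = (\<Sum>j\<in>{p, q}. b j * y j)"
      by (rule sum.mono_neutral_right) (use p q finX in \<open>auto simp: y_def\<close>)
    then show ?thesis using q by (simp add: y_def)
  qed
  show ?thesis
  proof (rule that)
    show l: "l \<in> forms X 1" unfolding l_def by (intro forms_sum forms_smul pvar_forms)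
    show "peval l y = 0" by (simp add: pl sumy)
    show ay: "peval a y \<noteq> 0" using \<xi>[of D] by (simp add: peval_linear[OF a(1)] sumy D)
    show "peval l (coef v) \<noteq> 0" if "v \<in> P" for v
      using \<xi>[of "E v"] that by (simp add: pl E_def peval_simps peval_smul mult.commute)
    have "\<xi> p \<noteq> 0 \<or> \<xi> q \<noteq> 0" using \<xi>[of D] by (auto simp: D)
    then show "l \<noteq> 0" unfolding l_def using p(1) q(1) linear_combination_nonzero[OF finX, of _ \<xi>] by blast
  qed
qed

lemma peval_coef_vec: "p \<in> forms X k \<Longrightarrow> peval p (coef (vec X x)) = peval p x"
  by (rule peval_cong_vars[of p X]) (use forms_subset_polys coef_vec[OF finX] in auto)

lemma zero_of_partials:
  assumes d: "0 < d" and f: "f \<in> forms X d" and x: "\<And>i. i \<in> X \<Longrightarrow> peval (pdiff i f) x = 0" and j: "j \<in> X" "x j \<noteq> 0"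
  shows "line (vec X x) \<in> sing X f"
proof -
  have u: "vec X x \<in> cspace X" "vec X x \<noteq> 0"
    using j vec_cspace[OF finX] coef_vec[OF finX, of x j] by auto
  show ?thesis
    by (subst sing_iff[OF finX d f u]) (simp add: peval_coef_vec[OF pdiff_forms[OF f]] x)
qed

lemma linear_form_avoiding_sing:
  assumes f: "f \<in> forms X d" and d: "0 < d" and iso: "at_most_isolated_singularities X f"
    and a: "a \<in> forms X 1" "a \<noteq> 0" and card: "2 \<le> card X"
  obtains l y where "l \<in> forms X 1" "l \<noteq> 0" "peval l y = 0" "peval a y \<noteq> 0"
    "\<forall>x. peval l x = 0 \<longrightarrow> (\<forall>i\<in>X. peval (pdiff i f) x = 0) \<longrightarrow> (\<forall>j\<in>X. x j = 0)"
proof -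
  define rep where "rep L = (SOME v. v \<in> cspace X \<and> v \<noteq> 0 \<and> L = line v)" for L
  have rep: "rep L \<in> cspace X \<and> rep L \<noteq> 0 \<and> L = line (rep L)" if "L \<in> sing X f" for L
  proof -
    have "L \<in> proj X" by (rule subsetD[OF sing_subset that])
    then have "\<exists>v. v \<in> cspace X \<and> v \<noteq> 0 \<and> L = line v" unfolding proj_iff by blast
    then show ?thesis unfolding rep_def by (rule someI_ex)
  qed
  have fs: "finite (sing X f)" by (rule finite_sing[OF finX d f iso])
  obtain l y where l: "l \<in> forms X 1" "l \<noteq> 0" "\<And>v. v \<in> rep ` sing X f \<Longrightarrow> peval l (coef v) \<noteq> 0"
    and y: "peval l y = 0" "peval a y \<noteq> 0"
  proof (rule generic_linear_form[of "rep ` sing X f", OF _ _ a card])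
    show "finite (rep ` sing X f)" using fs by (rule finite_imageI)
    show "v \<in> cspace X \<and> v \<noteq> 0" if "v \<in> rep ` sing X f" for v
    proof -
      from that obtain L where "L \<in> sing X f" "v = rep L" by blast
      then show ?thesis using rep[of L] by simp
    qed
  qed (rule that)
  have "x j = 0" if x: "peval l x = 0" "\<And>i. i \<in> X \<Longrightarrow> peval (pdiff i f) x = 0" and j: "j \<in> X" for x j
  proof (rule ccontr)
    assume xj: "x j \<noteq> 0"
    note s = zero_of_partials[where x = x and j = j, OF d f x(2) j xj]
    obtain c where "rep (line (vec X x)) = smul c (vec X x)" using rep[OF s] line_eq_iff by metis
    then have "peval l (coef (rep (line (vec X x)))) = 0" using peval_coef_smul[OF l(1)] peval_coef_vec[OF l(1)] x(1) by simp
    then show False using l(3) s by blast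
  qed
  then show ?thesis by (intro that[OF l(1,2) y]) blast
qed

text \<open>The gradient of \<open>f\<close> satisfies a relation \<open>R\<close> on the hyperplane \<open>l = 0\<close>. If \<open>R(w) \<noteq> 0\<close>, the gradient is not a
  multiple of \<open>w\<close> there, so the combinations of the partial derivatives that are orthogonal to \<open>w\<close> have
  no common zero on this hyperplane.\<close>

lemma syzygy_hilb_ge:
  assumes card: "card X = Suc n" "0 < n" and d: "2 \<le> d" and f: "f \<in> forms X d" and iso: "at_most_isolated_singularities X f"
    and a: "\<And>i. i \<in> X \<Longrightarrow> a i \<in> forms X 1" "(\<Sum>i\<in>X. a i * pdiff i f) = 0" "i0 \<in> X" "a i0 \<noteq> 0"
  obtains K where "\<And>k. k \<ge> K \<Longrightarrow> (d - 1) ^ n \<le> hilb (gspan (\<lambda>i. pdiff i f) (\<lambda>_. d - 1) X) k + (d - 1) ^ (n - 1)"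
proof -
  define e where "e = d - 1"
  have e: "0 < e" using d by (simp add: e_def)
  define F where "F i = pdiff i f" for i
  have F: "F i \<in> forms X e" for i unfolding F_def e_def by (rule pdiff_forms[OF f])
  obtain l y where l: "l \<in> forms X 1" "l \<noteq> 0" and y: "peval l y = 0" "peval (a i0) y \<noteq> 0"
    and lsing: "\<forall>x. peval l x = 0 \<longrightarrow> (\<forall>i\<in>X. peval (pdiff i f) x = 0) \<longrightarrow> (\<forall>j\<in>X. x j = 0)"
  proof (rule linear_form_avoiding_sing[OF f _ iso a(1)[OF a(3)] a(4)])
    show "2 \<le> card X" "0 < d" using card d by auto
  qed (rule that)
  obtain m where m: "n = Suc m" using card(2) gr0_implies_Suc by blast
  have cX: "card X = Suc (Suc m)" using card m by simp
  obtain r R where R: "R \<in> forms X r" "R \<noteq> 0" "\<And>x. peval l x = 0 \<Longrightarrow> peval R (\<lambda>i. peval (F i) x) = 0"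
    by (rule algebraic_dependence_on_hypersurface[OF finX cX finX cX l(1,2) e F]) (rule that)
  \<comment> \<open>The value of \<open>A\<close> at \<open>w\<close> is that of the combined
    coefficient \<open>a'\<close> at \<open>y\<close>. Choosing \<open>w\<close> outside its zeros
    keeps \<open>a'\<close> nonzero at a point of the hyperplane.\<close>
  define A where "A = (\<Sum>j\<in>X. smul (peval (a j) y) (pvar j))"
  have "A \<noteq> 0" unfolding A_def by (rule linear_combination_nonzero[where i = i0]) (use finX a(3) y(2) in simp_all)
  then have nz: "p \<noteq> 0" if "p \<in> {A, R}" for p using that R(2) by blast
  have "finite {A, R}" by simp
  then obtain w where "\<And>p. p \<in> {A, R} \<Longrightarrow> peval p w \<noteq> 0"
    by (rule peval_common_nonzero[OF _ nz]) (assumption, rule that)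
  then have w: "peval A w \<noteq> 0" "peval R w \<noteq> 0" by auto
  have Aw: "peval A w = (\<Sum>j\<in>X. w j * peval (a j) y)" by (simp add: A_def peval_simps peval_smul mult.commute)
  have "\<not> (\<forall>j\<in>X. w j = 0)"
  proof
    assume "\<forall>j\<in>X. w j = 0"
    then show False using w(1) unfolding Aw by simp
  qed
  then obtain j0 where j0: "j0 \<in> X" "w j0 \<noteq> 0" by blast
  define a' where "a' = (\<Sum>j\<in>X. smul (w j) (a j))"
  \<comment> \<open>For \<open>j \<noteq> j0\<close> these form a basis of the coefficient vectors
    orthogonal to \<open>w\<close> when applied to the partial derivatives; together with
    \<open>F j0\<close> they span all the partial derivatives.\<close>
  define G' where "G' j = smul (w j0) (F j) - smul (w j) (F j0)" for j
  have G': "G' j \<in> forms X e" for j unfolding G'_def by (intro forms_diff forms_smul F)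
  have "card (X - {j0}) = n" using j0(1) card finX by simp
  then obtain \<sigma> where \<sigma>: "bij_betw \<sigma> {..<n} (X - {j0})"
    using ex_bij_betw_nat_finite[of "X - {j0}"] finX by (auto simp: atLeast0LessThan)
  let ?G = "\<lambda>k. G' (\<sigma> k)"
  have \<sigma>j: "\<exists>k<n. j = \<sigma> k" if "j \<in> X" "j \<noteq> j0" for j
    using that \<sigma> unfolding bij_betw_def by blast
  have van: "x v = 0" if x: "peval l x = 0" "\<And>k. k < n \<Longrightarrow> peval (?G k) x = 0" and v: "v \<in> X" for x v
  proof -
    define t where "t = peval (F j0) x / w j0"
    have Ft: "peval (F j) x = t * w j" if j: "j \<in> X" for j
    proof (cases "j = j0")
      case False
      then have "peval (G' j) x = 0" using \<sigma>j[OF j] x(2) by blast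
      then show ?thesis using j0(2) by (simp add: G'_def peval_simps peval_smul t_def field_simps)
    qed (use j0(2) in \<open>simp add: t_def\<close>)
    have "0 = peval R (\<lambda>i. peval (F i) x)" using R(3)[OF x(1)] by simp
    also have "\<dots> = peval R (\<lambda>i. t * w i)"
      by (rule peval_cong_vars[of R X]) (use R(1) forms_subset_polys Ft in auto)
    also have "\<dots> = t ^ r * peval R w" by (rule peval_homog[OF R(1)])
    finally have "t = 0" using w(2) by simp
    then have "\<forall>i\<in>X. peval (pdiff i f) x = 0" using Ft by (simp add: F_def)
    then show ?thesis using lsing x(1) v by blast
  qed
  have a': "a' \<in> forms X 1" unfolding a'_def by (intro forms_sum forms_smul a)
  have a'y: "peval a' y \<noteq> 0" using w(1) unfolding Aw by (simp add: a'_def peval_simps peval_smul)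
  have mem: "F j0 * a' \<in> gspan ?G (\<lambda>_. e) {..<n} (e + 1)"
  proof (rule gspan_of_combination)
    show "F j0 * a' \<in> forms X (e + 1)" by (rule forms_mult[OF F a'])
    \<comment> \<open>Subtracting \<open>w j0\<close> times the syzygy rewrites
      \<open>F j0 * a'\<close> as a combination of the \<open>G' j\<close>, which is the relation
      required by \<open>syzygy_bound\<close>.\<close>
    have "F j0 * a' = F j0 * a' - smul (w j0) (\<Sum>i\<in>X. a i * F i)" using a(2) by (simp add: F_def smul_conv)
    also have "\<dots> = (\<Sum>j\<in>X. - a j * G' j)"
      unfolding a'_def cv.scale_sum_right sum_distrib_left sum_subtractf[symmetric]
      by (rule sum.cong) (simp_all add: G'_def smul_conv algebra_simps)
    also have "\<dots> = (\<Sum>j\<in>X - {j0}. - a j * G' j)"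
      by (rule sum.mono_neutral_right) (use finX in \<open>auto simp: G'_def\<close>)
    also have "\<dots> = (\<Sum>k<n. - a (\<sigma> k) * ?G k)" by (rule sum.reindex_bij_betw[OF \<sigma>, symmetric])
    finally show "F j0 * a' = (\<Sum>k<n. - a (\<sigma> k) * ?G k)" .
    show "- a (\<sigma> k) \<in> polys X" if "k \<in> {..<n}" for k
      using a(1)[of "\<sigma> k"] that \<sigma> forms_subset_polys polys_uminus unfolding bij_betw_def by blast
  qed (rule G')
  obtain K where K: "\<And>k. k \<ge> K \<Longrightarrow> e ^ n \<le> hilb (gadd (gspan ?G (\<lambda>_. e) {..<n}) (F j0) e) k + e ^ (n - 1)"
  proof (rule syzygy_bound[where G = ?G and g = "F j0" and a = a' and y = y and l = l and e = e, OF card l(1,2) e _ _ a' y(1) a'y])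
    show "F j0 * a' \<in> gspan ?G (\<lambda>_. e) {..<n} (e + 1)" by (rule mem)
    show "?G k \<in> forms X e" for k by (rule G')
    show "x v = 0" if "peval l x = 0" "\<And>k. k < n \<Longrightarrow> peval (?G k) x = 0" "v \<in> X" for x v using that by (rule van)
    show "F j0 \<in> forms X e" by (rule F)
  qed (rule that)
  let ?I = "gadd (gspan ?G (\<lambda>_. e) {..<n}) (F j0) e"
  have gG: "gideal (gspan ?G (\<lambda>_. e) {..<n})" by (rule gideal_gspan) (simp_all add: G')
  have gI: "gideal ?I" by (rule gideal_gadd[OF gG F])
  have "F j \<in> ?I e" if j: "j \<in> X" for j
  proof -
    have 0: "F j0 \<in> ?I e" using gadd_mem[OF gG, of 1 e e "F j0"] one_forms[of X] by (simp add: cofac_def)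
    show ?thesis
    proof (cases "j = j0")
      case False
      then obtain k where "k < n" "j = \<sigma> k" using \<sigma>j[OF j] by blast
      then have "G' j \<in> ?I e" using gspan_gen[of "{..<n}" k ?G "\<lambda>_. e"] gadd_superset[of "gspan ?G (\<lambda>_. e) {..<n}" e "F j0" e] by auto
      then have "smul (1 / w j0) (G' j + smul (w j) (F j0)) \<in> ?I e"
        using 0 gidealD(1)[OF gI] by (intro cv.subspace_scale cv.subspace_add)
      moreover have "smul (1 / w j0) (G' j + smul (w j) (F j0)) = F j" using j0(2) by (simp add: G'_def)
      ultimately show ?thesis by simp
    qed (use 0 in simp)
  qed
  then have "gspan F (\<lambda>_. e) X k \<subseteq> ?I k" for k by (intro gspan_least gI)
  then have "hilb ?I k \<le> hilb (gspan F (\<lambda>_. e) X) k" for k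
    by (intro hilb_mono gI gideal_gspan finX F)
  then have "e ^ n \<le> hilb (gspan F (\<lambda>_. e) X) k + e ^ (n - 1)" if "k \<ge> K" for k
    using K[OF that] by (meson add_le_mono1 order_trans)
  then show ?thesis unfolding e_def F_def by (rule that)
qed

text \<open>With \<open>l\<close> adjoined the ideal is everything in high degrees, so the Hilbert
  function in degree \<open>k + 1\<close> is that of the colon ideal by \<open>l\<close> in degree
  \<open>k\<close>, hence at most the value in degree \<open>k\<close>. Once the decreasing values
  are constant, \<open>l\<close> can be cancelled.\<close>

lemma hilb_stabilizes:
  assumes z: "finite A" "\<And>i. i \<in> A \<Longrightarrow> z i \<in> forms X (\<delta> i)" and l: "l \<in> forms X 1" "l \<noteq> 0"
    and van: "\<And>x v. peval l x = 0 \<Longrightarrow> (\<And>i. i \<in> A \<Longrightarrow> peval (z i) x = 0) \<Longrightarrow> v \<in> X \<Longrightarrow> x v = 0"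
  obtains K C where "\<And>k u. K \<le> k \<Longrightarrow> u \<in> forms X k \<Longrightarrow> l * u \<in> gspan z \<delta> A (k + 1) \<Longrightarrow> u \<in> gspan z \<delta> A k"
    "\<And>k. K \<le> k \<Longrightarrow> hilb (gspan z \<delta> A) k \<le> C"
proof -
  let ?J = "gspan z \<delta> A"
  have J: "gideal ?J" by (rule gideal_gspan[OF z])
  define z' where "z' j = (case j of None \<Rightarrow> l | Some i \<Rightarrow> z i)" for j
  define \<delta>' where "\<delta>' j = (case j of None \<Rightarrow> 1 | Some i \<Rightarrow> \<delta> i)" for j
  let ?A = "insert None (Some ` A)"
  obtain K where K: "\<And>k. k \<ge> K \<Longrightarrow> gspan z' \<delta>' ?A k = forms X k"
  proof (rule full_of_no_zeros[of ?A z' \<delta>'])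
    show "z' i \<in> forms X (\<delta>' i)" if "i \<in> ?A" for i using that z(2) l(1) by (auto simp: z'_def \<delta>'_def)
    show "x v = 0" if h: "\<And>i. i \<in> ?A \<Longrightarrow> peval (z' i) x = 0" "v \<in> X" for x v
    proof (rule van[OF _ _ h(2)])
      show "peval l x = 0" using h(1)[of None] by (simp add: z'_def)
      show "peval (z i) x = 0" if "i \<in> A" for i using h(1)[of "Some i"] that by (simp add: z'_def)
    qed
  qed (use z(1) in auto)
  have gl: "gideal (gadd ?J l 1)" by (rule gideal_gadd[OF J l(1)])
  have full: "gadd ?J l 1 k = forms X k" if k: "k \<ge> K" for k
  proof
    have "z' i \<in> gadd ?J l 1 (\<delta>' i)" if i: "i \<in> ?A" for i
    proof (cases i)
      case None
      then show ?thesis using gadd_mem[OF J, of 1 1 1 l] one_forms[of X] by (simp add: z'_def \<delta>'_def cofac_def)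
    next
      case (Some j)
      then show ?thesis using i gspan_gen[OF z(1), of j z \<delta>] gadd_superset[of ?J "\<delta> j" l 1] by (auto simp: z'_def \<delta>'_def)
    qed
    then show "forms X k \<subseteq> gadd ?J l 1 k" using gspan_least[OF gl, of ?A z' \<delta>' k] K[OF k] by blast
  qed (rule gidealD(7)[OF gl])
  have step: "hilb ?J (Suc k) = hilb (gcol ?J l 1) k" if "k \<ge> K" for k
  proof -
    have "hilb (gadd ?J l 1) (k + 1) = 0" unfolding hilb_eq_0[OF gl] by (rule full) (use that in simp)
    then show ?thesis using hilb_gadd[OF J l, of k] by simp
  qed
  have gc: "gideal (gcol ?J l 1)" by (rule gideal_gcol[OF J l(1)])
  have sup: "?J k \<subseteq> gcol ?J l 1 k" for k by (rule gcol_superset[OF J l(1)])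
  have dec: "hilb ?J (Suc k) \<le> hilb ?J k" if "k \<ge> K" for k
    unfolding step[OF that] by (rule hilb_mono[OF J gc sup])
  have mono: "hilb ?J (k + j) \<le> hilb ?J k" if "k \<ge> K" for k j
  proof (induction j)
    case (Suc j)
    then show ?case using dec[of "k + j"] that by simp
  qed simp
  \<comment> \<open>The smallest value attained from degree \<open>K\<close> on; after it is
    attained, monotonicity keeps the function there.\<close>
  define m where "m = (LEAST m. \<exists>k\<ge>K. hilb ?J k = m)"
  have "\<exists>k\<ge>K. hilb ?J k = hilb ?J K" by blast
  then have "\<exists>m. \<exists>k\<ge>K. hilb ?J k = m" by (rule exI)
  from LeastI_ex[OF this] have "\<exists>k\<ge>K. hilb ?J k = m" unfolding m_def .
  then obtain k1 where k1: "k1 \<ge> K" "hilb ?J k1 = m" by blast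
  have const: "hilb ?J k = m" if "k \<ge> k1" for k
  proof (rule antisym)
    show "hilb ?J k \<le> m" using mono[OF k1(1), of "k - k1"] that k1(2) by simp
    have "\<exists>j\<ge>K. hilb ?J j = hilb ?J k" using that k1(1) by (intro exI[of _ k]) simp
    then show "m \<le> hilb ?J k" unfolding m_def by (rule Least_le)
  qed
  show ?thesis
  proof (rule that)
    fix k u assume k: "k1 \<le> k" and u: "u \<in> forms X k" "l * u \<in> ?J (k + 1)"
    have "hilb ?J k \<le> hilb (gcol ?J l 1) k" using const[of k] const[of "Suc k"] step[of k] k k1(1) by simp
    from hilb_eqD[OF J gc sup this] show "u \<in> ?J k" using u by (simp add: gcol_def)
  next
    show "hilb ?J k \<le> m" if "k1 \<le> k" for k using const[OF that] by simp
  qed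
qed

end

section \<open>Local rings and Tjurina numbers\<close>

lemma ring_on_simps [simp]:
  "carrier (ring_on A) = A" "x \<otimes>\<^bsub>ring_on A\<^esub> y = x * y" "x \<oplus>\<^bsub>ring_on A\<^esub> y = x + y" "\<one>\<^bsub>ring_on A\<^esub> = 1" "\<zero>\<^bsub>ring_on A\<^esub> = 0"
  by (simp_all add: ring_on_def)

text \<open>A subring of a commutative ring type. Both the polynomials in \<open>X\<close> and the
  germs at a point obtain their record-based ring structure, ideals and cosets from it.\<close>

locale concrete_ring =
  fixes A :: "'a::comm_ring_1 set"
  assumes one_mem: "1 \<in> A" and add_mem: "x \<in> A \<Longrightarrow> y \<in> A \<Longrightarrow> x + y \<in> A"
    and mult_mem: "x \<in> A \<Longrightarrow> y \<in> A \<Longrightarrow> x * y \<in> A" and uminus_mem: "x \<in> A \<Longrightarrow> - x \<in> A"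
begin

lemma zero_mem: "0 \<in> A"
  using add_mem[OF one_mem uminus_mem[OF one_mem]] by simp

lemma cring_ring_on: "cring (ring_on A)"
proof (rule cringI)
  show "abelian_group (ring_on A)"
  proof (rule abelian_groupI)
    show "\<exists>y\<in>carrier (ring_on A). y \<oplus>\<^bsub>ring_on A\<^esub> x = \<zero>\<^bsub>ring_on A\<^esub>" if "x \<in> carrier (ring_on A)" for x
      using uminus_mem that by (intro bexI[of _ "- x"]) auto
  qed (use add_mem zero_mem in \<open>auto simp: algebra_simps\<close>)
  show "Group.comm_monoid (ring_on A)"
    by (rule comm_monoidI) (use mult_mem one_mem in \<open>auto simp: algebra_simps\<close>)
qed (simp add: algebra_simps)

lemma ring_ring_on: "ring (ring_on A)"
  by (rule cring.axioms(1)[OF cring_ring_on])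

lemma a_minus_ring_on: "x \<in> A \<Longrightarrow> y \<in> A \<Longrightarrow> x \<ominus>\<^bsub>ring_on A\<^esub> y = x - y"
proof -
  interpret R: cring "ring_on A" by (rule cring_ring_on)
  assume xy: "x \<in> A" "y \<in> A"
  have "\<ominus>\<^bsub>ring_on A\<^esub> y = - y" by (rule R.minus_equality) (use xy uminus_mem in auto)
  then show ?thesis by (simp add: a_minus_def)
qed

lemma ideal_ring_onI:
  assumes "I \<subseteq> A" "0 \<in> I" "\<And>x y. x \<in> I \<Longrightarrow> y \<in> I \<Longrightarrow> x + y \<in> I" "\<And>r x. r \<in> A \<Longrightarrow> x \<in> I \<Longrightarrow> r * x \<in> I"
  shows "ideal I (ring_on A)"
proof (rule idealI[OF ring_ring_on])
  interpret R: cring "ring_on A" by (rule cring_ring_on)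
  show "subgroup I (add_monoid (ring_on A))"
  proof (rule R.add.subgroupI)
    show "\<ominus>\<^bsub>ring_on A\<^esub> x \<in> I" if "x \<in> I" for x
    proof -
      have "\<ominus>\<^bsub>ring_on A\<^esub> x = - x" by (rule R.minus_equality) (use that assms(1) uminus_mem in auto)
      also have "\<dots> = - 1 * x" by simp
      also have "\<dots> \<in> I" by (rule assms(4)[OF uminus_mem[OF one_mem] that])
      finally show ?thesis .
    qed
  qed (use assms in auto)
qed (simp add: assms(4), metis assms(4) mult.commute ring_on_simps(1,2))

lemma idealD:
  assumes "ideal I (ring_on A)"
  shows "I \<subseteq> A" "0 \<in> I" "\<And>x y. x \<in> I \<Longrightarrow> y \<in> I \<Longrightarrow> x + y \<in> I" "\<And>r x. r \<in> A \<Longrightarrow> x \<in> I \<Longrightarrow> r * x \<in> I"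
proof -
  interpret ideal I "ring_on A" by (rule assms)
  show "I \<subseteq> A" "0 \<in> I" using a_subset additive_subgroup.zero_closed[OF is_additive_subgroup] by auto
  show "\<And>x y. x \<in> I \<Longrightarrow> y \<in> I \<Longrightarrow> x + y \<in> I" using additive_subgroup.a_closed[OF is_additive_subgroup] by simp
  show "\<And>r x. r \<in> A \<Longrightarrow> x \<in> I \<Longrightarrow> r * x \<in> I" using I_l_closed by simp
qed

lemma ideal_sum:
  assumes "ideal I (ring_on A)" "\<And>j. j \<in> B \<Longrightarrow> x j \<in> I"
  shows "sum x B \<in> I"
  using assms(2) by (induction B rule: infinite_finite_induct) (use idealD[OF assms(1)] in auto)

lemma coset_eq_iff:
  assumes I: "ideal I (ring_on A)" and xy: "x \<in> A" "y \<in> A"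
  shows "a_r_coset (ring_on A) I x = a_r_coset (ring_on A) I y \<longleftrightarrow> x - y \<in> I"
  using ring.quotient_eq_iff_same_a_r_cos[OF ring_ring_on I, of x y] xy a_minus_ring_on[OF xy] by simp

end

section \<open>Germs at a point and the dimension of their quotients\<close>

definition germs :: "nat set \<Rightarrow> (nat \<Rightarrow> complex) \<Rightarrow> nat cpoly fract set"
  where "germs J a = {Fract p q |p q. p \<in> polys J \<and> q \<in> polys J \<and> peval q a \<noteq> 0}"

lemma local_ring_eq: "local_ring J a = ring_on (germs J a)"
  by (simp add: local_ring_def germs_def)

lemma peval_nonzero_imp: "peval q a \<noteq> 0 \<Longrightarrow> q \<noteq> 0"
  by (auto simp: ev.geval_0)

lemma germsI: "p \<in> polys J \<Longrightarrow> q \<in> polys J \<Longrightarrow> peval q a \<noteq> 0 \<Longrightarrow> Fract p q \<in> germs J a"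
  unfolding germs_def by blast

lemma germs_poly: "p \<in> polys J \<Longrightarrow> Fract p 1 \<in> germs J a"
  by (rule germsI) (simp_all add: ev.geval_1)

lemma germsE:
  assumes "r \<in> germs J a"
  obtains p q where "r = Fract p q" "p \<in> polys J" "q \<in> polys J" "peval q a \<noteq> 0" "q \<noteq> 0"
  using assms peval_nonzero_imp unfolding germs_def by blast

interpretation germs: concrete_ring "germs J a" for J a
proof
  show "1 \<in> germs J a" using germs_poly[OF one_polys] by (simp add: One_fract_def)
  fix x y assume "x \<in> germs J a" "y \<in> germs J a"
  then obtain p q p' q' where x: "x = Fract p q" "p \<in> polys J" "q \<in> polys J" "peval q a \<noteq> 0" "q \<noteq> 0"
    and y: "y = Fract p' q'" "p' \<in> polys J" "q' \<in> polys J" "peval q' a \<noteq> 0" "q' \<noteq> 0" by (elim germsE) blast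
  show "x + y \<in> germs J a"
    unfolding x(1) y(1) add_fract[OF x(5) y(5)]
    by (rule germsI) (use x y in \<open>auto intro!: polys_add polys_mult simp: peval_simps\<close>)
  show "x * y \<in> germs J a"
    unfolding x(1) y(1) mult_fract by (rule germsI) (use x y in \<open>auto intro!: polys_mult simp: peval_simps\<close>)
next
  fix x assume "x \<in> germs J a"
  then obtain p q where x: "x = Fract p q" "p \<in> polys J" "q \<in> polys J" "peval q a \<noteq> 0" "q \<noteq> 0" by (rule germsE)
  show "- x \<in> germs J a" unfolding x(1) minus_fract by (rule germsI) (use x polys_uminus in auto)
qed

abbreviation cst :: "complex \<Rightarrow> nat cpoly fract" where "cst c \<equiv> Fract (pconst c) 1"

lemma cst_germs: "cst c \<in> germs J a"
  by (rule germs_poly) simp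

text \<open>Linear independence over the constants in the quotient by \<open>T\<close>, expressed by
  representatives instead of cosets.\<close>

definition germs_independent :: "nat set \<Rightarrow> (nat \<Rightarrow> complex) \<Rightarrow> nat cpoly fract set \<Rightarrow> nat \<Rightarrow> (nat \<Rightarrow> nat cpoly fract) \<Rightarrow> bool"
  where "germs_independent J a T m r \<longleftrightarrow> (\<forall>j<m. r j \<in> germs J a) \<and>
    (\<forall>c. (\<Sum>j<m. cst (c j) * r j) \<in> T \<longrightarrow> (\<forall>j<m. c j = 0))"

text \<open>The bound \<open>C\<close> makes the quotient finite-dimensional, so that the description operator is meaningful.\<close>

lemma germs_independent_le_dimension:
  assumes T: "ideal T (local_ring J a)" "1 \<notin> T" and bound: "\<And>m r. germs_independent J a T m r \<Longrightarrow> m \<le> C"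
    and r: "germs_independent J a T m r"
  defines "Q \<equiv> FactRing (local_ring J a) T" and "K \<equiv> range (\<lambda>c. a_r_coset (local_ring J a) T (cst c))"
  shows "m \<le> (THE k. ring.dimension Q k K (carrier Q))"
proof -
  let ?R = "ring_on (germs J a)"
  have T': "ideal T ?R" using T(1) by (simp add: local_ring_eq)
  interpret T: ideal T ?R by (rule T')
  define cls where "cls r = a_r_coset ?R T r" for r
  have Q: "Q = FactRing ?R T" by (simp add: Q_def local_ring_eq)
  interpret Q: ring Q unfolding Q by (rule T.quotient_is_ring)
  interpret h: ring_hom_ring ?R Q cls unfolding Q cls_def[abs_def] by (rule T.rcos_ring_hom_ring)
  have cls_eq: "cls x = cls y \<longleftrightarrow> x - y \<in> T" if "x \<in> germs J a" "y \<in> germs J a" for x y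
    unfolding cls_def by (rule germs.coset_eq_iff[OF T' that])
  have cls_0: "\<zero>\<^bsub>Q\<^esub> = cls 0" using h.hom_zero by simp
  have surj: "\<exists>r\<in>germs J a. u = cls r" if "u \<in> carrier Q" for u
    using that by (auto simp: Q FactRing_def A_RCOSETS_def RCOSETS_def cls_def a_r_coset_def)
  let ?C = "ring_on (UNIV :: complex set)"
  interpret C: concrete_ring "UNIV :: complex set" by unfold_locales auto
  interpret C: cring ?C by (rule C.cring_ring_on)
  have field: "field ?C"
  proof (rule C.cring_fieldI2)
    show "\<exists>b\<in>carrier ?C. x \<otimes>\<^bsub>?C\<^esub> b = \<one>\<^bsub>?C\<^esub>" if "x \<in> carrier ?C" "x \<noteq> \<zero>\<^bsub>?C\<^esub>" for x
      using that by (intro bexI[of _ "1 / x"]) auto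
  qed simp
  have cst: "cst (x + y) = cst x + cst y" "cst (x * y) = cst x * cst y" "cst 1 = 1" "cst 0 = 0" for x y
    by (simp_all add: pconst_add pconst_mult One_fract_def Zero_fract_def)
  \<comment> \<open>The complex numbers map onto the set \<open>K\<close> of classes of constants.
    As the quotient is nonzero, the map is injective and \<open>K\<close> is a subfield.\<close>
  define \<kappa> where "\<kappa> c = cls (cst c)" for c
  interpret k: ring_hom_ring ?C Q \<kappa>
  proof (rule ring_hom_ringI)
    show "\<kappa> x \<in> carrier Q" for x using h.hom_closed cst_germs by (simp add: \<kappa>_def)
    show "\<kappa> (x \<otimes>\<^bsub>?C\<^esub> y) = \<kappa> x \<otimes>\<^bsub>Q\<^esub> \<kappa> y" for x y using h.hom_mult[of "cst x" "cst y"] cst_germs by (simp add: \<kappa>_def cst)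
    show "\<kappa> (x \<oplus>\<^bsub>?C\<^esub> y) = \<kappa> x \<oplus>\<^bsub>Q\<^esub> \<kappa> y" for x y using h.hom_add[of "cst x" "cst y"] cst_germs by (simp add: \<kappa>_def cst)
    show "\<kappa> \<one>\<^bsub>?C\<^esub> = \<one>\<^bsub>Q\<^esub>" using h.hom_one by (simp add: \<kappa>_def One_fract_def)
  qed (unfold_locales)
  have K: "K = \<kappa> ` carrier ?C" by (simp add: K_def \<kappa>_def[abs_def] cls_def local_ring_eq)
  have one: "\<one>\<^bsub>Q\<^esub> \<noteq> \<zero>\<^bsub>Q\<^esub>"
    using h.hom_one cls_eq[OF germs.one_mem germs.zero_mem] T(2) unfolding cls_0 by auto
  have sub: "subfield K Q"
    unfolding K by (rule k.img_is_subfield(2)[OF field.carrier_is_subfield[OF field] one])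
  have \<kappa>0: "c = 0" if "\<kappa> c = \<zero>\<^bsub>Q\<^esub>" for c
    using k.img_is_subfield(1)[OF field.carrier_is_subfield[OF field] one] k.hom_zero that by (auto simp: inj_on_def)
  have comb: "Q.combine (map (\<lambda>j. \<kappa> (c j)) js) (map (\<lambda>j. cls (r j)) js) = cls (\<Sum>j\<leftarrow>js. cst (c j) * r j)
      \<and> (\<Sum>j\<leftarrow>js. cst (c j) * r j) \<in> germs J a" if "\<And>j. j \<in> set js \<Longrightarrow> r j \<in> germs J a" for c r and js :: "nat list"
    using that
  proof (induction js)
    case Nil
    then show ?case using germs.zero_mem by (simp add: cls_0)
  next
    case (Cons j js)
    then have IH: "Q.combine (map (\<lambda>j. \<kappa> (c j)) js) (map (\<lambda>j. cls (r j)) js) = cls (\<Sum>j\<leftarrow>js. cst (c j) * r j)"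
      "(\<Sum>j\<leftarrow>js. cst (c j) * r j) \<in> germs J a" and rj: "r j \<in> germs J a" by auto
    have m: "cst (c j) * r j \<in> germs J a" by (rule germs.mult_mem[OF cst_germs rj])
    have "\<kappa> (c j) \<otimes>\<^bsub>Q\<^esub> cls (r j) = cls (cst (c j) * r j)" using h.hom_mult[of "cst (c j)" "r j"] cst_germs rj by (simp add: \<kappa>_def)
    moreover have "cls (cst (c j) * r j) \<oplus>\<^bsub>Q\<^esub> cls (\<Sum>j\<leftarrow>js. cst (c j) * r j) = cls (cst (c j) * r j + (\<Sum>j\<leftarrow>js. cst (c j) * r j))"
      using h.hom_add[of "cst (c j) * r j" "\<Sum>j\<leftarrow>js. cst (c j) * r j"] m IH(2) by simp
    ultimately show ?case using IH m germs.add_mem by simp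
  qed
  have upt: "(\<Sum>j\<leftarrow>[0..<m]. x j) = (\<Sum>j<m. x j)" for x :: "nat \<Rightarrow> nat cpoly fract" and m
    by (simp add: interv_sum_list_conv_sum_set_nat atLeast0LessThan)
  have indep_iff: "Q.independent K (map (\<lambda>j. cls (r j)) [0..<m]) \<longleftrightarrow> germs_independent J a T m r"
    if r: "\<forall>j<m. r j \<in> germs J a" for m r
  proof
    assume ind: "Q.independent K (map (\<lambda>j. cls (r j)) [0..<m])"
    have "\<forall>j<m. c j = 0" if c: "(\<Sum>j<m. cst (c j) * r j) \<in> T" for c
    proof -
      have e: "Q.combine (map (\<lambda>j. \<kappa> (c j)) [0..<m]) (map (\<lambda>j. cls (r j)) [0..<m]) = cls (\<Sum>j<m. cst (c j) * r j)"
        and mem: "(\<Sum>j<m. cst (c j) * r j) \<in> germs J a"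
        using comb[of "[0..<m]" r c] r unfolding upt by auto
      note e
      also have "cls (\<Sum>j<m. cst (c j) * r j) = \<zero>\<^bsub>Q\<^esub>" unfolding cls_0 by (subst cls_eq[OF mem germs.zero_mem]) (simp add: c)
      finally have "set (take (length (map (\<lambda>j. cls (r j)) [0..<m])) (map (\<lambda>j. \<kappa> (c j)) [0..<m])) \<subseteq> {\<zero>\<^bsub>Q\<^esub>}"
        by (intro Q.independent_imp_trivial_combine[OF sub ind]) (auto simp: K)
      then have "(\<lambda>j. \<kappa> (c j)) ` {0..<m} \<subseteq> {\<zero>\<^bsub>Q\<^esub>}" by simp
      then have "\<kappa> (c j) = \<zero>\<^bsub>Q\<^esub>" if "j < m" for j using that by (simp add: image_subset_iff)
      then show ?thesis using \<kappa>0 by blast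
    qed
    then show "germs_independent J a T m r" using r by (simp add: germs_independent_def)
  next
    assume ind: "germs_independent J a T m r"
    show "Q.independent K (map (\<lambda>j. cls (r j)) [0..<m])"
    proof (rule ccontr)
      assume dep: "\<not> Q.independent K (map (\<lambda>j. cls (r j)) [0..<m])"
      have "set (map (\<lambda>j. cls (r j)) [0..<m]) \<subseteq> carrier Q" using r h.hom_closed by auto
      from Q.dependent_imp_non_trivial_combine[OF sub this dep] obtain Ks
        where Ks: "length Ks = m" "Q.combine Ks (map (\<lambda>j. cls (r j)) [0..<m]) = \<zero>\<^bsub>Q\<^esub>" "set Ks \<subseteq> K" "set Ks \<noteq> {\<zero>\<^bsub>Q\<^esub>}"
        by auto
      have "\<forall>j<m. \<exists>c. Ks ! j = \<kappa> c"
      proof (intro allI impI)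
        fix j assume "j < m"
        then have "Ks ! j \<in> K" using Ks(1,3) nth_mem by blast
        then show "\<exists>c. Ks ! j = \<kappa> c" unfolding K by blast
      qed
      then obtain c where c: "\<And>j. j < m \<Longrightarrow> Ks ! j = \<kappa> (c j)" by metis
      have Ksc: "Ks = map (\<lambda>j. \<kappa> (c j)) [0..<m]" by (rule nth_equalityI) (use Ks(1) c in auto)
      have e: "Q.combine Ks (map (\<lambda>j. cls (r j)) [0..<m]) = cls (\<Sum>j<m. cst (c j) * r j)" and mem: "(\<Sum>j<m. cst (c j) * r j) \<in> germs J a"
        using comb[of "[0..<m]" r c] r unfolding upt Ksc by auto
      have "cls (\<Sum>j<m. cst (c j) * r j) = cls 0" using e Ks(2) cls_0 by simp
      then have "(\<Sum>j<m. cst (c j) * r j) \<in> T" unfolding cls_eq[OF mem germs.zero_mem] by simp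
      then have "\<forall>j<m. c j = 0" using ind by (simp add: germs_independent_def)
      then have Kz: "Ks ! j = \<zero>\<^bsub>Q\<^esub>" if "j < m" for j using c[OF that] that k.hom_zero by simp
      have "set Ks \<subseteq> {\<zero>\<^bsub>Q\<^esub>}"
      proof
        fix x assume "x \<in> set Ks"
        then obtain j where "j < m" "x = Ks ! j" using Ks(1) by (auto simp: in_set_conv_nth)
        then show "x \<in> {\<zero>\<^bsub>Q\<^esub>}" using Kz by simp
      qed
      then have "Ks = []" using Ks(4) by (cases Ks) auto
      then have "map (\<lambda>j. cls (r j)) [0..<m] = []" using Ks(1) by simp
      then show False using dep by simp
    qed
  qed
  have to_fam: "\<exists>r. germs_independent J a T (length Us) r \<and> Us = map (\<lambda>j. cls (r j)) [0..<length Us]"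
    if Us: "Q.independent K Us" for Us
  proof -
    have "set Us \<subseteq> carrier Q" by (rule Q.independent_in_carrier[OF Us])
    then have "\<forall>j<length Us. \<exists>r. r \<in> germs J a \<and> Us ! j = cls r" using surj nth_mem by blast
    then obtain r where r: "\<And>j. j < length Us \<Longrightarrow> r j \<in> germs J a \<and> Us ! j = cls (r j)" by metis
    have e: "Us = map (\<lambda>j. cls (r j)) [0..<length Us]" by (rule nth_equalityI) (use r in auto)
    have "germs_independent J a T (length Us) r"
      by (subst indep_iff[symmetric]) (use r e Us in auto)
    then show ?thesis using e by blast
  qed
  have bounded: "length Us \<le> C" if "Q.independent K Us" for Us
    using to_fam[OF that] bound by blast
  \<comment> \<open>The maximal length of an independent list, available because of the bound. A
    list of this length spans, so \<open>M\<close> is the dimension picked by the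
    description.\<close>
  obtain M where M: "\<exists>Us. Q.independent K Us \<and> length Us = M" "\<And>Us. Q.independent K Us \<Longrightarrow> length Us \<le> M"
  proof -
    let ?S = "{length Us |Us. Q.independent K Us}"
    have fin: "finite ?S" by (rule finite_subset[of _ "{..C}"]) (use bounded in auto)
    have "length ([] :: nat cpoly fract set list) \<in> ?S" using Q.li_Nil by blast
    then have "Max ?S \<in> ?S" by (intro Max_in fin) blast
    moreover have "length Us \<le> Max ?S" if "Q.independent K Us" for Us using that by (intro Max_ge fin) blast
    ultimately show ?thesis by (intro that[of "Max ?S"]) auto
  qed
  obtain Us where Us: "Q.independent K Us" "length Us = M" using M(1) by blast
  have "Q.Span K Us = carrier Q"
  proof
    show "Q.Span K Us \<subseteq> carrier Q"
      by (rule Q.Span_in_carrier[OF _ Q.independent_in_carrier[OF Us(1)]]) (use subfieldE(3)[OF sub] in blast)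
    show "carrier Q \<subseteq> Q.Span K Us"
    proof (rule ccontr)
      assume "\<not> carrier Q \<subseteq> Q.Span K Us"
      then obtain u where "u \<in> carrier Q" "u \<notin> Q.Span K Us" by blast
      then have "Q.independent K (u # Us)" using Us(1) by (intro Q.li_Cons)
      then show False using M(2)[of "u # Us"] Us(2) by simp
    qed
  qed
  then have dim: "Q.dimension M K (carrier Q)" using Q.dimensionI[OF sub Us(1)] Us(2) by blast
  then have "(THE k. Q.dimension k K (carrier Q)) = M" using Q.dimension_is_inj[OF sub] by (intro the_equality) blast+
  moreover have "m \<le> M"
  proof -
    have "Q.independent K (map (\<lambda>j. cls (r j)) [0..<m])"
      by (subst indep_iff) (use r in \<open>auto simp: germs_independent_def\<close>)
    from M(2)[OF this] show ?thesis by simp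
  qed
  ultimately show ?thesis by simp
qed

section \<open>The Jacobian ideal and the Tjurina numbers\<close>

abbreviation dehom :: "'v \<Rightarrow> 'v cpoly \<Rightarrow> 'v cpoly"
  where "dehom i \<equiv> psubst (\<lambda>j. if j = i then 1 else pvar j)"

lemma peval_dehom: "peval (dehom i p) x = peval p (x(i := 1))"
  unfolding peval_psubst by (rule arg_cong[of _ _ "peval p"]) (auto simp: peval_simps)

lemma dehom_polys: "p \<in> polys X \<Longrightarrow> dehom i p \<in> polys (X - {i})"
  by (erule polys_psubst) (auto intro: pvar_polys)

lemma dehom_id: "p \<in> polys (X - {i}) \<Longrightarrow> dehom i p = p"
  by (rule peval_eqI, unfold peval_dehom, rule peval_cong_vars[of _ "X - {i}"]) auto

text \<open>A form is determined by its values where \<open>x i = 1\<close> at all points with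
  \<open>x i \<noteq> 0\<close>; multiplication by \<open>pvar i\<close> covers the remaining
  points.\<close>

lemma dehom_eq_0:
  assumes g: "g \<in> forms X k" and i: "i \<in> X" and 0: "dehom i g = 0"
  shows "g = 0"
proof -
  have "pvar i * g = 0"
  proof (rule peval_eq_0)
    fix x
    show "peval (pvar i * g) x = 0"
    proof (cases "x i = 0")
      case False
      have "x = (\<lambda>j. x i * ((\<lambda>j. x j / x i)(i := 1)) j)" using False by (auto simp: fun_eq_iff)
      then have "peval g x = x i ^ k * peval g ((\<lambda>j. x j / x i)(i := 1))" using peval_homog[OF g] by metis
      also have "peval g ((\<lambda>j. x j / x i)(i := 1)) = 0" using 0 peval_dehom[of i g] by (simp add: ev.geval_0)
      finally show ?thesis by (simp add: peval_simps)
    qed (simp add: peval_simps)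
  qed
  moreover have "pvar i \<noteq> (0 :: 'a cpoly)" using ev.geval_pvar[of i "\<lambda>_. 1"] by (auto simp: ev.geval_0)
  ultimately show ?thesis using cpoly_no_zero_divisors by blast
qed

text \<open>Each homogeneous part is padded by a power of \<open>pvar i\<close>. Every sufficiently
  large degree can be reached, so several polynomials can be brought to a common one.\<close>

lemma homogenize:
  assumes p: "p \<in> polys (X - {i})" and i: "i \<in> X"
  obtains N where "\<And>k. k \<ge> N \<Longrightarrow> \<exists>g\<in>forms X k. dehom i g = p"
proof -
  obtain D where D: "p = (\<Sum>j\<le>D. hpart j p)" by (rule hpart_decomp)
  have h: "hpart j p \<in> polys (X - {i})" "hpart j p \<in> forms X j" for j
  proof -
    show "hpart j p \<in> polys (X - {i})" using hpart_forms[OF p, of j] forms_subset_polys by blast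
    have "p \<in> polys X" using p by (auto simp: polys_def)
    then show "hpart j p \<in> forms X j" by (rule hpart_forms)
  qed
  show ?thesis
  proof (rule that)
    fix k assume k: "k \<ge> D"
    let ?g = "\<Sum>j\<le>D. pvar i ^ (k - j) * hpart j p"
    have "pvar i ^ (k - j) * hpart j p \<in> forms X k" if "j \<le> D" for j
    proof -
      have "pvar i ^ (k - j) * hpart j p \<in> forms X ((k - j) * 1 + j)" by (intro forms_mult forms_power pvar_forms i h)
      then show ?thesis using that k by simp
    qed
    then have "?g \<in> forms X k" by (intro forms_sum) simp
    moreover have "dehom i ?g = p"
      by (subst (2) D) (simp add: psubst_simps dehom_id[OF h(1)])
    ultimately show "\<exists>g\<in>forms X k. dehom i g = p" by blast
  qed
qed

lemma homogenize_family:
  assumes A: "finite A" and p: "\<And>j. j \<in> A \<Longrightarrow> p j \<in> polys (X - {i})" and i: "i \<in> X"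
  obtains N where "\<And>k. k \<ge> N \<Longrightarrow> \<exists>g. \<forall>j\<in>A. g j \<in> forms X k \<and> dehom i (g j) = p j"
proof -
  have "\<forall>j\<in>A. \<exists>N. \<forall>k\<ge>N. \<exists>g\<in>forms X k. dehom i g = p j" using homogenize[OF p i] by metis
  from bchoice[OF this] obtain N where N: "\<forall>j\<in>A. \<forall>k\<ge>N j. \<exists>g\<in>forms X k. dehom i g = p j" ..
  show ?thesis
  proof (rule that)
    fix k assume k: "k \<ge> sum N A"
    have "\<exists>g. g \<in> forms X k \<and> dehom i g = p j" if j: "j \<in> A" for j
    proof -
      have "N j \<le> sum N A" by (rule member_le_sum[OF j _ A]) simp
      then show ?thesis using N j k by (meson le_trans)
    qed
    then show "\<exists>g. \<forall>j\<in>A. g j \<in> forms X k \<and> dehom i (g j) = p j" by metis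
  qed
qed

lemma pdiff_dehom:
  assumes X: "finite X" and p: "p \<in> polys X" and j: "j \<in> X" "j \<noteq> i"
  shows "pdiff j (dehom i p) = dehom i (pdiff j p)"
proof (rule peval_eqI)
  fix x
  have d: "((\<lambda>s. peval q (y(j := s))) has_field_derivative peval (pdiff j q) y) (at (y j))" if q: "q \<in> polys X" for q and y :: "'a \<Rightarrow> complex"
  proof -
    have "((\<lambda>s. peval q (y(j := s))) has_field_derivative (\<Sum>k\<in>X. peval (pdiff k q) (y(j := y j)) * (if k = j then 1 else 0))) (at (y j))"
      by (rule peval_chain[OF X q]) auto
    also have "(\<Sum>k\<in>X. peval (pdiff k q) (y(j := y j)) * (if k = j then 1 else 0)) = peval (pdiff j q) y"
      using X j(1) by (simp add: if_distrib[of "(*) _"] cong: if_cong)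
    finally show ?thesis .
  qed
  have "dehom i p \<in> polys X" using dehom_polys[OF p, of i] by (auto simp: polys_def)
  from d[OF this, of x] have "((\<lambda>s. peval p ((x(i := 1))(j := s))) has_field_derivative peval (pdiff j (dehom i p)) x) (at (x j))"
    using j(2) by (simp add: peval_dehom fun_upd_twist)
  moreover have "((\<lambda>s. peval p ((x(i := 1))(j := s))) has_field_derivative peval (pdiff j p) (x(i := 1))) (at (x j))"
    using d[OF p, of "x(i := 1)"] j(2) by simp
  ultimately show "peval (pdiff j (dehom i p)) x = peval (dehom i (pdiff j p)) x"
    unfolding peval_dehom by (rule DERIV_unique)
qed

lemma Fract_sum: "(\<Sum>j\<in>B. Fract (p j) 1) = Fract (\<Sum>j\<in>B. p j) 1" for p :: "'b \<Rightarrow> nat cpoly"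
  by (induction B rule: infinite_finite_induct) (simp_all add: Zero_fract_def)

locale singular_point =
  fixes X :: "nat set" and d :: nat and f :: "nat cpoly" and i :: nat and v :: "nat cvec"
  assumes X: "finite X" and d: "0 < d" and f: "f \<in> forms X d" and i: "i \<in> X" and v: "v \<in> cspace X" "coef v i = 1" and sing: "line v \<in> sing X f"
begin

sublocale graded X by (simp add: graded_def X)

abbreviation J where "J \<equiv> gspan (\<lambda>j. pdiff j f) (\<lambda>_. d - 1) X"
abbreviation Y where "Y \<equiv> X - {i}"
abbreviation a where "a \<equiv> coef v"
abbreviation h where "h \<equiv> dehom i f"
abbreviation T where "T \<equiv> affine_tjurina_ideal Y a h"
abbreviation gens where "gens \<equiv> insert (Fract h 1) ((\<lambda>j. Fract (pdiff j h) 1) ` Y)"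

lemma fp: "f \<in> polys X"
  using f forms_subset_polys by blast

lemma hp: "h \<in> polys Y"
  by (rule dehom_polys[OF fp])

lemma gideal_J: "gideal J"
  by (rule gideal_gspan[OF X pdiff_forms[OF f]])

lemma f_mem: "f \<in> J d"
proof (rule gspan_of_combination[where q = "\<lambda>j. smul (1 / of_nat d) (pvar j)"])
  show "f = (\<Sum>j\<in>X. smul (1 / of_nat d) (pvar j) * pdiff j f)"
  proof (rule peval_eqI)
    fix x
    have "peval (\<Sum>j\<in>X. smul (1 / of_nat d) (pvar j) * pdiff j f) x = (1 / of_nat d) * (\<Sum>j\<in>X. x j * peval (pdiff j f) x)"
      by (simp add: peval_simps peval_smul sum_divide_distrib)
    also have "\<dots> = peval f x" unfolding euler[OF X f] using d by simp
    finally show "peval f x = peval (\<Sum>j\<in>X. smul (1 / of_nat d) (pvar j) * pdiff j f) x" by simp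
  qed
qed (use f pdiff_forms[OF f] in \<open>auto intro: polys_smul pvar_polys\<close>)

lemma gens_germs: "gens \<subseteq> germs Y a"
  using germs_poly[OF hp] germs_poly[OF polys_pdiff[OF hp]] by auto

lemma ideal_T: "ideal T (ring_on (germs Y a))"
  unfolding affine_tjurina_ideal_def local_ring_eq
  by (rule ring.genideal_ideal[OF germs.ring_ring_on]) (use gens_germs in simp)

lemmas TD = germs.idealD[OF ideal_T]

lemma gens_T: "gens \<subseteq> T"
  unfolding affine_tjurina_ideal_def local_ring_eq
  using ring.genideal_self[OF germs.ring_ring_on, of gens Y a] gens_germs by simp

text \<open>The derivative in the direction of the chart variable is not among the generators of the
  Tjurina ideal; Euler's relation at \<open>x i = 1\<close> expresses it by \<open>h\<close> and the
  other derivatives.\<close>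

lemma dehom_pdiff_T:
  assumes j: "j \<in> X" shows "Fract (dehom i (pdiff j f)) 1 \<in> T"
proof -
  have other: "Fract (dehom i (pdiff j f)) 1 \<in> T" if "j \<in> Y" for j
    using gens_T that pdiff_dehom[OF X fp, of j i] by auto
  show ?thesis
  proof (cases "j = i")
    case True
    have "dehom i (pdiff i f) = smul (of_nat d) h - (\<Sum>j\<in>Y. pvar j * dehom i (pdiff j f))"
    proof (rule peval_eqI)
      fix x
      have "(\<Sum>j\<in>X. (x(i := 1)) j * peval (pdiff j f) (x(i := 1))) = of_nat d * peval f (x(i := 1))" by (rule euler[OF X f])
      then have "peval (pdiff i f) (x(i := 1)) + (\<Sum>j\<in>Y. x j * peval (pdiff j f) (x(i := 1))) = of_nat d * peval f (x(i := 1))"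
        by (simp add: sum.remove[OF X i])
      then show "peval (dehom i (pdiff i f)) x = peval (smul (of_nat d) h - (\<Sum>j\<in>Y. pvar j * dehom i (pdiff j f))) x"
        by (simp add: peval_simps peval_smul peval_dehom algebra_simps)
    qed
    then have "Fract (dehom i (pdiff i f)) 1 = cst (of_nat d) * Fract h 1 + (\<Sum>j\<in>Y. Fract (- pvar j) 1 * Fract (dehom i (pdiff j f)) 1)"
    proof -
      assume e: "dehom i (pdiff i f) = smul (of_nat d) h - (\<Sum>j\<in>Y. pvar j * dehom i (pdiff j f))"
      show ?thesis unfolding e by (simp add: Fract_sum smul_conv sum_negf)
    qed
    also have "\<dots> \<in> T"
      by (intro TD(3) germs.ideal_sum[OF ideal_T] TD(4) cst_germs germs_poly polys_uminus pvar_polys other) (use gens_T in auto)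
    finally show ?thesis using True by simp
  qed (use other j in simp)
qed

lemma J_T:
  assumes "g \<in> J k" shows "Fract (dehom i g) 1 \<in> T"
proof -
  obtain q where q: "g = (\<Sum>j\<in>X. q j * pdiff j f)" "\<forall>j\<in>X. q j \<in> cofac k (d - 1)"
    using assms unfolding gspan_def by blast
  have qp: "q j \<in> polys X" if "j \<in> X" for j
    using q(2) that forms_subset_polys[of X "k - (d - 1)"] by (auto simp: cofac_def split: if_splits)
  have "Fract (dehom i g) 1 = (\<Sum>j\<in>X. Fract (dehom i (q j)) 1 * Fract (dehom i (pdiff j f)) 1)"
    by (simp add: q(1) psubst_simps Fract_sum)
  also have "\<dots> \<in> T"
    by (intro germs.ideal_sum[OF ideal_T] TD(4) germs_poly dehom_polys qp dehom_pdiff_T)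
  finally show ?thesis .
qed

text \<open>Fractions whose numerator is a polynomial combination of the generators already form an
  ideal, so a common denominator can always be pulled out.\<close>

lemma T_cases:
  assumes "r \<in> T"
  obtains q u w where "q \<in> polys Y" "peval q a \<noteq> 0" "u \<in> polys Y" "\<And>j. j \<in> Y \<Longrightarrow> w j \<in> polys Y"
    "r = Fract (u * h + (\<Sum>j\<in>Y. w j * pdiff j h)) q"
proof -
  define P where "P = {u * h + (\<Sum>j\<in>Y. w j * pdiff j h) |u w. u \<in> polys Y \<and> (\<forall>j\<in>Y. w j \<in> polys Y)}"
  have P_polys: "P \<subseteq> polys Y" unfolding P_def by (auto intro!: polys_add polys_sum polys_mult polys_pdiff hp)
  have P_I: "u * h + (\<Sum>j\<in>Y. w j * pdiff j h) \<in> P" if "u \<in> polys Y" "\<And>j. j \<in> Y \<Longrightarrow> w j \<in> polys Y" for u w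
    unfolding P_def using that by blast
  have P_add: "p + q \<in> P" if pq: "p \<in> P" "q \<in> P" for p q
  proof -
    obtain u w u' w' where h: "u \<in> polys Y" "\<forall>j\<in>Y. w j \<in> polys Y" "p = u * h + (\<Sum>j\<in>Y. w j * pdiff j h)"
      "u' \<in> polys Y" "\<forall>j\<in>Y. w' j \<in> polys Y" "q = u' * h + (\<Sum>j\<in>Y. w' j * pdiff j h)" using pq unfolding P_def by blast
    have "p + q = (u + u') * h + (\<Sum>j\<in>Y. (w j + w' j) * pdiff j h)" unfolding h(3,6) by (simp add: algebra_simps sum.distrib)
    also have "\<dots> \<in> P" by (rule P_I) (use h in \<open>auto intro: polys_add\<close>)
    finally show ?thesis .
  qed
  have P_mult: "p * q \<in> P" if pq: "p \<in> polys Y" "q \<in> P" for p q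
  proof -
    obtain u w where h: "u \<in> polys Y" "\<forall>j\<in>Y. w j \<in> polys Y" "q = u * h + (\<Sum>j\<in>Y. w j * pdiff j h)" using pq unfolding P_def by blast
    have "p * q = (p * u) * h + (\<Sum>j\<in>Y. (p * w j) * pdiff j h)" unfolding h(3) by (simp add: algebra_simps sum_distrib_left)
    also have "\<dots> \<in> P" by (rule P_I) (use h pq in \<open>auto intro: polys_mult\<close>)
    finally show ?thesis .
  qed
  define I where "I = {Fract p q |p q. p \<in> P \<and> q \<in> polys Y \<and> peval q a \<noteq> 0}"
  have h_P: "h \<in> P" using P_I[of 1 "\<lambda>_. 0"] by simp
  have d_P: "pdiff j h \<in> P" if "j \<in> Y" for j
    using P_I[of 0 "\<lambda>k. if k = j then 1 else 0"] that X by (simp add: if_distrib[of "\<lambda>x. x * _"] cong: if_cong)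
  have I: "ideal I (ring_on (germs Y a))"
  proof (rule germs.ideal_ring_onI)
    show "I \<subseteq> germs Y a" unfolding I_def germs_def using P_polys by blast
    have "0 \<in> P" using P_I[of 0 "\<lambda>_. 0"] by simp
    then have "Fract 0 1 \<in> I" unfolding I_def using one_polys[of Y] ev.geval_1[of a] by (metis (mono_tags, lifting) mem_Collect_eq zero_neq_one)
    then show "0 \<in> I" by (simp add: Zero_fract_def)
    fix x y assume "x \<in> I"
    then obtain p q where x: "x = Fract p q" "p \<in> P" "q \<in> polys Y" "peval q a \<noteq> 0" unfolding I_def by blast
    note q0 = peval_nonzero_imp[OF x(4)]
    {
      assume "y \<in> I"
      then obtain p' q' where y: "y = Fract p' q'" "p' \<in> P" "q' \<in> polys Y" "peval q' a \<noteq> 0" unfolding I_def by blast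
      have "x + y = Fract (q' * p + q * p') (q * q')"
        unfolding x(1) y(1) add_fract[OF q0 peval_nonzero_imp[OF y(4)]] by (simp add: mult.commute)
      moreover have "q' * p + q * p' \<in> P" by (intro P_add P_mult x y)
      moreover have "q * q' \<in> polys Y" "peval (q * q') a \<noteq> 0" using x y by (auto intro: polys_mult simp: peval_simps)
      ultimately show "x + y \<in> I" unfolding I_def by blast
    next
      assume "y \<in> germs Y a"
      then obtain p' q' where y: "y = Fract p' q'" "p' \<in> polys Y" "q' \<in> polys Y" "peval q' a \<noteq> 0" by (rule germsE)
      have "y * x = Fract (p' * p) (q' * q)" unfolding x(1) y(1) by simp
      moreover have "p' * p \<in> P" by (intro P_mult x y)
      moreover have "q' * q \<in> polys Y" "peval (q' * q) a \<noteq> 0" using x y by (auto intro: polys_mult simp: peval_simps)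
      ultimately show "y * x \<in> I" unfolding I_def by blast
    }
  qed
  have "gens \<subseteq> I"
  proof -
    have "Fract p 1 \<in> I" if "p \<in> P" for p
      unfolding I_def using that one_polys[of Y] ev.geval_1[of a] by (metis (mono_tags, lifting) mem_Collect_eq zero_neq_one)
    then show ?thesis using h_P d_P by auto
  qed
  then have "T \<subseteq> I" unfolding affine_tjurina_ideal_def local_ring_eq
    by (rule ring.genideal_minimal[OF germs.ring_ring_on I])
  then have "r \<in> I" using assms by blast
  then show ?thesis unfolding I_def P_def using that by blast
qed

text \<open>All generators vanish at a singular point, so the numerator of any member of
  \<open>T\<close> vanishes there. This makes the quotient nonzero.\<close>

lemma one_not_in_T: "1 \<notin> T"
proof
  assume "1 \<in> T"
  then obtain q u w where q: "peval q a \<noteq> 0" and e: "1 = Fract (u * h + (\<Sum>j\<in>Y. w j * pdiff j h)) q" by (rule T_cases)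
  have "Fract q q = Fract (u * h + (\<Sum>j\<in>Y. w j * pdiff j h)) q"
    unfolding e[symmetric] by (simp add: One_fract_def eq_fract peval_nonzero_imp[OF q])
  then have "q = u * h + (\<Sum>j\<in>Y. w j * pdiff j h)" using peval_nonzero_imp[OF q] by (simp add: eq_fract)
  moreover have av: "a(i := 1) = a" using v(2) by auto
  have v0: "v \<noteq> 0" using v(2) by auto
  have s: "peval f a = 0" "\<And>j. j \<in> X \<Longrightarrow> peval (pdiff j f) a = 0"
    using sing sing_line_iff[OF f v(1) v0] by auto
  have "peval h a = 0" "\<And>j. j \<in> Y \<Longrightarrow> peval (pdiff j h) a = 0"
    using s pdiff_dehom[OF X fp, of _ i] by (auto simp: peval_dehom av)
  ultimately have "peval q a = 0" by (simp add: peval_simps)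
  then show False using q by simp
qed

text \<open>The denominator of the local expression is cleared, and everything is homogenized to a
  common degree. The form \<open>s\<close> is the homogenized denominator, which does not vanish at
  the point.\<close>

lemma T_colon:
  assumes g: "g \<in> forms X k" "Fract (dehom i g) 1 \<in> T"
  obtains m s where "s \<in> forms X m" "peval s a \<noteq> 0" "s * g \<in> J (m + k)"
proof -
  from g(2) obtain q u w where q: "q \<in> polys Y" "peval q a \<noteq> 0" and uw: "u \<in> polys Y" "\<And>j. j \<in> Y \<Longrightarrow> w j \<in> polys Y"
    and e: "Fract (dehom i g) 1 = Fract (u * h + (\<Sum>j\<in>Y. w j * pdiff j h)) q" by (rule T_cases) blast
  have e': "q * dehom i g = u * h + (\<Sum>j\<in>Y. w j * pdiff j h)"
    using e peval_nonzero_imp[OF q(2)] by (simp add: eq_fract mult.commute)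
  obtain N1 where N1: "\<And>k. k \<ge> N1 \<Longrightarrow> \<exists>g\<in>forms X k. dehom i g = q" by (rule homogenize[OF q(1) i]) (rule that)
  obtain N2 where N2: "\<And>k. k \<ge> N2 \<Longrightarrow> \<exists>g\<in>forms X k. dehom i g = u" by (rule homogenize[OF uw(1) i]) (rule that)
  have "finite Y" using X by simp
  then obtain N3 where N3: "\<And>k. k \<ge> N3 \<Longrightarrow> \<exists>g. \<forall>j\<in>Y. g j \<in> forms X k \<and> dehom i (g j) = w j"
    by (rule homogenize_family[OF _ uw(2) i]) (assumption, rule that)
  \<comment> \<open>One degree for all homogenizations: the degrees \<open>m\<close>,
    \<open>m + k - d\<close> and \<open>m + k - (d - 1)\<close> exceed \<open>N1\<close>,
    \<open>N2\<close> and \<open>N3\<close>, and the summand \<open>d\<close> keeps the subtractions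
    exact.\<close>
  define m where "m = N1 + N2 + N3 + d"
  obtain s where s: "s \<in> forms X m" "dehom i s = q" using N1[of m] by (auto simp: m_def)
  obtain U where U: "U \<in> forms X (m + k - d)" "dehom i U = u" using N2[of "m + k - d"] by (auto simp: m_def)
  have "N3 \<le> m + k - (d - 1)" by (simp add: m_def)
  from N3[OF this] obtain W where W: "\<forall>j\<in>Y. W j \<in> forms X (m + k - (d - 1)) \<and> dehom i (W j) = w j" ..
  let ?R = "U * f + (\<Sum>j\<in>Y. W j * pdiff j f)"
  have md: "d \<le> m + k" "d - 1 \<le> m + k" by (simp_all add: m_def)
  have mem: "?R \<in> J (m + k)"
  proof -
    have "U * f \<in> J (m + k - d + d)" by (rule gidealD(3)[OF gideal_J U(1) f_mem])
    then have 1: "U * f \<in> J (m + k)" using md by simp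
    have "W j * pdiff j f \<in> J (m + k - (d - 1) + (d - 1))" if "j \<in> Y" for j
      by (rule gidealD(3)[OF gideal_J]) (use W that X in \<open>auto intro: gspan_gen\<close>)
    then have 2: "W j * pdiff j f \<in> J (m + k)" if "j \<in> Y" for j using md that by (simp only: le_add_diff_inverse2)
    show ?thesis by (intro gidealD(5)[OF gideal_J] cv.subspace_sum[OF gidealD(1)[OF gideal_J]] 1 2)
  qed
  have "s * g - ?R = 0"
  proof (rule dehom_eq_0[OF _ i])
    show "s * g - ?R \<in> forms X (m + k)" by (intro forms_diff forms_mult s g(1) gidealD(2)[OF gideal_J mem])
    have "(\<Sum>j\<in>Y. dehom i (W j) * dehom i (pdiff j f)) = (\<Sum>j\<in>Y. w j * pdiff j h)"
      by (rule sum.cong) (use W pdiff_dehom[OF X fp, of _ i] in auto)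
    then show "dehom i (s * g - ?R) = 0" by (simp add: psubst_simps s(2) U(2) e')
  qed
  then have "s * g = ?R" by simp
  moreover have "peval s a \<noteq> 0"
  proof -
    have "a(i := 1) = a" using v(2) by auto
    then show ?thesis using q(2) peval_dehom[of i s a] s(2) by simp
  qed
  ultimately show ?thesis using that[OF s(1)] mem by simp
qed

text \<open>The degree \<open>k\<close> piece of the contraction of the local Tjurina ideal to the
  homogeneous coordinate ring.\<close>

definition local_ideal :: "nat \<Rightarrow> nat cpoly set"
  where "local_ideal k = {g \<in> forms X k. Fract (dehom i g) 1 \<in> T}"

lemma subspace_local_ideal: "cv.subspace (local_ideal k)"
proof (rule cv.subspaceI)
  show "0 \<in> local_ideal k" using TD(2) by (simp add: local_ideal_def psubst_simps Zero_fract_def)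
  show "x + y \<in> local_ideal k" if "x \<in> local_ideal k" "y \<in> local_ideal k" for x y
    using that TD(3)[of "Fract (dehom i x) 1" "Fract (dehom i y) 1"] by (auto simp: local_ideal_def psubst_simps intro: forms_add)
  show "smul c x \<in> local_ideal k" if "x \<in> local_ideal k" for c x
    using that TD(4)[OF cst_germs, of "Fract (dehom i x) 1" c] by (auto simp: local_ideal_def psubst_smul smul_conv[of c "dehom i x"] intro: forms_smul)
qed

text \<open>Forms independent modulo the local ideal become germs independent modulo
  \<open>T\<close>. To know that the Tjurina number is a true dimension, independent germs are
  conversely lifted to forms independent modulo the Jacobian ideal, whose Hilbert function is
  bounded by \<open>C\<close>.\<close>

lemma codim_local_ideal:
  assumes C: "\<And>k. K \<le> k \<Longrightarrow> hilb J k \<le> C"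
  shows "cv.dim (forms X k) - cv.dim (local_ideal k) \<le> affine_tjurina Y a h"
proof -
  let ?m = "cv.dim (forms X k) - cv.dim (local_ideal k)"
  have sum_T: "(\<Sum>j<m. cst (c j) * Fract (dehom i (g j)) 1) = Fract (dehom i (\<Sum>j<m. smul (c j) (g j))) 1" for m c g
    by (simp add: psubst_simps psubst_smul Fract_sum smul_conv)
  have bound: "m \<le> C" if r: "germs_independent Y a T m r" for m r
  proof -
    have "\<forall>j<m. \<exists>p q. r j = Fract p q \<and> p \<in> polys Y \<and> q \<in> polys Y \<and> peval q a \<noteq> 0"
      using r unfolding germs_independent_def germs_def by blast
    then obtain p q where pq: "\<And>j. j < m \<Longrightarrow> r j = Fract (p j) (q j) \<and> p j \<in> polys Y \<and> q j \<in> polys Y \<and> peval (q j) a \<noteq> 0" by metis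
    \<comment> \<open>A common denominator. It is a unit of the local ring, so multiplying the germs
      by it preserves independence and leaves polynomials to homogenize.\<close>
    define Q where "Q = (\<Prod>j<m. q j)"
    define p' where "p' j = p j * (\<Prod>l\<in>{..<m} - {j}. q l)" for j
    have Q: "Q \<in> polys Y" "peval Q a \<noteq> 0" using pq by (auto simp: Q_def peval_simps intro: polys_prod)
    have p': "p' j \<in> polys Y" if "j < m" for j using pq that by (auto simp: p'_def intro!: polys_mult polys_prod)
    have Qr: "Fract Q 1 * r j = Fract (p' j) 1" if j: "j < m" for j
    proof -
      have "Q = q j * (\<Prod>l\<in>{..<m} - {j}. q l)" unfolding Q_def by (rule prod.remove) (use j in auto)
      then have "Q * p j = p' j * q j" by (simp add: p'_def algebra_simps)
      moreover have "q j \<noteq> 0" using pq[OF j] peval_nonzero_imp by blast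
      ultimately show ?thesis using pq[OF j] by (simp add: eq_fract)
    qed
    have "finite {..<m}" by simp
    then obtain N where N: "\<And>k. k \<ge> N \<Longrightarrow> \<exists>g. \<forall>j\<in>{..<m}. g j \<in> forms X k \<and> dehom i (g j) = p' j"
      by (rule homogenize_family[of _ p' X i]) (use p' i that in auto)
    define k where "k = N + K"
    obtain g where g: "\<forall>j\<in>{..<m}. g j \<in> forms X k \<and> dehom i (g j) = p' j" using N[of k] by (auto simp: k_def)
    have "cv.dim (J k) + m \<le> cv.dim (forms X k)"
    proof (rule codim_ge_family[of _ _ _ g])
      show "fdim (forms X k)" by (rule fdim_forms[OF X])
      show "cv.subspace (J k)" "J k \<subseteq> forms X k" using gidealD[OF gideal_J] by auto
      show "g j \<in> forms X k" if "j < m" for j using g that by simp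
      fix c assume c: "(\<Sum>j<m. smul (c j) (g j)) \<in> J k"
      have "Fract (dehom i (\<Sum>j<m. smul (c j) (g j))) 1 = (\<Sum>j<m. cst (c j) * (Fract Q 1 * r j))"
        unfolding sum_T[symmetric] by (rule sum.cong) (use g Qr in auto)
      also have "\<dots> = Fract Q 1 * (\<Sum>j<m. cst (c j) * r j)" by (simp add: sum_distrib_left algebra_simps del: mult_fract)
      finally have "Fract Q 1 * (\<Sum>j<m. cst (c j) * r j) \<in> T" using J_T[OF c] by simp
      then have "Fract 1 Q * (Fract Q 1 * (\<Sum>j<m. cst (c j) * r j)) \<in> T"
        by (rule TD(4)[OF germsI[OF one_polys Q]])
      moreover have "Fract 1 Q * (Fract Q 1 * s) = s" for s
      proof -
        have "Fract 1 Q * Fract Q 1 = Fract 1 1" using peval_nonzero_imp[OF Q(2)] by (simp add: eq_fract)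
        then show ?thesis by (simp only: mult.assoc[symmetric] One_fract_def[symmetric] mult_1_left)
      qed
      ultimately show "\<forall>j<m. c j = 0" using r by (simp add: germs_independent_def)
    qed simp
    then have "m \<le> hilb J k" by (simp add: hilb_def)
    also have "\<dots> \<le> C" by (rule C) (simp add: k_def)
    finally show ?thesis .
  qed
  have sub: "local_ideal k \<subseteq> forms X k" by (auto simp: local_ideal_def)
  have "cv.dim (local_ideal k) + ?m \<le> cv.dim (forms X k)" using dim_mono[OF fdim_forms[OF X] sub] by simp
  then obtain g where g: "\<And>j. j < ?m \<Longrightarrow> g j \<in> forms X k"
    "\<And>c. (\<Sum>j<?m. smul (c j) (g j)) \<in> local_ideal k \<Longrightarrow> \<forall>j<?m. c j = 0"
    by (rule codim_family[OF fdim_forms[OF X] subspace_local_ideal sub]) (rule that)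
  have ind: "germs_independent Y a T ?m (\<lambda>j. Fract (dehom i (g j)) 1)"
    unfolding germs_independent_def
  proof (intro conjI allI impI)
    show "Fract (dehom i (g j)) 1 \<in> germs Y a" if "j < ?m" for j
      using g(1)[OF that] forms_subset_polys by (intro germs_poly dehom_polys) blast
    fix c j assume c: "(\<Sum>j<?m. cst (c j) * Fract (dehom i (g j)) 1) \<in> T" and j: "j < ?m"
    have "(\<Sum>j<?m. smul (c j) (g j)) \<in> local_ideal k"
    proof -
      have "(\<Sum>j<?m. smul (c j) (g j)) \<in> forms X k" by (intro forms_sum forms_smul g(1)) simp
      moreover have "Fract (dehom i (\<Sum>j<?m. smul (c j) (g j))) 1 \<in> T" using c unfolding sum_T .
      ultimately show ?thesis unfolding local_ideal_def[of k] by simp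
    qed
    then show "c j = 0" using g(2) j by blast
  qed
  show ?thesis
    unfolding affine_tjurina_def Let_def
    by (rule germs_independent_le_dimension[OF _ one_not_in_T bound ind]) (use ideal_T in \<open>simp add: local_ring_eq\<close>)
qed

end

lemma tjurina_at_chart:
  assumes f: "f \<in> forms X d" and X: "finite X" and d: "0 < d" and L: "L \<in> sing X f"
  obtains i v where "singular_point X d f i v" "L = line v" "tjurina_at X f L = affine_tjurina (X - {i}) (coef v) (dehom i f)"
proof -
  have "L \<in> proj X" by (rule subsetD[OF sing_subset L])
  then obtain w where w: "w \<in> cspace X" "w \<noteq> 0" "L = line w" unfolding proj_iff by blast
  obtain i where i: "coef w i \<noteq> 0" using w(2) by (metis lookup_zero poly_mapping_eqI)
  have iX: "i \<in> X" using i cspace_coef[OF w(1)] by metis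
  let ?P = "\<lambda>(i, v). i \<in> X \<and> v \<in> L \<and> coef v i = 1"
  have "smul (1 / coef w i) w \<in> L" unfolding w(3) line_conv using i by (intro CollectI exI[of _ "1 / coef w i"]) simp
  then have "?P (i, smul (1 / coef w i) w)" using iX i by simp
  then have "?P (Eps ?P)" by (rule someI)
  then obtain j v where jv: "Eps ?P = (j, v)" "j \<in> X" "v \<in> L" "coef v j = 1" by (cases "Eps ?P") auto
  have "L = line v" using line_mem[of v w] jv(3) w(3) by simp
  moreover have "v \<in> cspace X" using jv(3) w(1) cv.subspace_scale[OF subspace_cspace] by (auto simp: w(3) line_conv)
  ultimately show ?thesis
    by (intro that[of j v]) (use jv X d f L in \<open>auto simp: singular_point_def tjurina_at_def\<close>)
qed

text \<open>Codimension is subadditive under intersection: in the dimension formula for two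
  subspaces the sum has at most the dimension of \<open>V\<close>.\<close>

lemma codim_INT:
  assumes V: "cv.subspace V" "fdim V" and S: "finite S" and W: "\<And>p. p \<in> S \<Longrightarrow> cv.subspace (W p) \<and> W p \<subseteq> V"
  shows "cv.dim V - cv.dim (V \<inter> (\<Inter>p\<in>S. W p)) \<le> (\<Sum>p\<in>S. cv.dim V - cv.dim (W p))"
  using S W
proof (induction S)
  case (insert p S)
  let ?U = "V \<inter> (\<Inter>p\<in>S. W p)"
  have U: "cv.subspace ?U" using insert.prems V(1) by (intro cv.subspace_inter cv.subspace_Inter) auto
  have Wp: "cv.subspace (W p)" "W p \<subseteq> V" using insert.prems by auto
  have fd: "fdim ?U" "fdim (W p)" using fdim_mono[OF V(2)] Wp by auto
  have "{x + y |x y. x \<in> W p \<and> y \<in> ?U} \<subseteq> V" using Wp(2) cv.subspace_add[OF V(1)] by auto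
  then have s: "cv.dim {x + y |x y. x \<in> W p \<and> y \<in> ?U} \<le> cv.dim V" by (rule dim_mono[OF V(2)])
  have e: "V \<inter> (\<Inter>p\<in>insert p S. W p) = W p \<inter> ?U" using Wp(2) by auto
  have le: "cv.dim (W p) \<le> cv.dim V" "cv.dim ?U \<le> cv.dim V" by (rule dim_mono[OF V(2)], use Wp in blast)+
  have ar: "a - c \<le> (a - b) + (a - b')" if "s \<le> a" "s + c = b + b'" "b \<le> a" "b' \<le> a" for a b b' c s :: nat
    using that by linarith
  have "cv.dim V - cv.dim (W p \<inter> ?U) \<le> (cv.dim V - cv.dim (W p)) + (cv.dim V - cv.dim ?U)"
    by (rule ar[OF s dim_sums_Int[OF Wp(1) fd(2) U fd(1)] le])
  also have "\<dots> \<le> (cv.dim V - cv.dim (W p)) + (\<Sum>p\<in>S. cv.dim V - cv.dim (W p))"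
    using insert by (intro add_left_mono) simp
  finally show ?case unfolding e using insert.hyps by simp
qed simp

text \<open>A form in all local ideals is multiplied into the Jacobian ideal by forms that avoid
  each singular point. By the Nullstellensatz a power of \<open>l\<close> does the same, and in high
  degrees \<open>l\<close> can be cancelled. The codimensions of the local ideals then add up to a
  bound that contradicts \<open>syzygy_hilb_ge\<close>.\<close>

theorem no_linear_syzygy_of_small_tjurina:
  assumes X: "finite X" "card X = Suc n" "0 < n" and d: "2 \<le> d" and f: "f \<in> forms X d"
    and iso: "at_most_isolated_singularities X f" and \<tau>: "tjurina X f < (d - 2) * (d - 1) ^ (n - 1)"
  shows "no_linear_syzygy X f"
  unfolding no_linear_syzygy_def
proof (intro allI impI ballI, rule ccontr)
  interpret graded X by (simp add: graded_def X)
  fix a i0 assume a: "\<forall>i\<in>X. a i \<in> forms X 1" and syz: "(\<Sum>i\<in>X. a i * pdiff i f) = 0" and i0: "i0 \<in> X" "a i0 \<noteq> 0"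
  let ?J = "gspan (\<lambda>i. pdiff i f) (\<lambda>_. d - 1) X"
  have d0: "0 < d" using d by simp
  have J: "gideal ?J" by (rule gideal_gspan[OF X(1) pdiff_forms[OF f]])
  have a': "a i \<in> forms X 1" if "i \<in> X" for i using a that by blast
  obtain K1 where K1: "\<And>k. k \<ge> K1 \<Longrightarrow> (d - 1) ^ n \<le> hilb ?J k + (d - 1) ^ (n - 1)"
    by (rule syzygy_hilb_ge[OF X(2,3) d f iso a' syz i0]) (assumption, rule that)
  have fs: "finite (sing X f)" by (rule finite_sing[OF X(1) d0 f iso])
  define chart where "chart L p \<longleftrightarrow> singular_point X d f (fst p) (snd p) \<and> L = line (snd p) \<and>
    tjurina_at X f L = affine_tjurina (X - {fst p}) (coef (snd p)) (dehom (fst p) f)" for L p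
  have "\<forall>L\<in>sing X f. \<exists>p. chart L p"
  proof
    fix L assume L: "L \<in> sing X f"
    obtain i v where "singular_point X d f i v" "L = line v" "tjurina_at X f L = affine_tjurina (X - {i}) (coef v) (dehom i f)"
      by (rule tjurina_at_chart[OF f X(1) d0 L])
    then have "chart L (i, v)" by (simp add: chart_def)
    then show "\<exists>p. chart L p" ..
  qed
  from bchoice[OF this] obtain ch where ch: "\<forall>L\<in>sing X f. chart L (ch L)" ..
  define iv where "iv L = fst (ch L)" for L
  define vv where "vv L = snd (ch L)" for L
  have sp: "singular_point X d f (iv L) (vv L)" "L = line (vv L)"
    "tjurina_at X f L = affine_tjurina (X - {iv L}) (coef (vv L)) (dehom (iv L) f)" if "L \<in> sing X f" for L
    using ch that by (simp_all add: chart_def iv_def vv_def)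
  obtain l y where l: "l \<in> forms X 1" "l \<noteq> 0" and "peval l y = 0" "peval (a i0) y \<noteq> 0"
    and van: "\<forall>x. peval l x = 0 \<longrightarrow> (\<forall>i\<in>X. peval (pdiff i f) x = 0) \<longrightarrow> (\<forall>j\<in>X. x j = 0)"
  proof (rule linear_form_avoiding_sing[OF f d0 iso a'[OF i0(1)] i0(2)])
    show "2 \<le> card X" using X by simp
  qed (rule that)
  obtain K2 C where K2: "\<And>k u. K2 \<le> k \<Longrightarrow> u \<in> forms X k \<Longrightarrow> l * u \<in> ?J (k + 1) \<Longrightarrow> u \<in> ?J k"
    "\<And>k. K2 \<le> k \<Longrightarrow> hilb ?J k \<le> C"
  proof (rule hilb_stabilizes[of X "\<lambda>i. pdiff i f" "\<lambda>_. d - 1" l])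
    show "x v = 0" if "peval l x = 0" "\<And>i. i \<in> X \<Longrightarrow> peval (pdiff i f) x = 0" "v \<in> X" for x v using that van by blast
  qed (rule X(1) pdiff_forms[OF f] l(1) l(2) | rule that, assumption+)+
  define k where "k = K1 + K2"
  \<comment> \<open>Cancellation of \<open>l\<close>, repeated \<open>N\<close> times; all degrees
    that occur are at least \<open>K2\<close>.\<close>
  have lpow: "u \<in> ?J j" if "K2 \<le> j" "u \<in> forms X j" "l ^ N * u \<in> ?J (j + N)" for j u N
    using that
  proof (induction N arbitrary: u j)
    case (Suc N)
    have "l ^ N * (l * u) \<in> ?J (Suc j + N)" using Suc.prems(3) by (simp add: mult.assoc mult.left_commute)
    moreover have "l * u \<in> forms X (1 + j)" by (rule forms_mult[OF l(1) Suc.prems(2)])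
    ultimately have "l * u \<in> ?J (Suc j)" using Suc.IH[of "Suc j" "l * u"] Suc.prems(1) by simp
    then show ?case using K2(1)[of j u] Suc.prems by simp
  qed simp
  define I where "I L = singular_point.local_ideal X f (iv L) (vv L) k" for L
  have I: "cv.subspace (I L)" "I L \<subseteq> forms X k" "cv.dim (forms X k) - cv.dim (I L) \<le> tjurina_at X f L" if L: "L \<in> sing X f" for L
  proof -
    interpret p: singular_point X d f "iv L" "vv L" by (rule sp(1)[OF L])
    show "cv.subspace (I L)" unfolding I_def by (rule p.subspace_local_ideal)
    show "I L \<subseteq> forms X k" by (auto simp: I_def p.local_ideal_def)
    show "cv.dim (forms X k) - cv.dim (I L) \<le> tjurina_at X f L"
      unfolding I_def sp(3)[OF L] by (rule p.codim_local_ideal[OF K2(2)])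
  qed
  have "forms X k \<inter> (\<Inter>L\<in>sing X f. I L) \<subseteq> ?J k"
  proof
    fix g assume g: "g \<in> forms X k \<inter> (\<Inter>L\<in>sing X f. I L)"
    have "\<forall>L\<in>sing X f. \<exists>q. snd q \<in> forms X (fst q) \<and> peval (snd q) (coef (vv L)) \<noteq> 0 \<and> snd q * g \<in> ?J (fst q + k)"
    proof
      fix L assume L: "L \<in> sing X f"
      interpret p: singular_point X d f "iv L" "vv L" by (rule sp(1)[OF L])
      have "g \<in> forms X k" "Fract (dehom (iv L) g) 1 \<in> p.T" using g L by (auto simp: I_def p.local_ideal_def)
      then obtain m s where "s \<in> forms X m" "peval s (coef (vv L)) \<noteq> 0" "s * g \<in> ?J (m + k)" by (rule p.T_colon)
      then show "\<exists>q. snd q \<in> forms X (fst q) \<and> peval (snd q) (coef (vv L)) \<noteq> 0 \<and> snd q * g \<in> ?J (fst q + k)"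
        by (intro exI[of _ "(m, s)"]) simp
    qed
    from bchoice[OF this] obtain q where q: "\<forall>L\<in>sing X f. snd (q L) \<in> forms X (fst (q L)) \<and>
      peval (snd (q L)) (coef (vv L)) \<noteq> 0 \<and> snd (q L) * g \<in> ?J (fst (q L) + k)" ..
    \<comment> \<open>The partial derivatives together with one multiplier for each singular point.
      All of them lie in the colon ideal of \<open>g\<close>, and \<open>l\<close> vanishes at all
      their common zeros.\<close>
    define z where "z t = (case t of Inl j \<Rightarrow> pdiff j f | Inr L \<Rightarrow> snd (q L))" for t
    define \<delta> where "\<delta> t = (case t of Inl j \<Rightarrow> d - 1 | Inr L \<Rightarrow> fst (q L))" for t :: "nat + nat cvec set"
    let ?A = "Inl ` X \<union> Inr ` sing X f"
    have z: "z t \<in> forms X (\<delta> t)" if "t \<in> ?A" for t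
      using that q pdiff_forms[OF f] by (auto simp: z_def \<delta>_def)
    have fA: "finite ?A" using X(1) fs by simp
    have vanl: "peval l x = 0" if x: "\<And>t. t \<in> ?A \<Longrightarrow> peval (z t) x = 0" for x
    proof (rule ccontr)
      assume lx: "peval l x \<noteq> 0"
      have "\<exists>j\<in>X. x j \<noteq> 0" using lx peval_0_eq_0[OF l(1), of x] by auto
      then obtain j where j: "j \<in> X" "x j \<noteq> 0" by blast
      have px: "peval (pdiff i f) x = 0" if "i \<in> X" for i using x[of "Inl i"] that by (simp add: z_def)
      note s = zero_of_partials[where x = x and j = j, OF d0 f px j]
      let ?L = "line (vec X x)"
      have "peval (snd (q ?L)) x = 0" using x[of "Inr ?L"] s by (simp add: z_def)
      then have 0: "peval (snd (q ?L)) (coef (vec X x)) = 0" using s q peval_coef_vec by metis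
      obtain c where "vv ?L = smul c (vec X x)" using sp(2)[of ?L] s line_eq_iff by metis
      then have "peval (snd (q ?L)) (coef (vv ?L)) = 0" using peval_coef_smul q s 0 by (metis mult_zero_right)
      then show False using q s by blast
    qed
    obtain N where "l ^ N \<in> gspan z \<delta> ?A (N * 1)"
    proof (rule power_mem_gspan[of ?A z \<delta> l])
      show "peval l x = 0" if "\<And>t. t \<in> ?A \<Longrightarrow> peval (z t) x = 0" for x using that by (rule vanl)
    qed (rule fA z l(1) that | assumption)+
    moreover have "gspan z \<delta> ?A (N * 1) \<subseteq> gcol ?J g k (N * 1)"
    proof (rule gspan_least)
      show "gideal (gcol ?J g k)" by (rule gideal_gcol[OF J]) (use g in blast)
      show "z t \<in> gcol ?J g k (\<delta> t)" if t: "t \<in> ?A" for t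
      proof (cases t)
        case (Inl j)
        have "pdiff j f \<in> ?J (d - 1)" by (rule gspan_gen[OF X(1)]) (use t Inl in auto)
        from gidealD(3)[OF J _ this, of g k] have "g * pdiff j f \<in> ?J (d - 1 + k)" using g by (simp add: add.commute)
        then show ?thesis using Inl pdiff_forms[OF f] by (simp add: gcol_def z_def \<delta>_def)
      next
        case (Inr L)
        then have "L \<in> sing X f" using t by auto
        then show ?thesis using q Inr by (simp add: gcol_def z_def \<delta>_def mult.commute)
      qed
    qed
    ultimately have "g * l ^ N \<in> ?J (N + k)" by (auto simp: gcol_def)
    then show "g \<in> ?J k" using lpow[of k g N] g by (simp add: k_def mult.commute add.commute add.left_commute)
  qed
  then have "cv.dim (forms X k \<inter> (\<Inter>L\<in>sing X f. I L)) \<le> cv.dim (?J k)" by (rule dim_mono[OF fdim_gideal[OF J]])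
  then have "hilb ?J k \<le> cv.dim (forms X k) - cv.dim (forms X k \<inter> (\<Inter>L\<in>sing X f. I L))" by (simp add: hilb_def)
  also have "\<dots> \<le> (\<Sum>L\<in>sing X f. cv.dim (forms X k) - cv.dim (I L))"
    by (rule codim_INT) (use fs I(1,2) fdim_forms[OF X(1)] in auto)
  also have "\<dots> \<le> tjurina X f" unfolding tjurina_def by (rule sum_mono) (rule I(3))
  finally have "hilb ?J k < (d - 2) * (d - 1) ^ (n - 1)" using \<tau> by simp
  moreover have "(d - 1) ^ n = (d - 2) * (d - 1) ^ (n - 1) + (d - 1) ^ (n - 1)"
  proof -
    obtain m e where "n = Suc m" "d = Suc (Suc e)" using X(3) d by (metis Suc_1 Suc_diff_le Suc_pred diff_diff_cancel diff_Suc_Suc gr0_implies_Suc le_add_diff_inverse2 add_2_eq_Suc')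
    then show ?thesis by simp
  qed
  ultimately show False using K1[of k] by (simp add: k_def)
qed

section \<open>The Milnor algebra\<close>

interpretation polys: concrete_ring "polys X" for X :: "'v set"
  by unfold_locales (auto intro: polys_add polys_mult polys_uminus)

locale milnor = graded +
  fixes d :: nat and f :: "'a cpoly"
  assumes d: "0 < d" and f: "f \<in> forms X d"
begin

abbreviation J where "J \<equiv> gspan (\<lambda>i. pdiff i f) (\<lambda>_. d - 1) X"

lemma F: "pdiff i f \<in> forms X (d - 1)"
  by (rule pdiff_forms[OF f])

lemma gideal_J: "gideal J"
  by (rule gideal_gspan[OF finX F])

lemma fp: "f \<in> polys X"
  using f forms_subset_polys by blast

lemma ideal_jacobian: "ideal (jacobian_ideal X f) (ring_on (polys X))"
  unfolding jacobian_ideal_def poly_ring_def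
  by (rule ring.genideal_ideal[OF polys.ring_ring_on]) (use polys_pdiff[OF fp] in auto)

lemma jacobian_ideal_eq: "jacobian_ideal X f = {\<Sum>i\<in>X. q i * pdiff i f |q. \<forall>i\<in>X. q i \<in> polys X}" (is "_ = ?I")
proof
  have P: "pideal X ?I" by (rule pideal_combinations) (rule polys_pdiff[OF fp])
  have "ideal ?I (ring_on (polys X))"
    by (rule polys.ideal_ring_onI) (use pidealD[OF P] in auto)
  moreover have "pdiff j f \<in> ?I" if "j \<in> X" for j
  proof -
    have "pdiff j f = (\<Sum>i\<in>X. (if i = j then 1 else 0) * pdiff i f)"
      using that finX by (simp add: if_distrib[of "\<lambda>x. x * _"] cong: if_cong)
    moreover have "\<forall>i\<in>X. (if i = j then 1 else 0) \<in> polys X" by simp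
    ultimately show ?thesis by (intro CollectI exI[of _ "\<lambda>i. if i = j then 1 else 0"] conjI)
  qed
  ultimately show "jacobian_ideal X f \<subseteq> ?I"
    unfolding jacobian_ideal_def poly_ring_def by (intro ring.genideal_minimal[OF polys.ring_ring_on]) auto
  have "pdiff j f \<in> jacobian_ideal X f" if "j \<in> X" for j
    unfolding jacobian_ideal_def poly_ring_def
    using ring.genideal_self[OF polys.ring_ring_on, of "(\<lambda>i. pdiff i f) ` X" X] polys_pdiff[OF fp] that by auto
  then show "?I \<subseteq> jacobian_ideal X f"
    using polys.ideal_sum[OF ideal_jacobian] polys.idealD(4)[OF ideal_jacobian] by (smt (verit) mem_Collect_eq subsetI)
qed

lemma jacobian_ideal_iff: "g \<in> forms X k \<Longrightarrow> g \<in> jacobian_ideal X f \<longleftrightarrow> g \<in> J k"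
proof
  assume g: "g \<in> forms X k" "g \<in> jacobian_ideal X f"
  then obtain q where q: "\<forall>i\<in>X. q i \<in> polys X" "g = (\<Sum>i\<in>X. q i * pdiff i f)" unfolding jacobian_ideal_eq by blast
  show "g \<in> J k" by (rule gspan_of_combination[OF g(1) q(2)]) (use q(1) F in auto)
next
  assume "g \<in> J k"
  then obtain q where q: "\<forall>i\<in>X. q i \<in> cofac k (d - 1)" "g = (\<Sum>i\<in>X. q i * pdiff i f)" unfolding gspan_def by blast
  have "\<forall>i\<in>X. q i \<in> polys X" using q(1) forms_subset_polys[of X "k - (d - 1)"] by (auto simp: cofac_def split: if_splits)
  then show "g \<in> jacobian_ideal X f" using q(2) unfolding jacobian_ideal_eq by blast
qed

lemma milnor_class_eq_iff:
  "g \<in> forms X k \<Longrightarrow> h \<in> forms X k \<Longrightarrow> milnor_class X f g = milnor_class X f h \<longleftrightarrow> g - h \<in> J k"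
  unfolding milnor_class_def poly_ring_def using forms_subset_polys
  by (subst polys.coset_eq_iff[OF ideal_jacobian]) (auto simp: jacobian_ideal_iff[OF forms_diff])

lemma milnor_mult_class:
  assumes "l \<in> polys X" "g \<in> polys X"
  shows "milnor_mult X f l (milnor_class X f g) = milnor_class X f (l * g)"
  unfolding milnor_mult_def milnor_algebra_def milnor_class_def poly_ring_def FactRing_def
  using ideal.rcoset_mult_add[OF ideal_jacobian, of l g] assms by simp

section \<open>Injectivity and surjectivity from degree \<open>d - 1\<close> to degree
  \<open>d\<close>\<close>

definition injective_in_degree :: "'a cpoly \<Rightarrow> bool"
  where "injective_in_degree l \<longleftrightarrow> (\<forall>h\<in>forms X (d - 1). l * h \<in> J d \<longrightarrow> h \<in> J (d - 1))"

lemma mult_linear_forms: "l \<in> forms X 1 \<Longrightarrow> h \<in> forms X (d - 1) \<Longrightarrow> l * h \<in> forms X d"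
  using forms_mult[of l X 1 h "d - 1"] d by simp

lemma injective_in_degreeI:
  assumes l: "l \<in> forms X 1" and inj: "milnor_mult_injective X f d l"
  shows "injective_in_degree l"
  unfolding injective_in_degree_def
proof (intro ballI impI)
  fix h assume h: "h \<in> forms X (d - 1)" "l * h \<in> J d"
  have p: "l \<in> polys X" "h \<in> polys X" using l h(1) forms_subset_polys by blast+
  have "milnor_class X f (l * h) = milnor_class X f (l * 0)"
    using milnor_class_eq_iff[OF mult_linear_forms[OF l h(1)] mult_linear_forms[OF l forms_0]] h(2) by simp
  then have "milnor_mult X f l (milnor_class X f h) = milnor_mult X f l (milnor_class X f 0)"
    using p by (simp add: milnor_mult_class)
  then have "milnor_class X f h = milnor_class X f 0"
    using inj h(1) forms_0 unfolding milnor_mult_injective_def milnor_piece_def inj_on_def by blast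
  then show "h \<in> J (d - 1)" using milnor_class_eq_iff[OF h(1) forms_0] by simp
qed

text \<open>The open set of general linear forms may contain \<open>0\<close>, for which injectivity means that the source vanishes.\<close>

lemma injective_in_degree_nonzero:
  assumes inj: "injective_in_degree l" and i: "i \<in> X" and l: "l \<in> forms X 1"
  obtains l' where "l' \<in> forms X 1" "l' \<noteq> 0" "injective_in_degree l'"
proof (cases "l = 0")
  case True
  then have "injective_in_degree (pvar i)" using inj gidealD(4)[OF gideal_J] by (simp add: injective_in_degree_def)
  moreover have "pvar i \<noteq> (0 :: 'a cpoly)" using ev.geval_pvar[of i "\<lambda>_. 1"] by (auto simp: ev.geval_0)
  ultimately show ?thesis using that pvar_forms[OF i] by blast
qed (use that inj l in blast)

lemma linear_jacobian_injectiveI: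
  assumes l: "l \<in> forms X 1" and inj: "injective_in_degree l"
  shows "linear_jacobian_injective X f d l"
  unfolding linear_jacobian_injective_def
proof (intro ballI allI impI)
  fix h a assume h: "h \<in> forms X (d - 1)" and a: "\<forall>i\<in>X. a i \<in> forms X 1" and e: "l * h = (\<Sum>i\<in>X. a i * pdiff i f)"
  have "l * h \<in> J d"
    by (rule gspan_of_combination[OF mult_linear_forms[OF l h] e]) (use a forms_subset_polys F in auto)
  then have "h \<in> J (d - 1)" using inj h by (simp add: injective_in_degree_def)
  then obtain q where q: "\<forall>i\<in>X. q i \<in> cofac (d - 1) (d - 1)" "h = (\<Sum>i\<in>X. q i * pdiff i f)" unfolding gspan_def by blast
  have "\<forall>i\<in>X. \<exists>c. q i = pconst c" using q(1) by (simp add: cofac_def forms_0_iff)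
  then obtain c where "\<forall>i\<in>X. q i = pconst (c i)" by metis
  then have "h = (\<Sum>i\<in>X. smul (c i) (pdiff i f))" using q(2) by (simp add: smul_conv)
  then show "\<exists>c. h = (\<Sum>i\<in>X. smul (c i) (pdiff i f))" by blast
qed

lemma full_of_surjective:
  assumes l: "l \<in> forms X 1" and surj: "milnor_mult_surjective X f d l"
  shows "gadd J l 1 d = forms X d"
proof
  show "gadd J l 1 d \<subseteq> forms X d" by (rule gidealD(7)[OF gideal_gadd[OF gideal_J l]])
  show "forms X d \<subseteq> gadd J l 1 d"
  proof
    fix g assume g: "g \<in> forms X d"
    then have "milnor_class X f g \<in> milnor_mult X f l ` milnor_piece X f (d - 1)"
      using surj unfolding milnor_mult_surjective_def milnor_piece_def by blast
    then obtain h where h: "h \<in> forms X (d - 1)" "milnor_class X f g = milnor_mult X f l (milnor_class X f h)"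
      unfolding milnor_piece_def by blast
    have "l \<in> polys X" "h \<in> polys X" using l h(1) forms_subset_polys by blast+
    then have "g - l * h \<in> J d" using h(2) milnor_class_eq_iff[OF g mult_linear_forms[OF l h(1)]] by (simp add: milnor_mult_class)
    moreover have "h \<in> cofac d 1" using h(1) d by (simp add: cofac_def)
    ultimately have "(g - l * h) + h * l \<in> gadd J l 1 d" unfolding gadd_def by blast
    then show "g \<in> gadd J l 1 d" by (simp add: mult.commute)
  qed
qed

text \<open>Surjectivity identifies the Hilbert function of the colon ideal in degree
  \<open>d - 1\<close> with that of the Jacobian ideal in degree \<open>d\<close>. If the latter has
  not dropped, the two ideals agree in degree \<open>d - 1\<close>.\<close>

lemma injective_in_degree_of_surjective:
  assumes l: "l \<in> forms X 1" "l \<noteq> 0" and full: "gadd J l 1 d = forms X d" and le: "hilb J (d - 1) \<le> hilb J d"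
  shows "injective_in_degree l"
proof -
  have gl: "gideal (gadd J l 1)" by (rule gideal_gadd[OF gideal_J l(1)])
  have gc: "gideal (gcol J l 1)" by (rule gideal_gcol[OF gideal_J l(1)])
  have "hilb (gadd J l 1) d = 0" unfolding hilb_eq_0[OF gl] by (rule full)
  then have "hilb (gcol J l 1) (d - 1) = hilb J d" using hilb_gadd[OF gideal_J l, of "d - 1"] d by simp
  then have "J (d - 1) = gcol J l 1 (d - 1)"
    using le by (intro hilb_eqD[OF gideal_J gc gcol_superset[OF gideal_J l(1)]]) simp
  then show ?thesis using d by (auto simp: injective_in_degree_def gcol_def)
qed

text \<open>A linear relation among the partial derivatives with constant coefficients becomes a
  linear syzygy after multiplication by a variable.\<close>

lemma partials_independent:
  assumes ns: "no_linear_syzygy X f"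
  shows "card X \<le> cv.dim (J (d - 1))"
proof -
  obtain \<sigma> where \<sigma>: "bij_betw \<sigma> {0..<card X} X" using ex_bij_betw_nat_finite[OF finX] by blast
  have "cv.dim {0 :: 'a cpoly} + card X \<le> cv.dim (J (d - 1))"
  proof (rule codim_ge_family[of _ _ _ "\<lambda>k. pdiff (\<sigma> k) f"])
    show "cv.subspace (J (d - 1))" "fdim (J (d - 1))" "cv.subspace {0 :: 'a cpoly}" "{0} \<subseteq> J (d - 1)"
      using gidealD[OF gideal_J] fdim_gideal[OF gideal_J] cv.subspace_single_0 by auto
    show "pdiff (\<sigma> k) f \<in> J (d - 1)" if "k < card X" for k
      by (rule gspan_gen[OF finX]) (use \<sigma> that in \<open>auto simp: bij_betw_def\<close>)
    fix c assume c: "(\<Sum>k<card X. smul (c k) (pdiff (\<sigma> k) f)) \<in> {0}"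
    show "\<forall>k<card X. c k = 0"
    proof (intro allI impI)
      fix k assume k: "k < card X"
      define \<rho> where "\<rho> = the_inv_into {0..<card X} \<sigma>"
      have \<rho>: "\<rho> (\<sigma> k) = k" if "k < card X" for k
        unfolding \<rho>_def by (rule the_inv_into_f_f) (use \<sigma> that in \<open>auto simp: bij_betw_def\<close>)
      have \<sigma>X: "\<sigma> k \<in> X" using \<sigma> k by (auto simp: bij_betw_def)
      define a where "a i = smul (c (\<rho> i)) (pvar (\<sigma> k))" for i
      have "(\<Sum>i\<in>X. smul (c (\<rho> i)) (pdiff i f)) = (\<Sum>k\<in>{0..<card X}. smul (c (\<rho> (\<sigma> k))) (pdiff (\<sigma> k) f))"
        by (rule sum.reindex_bij_betw[OF \<sigma>, symmetric])
      also have "\<dots> = (\<Sum>k<card X. smul (c k) (pdiff (\<sigma> k) f))"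
        unfolding atLeast0LessThan by (rule sum.cong) (simp_all add: \<rho>)
      finally have "pvar (\<sigma> k) * (\<Sum>i\<in>X. smul (c (\<rho> i)) (pdiff i f)) = 0" using c by simp
      then have "(\<Sum>i\<in>X. a i * pdiff i f) = 0" by (simp add: sum_distrib_left a_def smul_mult_left smul_mult_right)
      moreover have "\<forall>i\<in>X. a i \<in> forms X 1" unfolding a_def by (intro ballI forms_smul pvar_forms \<sigma>X)
      ultimately have "a (\<sigma> k) = 0" using ns \<sigma>X unfolding no_linear_syzygy_def by blast
      then have "peval (a (\<sigma> k)) (\<lambda>_. 1) = 0" by (simp only: ev.geval_0)
      then show "c k = 0" by (simp add: a_def peval_smul ev.geval_pvar \<rho>[OF k])
    qed
  qed
  then show ?thesis by simp
qed

text \<open>In degree \<open>d\<close> the Jacobian ideal is spanned by the products of a variable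
  with a partial derivative.\<close>

lemma dim_jacobian_le: "cv.dim (J d) \<le> card X * card X"
proof -
  let ?B = "(\<lambda>(i, j). pvar j * pdiff i f) ` (X \<times> X)"
  have "J d \<subseteq> cv.span ?B"
  proof
    fix g assume "g \<in> J d"
    then obtain q where q: "\<forall>i\<in>X. q i \<in> cofac d (d - 1)" "g = (\<Sum>i\<in>X. q i * pdiff i f)" unfolding gspan_def by blast
    have q1: "q i \<in> forms X 1" if "i \<in> X" for i using q(1) that d by (auto simp: cofac_def)
    have qe: "q i = (\<Sum>j\<in>X. smul (coef (q i) (sgl j 1)) (pvar j))" if "i \<in> X" for i
      by (rule peval_eqI) (simp add: peval_linear[OF q1[OF that]] peval_simps peval_smul)
    have "q i * pdiff i f \<in> cv.span ?B" if i: "i \<in> X" for i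
    proof -
      have "q i * pdiff i f = (\<Sum>j\<in>X. smul (coef (q i) (sgl j 1)) (pvar j * pdiff i f))"
        by (subst qe[OF i]) (simp add: sum_distrib_right smul_mult_left)
      also have "\<dots> \<in> cv.span ?B"
        by (intro cv.span_sum cv.span_scale cv.span_base) (use i in force)
      finally show ?thesis .
    qed
    then show "g \<in> cv.span ?B" unfolding q(2) by (rule cv.span_sum)
  qed
  then have "cv.dim (J d) \<le> card ?B" by (rule cv.dim_le_card) (use finX in simp)
  also have "\<dots> \<le> card (X \<times> X)" by (rule card_image_le) (use finX in simp)
  finally show ?thesis by (simp add: card_cartesian_product)
qed

end

section \<open>Binomial estimates and the ranges of \<open>n\<close> and \<open>d\<close>\<close>

lemma six_choose_three: "6 * (Suc (Suc (Suc m)) choose 3) = Suc (Suc (Suc m)) * Suc (Suc m) * Suc m"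
proof -
  have ar: "6 * x = A * B * C" if "A * y = x * 3" "B * C = y * 2" for x y A B C :: nat
  proof -
    have "6 * x = 2 * (x * 3)" by simp
    also have "\<dots> = A * (y * 2)" unfolding that(1)[symmetric] by simp
    finally show ?thesis unfolding that(2)[symmetric] by (simp only: mult.assoc)
  qed
  show ?thesis
  proof (rule ar)
    show "Suc (Suc (Suc m)) * (Suc (Suc m) choose 2) = (Suc (Suc (Suc m)) choose 3) * 3"
      using Suc_times_binomial_eq[of "Suc (Suc m)" 2] by (simp only: Suc_numeral semiring_norm)
    show "Suc (Suc m) * Suc m = (Suc (Suc m) choose 2) * 2"
      using Suc_times_binomial_eq[of "Suc m" 1] by (simp only: Suc_1 choose_one)
  qed
qed

text \<open>From degree \<open>d - 1\<close> to \<open>d\<close> the Jacobian ideal grows by at most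
  \<open>(n + 1)^2 - (n + 1) = n * (n + 1)\<close>. The ranges are where the space of all forms
  grows by at least as much; by Pascal's rule its growth is the binomial coefficient of
  \<open>d - 1 + n\<close> over \<open>n - 1\<close>.\<close>

lemma binomial_growth_in_range:
  fixes n d :: nat
  assumes "n = 2 \<and> d \<ge> 5 \<or> n = 3 \<and> d \<ge> 4 \<or> n \<ge> 4 \<and> d \<ge> 3"
  shows "(d - 1 + n choose n) + n * (n + 1) \<le> d + n choose n"
proof -
  obtain e m where e: "d = Suc e" and m: "n = Suc m" using assms by (metis Suc_diff_1 gr0I not_numeral_le_zero zero_neq_numeral)
  have pascal: "d + n choose n = (e + n choose n) + (e + n choose m)" by (simp add: e m)
  have mono: "a choose m \<le> b choose m" if "a \<le> b" for a b by (rule binomial_right_mono[OF that])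
  from assms consider "n = 2" "d \<ge> 5" | "n = 3" "d \<ge> 4" | "n \<ge> 4" "d \<ge> 3" by blast
  then have "n * (n + 1) \<le> e + n choose m"
  proof cases
    case 1
    then show ?thesis using m e by simp
  next
    case 2
    then have "6 choose m \<le> e + n choose m" using e by (intro mono) simp
    moreover have "6 choose m = 15"
    proof -
      have "m = 2" using m 2 by simp
      then show ?thesis by (simp add: eval_nat_numeral)
    qed
    ultimately show ?thesis using 2 by simp
  next
    \<comment> \<open>The worst case is \<open>d = 3\<close>, where the growth is
      \<open>(n + 2) * (n + 1) * n / 6\<close>, and \<open>n + 2 \<ge> 6\<close>.\<close>
    case 3
    have "n + 2 choose m \<le> e + n choose m" using e 3 by (intro mono) simp
    moreover have "n + 2 choose m = n + 2 choose 3" using binomial_symmetric[of m "n + 2"] m by simp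
    moreover have "6 * (n + 2 choose 3) = (n + 2) * (n + 1) * n" using six_choose_three[of m] m by simp
    moreover have "6 * (n * (n + 1)) \<le> (n + 2) * (n + 1) * n"
    proof -
      have "6 * ((n + 1) * n) \<le> (n + 2) * ((n + 1) * n)" by (rule mult_le_mono1) (use 3 in simp)
      then show ?thesis by (simp only: mult.assoc mult.commute[of n "n + 1"])
    qed
    ultimately have "6 * (n * (n + 1)) \<le> 6 * (e + n choose m)" by linarith
    then show ?thesis by simp
  qed
  then show ?thesis using pascal by (simp add: e)
qed

lemma general_linear_form_ex:
  assumes "for_general_linear_form X P" obtains l where "l \<in> forms X 1" "P l"
proof -
  obtain W where W: "openin (zariski_affine (mons X 1)) W" "W \<noteq> {}" "\<forall>l\<in>W. P l"
    using assms unfolding for_general_linear_form_def by blast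
  have "topspace (zariski_affine (mons X 1)) \<subseteq> cspace (mons X 1)"
    unfolding zariski_affine_def topology_generated_by_topspace by blast
  then show ?thesis using that W openin_subset by blast
qed

lemma linear_jacobian_injective_of_WLP:
  fixes n d :: nat
  assumes f: "f \<in> forms {..n} d" and d: "0 < d" and ns: "no_linear_syzygy {..n} f"
    and range: "n = 2 \<and> d \<ge> 5 \<or> n = 3 \<and> d \<ge> 4 \<or> n \<ge> 4 \<and> d \<ge> 3" and wlp: "milnor_WLP_in_degree {..n} f d"
  obtains l where "l \<in> forms {..n} 1" "l \<noteq> 0" "linear_jacobian_injective {..n} f d l"
proof -
  interpret milnor "{..n}" d f by unfold_locales (use f d in auto)
  obtain l where l: "l \<in> forms {..n} 1" "milnor_mult_injective {..n} f d l \<or> milnor_mult_surjective {..n} f d l"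
    using wlp unfolding milnor_WLP_in_degree_def by (rule general_linear_form_ex)
  have c: "card {..n} = Suc n" by simp
  have "\<exists>l'. l' \<in> forms {..n} 1 \<and> l' \<noteq> 0 \<and> injective_in_degree l'"
  proof (cases "milnor_mult_injective {..n} f d l")
    case True
    show ?thesis by (rule injective_in_degree_nonzero[OF injective_in_degreeI[OF l(1) True] _ l(1), of 0]) auto
  next
    case False
    then have full: "gadd J l 1 d = forms {..n} d" using l full_of_surjective by blast
    have dims: "cv.dim (forms {..n} k) = k + n choose n" for k by (simp add: dim_forms card_mons[OF _ c])
    have "hilb J (d - 1) \<le> hilb J d"
    proof -
      have ar: "s' - j' \<le> s - j" if "c \<le> j'" "j \<le> p + c" "s' + p \<le> s" for s s' j j' p c :: nat using that by linarith
      have "Suc n * Suc n = n * (n + 1) + Suc n" by simp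
      then show ?thesis
        unfolding hilb_def dims using partials_independent[OF ns] dim_jacobian_le binomial_growth_in_range[OF range] unfolding c
        by (intro ar[of "Suc n" _ _ "n * (n + 1)"]) simp_all
    qed
    obtain l' where l': "l' \<in> forms {..n} 1" "l' \<noteq> 0" "gadd J l' 1 d = forms {..n} d"
    proof (cases "l = 0")
      case True
      \<comment> \<open>Surjectivity of multiplication by 0 means that the Jacobian ideal is
        everything in degree \<open>d\<close>; then any nonzero linear form serves.\<close>
      have "gadd J l 1 d \<subseteq> J d" unfolding gadd_def True by auto
      then have "J d = forms {..n} d" using full gidealD(7)[OF gideal_J] by blast
      moreover have v: "pvar 0 \<in> forms {..n} 1" by (rule pvar_forms) simp
      moreover have "pvar 0 \<noteq> (0 :: nat cpoly)" using ev.geval_pvar[of 0 "\<lambda>_ :: nat. 1"] by (auto simp: ev.geval_0)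
      moreover have "gadd J (pvar 0) 1 d \<subseteq> forms {..n} d" by (rule gidealD(7)[OF gideal_gadd[OF gideal_J v]])
      ultimately show ?thesis using that[of "pvar 0"] gadd_superset[of J d "pvar 0" 1] by blast
    qed (use that l(1) full in blast)
    have "injective_in_degree l'" by (rule injective_in_degree_of_surjective[OF l']) fact
    then show ?thesis using l' by blast
  qed
  then show ?thesis using that linear_jacobian_injectiveI by blast
qed

theorem theorem3p3:
  fixes n d :: nat and f :: "nat cpoly"
  assumes "n \<ge> 2" and "d \<ge> 3"
    and "f \<in> forms {..n} d" and "f \<noteq> 0"
    and "at_most_isolated_singularities {..n} f"
  shows "(dim_projective_aut {..n} f = 0 \<and>
          for_general_linear_form {..n} (milnor_mult_injective {..n} f d)
            \<longrightarrow> section_map_generically_finite n d f) \<and>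
         (tjurina {..n} f < (d - 2) * (d - 1) ^ (n - 1) \<and>
          (n = 2 \<and> d \<ge> 5 \<or> n = 3 \<and> d \<ge> 4 \<or> n \<ge> 4 \<and> d \<ge> 3) \<and>
          milnor_WLP_in_degree {..n} f d
            \<longrightarrow> section_map_generically_finite n d f)"
proof (intro conjI impI; elim conjE)
  have n: "1 \<le> n" "0 < n" and ge2: "2 \<le> d" using assms(1,2) by auto
  interpret milnor "{..n}" d f by unfold_locales (use assms(3) ge2 in auto)
  {
    assume dim: "dim_projective_aut {..n} f = 0" and gen: "for_general_linear_form {..n} (milnor_mult_injective {..n} f d)"
    have ns: "no_linear_syzygy {..n} f" by (rule no_linear_syzygy_of_finite_aut[OF _ assms(3,4) d dim]) simp
    obtain l where l: "l \<in> forms {..n} 1" "milnor_mult_injective {..n} f d l" using gen by (rule general_linear_form_ex)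
    obtain l' where l': "l' \<in> forms {..n} 1" "l' \<noteq> 0" "injective_in_degree l'"
      by (rule injective_in_degree_nonzero[OF injective_in_degreeI[OF l] _ l(1), of 0]) auto
    show "section_map_generically_finite n d f"
      by (rule generically_finite[OF n(1) ge2 assms(3,4,5) ns l'(1,2) linear_jacobian_injectiveI[OF l'(1,3)]])
  next
    assume \<tau>: "tjurina {..n} f < (d - 2) * (d - 1) ^ (n - 1)"
      and range: "n = 2 \<and> d \<ge> 5 \<or> n = 3 \<and> d \<ge> 4 \<or> n \<ge> 4 \<and> d \<ge> 3" and wlp: "milnor_WLP_in_degree {..n} f d"
    have ns: "no_linear_syzygy {..n} f" 
      by (rule no_linear_syzygy_of_small_tjurina[OF _ _ n(2) ge2 assms(3,5) \<tau>]) simp_all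
    obtain l where "l \<in> forms {..n} 1" "l \<noteq> 0" "linear_jacobian_injective {..n} f d l"
      by (rule linear_jacobian_injective_of_WLP[OF assms(3) d ns range wlp])
    then show "section_map_generically_finite n d f" by (rule generically_finite[OF n(1) ge2 assms(3,4,5) ns])
  }
qed

end
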